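(* Let $H$ be an infinite dimensional separable complex Hilbert space and let $(X,Y)$ be one of the following pairs of topological spaces: $(\mathcal{CF}^{\mathrm{sa}}(H),\,G\mathcal{C}^{\mathrm{sa}}(H))$ with the gap topology; $(\mathcal{CF}^{\mathrm{sa}}_\ast(H),\,G\mathcal{C}^{\mathrm{sa}}(H)\cap\mathcal{CF}^{\mathrm{sa}}_\ast(H))$ with the Riesz topology; or $(\mathcal{BF}^{\mathrm{sa}}_\ast(H),\,G\mathcal{B}^{\mathrm{sa}}(H)\cap\mathcal{BF}^{\mathrm{sa}}_\ast(H))$ with the norm topology. Let $\Omega(X)$ be the set of all (continuous) paths $I=[0,1]\to X$ and let $\mu:\Omega(X)\rightarrow\mathbb{Z}$ be a map with the following properties: (C) If $\mathcal{A}^1,\mathcal{A}^2\in\Omega(X)$ are such that $\mathcal{A}^1_1=\mathcal{A}^2_0$, then $\mu(\mathcal{A}^1\ast\mathcal{A}^2)=\mu(\mathcal{A}^1)+\mu(\mathcal{A}^2)$. (H) If $h:I\times I\rightarrow X$ is a homotopy (continuous map) such that $h(\lambda,0)$ and $h(\lambda,1)$ are constant for all $\lambda\in I$, then $\mu(h(0,\cdot))=\mu(h(1,\cdot))$. (Z) If $\mathcal{A}\in\Omega(X)$ is such that $\mathcal{A}_\lambda\in Y$ for all $\lambda\in I$, then $\mu(\mathcal{A})=0$. (N) For every $T\in X$, if $\delta(T)=\frac12\min\{|\lambda|:0\neq\lambda\in\sigma(T)\}$ and $\mathcal{A}^0$ is the path $\mathcal{A}^0_t=T+tI_H$, $t\in[-\delta(T),\delta(T)]$,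 then $$\mu(\mathcal{A}^0)=\dim\ker(T),\qquad \mu(\mathcal{A}^0|_{[0,\delta(T)]})=0.$$ Then $\mu(\mathcal{A})=\operatorname{sf}(\mathcal{A})$ for all $\mathcal{A}\in\Omega(X)$.
   Context: $\mathcal{C}^{\mathrm{sa}}(H)$ is the set of (generally unbounded, densely defined) selfadjoint operators on $H$, $\mathcal{CF}^{\mathrm{sa}}(H)$ the subset of Fredholm ones, $\mathcal{B}^{\mathrm{sa}}(H)$ the bounded selfadjoint operators, $\mathcal{BF}^{\mathrm{sa}}(H)$ the bounded selfadjoint Fredholm operators; $G\mathcal{C}^{\mathrm{sa}}(H)$ and $G\mathcal{B}^{\mathrm{sa}}(H)$ are the sets of invertible elements of $\mathcal{C}^{\mathrm{sa}}(H)$ and $\mathcal{B}^{\mathrm{sa}}(H)$. The gap topology is induced by $d_G(T,S)=\|P_T-P_S\|$, where $P_T,P_S$ are the orthogonal projections in $H\times H$ onto the graphs. The Riesz topology is induced by $d_R(T,S)=\|F(T)-F(S)\|$, where $F(T)=T(I_H+T^2)^{-1/2}$. $\mathcal{BF}^{\mathrm{sa}}_\ast(H)$ is the path component of $\mathcal{BF}^{\mathrm{sa}}(H)$ consisting of operators having both positive and negative essential spectrum, and $\mathcal{CF}^{\mathrm{sa}}_\ast(H)$ is the corresponding path component of $(\mathcal{CF}^{\mathrm{sa}}(H),d_R)$, i.e. the set of $T\in\mathcal{CF}^{\mathrm{sa}}(H)$ with $F(T)\in\mathcal{BF}^{\mathrm{sa}}_\ast(H)$. $\mathcal{A}^1\ast\mathcal{A}^2$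 denotes the usual concatenation of paths. Paths parametrised by a compact interval other than $I$ are regarded as elements of $\Omega(X)$ after affine reparametrisation. Recall that for a selfadjoint Fredholm operator $0$ is either in the resolvent set or an isolated eigenvalue of finite multiplicity. Spectral flow: in all three cases elements of $\Omega(X)$ are gap-continuous paths in $\mathcal{CF}^{\mathrm{sa}}(H)$. Let $\chi_{[a,b]}(T)$ denote the spectral projection of $T$ for $[a,b]$. For such a path $\mathcal{A}$ there are a partition $0=\lambda_0<\dots<\lambda_N=1$ and numbers $a_i>0$ such that $\pm a_i\notin\sigma(\mathcal{A}_\lambda)$ and $[-a_i,a_i]\cap\sigma_{ess}(\mathcal{A}_\lambda)=\emptyset$ for all $\lambda\in[\lambda_{i-1},\lambda_i]$, and $\lambda\mapsto\chi_{[-a_i,a_i]}(\mathcal{A}_\lambda)$ is norm-continuous on $[\lambda_{i-1},\lambda_i]$. The spectral flow is the integer $$\operatorname{sf}(\mathcal{A})=\sum_{i=1}^N\left(\dim\operatorname{im}\chi_{[0,a_i]}(\mathcal{A}_{\lambda_i})-\dim\operatorname{im}\chi_{[0,a_i]}(\mathcal{A}_{\lambda_{i-1}})\right),$$ which is independent of the choices. *)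

theory Defs
  imports "HOL-Analysis.Analysis"
begin

section \<open>Complex Hilbert spaces\<close>

text \<open>The norm and the topology are those of \<^class>\<open>real_inner\<close>; the complex inner product
  is linear in its first argument, and its real part is the real inner product.\<close>

class complex_hilbert = real_inner + complete_space +
  fixes scaleC :: "complex \<Rightarrow> 'a \<Rightarrow> 'a"  (infixr \<open>*\<^sub>C\<close> 75)
    and cinner :: "'a \<Rightarrow> 'a \<Rightarrow> complex"
  assumes scaleC_add_right: "c *\<^sub>C (x + y) = c *\<^sub>C x + c *\<^sub>C y"
    and scaleC_add_left: "(c + d) *\<^sub>C x = c *\<^sub>C x + d *\<^sub>C x"
    and scaleC_scaleC: "c *\<^sub>C d *\<^sub>C x = (c * d) *\<^sub>C x"
    and scaleC_of_real: "complex_of_real r *\<^sub>C x = r *\<^sub>R x"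
    and cinner_commute: "cinner x y = cnj (cinner y x)"
    and cinner_add_left: "cinner (x + y) z = cinner x z + cinner y z"
    and cinner_scaleC_left: "cinner (c *\<^sub>C x) y = c * cinner x y"
    and Re_cinner: "Re (cinner x y) = inner x y"

interpretation complex_vector: vector_space "scaleC :: complex \<Rightarrow> 'a \<Rightarrow> 'a::complex_hilbert"
  by unfold_locales
    (simp_all add: scaleC_add_right scaleC_add_left scaleC_scaleC
      scaleC_of_real[of 1, simplified])

instantiation prod :: (complex_hilbert, complex_hilbert) complex_hilbert
begin

definition "c *\<^sub>C p = (c *\<^sub>C fst p, c *\<^sub>C snd p)"
definition "cinner p q = cinner (fst p) (fst q) + cinner (snd p) (snd q)"

instance
proof
  fix p q :: "'a \<times> 'b"
  show "cinner p q = cnj (cinner q p)"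
    unfolding cinner_prod_def complex_cnj_add
    by (simp only: cinner_commute[symmetric])
qed (simp_all add: scaleC_prod_def cinner_prod_def scaleC_add_right scaleC_add_left
    scaleC_scaleC scaleC_of_real scaleR_prod_def cinner_add_left cinner_scaleC_left
    Re_cinner inner_prod_def algebra_simps)

end

definition fin_dim :: "'a::complex_hilbert set \<Rightarrow> bool" where
  "fin_dim V \<longleftrightarrow> (\<exists>B. finite B \<and> V \<subseteq> complex_vector.span B)"

definition fin_codim :: "'a::complex_hilbert set \<Rightarrow> bool" where
  "fin_codim V \<longleftrightarrow> (\<exists>B. finite B \<and> complex_vector.span (V \<union> B) = UNIV)"


section \<open>Unbounded operators\<close>

text \<open>An operator is identified with its graph, so that its domain is \<^const>\<open>Domain\<close>, its
  range is \<^const>\<open>Range\<close>, the composition of \<open>S\<close> after \<open>T\<close> is the relation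
  composition \<open>T O S\<close>, and the inverse is the converse relation.\<close>

type_synonym 'a op = "('a \<times> 'a) set"

definition is_operator :: "'a::complex_hilbert op \<Rightarrow> bool" where
  "is_operator T \<longleftrightarrow> complex_vector.subspace T \<and> single_valued T"

definition adjoint_op :: "'a::complex_hilbert op \<Rightarrow> 'a op" where
  "adjoint_op T = {(y, z). \<forall>(x, w)\<in>T. cinner w y = cinner x z}"

definition selfadjoint :: "'a::complex_hilbert op \<Rightarrow> bool" where
  "selfadjoint T \<longleftrightarrow> is_operator T \<and> closure (Domain T) = UNIV \<and> adjoint_op T = T"

definition op_of :: "('a \<Rightarrow>\<^sub>L 'a) \<Rightarrow> 'a::complex_hilbert op" where
  "op_of B = {(x, blinfun_apply B x) | x. True}"

definition clinear_blinfun :: "('a::complex_hilbert \<Rightarrow>\<^sub>L 'a) \<Rightarrow> bool" where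
  "clinear_blinfun B \<longleftrightarrow>
     (\<forall>c x. blinfun_apply B (c *\<^sub>C x) = c *\<^sub>C blinfun_apply B x)"

definition bounded_op :: "'a::complex_hilbert op \<Rightarrow> bool" where
  "bounded_op T \<longleftrightarrow> (\<exists>B. clinear_blinfun B \<and> T = op_of B)"

definition invertible_op :: "'a::complex_hilbert op \<Rightarrow> bool" where
  "invertible_op T \<longleftrightarrow> bounded_op (T\<inverse>)"

text \<open>\<open>plus_scalar T c\<close> is \<open>T + c I\<close>.\<close>

definition plus_scalar :: "'a::complex_hilbert op \<Rightarrow> complex \<Rightarrow> 'a op" where
  "plus_scalar T c = {(x, y + c *\<^sub>C x) | x y. (x, y) \<in> T}"

definition ker_op :: "'a::complex_hilbert op \<Rightarrow> 'a set" where
  "ker_op T = {x. (x, 0) \<in> T}"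

text \<open>For closed operators, the only ones to which this is applied, the range is automatically
  closed if it has finite codimension.\<close>

definition fredholm :: "'a::complex_hilbert op \<Rightarrow> bool" where
  "fredholm T \<longleftrightarrow> fin_dim (ker_op T) \<and> fin_codim (Range T)"

definition op_spectrum :: "'a::complex_hilbert op \<Rightarrow> complex set" where
  "op_spectrum T = {c. \<not> invertible_op (plus_scalar T (- c))}"

definition ess_spectrum :: "'a::complex_hilbert op \<Rightarrow> complex set" where
  "ess_spectrum T = {c. \<not> fredholm (plus_scalar T (- c))}"


section \<open>The three spaces of selfadjoint Fredholm operators\<close>

definition Csa :: "'a::complex_hilbert op set" where
  "Csa = {T. selfadjoint T}"

definition CFsa :: "'a::complex_hilbert op set" where
  "CFsa = {T \<in> Csa. fredholm T}"

definition GCsa :: "'a::complex_hilbert op set" where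
  "GCsa = {T \<in> Csa. invertible_op T}"

definition Bsa :: "'a::complex_hilbert op set" where
  "Bsa = {T \<in> Csa. bounded_op T}"

definition BFsa :: "'a::complex_hilbert op set" where
  "BFsa = {T \<in> Bsa. fredholm T}"

definition GBsa :: "'a::complex_hilbert op set" where
  "GBsa = {T \<in> Bsa. invertible_op T}"

definition BFsa_star :: "'a::complex_hilbert op set" where
  "BFsa_star = {T \<in> BFsa. (\<exists>r>0. complex_of_real r \<in> ess_spectrum T) \<and>
                          (\<exists>r<0. complex_of_real r \<in> ess_spectrum T)}"

text \<open>\<open>inv_sqrt_op T\<close> is \<open>(I + T\<^sup>2)\<^sup>-\<^sup>1\<^sup>/\<^sup>2\<close>, the positive square root of the bounded positive
  operator \<open>(I + T\<^sup>2)\<^sup>-\<^sup>1\<close>.\<close>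

definition inv_sqrt_op :: "'a::complex_hilbert op \<Rightarrow> 'a op" where
  "inv_sqrt_op T = (THE S. S \<in> Bsa \<and> (\<forall>(x, y)\<in>S. 0 \<le> Re (cinner y x)) \<and>
                           S O S = (plus_scalar (T O T) 1)\<inverse>)"

definition riesz_transform :: "'a::complex_hilbert op \<Rightarrow> 'a op" where
  "riesz_transform T = inv_sqrt_op T O T"

definition CFsa_star :: "'a::complex_hilbert op set" where
  "CFsa_star = {T \<in> CFsa. riesz_transform T \<in> BFsa_star}"

text \<open>On bounded operators, and for orthogonal projections, \<^const>\<open>Blinfun\<close> turns the
  underlying function into an element of the space of bounded linear maps, whose \<^const>\<open>norm\<close>
  is the operator norm.\<close>

definition blinfun_of :: "'a::complex_hilbert op \<Rightarrow> 'a \<Rightarrow>\<^sub>L 'a" where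
  "blinfun_of T = Blinfun (\<lambda>x. THE y. (x, y) \<in> T)"

definition orth_proj :: "'a::complex_hilbert set \<Rightarrow> 'a \<Rightarrow> 'a" where
  "orth_proj V z = (THE w. w \<in> V \<and> (\<forall>v\<in>V. cinner (z - w) v = 0))"

definition norm_dist :: "'a::complex_hilbert op \<Rightarrow> 'a op \<Rightarrow> real" where
  "norm_dist T S = norm (blinfun_of T - blinfun_of S)"

definition gap_dist :: "'a::complex_hilbert op \<Rightarrow> 'a op \<Rightarrow> real" where
  "gap_dist T S = norm (Blinfun (orth_proj T) - Blinfun (orth_proj S))"

definition riesz_dist :: "'a::complex_hilbert op \<Rightarrow> 'a op \<Rightarrow> real" where
  "riesz_dist T S = norm_dist (riesz_transform T) (riesz_transform S)"

definition top_CFsa :: "'a::complex_hilbert op topology" where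
  "top_CFsa = Metric_space.mtopology CFsa gap_dist"

definition top_CFsa_star :: "'a::complex_hilbert op topology" where
  "top_CFsa_star = Metric_space.mtopology CFsa_star riesz_dist"

definition top_BFsa_star :: "'a::complex_hilbert op topology" where
  "top_BFsa_star = Metric_space.mtopology BFsa_star norm_dist"


section \<open>Paths\<close>

text \<open>Paths are functions on the unit interval, made unique by requiring them to be
  \<^const>\<open>undefined\<close> outside it.\<close>

definition path_space :: "'b topology \<Rightarrow> (real \<Rightarrow> 'b) set" where
  "path_space X = {A. pathin X A \<and> A \<in> extensional {0..1}}"

definition concat_path :: "(real \<Rightarrow> 'b) \<Rightarrow> (real \<Rightarrow> 'b) \<Rightarrow> real \<Rightarrow> 'b" where
  "concat_path A B =
     restrict (\<lambda>t. if t \<le> 1/2 then A (2 * t) else B (2 * t - 1)) {0..1}"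

text \<open>\<open>reparam a b A\<close> is the path \<open>A\<close>, parametrised by \<open>[a, b]\<close>, as a path on \<open>[0, 1]\<close>.\<close>

definition reparam :: "real \<Rightarrow> real \<Rightarrow> (real \<Rightarrow> 'b) \<Rightarrow> real \<Rightarrow> 'b" where
  "reparam a b A = restrict (\<lambda>t. A (a + t * (b - a))) {0..1}"

definition spectral_gap :: "'a::complex_hilbert op \<Rightarrow> real" where
  "spectral_gap T =
     1/2 * (LEAST r. r \<in> {cmod z | z. z \<noteq> 0 \<and> z \<in> op_spectrum T})"

definition shift_path :: "'a::complex_hilbert op \<Rightarrow> real \<Rightarrow> 'a op" where
  "shift_path T t = plus_scalar T (complex_of_real t)"


section \<open>Spectral projections\<close>

definition is_orth_projection :: "('a::complex_hilbert \<Rightarrow>\<^sub>L 'a) \<Rightarrow> bool" where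
  "is_orth_projection P \<longleftrightarrow> P o\<^sub>L P = P \<and>
     (\<forall>x y. cinner (blinfun_apply P x) y = cinner x (blinfun_apply P y))"

text \<open>\<open>spectral_measure E x\<close> is \<open>d\<langle>E\<^sub>t x, x\<rangle>\<close>; for an orthogonal projection
  \<open>\<langle>E\<^sub>t x, x\<rangle> = \<parallel>E\<^sub>t x\<parallel>\<^sup>2\<close>.\<close>

definition spectral_measure ::
    "(real \<Rightarrow> 'a::complex_hilbert \<Rightarrow>\<^sub>L 'a) \<Rightarrow> 'a \<Rightarrow> real measure" where
  "spectral_measure E x = interval_measure (\<lambda>t. Re (cinner (blinfun_apply (E t) x) x))"

text \<open>\<open>E\<close> is the resolution of the identity of \<open>T\<close>, where \<open>E\<^sub>t\<close> is the spectral projection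
  for \<open>(-\<infinity>, t]\<close>. The last two conditions say \<open>T = \<integral> t dE\<^sub>t\<close>: an operator with this domain is
  determined by its quadratic form.\<close>

definition resolution_of_identity ::
    "'a::complex_hilbert op \<Rightarrow> (real \<Rightarrow> 'a \<Rightarrow>\<^sub>L 'a) \<Rightarrow> bool" where
  "resolution_of_identity T E \<longleftrightarrow>
     (\<forall>t. is_orth_projection (E t)) \<and>
     (\<forall>s t. s \<le> t \<longrightarrow> E s o\<^sub>L E t = E s) \<and>
     (\<forall>t x. ((\<lambda>s. blinfun_apply (E s) x) \<longlongrightarrow> blinfun_apply (E t) x) (at_right t)) \<and>
     (\<forall>x. ((\<lambda>s. blinfun_apply (E s) x) \<longlongrightarrow> 0) at_bot) \<and>
     (\<forall>x. ((\<lambda>s. blinfun_apply (E s) x) \<longlongrightarrow> x) at_top) \<and>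
     Domain T = {x. integrable (spectral_measure E x) (\<lambda>t. t\<^sup>2)} \<and>
     (\<forall>(x, y)\<in>T. cinner y x = complex_of_real (LINT t|spectral_measure E x. t))"

definition spectral_family :: "'a::complex_hilbert op \<Rightarrow> real \<Rightarrow> 'a \<Rightarrow>\<^sub>L 'a" where
  "spectral_family T = (THE E. resolution_of_identity T E)"

text \<open>The spectral projection of \<open>T\<close> for the closed interval \<open>[a, b]\<close> is the strong limit
  \<open>E\<^sub>b - lim\<^bsub>t\<up>a\<^esub> E\<^sub>t\<close>.\<close>

definition spectral_proj :: "'a::complex_hilbert op \<Rightarrow> real \<Rightarrow> real \<Rightarrow> 'a \<Rightarrow> 'a" where
  "spectral_proj T a b x =
     blinfun_apply (spectral_family T b) x -
     Lim (at_left a) (\<lambda>t. blinfun_apply (spectral_family T t) x)"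


section \<open>The spectral flow\<close>

definition sf_partition ::
    "(real \<Rightarrow> 'a::complex_hilbert op) \<Rightarrow> nat \<Rightarrow> (nat \<Rightarrow> real) \<Rightarrow> (nat \<Rightarrow> real) \<Rightarrow> bool" where
  "sf_partition A N l a \<longleftrightarrow>
     l 0 = 0 \<and> l N = 1 \<and>
     (\<forall>i\<in>{1..N}. l (i - 1) < l i \<and> a i > 0 \<and>
        (\<forall>s\<in>{l (i - 1)..l i}.
           complex_of_real (a i) \<notin> op_spectrum (A s) \<and>
           complex_of_real (- a i) \<notin> op_spectrum (A s) \<and>
           complex_of_real ` {- a i..a i} \<inter> ess_spectrum (A s) = {}) \<and>
        continuous_on {l (i - 1)..l i} (\<lambda>s. Blinfun (spectral_proj (A s) (- a i) (a i))))"

definition sf_sum ::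
    "(real \<Rightarrow> 'a::complex_hilbert op) \<Rightarrow> nat \<Rightarrow> (nat \<Rightarrow> real) \<Rightarrow> (nat \<Rightarrow> real) \<Rightarrow> int" where
  "sf_sum A N l a =
     (\<Sum>i = 1..N. int (complex_vector.dim (range (spectral_proj (A (l i)) 0 (a i)))) -
                  int (complex_vector.dim (range (spectral_proj (A (l (i - 1))) 0 (a i)))))"

definition spectral_flow :: "(real \<Rightarrow> 'a::complex_hilbert op) \<Rightarrow> int" where
  "spectral_flow A = (THE k. \<exists>N l a. sf_partition A N l a \<and> k = sf_sum A N l a)"

end

theory Submission
  imports Defs "HOL-Probability.Distribution_Functions"
begin

text \<open>Fix a piece \<open>[c, d]\<close> of a partition for \<open>A\<close>, with window \<open>[-a, a]\<close>. The operators \<open>A \<lambda> + \<tau>\<close>,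
  \<open>0 \<le> \<tau> \<le> a\<close>, stay in \<open>X\<close>, and along the boundary of this rectangle \<open>\<mu>\<close> adds up to zero by (C) and (H).
  The edge \<open>\<tau> = a\<close> is invertible, so it contributes zero by (Z). On a vertical edge (N) and (Z)
  determine \<open>\<mu>\<close> near every point, hence \<open>\<mu>\<close> counts the eigenvalues of \<open>A \<lambda>\<close> in \<open>[-a, 0)\<close>. Since the dimension of the
  spectral projection for \<open>[-a, a]\<close> is constant along the piece, the difference of the two counts is the
  contribution of the piece to the spectral flow.

  The spectral family is built from the bounded operators \<open>(1 + T\<^sup>2)\<^sup>-\<^sup>1\<close> and \<open>T (1 + T\<^sup>2)\<^sup>-\<^sup>1\<close>: \<open>Eproj T t\<close>, for
  \<open>(-\<infinity>, t]\<close>, is the sign projection of a bounded symmetric operator, and \<open>Lproj T t\<close>, for \<open>(-\<infinity>, t)\<close>, is its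
  left limit. Orthogonality and selfadjointness are treated over the reals, complex linearity being
  recovered from commutation with the multiplications by scalars.\<close>

text \<open>The half-open counting is dictated by (N): \<mu> is dim ker T on [-delta, delta] and 0
  on [0, delta], so an eigenvalue counts at the moment it reaches 0 from below. This is why vertical
  edges count eigenvalues in intervals [-t, -s), complementary to the interval [0, a] counted by the
  spectral flow. The main obstacle is continuity. The gap metric controls (1 + T^2)^-1, which sees a
  spectral point t only through |t|; a window symmetric about 0 is a spectral subspace of that
  operator, and this is enough to produce partitions. In the Riesz metric the joint continuity of
  (T, r) -> T + r is not evident and rests on a norm estimate for differences of square roots.
  Infinite dimension guarantees that a Fredholm operator has a nonzero spectral point, so that
  delta(T) is defined. The spectral flow is a definite description. Every partition sum turns out to
  equal \<mu> of the path, so independence of the choices comes with the result, whereas existence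
  of a partition has to be shown.\<close>

instance complex_hilbert \<subseteq> banach ..

section \<open>Bounded symmetric operators on a real Hilbert space\<close>

text \<open>The parallelogram law makes a minimising sequence for the distance to \<open>z\<close>
  Cauchy; at the limit the distance cannot be lowered in any direction \<open>v\<close> of
  \<open>V\<close>, which is orthogonality.\<close>

lemma exists_nearest_orthogonal:
  fixes V :: "'a::{real_inner,banach} set"
  assumes V: "closed V" "subspace V"
  shows "\<exists>w\<in>V. \<forall>v\<in>V. inner (z - w) v = 0"
proof -
  define f where "f = (\<lambda>w. (norm (z - w))\<^sup>2)"
  define d where "d = Inf (f ` V)"
  have bdd: "bdd_below (f ` V)" unfolding f_def by (rule bdd_belowI[of _ 0]) auto
  have ne: "f ` V \<noteq> {}" using subspace_0[OF V(2)] by auto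
  have dle: "d \<le> f w" if "w \<in> V" for w unfolding d_def using bdd that by (simp add: cINF_lower)
  have "\<exists>w\<in>V. f w < d + 1 / real (Suc n)" for n
    using cInf_lessD[OF ne, of "d + 1 / real (Suc n)"] by (auto simp: d_def)
  then obtain w where w: "\<And>n. w n \<in> V" "\<And>n. f (w n) < d + 1 / real (Suc n)" by metis
  have par: "(norm (a - b))\<^sup>2 = 2 * f a + 2 * f b - 4 * f ((1/2) *\<^sub>R (a + b))" for a b
    unfolding f_def by (simp add: power2_norm_eq_inner inner_diff_left inner_diff_right inner_add_left
        inner_add_right algebra_simps inner_commute)
  have mid: "(1/2) *\<^sub>R (a + b) \<in> V" if "a \<in> V" "b \<in> V" for a b
    using that V(2) by (intro subspace_scale subspace_add)
  have small: "(norm (w m - w n))\<^sup>2 \<le> 2 / real (Suc m) + 2 / real (Suc n)" for m n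
    using par[of "w m" "w n"] dle[OF mid[OF w(1)[of m] w(1)[of n]]] w(2)[of m] w(2)[of n] by simp
  have "Cauchy w"
  proof (rule metric_CauchyI)
    fix e :: real assume e: "e > 0"
    obtain N where N: "4 / e\<^sup>2 < real (Suc N)"
      using reals_Archimedean2 by (metis less_Suc_eq of_nat_less_iff order.strict_trans)
    have "dist (w m) (w n) < e" if "m \<ge> N" "n \<ge> N" for m n
    proof -
      have "(norm (w m - w n))\<^sup>2 \<le> 2 / real (Suc N) + 2 / real (Suc N)"
        using small[of m n] that frac_le[of 2 2 "real (Suc N)" "real (Suc m)"]
          frac_le[of 2 2 "real (Suc N)" "real (Suc n)"] by simp
      also have "\<dots> = 4 / real (Suc N)" by simp
      also have "\<dots> < e\<^sup>2" using N e by (simp add: divide_less_eq mult.commute del: of_nat_Suc)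
      finally show ?thesis using e by (simp add: dist_norm power_less_imp_less_base)
    qed
    then show "\<exists>M. \<forall>m\<ge>M. \<forall>n\<ge>M. dist (w m) (w n) < e" by blast
  qed
  then obtain l where l: "w \<longlonglongrightarrow> l" using Cauchy_convergent convergent_def by blast
  have lV: "l \<in> V" using closed_sequentially[OF V(1)] w(1) l by blast
  have "(\<lambda>n. f (w n)) \<longlonglongrightarrow> f l" unfolding f_def by (intro tendsto_intros l)
  moreover have "(\<lambda>n. d + 1 / real (Suc n)) \<longlonglongrightarrow> d + 0"
    by (intro tendsto_intros LIMSEQ_Suc lim_1_over_n)
  ultimately have fl: "f l \<le> d"
    using LIMSEQ_le[of "\<lambda>n. f (w n)" "f l" "\<lambda>n. d + 1 / real (Suc n)" "d + 0"] w(2) less_imp_le by auto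
  have "inner (z - l) v = 0" if v: "v \<in> V" for v
  proof (cases "v = 0")
    case False
    \<comment> \<open>The minimiser of the quadratic polynomial t -> f (l + t v).\<close>
    define t where "t = inner (z - l) v / inner v v"
    have "f l \<le> f (l + t *\<^sub>R v)"
      using fl dle[of "l + t *\<^sub>R v"] lV v V(2) by (meson order_trans subspace_add subspace_scale)
    also have "f (l + t *\<^sub>R v) = f l - 2 * t * inner (z - l) v + t\<^sup>2 * inner v v"
      unfolding f_def by (simp only: power2_norm_eq_inner inner_diff_left inner_diff_right inner_add_left
        inner_add_right inner_scaleR_left inner_scaleR_right)
        (simp add: algebra_simps inner_commute power2_eq_square)
    also have "\<dots> = f l - (inner (z - l) v)\<^sup>2 / inner v v"
      using False by (simp add: t_def power2_eq_square field_simps)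
    finally have "(inner (z - l) v)\<^sup>2 / inner v v \<le> 0" by simp
    then show ?thesis using False
      by (simp add: divide_le_0_iff inner_gt_zero_iff) (metis inner_gt_zero_iff not_less zero_le_power2)
  qed simp
  then show ?thesis using lV by blast
qed

section \<open>Orthogonal projections as bounded operators\<close>

definition is_proj :: "('a::{real_inner,banach} \<Rightarrow>\<^sub>L 'a) \<Rightarrow> bool" where
  "is_proj P \<longleftrightarrow> (\<forall>x. P (P x) = P x) \<and> (\<forall>x y. inner (P x) y = inner x (P y))"

lemma is_proj_idem: "is_proj P \<Longrightarrow> P (P x) = P x"
  and is_proj_sym: "is_proj P \<Longrightarrow> inner (P x) y = inner x (P y)"
  by (auto simp: is_proj_def)

lemma is_proj_inner: "is_proj P \<Longrightarrow> inner (P x) x = (norm (P x))\<^sup>2"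
  by (metis is_proj_def power2_norm_eq_inner)

lemma is_proj_orth: "is_proj P \<Longrightarrow> P x = x \<Longrightarrow> P y = 0 \<Longrightarrow> inner x y = 0"
  by (metis is_proj_sym inner_zero_right)

lemma norm_Pythagoras_eq: "inner x y = 0 \<Longrightarrow> (norm (x + y))\<^sup>2 = (norm x)\<^sup>2 + (norm (y::'a::real_inner))\<^sup>2"
  by (simp add: power2_norm_eq_inner inner_add_left inner_add_right inner_commute)

lemma is_proj_Pythagoras: "is_proj P \<Longrightarrow> (norm x)\<^sup>2 = (norm (P x))\<^sup>2 + (norm (x - P x))\<^sup>2"
  using norm_Pythagoras_eq[of "P x" "x - P x"] is_proj_orth[of P "P x" "x - P x"]
  by (simp add: blinfun.bilinear_simps is_proj_idem)

lemma is_proj_norm_le: "is_proj P \<Longrightarrow> norm (P x) \<le> norm x"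
  using is_proj_Pythagoras[of P x] by (auto intro: power2_le_imp_le[OF _ norm_ge_zero])

lemma is_proj_id: "is_proj id_blinfun"
  by (simp add: is_proj_def)

lemma is_proj_compl: "is_proj P \<Longrightarrow> is_proj (id_blinfun - P)"
  by (simp add: is_proj_def blinfun.bilinear_simps inner_diff_left inner_diff_right)

lemma is_proj_range: "is_proj P \<Longrightarrow> x \<in> range P \<longleftrightarrow> P x = x"
  by (metis is_proj_idem rangeE rangeI)

lemma is_proj_zero_if: "is_proj P \<Longrightarrow> (\<And>x. P x = x \<Longrightarrow> x = 0) \<Longrightarrow> P = 0"
  by (intro blinfun_eqI) (simp add: is_proj_idem)

lemma is_proj_compose:
  assumes "is_proj P" "is_proj Q" "P o\<^sub>L Q = Q o\<^sub>L P" shows "is_proj (P o\<^sub>L Q)"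
proof -
  have c: "P (Q x) = Q (P x)" for x
    using assms(3) by (metis blinfun_apply_blinfun_compose)
  show ?thesis unfolding is_proj_def
    by (metis assms(1,2) blinfun_apply_blinfun_compose c is_proj_def)
qed

text \<open>The last hypothesis says that the range of \<open>Q\<close> lies in that of
  \<open>P\<close>; taking adjoints also gives Q P = Q, and then P - Q is idempotent.\<close>

lemma is_proj_diff:
  assumes "is_proj P" "is_proj Q" "P o\<^sub>L Q = Q" shows "is_proj (P - Q)"
proof -
  have 1: "P (Q x) = Q x" for x using assms(3) by (metis blinfun_apply_blinfun_compose)
  have 2: "Q (P x) = Q x" for x
  proof -
    have "inner (Q (P x) - Q x) y = 0" for y
      by (simp add: inner_diff_left is_proj_sym[OF assms(2)] is_proj_sym[OF assms(1)] 1)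
    then show ?thesis using inner_eq_zero_iff[of "Q (P x) - Q x"] by simp
  qed
  show ?thesis
    by (simp add: is_proj_def blinfun.bilinear_simps inner_diff_left inner_diff_right 1 2
        is_proj_idem[OF assms(1)] is_proj_idem[OF assms(2)] is_proj_sym[OF assms(1)] is_proj_sym[OF assms(2)])
qed

text \<open>Linearity comes from uniqueness of the element of \<open>V\<close> with orthogonal
  residual, and the norm bound from Pythagoras.\<close>

lemma proj_exists:
  fixes V :: "'a::{real_inner,banach} set"
  assumes V: "closed V" "subspace V"
  obtains P where "is_proj P" "range (blinfun_apply P) = V" "\<And>x v. v \<in> V \<Longrightarrow> inner (x - P x) v = 0"
proof -
  obtain p where p: "\<And>z. p z \<in> V" "\<And>z v. v \<in> V \<Longrightarrow> inner (z - p z) v = 0"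
    using exists_nearest_orthogonal[OF V] by metis
  have uniq: "w = p z" if "w \<in> V" "\<And>v. v \<in> V \<Longrightarrow> inner (z - w) v = 0" for w z
  proof -
    have "w - p z \<in> V" using that p V(2) by (simp add: subspace_diff)
    then have "inner (z - p z) (w - p z) - inner (z - w) (w - p z) = 0" using that p by simp
    then have "inner (w - p z) (w - p z) = 0" by (simp add: inner_diff_left)
    then show ?thesis by simp
  qed
  have add: "p (x + y) = p x + p y" for x y
  proof (rule uniq[symmetric])
    show "p x + p y \<in> V" using p V(2) by (simp add: subspace_add)
    show "inner (x + y - (p x + p y)) v = 0" if "v \<in> V" for v
      using p(2)[OF that, of x] p(2)[OF that, of y] by (simp add: inner_diff_left inner_add_left)
  qed
  have scale: "p (r *\<^sub>R x) = r *\<^sub>R p x" for r x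
  proof (rule uniq[symmetric])
    show "r *\<^sub>R p x \<in> V" using p V(2) by (simp add: subspace_scale)
    show "inner (r *\<^sub>R x - r *\<^sub>R p x) v = 0" if "v \<in> V" for v
      using p(2)[OF that, of x] by (simp add: inner_diff_left)
  qed
  have nle: "norm (p x) \<le> norm x" for x
  proof -
    have "(norm x)\<^sup>2 = (norm (p x))\<^sup>2 + (norm (x - p x))\<^sup>2"
      using norm_Pythagoras_eq[of "p x" "x - p x"] p(2)[OF p(1), of x x] by (simp add: inner_commute)
    then show ?thesis by (auto intro: power2_le_imp_le[OF _ norm_ge_zero])
  qed
  have bl: "bounded_linear p"
    by (rule bounded_linear_intro[of _ 1]) (auto simp: add scale nle)
  have ap: "blinfun_apply (Blinfun p) = p" by (rule bounded_linear_Blinfun_apply[OF bl])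
  have fx: "p v = v" if "v \<in> V" for v using uniq[of v v] that by simp
  have sym: "inner (p x) y = inner x (p y)" for x y
    using p(2)[OF p(1), of x y] p(2)[OF p(1), of y x] by (simp add: inner_diff_left inner_diff_right inner_commute)
  show ?thesis
  proof (rule that[of "Blinfun p"])
    show "is_proj (Blinfun p)" unfolding is_proj_def ap using fx[OF p(1)] sym by blast
    show "range (blinfun_apply (Blinfun p)) = V" 
    proof -
      have "range p \<subseteq> V" using p(1) by auto
      moreover have "V \<subseteq> range p" using fx by (metis rangeI subsetI)
      ultimately show ?thesis unfolding ap by simp
    qed
  qed (simp add: ap p)
qed

lemma closed_subspace_eq_UNIV:
  fixes V :: "'a::{real_inner,banach} set"
  assumes V: "closed V" "subspace V" and "\<And>x. (\<And>v. v \<in> V \<Longrightarrow> inner x v = 0) \<Longrightarrow> x = 0"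
  shows "V = UNIV"
proof -
  obtain P where P: "range (blinfun_apply P) = V" "\<And>x v. v \<in> V \<Longrightarrow> inner (x - P x) v = 0"
    using proj_exists[OF V] by metis
  have "x - P x = 0" for x by (rule assms(3)) (rule P(2))
  then show ?thesis using P(1) by (metis UNIV_eq_I eq_iff_diff_eq_0 rangeI)
qed

lemma inner_eq_all_eq: "(\<And>y. inner a y = inner b (y::'a::real_inner)) \<Longrightarrow> a = b"
  by (metis inner_eq_zero_iff inner_diff_left eq_iff_diff_eq_0)

lemma subspace_closure:
  assumes S: "subspace (S :: 'a::real_normed_vector set)" shows "subspace (closure S)"
  unfolding subspace_def
proof (intro conjI ballI allI)
  show "0 \<in> closure S" using subspace_0[OF S] closure_subset by blast
  fix x y assume "x \<in> closure S" "y \<in> closure S"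
  then obtain a b where "\<forall>n. a n \<in> S" "a \<longlonglongrightarrow> x" "\<forall>n. b n \<in> S" "b \<longlonglongrightarrow> y"
    unfolding closure_sequential by blast
  then have "\<forall>n. a n + b n \<in> S" "(\<lambda>n. a n + b n) \<longlonglongrightarrow> x + y"
    using subspace_add[OF S] by (auto intro: tendsto_add)
  then show "x + y \<in> closure S" unfolding closure_sequential
    by (intro exI[of _ "\<lambda>n. a n + b n"] conjI)
next
  fix c x assume "x \<in> closure S"
  then obtain a where "\<forall>n. a n \<in> S" "a \<longlonglongrightarrow> x" unfolding closure_sequential by blast
  then have "\<forall>n. c *\<^sub>R a n \<in> S" "(\<lambda>n. c *\<^sub>R a n) \<longlonglongrightarrow> c *\<^sub>R x"
    using subspace_scale[OF S] by (auto intro: tendsto_intros)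
  then show "c *\<^sub>R x \<in> closure S" unfolding closure_sequential
    by (intro exI[of _ "\<lambda>n. c *\<^sub>R a n"] conjI)
qed

lemma subspace_closure_range: "subspace (closure (range (blinfun_apply B)))"
  by (rule subspace_closure) (rule linear_subspace_image[OF bounded_linear.linear[OF blinfun.bounded_linear_right] subspace_UNIV])

section \<open>Symmetric and positive operators, square roots\<close>

definition symm :: "('a::{real_inner,banach} \<Rightarrow>\<^sub>L 'a) \<Rightarrow> bool" where
  "symm B \<longleftrightarrow> (\<forall>x y. inner (B x) y = inner x (B y))"

definition positive :: "('a::{real_inner,banach} \<Rightarrow>\<^sub>L 'a) \<Rightarrow> bool" where
  "positive B \<longleftrightarrow> symm B \<and> (\<forall>x. 0 \<le> inner (B x) x)"

abbreviation commutes :: "('a::{real_inner,banach} \<Rightarrow>\<^sub>L 'a) \<Rightarrow> ('a \<Rightarrow>\<^sub>L 'a) \<Rightarrow> bool" where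
  "commutes A B \<equiv> A o\<^sub>L B = B o\<^sub>L A"

lemma commutes_iff: "commutes A B \<longleftrightarrow> (\<forall>x. A (B x) = B (A x))"
  by (metis blinfun_apply_blinfun_compose blinfun_eqI)

lemma commutesD: "commutes A B \<Longrightarrow> A (B x) = B (A x)"
  by (metis blinfun_apply_blinfun_compose)

lemma symmD: "symm B \<Longrightarrow> inner (B x) y = inner x (B y)"
  by (simp add: symm_def)

text \<open>Polarisation. It is stated for a relation, so that it applies to a restriction of an
  unbounded operator before that restriction is known to be bounded.\<close>

lemma symm_relation_form_bound:
  fixes T :: "('a::real_inner \<times> 'a) set"
  assumes T: "subspace T" and sym: "\<And>x y u v. (x, y) \<in> T \<Longrightarrow> (u, v) \<in> T \<Longrightarrow> inner y u = inner x v"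
    and bd: "\<And>x y. (x, y) \<in> T \<Longrightarrow> \<bar>inner y x\<bar> \<le> M * (norm x)\<^sup>2"
    and xy: "(x, y) \<in> T" and uv: "(u, v) \<in> T"
  shows "inner y u \<le> M * norm x * norm u"
proof (cases "x = 0 \<or> u = 0")
  case True
  then show ?thesis using sym[OF xy uv] by auto
next
  case False
  \<comment> \<open>The vectors b x and a u both have norm a b; without this balancing the
    parallelogram identity would yield only a sum of squares instead of the product of the
    norms.\<close>
  define a b where "a = norm x" and "b = norm u"
  have ab: "a > 0" "b > 0" using False by (auto simp: a_def b_def)
  have 1: "(b *\<^sub>R x, b *\<^sub>R y) \<in> T" "(a *\<^sub>R u, a *\<^sub>R v) \<in> T"
    using subspace_scale[OF T xy, of b] subspace_scale[OF T uv, of a] by auto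
  have 2: "(b *\<^sub>R x + a *\<^sub>R u, b *\<^sub>R y + a *\<^sub>R v) \<in> T" "(b *\<^sub>R x - a *\<^sub>R u, b *\<^sub>R y - a *\<^sub>R v) \<in> T"
    using subspace_add[OF T 1] subspace_diff[OF T 1] by auto
  have "4 * (a * b * inner y u) = inner (b *\<^sub>R y + a *\<^sub>R v) (b *\<^sub>R x + a *\<^sub>R u)
      - inner (b *\<^sub>R y - a *\<^sub>R v) (b *\<^sub>R x - a *\<^sub>R u)"
    using sym[OF xy uv] by (simp add: inner_add_left inner_add_right inner_diff_left inner_diff_right
        algebra_simps inner_commute)
  also have "\<dots> \<le> M * (norm (b *\<^sub>R x + a *\<^sub>R u))\<^sup>2 + M * (norm (b *\<^sub>R x - a *\<^sub>R u))\<^sup>2"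
    using bd[OF 2(1)] bd[OF 2(2)] by linarith
  also have "\<dots> = 2 * M * (b\<^sup>2 * (norm x)\<^sup>2 + a\<^sup>2 * (norm u)\<^sup>2)"
    by (simp only: power2_norm_eq_inner inner_add_left inner_add_right inner_diff_left inner_diff_right
        inner_scaleR_left inner_scaleR_right) (simp add: algebra_simps inner_commute power2_eq_square)
  also have "\<dots> = 4 * (a * b * (M * a * b))" by (simp add: a_def b_def power2_eq_square)
  finally show ?thesis using ab by (simp add: a_def b_def)
qed

text \<open>The numerical radius of a symmetric operator is its norm: in the polarised bound the
  second vector is taken to be \<open>B x\<close>.\<close>

lemma symm_norm_le:
  assumes "symm B" and bd: "\<And>x. \<bar>inner (B x) x\<bar> \<le> M * (norm x)\<^sup>2"
  shows "norm (B x) \<le> M * norm x"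
proof -
  have sub: "subspace {(x, B x) |x. True}"
    unfolding subspace_def by (auto simp: blinfun.bilinear_simps zero_prod_def)
  have "inner (B x) (B x) \<le> M * norm x * norm (B x)"
    by (rule symm_relation_form_bound[OF sub]) (use assms in \<open>auto simp: symm_def\<close>)
  then have "norm (B x) * norm (B x) \<le> (M * norm x) * norm (B x)"
    by (simp add: power2_norm_eq_inner[symmetric] power2_eq_square)
  moreover have "0 \<le> M * norm x"
  proof (cases "x = 0")
    case False
    have "0 \<le> M * (norm x)\<^sup>2" using bd[of x] by linarith
    then show ?thesis using False by (simp add: zero_le_mult_iff)
  qed simp
  ultimately show ?thesis by (cases "B x = 0") auto
qed

text \<open>The square root is the limit of the iteration \<open>X\<^sub>n\<^sub>+\<^sub>1 = (Z + X\<^sub>n\<^sup>2) / 2\<close> for \<open>1 - \<surd>(1 - Z)\<close>,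
  whose increments are dominated by those of the scalar iteration for \<open>Z = 1\<close>.\<close>

lemma one_minus_sqrt_exists:
  fixes Z :: "'a::{real_inner,banach} \<Rightarrow>\<^sub>L 'a"
  assumes Z: "symm Z" "norm Z \<le> 1"
  obtains X where "symm X" "norm X \<le> 1" "2 *\<^sub>R X = Z + (X o\<^sub>L X)" "\<And>B. commutes B Z \<Longrightarrow> commutes B X"
proof -
  define X where "X = rec_nat (0::'a \<Rightarrow>\<^sub>L 'a) (\<lambda>_ X. (1/2) *\<^sub>R (Z + (X o\<^sub>L X)))"
  define r where "r = rec_nat (0::real) (\<lambda>_ x. (1 + x\<^sup>2) / 2)"
  have X0: "X 0 = 0" and XS: "X (Suc n) = (1/2) *\<^sub>R (Z + (X n o\<^sub>L X n))" for n by (simp_all add: X_def)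
  have r0: "r 0 = 0" and rS: "r (Suc n) = (1 + (r n)\<^sup>2) / 2" for n by (simp_all add: r_def)
  have r1: "0 \<le> r n \<and> r n \<le> 1" for n
    by (induction n) (auto simp: r0 rS power_le_one)
  have rmono: "r n \<le> r (Suc n)" for n
    using zero_le_power2[of "r n - 1"] by (simp add: rS power2_diff)
  have comm: "commutes B (X n)" if "commutes B Z" for B n
    using that by (induction n) (auto simp: X0 XS commutes_iff blinfun.bilinear_simps)
  have XX: "commutes (X m) (X n)" for m n
    using comm[of "X m" n] comm[of Z m] by (metis comm)
  have symX: "symm (X n)" for n
  proof (induction n)
    case (Suc n)
    then show ?case using Z(1)
      by (simp add: symm_def XS blinfun.bilinear_simps inner_add_left inner_add_right)
  qed (simp add: symm_def X0)
  have nX: "norm (X n) \<le> r n" for n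
  proof (induction n)
    case (Suc n)
    have "norm (X (Suc n)) \<le> (1/2) * (norm Z + norm (X n) * norm (X n))"
      using norm_triangle_ineq[of Z "X n o\<^sub>L X n"] norm_blinfun_compose[of "X n" "X n"]
      by (simp add: XS)
    also have "\<dots> \<le> (1/2) * (1 + r n * r n)"
      using Z(2) Suc mult_mono[OF Suc Suc] r1[of n] by simp
    finally show ?case by (simp add: rS power2_eq_square)
  qed (simp add: X0 r0)
  \<comment> \<open>All iterates commute with one another, being built from \<open>Z\<close>; so a
    difference of squares factorises and the increments obey the recursion of the scalar
    ones.\<close>
  have step: "norm (X (Suc n) - X n) \<le> r (Suc n) - r n" for n
  proof (induction n)
    case 0
    then show ?case using Z(2) by (simp add: X0 XS r0 rS)
  next
    case (Suc n)
    have "X (Suc (Suc n)) - X (Suc n) = (1/2) *\<^sub>R ((X (Suc n) - X n) o\<^sub>L (X (Suc n) + X n))"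
    proof (rule blinfun_eqI)
      fix x
      show "(X (Suc (Suc n)) - X (Suc n)) x = ((1/2) *\<^sub>R ((X (Suc n) - X n) o\<^sub>L (X (Suc n) + X n))) x"
        using commutesD[OF XX[of "Suc n" n], of x]
        by (simp add: XS[of "Suc n"] blinfun.bilinear_simps) (simp add: XS[of n] blinfun.bilinear_simps scaleR_diff_right[symmetric])
    qed
    then have "norm (X (Suc (Suc n)) - X (Suc n)) \<le> (1/2) * (norm (X (Suc n) - X n) * norm (X (Suc n) + X n))"
      using norm_blinfun_compose[of "X (Suc n) - X n" "X (Suc n) + X n"] by simp
    also have "\<dots> \<le> (1/2) * ((r (Suc n) - r n) * (r (Suc n) + r n))"
      using Suc norm_triangle_le[OF add_mono[OF nX[of "Suc n"] nX[of n]]] rmono[of n]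
      by (intro mult_left_mono mult_mono) auto
    also have "\<dots> = r (Suc (Suc n)) - r (Suc n)"
      by (simp add: rS[of "Suc n"]) (simp add: rS[of n] power2_eq_square field_simps)
    finally show ?case .
  qed
  have diff: "norm (X (n + k) - X n) \<le> r (n + k) - r n" for n k
  proof (induction k)
    case (Suc k)
    have "norm (X (n + Suc k) - X n) \<le> norm (X (Suc (n + k)) - X (n + k)) + norm (X (n + k) - X n)"
      using norm_triangle_ineq[of "X (Suc (n + k)) - X (n + k)" "X (n + k) - X n"] by simp
    then show ?case using step[of "n + k"] Suc by simp
  qed simp
  have "incseq r" using rmono by (rule incseq_SucI)
  moreover have "Bseq r" by (rule BseqI'[of _ 1]) (use r1 in auto)
  ultimately have "Cauchy r" by (simp add: Bseq_mono_convergent convergent_Cauchy incseqD)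
  have "Cauchy X"
  proof (rule metric_CauchyI)
    fix e :: real assume "e > 0"
    then obtain N where N: "\<And>m n. m \<ge> N \<Longrightarrow> n \<ge> N \<Longrightarrow> dist (r m) (r n) < e"
      using \<open>Cauchy r\<close> by (meson metric_CauchyD)
    have aux: "dist (X m) (X n) < e" if "m \<ge> n" "n \<ge> N" for m n
      using diff[of n "m - n"] N[of m n] that by (auto simp: dist_norm)
    have "dist (X m) (X n) < e" if "m \<ge> N" "n \<ge> N" for m n
      using aux[of m n] aux[of n m] that by (cases "m \<ge> n") (auto simp: dist_commute)
    then show "\<exists>M. \<forall>m\<ge>M. \<forall>n\<ge>M. dist (X m) (X n) < e" by blast
  qed
  then obtain L where L: "X \<longlonglongrightarrow> L" using Cauchy_convergent convergent_def by blast
  have Lx: "(\<lambda>n. X n x) \<longlonglongrightarrow> L x" for x by (intro tendsto_intros L)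
  show ?thesis
  proof (rule that[of L])
    show "symm L" unfolding symm_def
    proof (intro allI)
      fix x y
      have "(\<lambda>n. inner (X n x) y) \<longlonglongrightarrow> inner (L x) y" "(\<lambda>n. inner x (X n y)) \<longlonglongrightarrow> inner x (L y)"
        by (intro tendsto_intros Lx)+
      then show "inner (L x) y = inner x (L y)"
        using symX LIMSEQ_unique by (simp add: symm_def)
    qed
    show "norm L \<le> 1"
      by (rule LIMSEQ_le_const2[OF tendsto_norm[OF L]]) (meson nX r1 order_trans)
    have "(\<lambda>n. X (Suc n)) \<longlonglongrightarrow> L" using L by (rule LIMSEQ_Suc)
    moreover have "(\<lambda>n. X (Suc n)) \<longlonglongrightarrow> (1/2) *\<^sub>R (Z + (L o\<^sub>L L))"
      unfolding XS by (intro tendsto_intros L bounded_bilinear.tendsto[OF bounded_bilinear_blinfun_compose])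
    ultimately have "L = (1/2) *\<^sub>R (Z + (L o\<^sub>L L))" by (rule LIMSEQ_unique)
    then have "2 *\<^sub>R L = 2 *\<^sub>R ((1/2) *\<^sub>R (Z + (L o\<^sub>L L)))" by (rule arg_cong[where f = "\<lambda>y. 2 *\<^sub>R y"])
    then show "2 *\<^sub>R L = Z + (L o\<^sub>L L)" by simp
    show "commutes B L" if "commutes B Z" for B
    proof -
      have "(\<lambda>n. B o\<^sub>L X n) \<longlonglongrightarrow> (B o\<^sub>L L)" "(\<lambda>n. X n o\<^sub>L B) \<longlonglongrightarrow> (L o\<^sub>L B)"
        by (intro tendsto_intros L bounded_bilinear.tendsto[OF bounded_bilinear_blinfun_compose])+
      then show ?thesis using comm[OF that] LIMSEQ_unique by simp
    qed
  qed
qed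

lemma positive_le_norm: "positive A \<Longrightarrow> inner (A x) x \<le> norm A * (norm x)\<^sup>2"
  using norm_cauchy_schwarz[of "A x" x] mult_right_mono[OF norm_blinfun[of A x] norm_ge_zero[of x]]
  by (simp add: power2_eq_square)

text \<open>With n = norm A, the operator Z = 1 - A/n is a symmetric contraction, and X = 1 - sqrt
  (1 - Z) gives the root sqrt n (1 - X) of A. Commutation with everything that commutes with
  \<open>A\<close> is inherited from \<open>X\<close>; uniqueness of the root and all later
  commutation arguments depend on it.\<close>

lemma positive_sqrt_exists:
  fixes A :: "'a::{real_inner,banach} \<Rightarrow>\<^sub>L 'a"
  assumes A: "positive A"
  obtains S where "positive S" "S o\<^sub>L S = A" "\<And>B. commutes B A \<Longrightarrow> commutes B S"
proof (cases "A = 0")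
  case True
  show ?thesis by (rule that[of 0]) (auto simp: True positive_def symm_def intro!: blinfun_eqI)
next
  case False
  define n where "n = norm A"
  have n: "n > 0" using False by (simp add: n_def)
  define Z where "Z = id_blinfun - (1/n) *\<^sub>R A"
  have Zx: "Z x = x - (1/n) *\<^sub>R A x" for x by (simp add: Z_def blinfun.bilinear_simps)
  have sZ: "symm Z" using A by (simp add: symm_def positive_def Zx inner_diff_left inner_diff_right)
  have "norm (Z x) \<le> 1 * norm x" for x
  proof (rule symm_norm_le[OF sZ])
    fix x
    have "inner (Z x) x = (norm x)\<^sup>2 - inner (A x) x / n"
      by (simp add: Zx inner_diff_left power2_norm_eq_inner)
    moreover have "0 \<le> inner (A x) x / n" "inner (A x) x / n \<le> (norm x)\<^sup>2"
      using A positive_le_norm[OF A, of x] n by (auto simp: positive_def n_def field_simps)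
    ultimately show "\<bar>inner (Z x) x\<bar> \<le> 1 * (norm x)\<^sup>2" by simp
  qed
  then have nZ: "norm Z \<le> 1" by (intro norm_blinfun_bound) auto
  obtain X where X: "symm X" "norm X \<le> 1" "2 *\<^sub>R X = Z + (X o\<^sub>L X)" "\<And>B. commutes B Z \<Longrightarrow> commutes B X"
    using one_minus_sqrt_exists[OF sZ nZ] by blast
  define S where "S = sqrt n *\<^sub>R (id_blinfun - X)"
  have Sx: "S x = sqrt n *\<^sub>R (x - X x)" for x by (simp add: S_def blinfun.bilinear_simps)
  show ?thesis
  proof (rule that[of S])
    have "0 \<le> inner (x - X x) x" for x
    proof -
      have "inner (X x) x \<le> norm (X x) * norm x" by (rule norm_cauchy_schwarz)
      also have "\<dots> \<le> norm x * norm x"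
        using norm_blinfun[of X x] mult_right_mono[OF X(2) norm_ge_zero[of x]] by (intro mult_right_mono) auto
      finally show ?thesis by (simp add: inner_diff_left power2_norm_eq_inner[symmetric] power2_eq_square)
    qed
    then show "positive S" using X(1) n
      by (auto simp: positive_def symm_def Sx inner_diff_left inner_diff_right)
    show "S o\<^sub>L S = A"
    proof (rule blinfun_eqI)
      fix x
      have "2 *\<^sub>R X x = Z x + X (X x)" using X(3) by (metis blinfun.add_left blinfun.scaleR_left blinfun_apply_blinfun_compose)
      then have *: "X (X x) = 2 *\<^sub>R X x - x + (1/n) *\<^sub>R A x" by (simp add: Zx)
      have "S (S x) = n *\<^sub>R (x - X x - (X x - X (X x)))"
        using n by (simp add: Sx blinfun.bilinear_simps scaleR_diff_right)
      also have "\<dots> = n *\<^sub>R ((1/n) *\<^sub>R A x)" unfolding * by (simp add: scaleR_2 algebra_simps)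
      finally show "(S o\<^sub>L S) x = A x" using n by simp
    qed
    show "commutes B S" if "commutes B A" for B
    proof -
      have "commutes B Z" using that by (simp add: commutes_iff Zx blinfun.bilinear_simps)
      then have "commutes B X" by (rule X(4))
      then show ?thesis by (simp add: commutes_iff Sx blinfun.bilinear_simps)
    qed
  qed
qed

text \<open>With A = S^2 the form is the square of the norm of \<open>S x\<close>.\<close>

lemma positive_inner_0:
  assumes A: "positive A" and "inner (A x) x = 0" shows "A x = 0"
proof -
  obtain S where S: "positive S" "S o\<^sub>L S = A" using positive_sqrt_exists[OF A] by blast
  have "inner (A x) x = (norm (S x))\<^sup>2"
    using S by (metis blinfun_apply_blinfun_compose positive_def power2_norm_eq_inner symmD)
  then have "S x = 0" using assms by simp
  then show ?thesis using S(2) by (metis blinfun.zero_right blinfun_apply_blinfun_compose)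
qed

text \<open>Any positive root B of A commutes with A, hence with the constructed root Q. Then (B +
  Q)(B - Q) = 0, so for y = (B - Q) x the nonnegative numbers <B y, y> and <Q y, y> add up to 0;
  hence B y = Q y = 0 and <y, y> = <x, (B - Q) y> = 0.\<close>

lemma positive_sqrt_unique:
  assumes S: "positive S" "positive R" "S o\<^sub>L S = R o\<^sub>L R"
  shows "S = R"
proof -
  define A where "A = S o\<^sub>L S"
  have "positive A" using S(1) unfolding A_def positive_def symm_def
    by (metis blinfun_apply_blinfun_compose inner_ge_zero)
  then obtain Q where Q: "positive Q" "Q o\<^sub>L Q = A" "\<And>B. commutes B A \<Longrightarrow> commutes B Q"
    using positive_sqrt_exists by blast
  have *: "B = Q" if B: "positive B" "B o\<^sub>L B = A" for B
  proof (rule blinfun_eqI)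
    fix x
    have c: "B (Q y) = Q (B y)" for y
    proof -
      have "commutes B A" unfolding B(2)[symmetric] by (simp add: commutes_iff)
      then show ?thesis by (rule commutesD[OF Q(3)])
    qed
    have BQ: "B (B y) = Q (Q y)" for y using B(2) Q(2) by (metis blinfun_apply_blinfun_compose)
    define y where "y = B x - Q x"
    have "B y + Q y = 0" by (simp add: y_def blinfun.bilinear_simps BQ c)
    then have "inner (B y) y + inner (Q y) y = 0" by (metis inner_add_left inner_zero_left)
    then have "inner (B y) y = 0" "inner (Q y) y = 0"
      using B(1) Q(1) by (simp_all add: positive_def add_nonneg_eq_0_iff)
    then have "B y = 0" "Q y = 0" using positive_inner_0 B(1) Q(1) by auto
    then have "inner x (B y - Q y) = 0" by simp
    moreover have "inner x (B y - Q y) = inner y y"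
      using B(1) Q(1) by (simp add: inner_diff_right inner_diff_left positive_def symm_def y_def blinfun.bilinear_simps)
    ultimately show "B x = Q x" by (simp add: y_def)
  qed
  show ?thesis using *[OF S(1)] *[OF S(2)] S(3) by (simp add: A_def)
qed

definition psqrt :: "('a::{real_inner,banach} \<Rightarrow>\<^sub>L 'a) \<Rightarrow> 'a \<Rightarrow>\<^sub>L 'a" where
  "psqrt A = (THE S. positive S \<and> S o\<^sub>L S = A)"

lemma psqrt:
  assumes "positive A"
  shows psqrt_positive: "positive (psqrt A)" and psqrt_square: "psqrt A o\<^sub>L psqrt A = A"
    and psqrt_commutes: "commutes B A \<Longrightarrow> commutes B (psqrt A)"
proof -
  obtain S where S: "positive S" "S o\<^sub>L S = A" "\<And>B. commutes B A \<Longrightarrow> commutes B S"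
    using positive_sqrt_exists[OF assms] by blast
  have "psqrt A = S" unfolding psqrt_def
  proof (rule the_equality)
    show "R = S" if "positive R \<and> R o\<^sub>L R = A" for R
      by (rule positive_sqrt_unique) (simp_all add: that S)
  qed (simp add: S)
  then show "positive (psqrt A)" "psqrt A o\<^sub>L psqrt A = A" "commutes B A \<Longrightarrow> commutes B (psqrt A)"
    using S(1,2) S(3)[of B] by simp_all
qed

text \<open>The root R of A commutes with B, so <A B x, x> = <B R x, R x>.\<close>

lemma positive_mult:
  assumes "positive A" "positive B" "commutes A B" shows "positive (A o\<^sub>L B)"
proof -
  define R where "R = psqrt A"
  have R0: "symm R" using psqrt_positive[OF assms(1)] by (simp add: R_def positive_def)
  have R1: "R (R x) = A x" for x
    unfolding R_def by (metis psqrt_square[OF assms(1)] blinfun_apply_blinfun_compose)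
  have "commutes B R" unfolding R_def by (rule psqrt_commutes[OF assms(1)]) (simp add: assms(3))
  then have R2: "R (B x) = B (R x)" for x by (simp add: commutesD)
  have "inner (A (B x)) x = inner (B (R x)) (R x)" for x
    using symmD[OF R0, of "B (R x)" x] by (simp add: R1[symmetric] R2)
  moreover have "symm (A o\<^sub>L B)" using assms commutesD[OF assms(3)]
    by (simp add: symm_def positive_def)
  ultimately show ?thesis using assms(2) by (simp add: positive_def)
qed


text \<open>\<open>P\<close> projects onto the kernel of N = |D| + D, where |D| is the root of D^2.
  On this kernel D = - |D|; on the closure of the range of N, D = |D|, and strictly so because the
  kernel of D is contained in that of N. Null vectors of \<open>D\<close> fall to \<open>P\<close>,
  which later puts the eigenvalue t into the projection for (-infinity, t].\<close>

lemma sign_projection: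
  assumes D: "symm D"
  obtains P where "is_proj P" "\<And>B. commutes B D \<Longrightarrow> commutes B P"
    "\<And>x. P x = x \<Longrightarrow> inner (D x) x \<le> 0" "\<And>x. P x = 0 \<Longrightarrow> x \<noteq> 0 \<Longrightarrow> 0 < inner (D x) x"
proof -
  have pos: "positive (D o\<^sub>L D)"
    unfolding positive_def symm_def by (metis symmD[OF D] blinfun_apply_blinfun_compose inner_ge_zero)
  define A where "A = psqrt (D o\<^sub>L D)"
  have A: "symm A" "\<And>x. 0 \<le> inner (A x) x"
    using psqrt_positive[OF pos] by (simp_all add: A_def positive_def)
  have AA: "A (A x) = D (D x)" for x
    unfolding A_def by (metis psqrt_square[OF pos] blinfun_apply_blinfun_compose)
  have commA: "commutes B A" if "commutes B D" for B
    unfolding A_def by (rule psqrt_commutes[OF pos]) (simp add: commutes_iff commutesD[OF that])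
  have AD: "A (D x) = D (A x)" for x by (rule commutesD[symmetric]) (rule commA, simp)
  define N where "N = A + D"
  have Nx: "N x = A x + D x" for x by (simp add: N_def blinfun.bilinear_simps)
  have symN: "inner (N x) y = inner x (N y)" for x y
    by (simp add: Nx inner_add_left inner_add_right symmD[OF A(1)] symmD[OF D])
  define W where "W = closure (range N)"
  have W: "closed W" "subspace W" unfolding W_def
    by (rule closed_closure, rule subspace_closure_range)
  obtain Q where Q: "is_proj Q" "range (blinfun_apply Q) = W" "\<And>x v. v \<in> W \<Longrightarrow> inner (x - Q x) v = 0"
    using proj_exists[OF W] by blast
  have QW: "Q x = x \<longleftrightarrow> x \<in> W" for x using is_proj_range[OF Q(1), of x] unfolding Q(2) by simp
  have NQ: "Q (N x) = N x" for x
    unfolding QW W_def by (rule subsetD[OF closure_subset]) (rule rangeI)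
  have kerN: "Q x = 0 \<longleftrightarrow> N x = 0" for x
  proof
    assume "Q x = 0"
    then have "inner (N x) (N x) = 0"
      using is_proj_sym[OF Q(1), of x "N (N x)"] by (simp add: NQ symN)
    then show "N x = 0" by simp
  next
    assume "N x = 0"
    then have "range N \<subseteq> {v. inner x v = 0}" by (auto simp: symN[symmetric])
    then have "W \<subseteq> {v. inner x v = 0}" unfolding W_def
      by (intro closure_minimal closed_Collect_eq continuous_intros) auto
    then have "inner x (Q x) = 0" using QW is_proj_idem[OF Q(1)] by blast
    then show "Q x = 0" using is_proj_inner[OF Q(1), of x] by (simp add: inner_commute)
  qed
  have commQ: "commutes B Q" if B: "commutes B D" for B
  proof -
    have BN: "B (N x) = N (B x)" for x
      by (simp add: Nx blinfun.bilinear_simps commutesD[OF B] commutesD[OF commA[OF B]])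
    have "range N \<subseteq> {x. B x \<in> W}"
      unfolding W_def using BN closure_subset by fastforce
    moreover have "closed {x. B x \<in> W}"
      using closed_vimage[OF W(1), of B] by (simp add: vimage_def linear_continuous_on[OF blinfun.bounded_linear_right])
    ultimately have BW: "B x \<in> W" if "x \<in> W" for x
      using that closure_minimal[of "range N" "{x. B x \<in> W}"] unfolding W_def by blast
    have "Q (B x) = B (Q x)" for x
    proof -
      have "B (Q x) \<in> W" by (rule BW) (use QW is_proj_idem[OF Q(1)] in blast)
      then have 1: "Q (B (Q x)) = B (Q x)" by (simp add: QW)
      have "Q (x - Q x) = 0" by (simp add: blinfun.bilinear_simps is_proj_idem[OF Q(1)])
      then have "N (x - Q x) = 0" by (simp add: kerN)
      then have "N (B (x - Q x)) = 0" by (simp add: BN[symmetric])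
      then have 2: "Q (B (x - Q x)) = 0" by (simp add: kerN)
      show ?thesis using 1 2 by (simp add: blinfun.bilinear_simps)
    qed
    then show ?thesis by (simp add: commutes_iff)
  qed
  show ?thesis
  proof (rule that[of "id_blinfun - Q"])
    show "is_proj (id_blinfun - Q)" by (rule is_proj_compl[OF Q(1)])
    show "commutes B (id_blinfun - Q)" if "commutes B D" for B
      by (simp add: commutes_iff blinfun.bilinear_simps commutesD[OF commQ[OF that]])
    fix x
    { assume "(id_blinfun - Q) x = x"
      then have "N x = 0" by (simp add: kerN[symmetric] blinfun.bilinear_simps)
      then have "D x = - A x" by (simp add: Nx add_eq_0_iff)
      then show "inner (D x) x \<le> 0" using A(2)[of x] by simp }
    { assume x: "(id_blinfun - Q) x = 0" "x \<noteq> 0"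
      then have Qx: "Q x = x" by (simp add: blinfun.bilinear_simps)
      \<comment> \<open>This is (A - D)(A + D) = A^2 - D^2 = 0, as A and D commute.\<close>
      have "range N \<subseteq> {x. A x = D x}" by (auto simp: Nx blinfun.bilinear_simps AA AD)
      then have "W \<subseteq> {x. A x = D x}" unfolding W_def
        by (intro closure_minimal closed_Collect_eq continuous_intros) auto
      then have eq: "A x = D x" using Qx QW by blast
      show "0 < inner (D x) x"
      proof (rule ccontr)
        assume "\<not> 0 < inner (D x) x"
        then have "inner (A x) x = 0" using A(2)[of x] eq by simp
        then have "A x = 0" using positive_inner_0 psqrt_positive[OF pos] by (simp add: A_def)
        then have "N x = 0" by (simp add: Nx eq[symmetric])
        then have "x = 0" using Qx kerN[of x] by simp
        then show False using x by simp
      qed }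
  qed
qed

section \<open>Selfadjoint relations\<close>

text \<open>The equivalence says that T equals its adjoint for the real inner product. Linearity,
  single-valuedness and closedness are consequences of this equality and are derived below.\<close>

definition sa :: "('a::{real_inner,banach} \<times> 'a) set \<Rightarrow> bool" where
  "sa T \<longleftrightarrow> closure (Domain T) = UNIV \<and>
     (\<forall>y z. (y, z) \<in> T \<longleftrightarrow> (\<forall>(x, w)\<in>T. inner w y = inner x z))"

lemma sa_sym: "sa T \<Longrightarrow> (x, y) \<in> T \<Longrightarrow> (u, v) \<in> T \<Longrightarrow> inner y u = inner x v"
  unfolding sa_def by blast

lemma sa_memI: "sa T \<Longrightarrow> (\<And>x w. (x, w) \<in> T \<Longrightarrow> inner w y = inner x z) \<Longrightarrow> (y, z) \<in> T"
  unfolding sa_def by blast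

lemma sa_dense: "sa T \<Longrightarrow> closure (Domain T) = UNIV"
  by (simp add: sa_def)

lemma dense_orthogonal_0:
  assumes "closure D = UNIV" "\<And>x. x \<in> D \<Longrightarrow> inner x z = 0" shows "z = (0::'a::real_inner)"
proof -
  have "closed {x. inner x z = 0}" by (intro closed_Collect_eq continuous_intros)
  moreover have "D \<subseteq> {x. inner x z = 0}" using assms(2) by blast
  ultimately have "closure D \<subseteq> {x. inner x z = 0}" by (rule closure_minimal[rotated])
  then have "inner z z = 0" using assms(1) by blast
  then show ?thesis by simp
qed

lemma sa_single: "sa T \<Longrightarrow> (x, y) \<in> T \<Longrightarrow> (x, z) \<in> T \<Longrightarrow> y = z"
proof -
  assume T: "sa T" "(x, y) \<in> T" "(x, z) \<in> T"
  have "y - z = 0"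
  proof (rule dense_orthogonal_0[OF sa_dense[OF T(1)]])
    fix u assume "u \<in> Domain T"
    then obtain v where "(u, v) \<in> T" by blast
    then show "inner u (y - z) = 0"
      using sa_sym[OF T(1) _ T(2)] sa_sym[OF T(1) _ T(3)] by (simp add: inner_diff_right)
  qed
  then show "y = z" by simp
qed

lemma sa_subspace: "sa T \<Longrightarrow> subspace T"
  unfolding subspace_def
proof (intro conjI ballI allI)
  assume T: "sa T"
  show "0 \<in> T" using sa_memI[OF T, of 0 0] by (simp add: zero_prod_def)
  fix p q assume pq: "p \<in> T" "q \<in> T"
  show "p + q \<in> T"
    using pq sa_sym[OF T] by (cases p; cases q) (auto intro!: sa_memI[OF T] simp: inner_add_right)
next
  assume T: "sa T"
  fix r p assume pq: "p \<in> T"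
  show "r *\<^sub>R p \<in> T"
    using pq sa_sym[OF T] by (cases p) (auto intro!: sa_memI[OF T])
qed

lemma sa_0: "sa T \<Longrightarrow> (0, 0) \<in> T"
  using subspace_0[OF sa_subspace] by (simp add: zero_prod_def)

lemma sa_add: "sa T \<Longrightarrow> (x, y) \<in> T \<Longrightarrow> (u, v) \<in> T \<Longrightarrow> (x + u, y + v) \<in> T"
  using subspace_add[OF sa_subspace] by fastforce

lemma sa_diff: "sa T \<Longrightarrow> (x, y) \<in> T \<Longrightarrow> (u, v) \<in> T \<Longrightarrow> (x - u, y - v) \<in> T"
  using subspace_diff[OF sa_subspace] by fastforce

lemma sa_scale: "sa T \<Longrightarrow> (x, y) \<in> T \<Longrightarrow> (r *\<^sub>R x, r *\<^sub>R y) \<in> T"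
  using subspace_scale[OF sa_subspace] by fastforce

text \<open>An adjoint is closed. General filters are allowed because limits of the spectral family
  are taken along one-sided neighbourhoods and at infinity.\<close>

lemma sa_limit:
  assumes T: "sa T" and F: "F \<noteq> bot" and mem: "eventually (\<lambda>n. (a n, b n) \<in> T) F"
    and a: "(a \<longlongrightarrow> x) F" and b: "(b \<longlongrightarrow> y) F"
  shows "(x, y) \<in> T"
proof (rule sa_memI[OF T])
  fix u v assume uv: "(u, v) \<in> T"
  have 1: "((\<lambda>n. inner v (a n)) \<longlongrightarrow> inner v x) F"
    by (intro tendsto_intros a)
  have 2: "((\<lambda>n. inner u (b n)) \<longlongrightarrow> inner u y) F"
    by (intro tendsto_intros b)
  have "eventually (\<lambda>n. inner v (a n) = inner u (b n)) F"
    using mem by eventually_elim (rule sa_sym[OF T uv])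
  then have "((\<lambda>n. inner v (a n)) \<longlongrightarrow> inner u y) F"
    using 2 by (simp add: tendsto_cong)
  then show "inner v x = inner u y"
    by (rule tendsto_unique[OF F 1])
qed

lemma sa_closed: "sa T \<Longrightarrow> closed T"
  unfolding closed_sequential_limits
proof (intro allI impI)
  fix s l assume T: "sa T" and s: "(\<forall>n. s n \<in> T) \<and> s \<longlonglongrightarrow> l"
  have "(fst l, snd l) \<in> T"
    by (rule sa_limit[OF T, of sequentially "\<lambda>n. fst (s n)" "\<lambda>n. snd (s n)"])
      (use s in \<open>auto intro!: tendsto_intros\<close>)
  then show "l \<in> T" by simp
qed

definition shift_op :: "('a::real_vector \<times> 'a) set \<Rightarrow> real \<Rightarrow> ('a \<times> 'a) set" where
  "shift_op T r = {(x, y + r *\<^sub>R x) |x y. (x, y) \<in> T}"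

lemma mem_shift_op: "(x, y) \<in> shift_op T r \<longleftrightarrow> (x, y - r *\<^sub>R x) \<in> T"
  by (auto simp: shift_op_def) (metis diff_add_cancel)

lemma shift_opI: "(x, y) \<in> T \<Longrightarrow> (x, y + r *\<^sub>R x) \<in> shift_op T r"
  by (auto simp: shift_op_def)

lemma shift_op_shift_op: "shift_op (shift_op T r) s = shift_op T (r + s)"
  by (auto simp: mem_shift_op scaleR_add_left algebra_simps)

lemma shift_op_0 [simp]: "shift_op T 0 = T"
  by (auto simp: mem_shift_op)

lemma sa_shift_op:
  assumes T: "sa T" shows "sa (shift_op T r)"
  unfolding sa_def
proof (intro conjI allI iffI)
  have "Domain (shift_op T r) = Domain T" by (auto simp: shift_op_def)
  then show "closure (Domain (shift_op T r)) = UNIV" using T by (simp add: sa_def)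
  fix y z
  { assume "(y, z) \<in> shift_op T r"
    then show "\<forall>(x, w)\<in>shift_op T r. inner w y = inner x z"
      using sa_sym[OF T] by (fastforce simp: shift_op_def inner_add_left inner_add_right) }
  { assume *: "\<forall>(x, w)\<in>shift_op T r. inner w y = inner x z"
    show "(y, z) \<in> shift_op T r" unfolding mem_shift_op
    proof (rule sa_memI[OF T])
      fix x w assume "(x, w) \<in> T"
      then have "(x, w + r *\<^sub>R x) \<in> shift_op T r" by (rule shift_opI)
      with * have "inner (w + r *\<^sub>R x) y = inner x z" by blast
      then show "inner w y = inner x (z - r *\<^sub>R y)" by (simp add: inner_add_left inner_diff_right)
    qed }
qed

text \<open>The usual commutation B T \<subseteq> T B of a bounded with an unbounded operator:
  \<open>B\<close> acting on both components preserves the graph.\<close>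

definition comm_op :: "('a::{real_inner,banach} \<Rightarrow>\<^sub>L 'a) \<Rightarrow> ('a \<times> 'a) set \<Rightarrow> bool" where
  "comm_op B T \<longleftrightarrow> (\<forall>x y. (x, y) \<in> T \<longrightarrow> (B x, B y) \<in> T)"

lemma comm_opD: "comm_op B T \<Longrightarrow> (x, y) \<in> T \<Longrightarrow> (B x, B y) \<in> T"
  by (simp add: comm_op_def)

lemma comm_op_shift: "comm_op B (shift_op T r) \<longleftrightarrow> comm_op B T"
proof -
  have *: "comm_op B (shift_op T r)" if "comm_op B T" for T and r :: real
    using that unfolding comm_op_def mem_shift_op
    by (metis blinfun.diff_right blinfun.scaleR_right)
  show ?thesis using *[of T r] *[of "shift_op T r" "- r"] by (auto simp: shift_op_shift_op)
qed

lemma comm_op_id: "comm_op id_blinfun T"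
  by (simp add: comm_op_def)

lemma comm_op_diff: "sa T \<Longrightarrow> comm_op A T \<Longrightarrow> comm_op B T \<Longrightarrow> comm_op (A - B) T"
  by (simp add: comm_op_def blinfun.bilinear_simps sa_diff)

lemma comm_op_compose: "comm_op A T \<Longrightarrow> comm_op B T \<Longrightarrow> comm_op (A o\<^sub>L B) T"
  by (simp add: comm_op_def)

subsection \<open>Bounded functions of a selfadjoint operator\<close>

text \<open>With \<open>C = (1 + T\<^sup>2)\<^sup>-\<^sup>1\<close> and \<open>D = T C\<close>, the pair \<open>(C x, D x)\<close> is the orthogonal projection of
  \<open>(x, 0)\<close> onto the graph of \<open>T\<close>.\<close>

lemma sa_resolvent_exists:
  fixes T :: "('a::{real_inner,banach} \<times> 'a) set"
  assumes T: "sa T"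
  obtains C D :: "'a \<Rightarrow>\<^sub>L 'a" where "\<And>x. (C x, D x) \<in> T" "\<And>x. (D x, x - C x) \<in> T"
proof -
  obtain P :: "('a \<times> 'a) \<Rightarrow>\<^sub>L ('a \<times> 'a)" where P: "is_proj P" "range (blinfun_apply P) = T"
    "\<And>x v. v \<in> T \<Longrightarrow> inner (x - P x) v = 0"
    using proj_exists[OF sa_closed[OF T] sa_subspace[OF T]] by blast
  have bl: "bounded_linear (\<lambda>x. fst (P (x, 0)))" "bounded_linear (\<lambda>x. snd (P (x, 0)))"
    by (intro bounded_linear_compose[OF bounded_linear_fst] bounded_linear_compose[OF bounded_linear_snd]
        bounded_linear_compose[OF blinfun.bounded_linear_right] bounded_linear_Pair
        bounded_linear_ident bounded_linear_zero)+
  define C where "C = Blinfun (\<lambda>x. fst (P (x, 0)))"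
  define D where "D = Blinfun (\<lambda>x. snd (P (x, 0)))"
  have CD: "(C x, D x) = P (x, 0)" for x
    by (simp add: C_def D_def bounded_linear_Blinfun_apply bl)
  show ?thesis
  proof (rule that[of C D])
    fix x
    show CDT: "(C x, D x) \<in> T" unfolding CD using P(2) by blast
    show "(D x, x - C x) \<in> T"
    proof (rule sa_memI[OF T])
      fix u v assume "(u, v) \<in> T"
      then have "inner ((x, 0) - (C x, D x)) (u, v) = 0" unfolding CD by (rule P(3))
      then show "inner v (D x) = inner u (x - C x)"
        by (simp add: inner_diff_left inner_diff_right inner_commute)
    qed
  qed
qed

definition Cop :: "('a::{real_inner,banach} \<times> 'a) set \<Rightarrow> 'a \<Rightarrow>\<^sub>L 'a" where
  "Cop T = (SOME C :: 'a \<Rightarrow>\<^sub>L 'a. \<exists>D :: 'a \<Rightarrow>\<^sub>L 'a. \<forall>x. (C x, D x) \<in> T \<and> (D x, x - C x) \<in> T)"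

definition Dop :: "('a::{real_inner,banach} \<times> 'a) set \<Rightarrow> 'a \<Rightarrow>\<^sub>L 'a" where
  "Dop T = (SOME D :: 'a \<Rightarrow>\<^sub>L 'a. \<forall>x. (Cop T x, D x) \<in> T \<and> (D x, x - Cop T x) \<in> T)"

lemma
  assumes T: "sa T"
  shows Cop_Dop: "(Cop T x, Dop T x) \<in> T" and Dop_mem: "(Dop T x, x - Cop T x) \<in> T"
proof -
  have "\<exists>C :: 'a \<Rightarrow>\<^sub>L 'a. \<exists>D :: 'a \<Rightarrow>\<^sub>L 'a. \<forall>x. (C x, D x) \<in> T \<and> (D x, x - C x) \<in> T"
    using sa_resolvent_exists[OF T] by metis
  then have "\<exists>D :: 'a \<Rightarrow>\<^sub>L 'a. \<forall>x. (Cop T x, D x) \<in> T \<and> (D x, x - Cop T x) \<in> T"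
    unfolding Cop_def by (rule someI_ex)
  then have "\<forall>x. (Cop T x, Dop T x) \<in> T \<and> (Dop T x, x - Cop T x) \<in> T"
    unfolding Dop_def by (rule someI_ex)
  then show "(Cop T x, Dop T x) \<in> T" "(Dop T x, x - Cop T x) \<in> T" by auto
qed

text \<open>The differences p, q of two solutions satisfy (p, q) \<in> T and (q, - p) \<in> T, so
  symmetry gives <q, q> = - <p, p>. Identities for \<open>Cop\<close> and \<open>Dop\<close> are
  from here on proved by exhibiting two elements of the graph.\<close>

lemma Cop_Dop_unique:
  assumes T: "sa T" and uv: "(u, v) \<in> T" "(v, x - u) \<in> T"
  shows "Cop T x = u" "Dop T x = v"
proof -
  have 1: "(Cop T x - u, Dop T x - v) \<in> T" by (rule sa_diff[OF T Cop_Dop[OF T] uv(1)])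
  have "(Dop T x - v, (x - Cop T x) - (x - u)) \<in> T" by (rule sa_diff[OF T Dop_mem[OF T] uv(2)])
  then have 2: "(Dop T x - v, - (Cop T x - u)) \<in> T" by simp
  have "inner (Dop T x - v) (Dop T x - v) = - inner (Cop T x - u) (Cop T x - u)"
    using sa_sym[OF T 1 2] by (simp add: inner_diff_right)
  then have "inner (Dop T x - v) (Dop T x - v) = 0 \<and> inner (Cop T x - u) (Cop T x - u) = 0"
    using inner_ge_zero[of "Dop T x - v"] inner_ge_zero[of "Cop T x - u"] by linarith
  then show "Cop T x = u" "Dop T x = v" by simp_all
qed

lemma
  assumes T: "sa T" and B: "comm_op B T"
  shows Cop_commutes: "commutes B (Cop T)" and Dop_commutes: "commutes B (Dop T)"
proof -
  have "(B (Cop T x), B (Dop T x)) \<in> T" "(B (Dop T x), B x - B (Cop T x)) \<in> T" for x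
    using comm_opD[OF B Cop_Dop[OF T]] comm_opD[OF B Dop_mem[OF T, of x]]
    by (simp_all add: blinfun.bilinear_simps)
  then have "Cop T (B x) = B (Cop T x) \<and> Dop T (B x) = B (Dop T x)" for x
    using Cop_Dop_unique[OF T] by blast
  then show "commutes B (Cop T)" "commutes B (Dop T)" by (simp_all add: commutes_iff)
qed

text \<open>Subtracting the graph pair (C x, D x) from (x, y) leaves a pair that, with (D x, x - C
  x), solves the equations characterising C y and D y.\<close>

lemma Cop_apply: "sa T \<Longrightarrow> (x, y) \<in> T \<Longrightarrow> Cop T y = Dop T x"
  and Dop_apply: "sa T \<Longrightarrow> (x, y) \<in> T \<Longrightarrow> Dop T y = x - Cop T x"
proof -
  assume T: "sa T" and xy: "(x, y) \<in> T"
  have "(x - Cop T x, y - Dop T x) \<in> T" by (rule sa_diff[OF T xy Cop_Dop[OF T]])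
  then show "Cop T y = Dop T x" "Dop T y = x - Cop T x"
    by (rule Cop_Dop_unique(1)[OF T Dop_mem[OF T, of x]], rule Cop_Dop_unique(2)[OF T Dop_mem[OF T, of x]])
qed

lemma comm_op_Cop: "sa T \<Longrightarrow> comm_op (Cop T) T"
  unfolding comm_op_def using Cop_Dop[of T] Cop_apply[of T] by simp

lemma comm_op_Dop: "sa T \<Longrightarrow> comm_op (Dop T) T"
  unfolding comm_op_def using Dop_mem[of T] Dop_apply[of T] by simp

text \<open>A graph element (x, y) is the sum of the projections of (x, 0) and of (0, y) onto the
  graph, which are (C x, D x) and (D y, y - C y); so commutation with \<open>C\<close> and
  \<open>D\<close> is enough.\<close>

lemma comm_opI:
  assumes T: "sa T" and B: "commutes B (Cop T)" "commutes B (Dop T)" shows "comm_op B T"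
  unfolding comm_op_def
proof (intro allI impI)
  fix x y assume xy: "(x, y) \<in> T"
  have x: "x = Cop T x + Dop T y" using Dop_apply[OF T xy] by simp
  have y: "y = Dop T x + (y - Cop T y)" using Cop_apply[OF T xy] by simp
  have "(Cop T (B x) + Dop T (B y), Dop T (B x) + (B y - Cop T (B y))) \<in> T"
    by (rule sa_add[OF T Cop_Dop[OF T] Dop_mem[OF T]])
  moreover have "Cop T (B x) + Dop T (B y) = B x"
    using arg_cong[OF x, of "blinfun_apply B"]
    by (simp add: blinfun.bilinear_simps commutesD[OF B(1)] commutesD[OF B(2)])
  moreover have "Dop T (B x) + (B y - Cop T (B y)) = B y"
    using arg_cong[OF y, of "blinfun_apply B"]
    by (simp add: blinfun.bilinear_simps commutesD[OF B(1)] commutesD[OF B(2)])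
  ultimately show "(B x, B y) \<in> T" by simp
qed

text \<open>The identity C = C^2 + D^2 in form language, read off from the graph pairs (C x, D x)
  and (D y, y - C y).\<close>

lemma inner_Cop:
  assumes T: "sa T"
  shows "inner (Cop T x) y = inner (Cop T x) (Cop T y) + inner (Dop T x) (Dop T y)"
  using sa_sym[OF T Cop_Dop[OF T, of x] Dop_mem[OF T, of y]] by (simp add: inner_diff_right)

lemma Cop_positive: "sa T \<Longrightarrow> positive (Cop T)"
  unfolding positive_def symm_def
  using inner_Cop[of T] by (metis inner_commute add_nonneg_nonneg inner_ge_zero)

lemma Dop_symm: "sa T \<Longrightarrow> symm (Dop T)"
  unfolding symm_def
proof (intro allI)
  fix x y assume T: "sa T"
  show "inner (Dop T x) y = inner x (Dop T y)"
    using sa_sym[OF T Cop_Dop[OF T, of x] Cop_Dop[OF T, of y]]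
      sa_sym[OF T Dop_mem[OF T, of x] Dop_mem[OF T, of y]]
    by (simp add: inner_diff_left inner_diff_right)
qed

lemma Cop_eq_0: assumes T: "sa T" and "Cop T x = 0" shows "x = 0"
proof -
  have "Dop T x = 0" using inner_Cop[OF T, of x x] assms by simp
  then have "(0, x) \<in> T" using Dop_mem[OF T, of x] assms by simp
  then show ?thesis using sa_single[OF T _ sa_0[OF T]] by blast
qed

section \<open>The bounded transform: G = (1 + T^2)^(-1/2) and F = T G\<close>

definition Gop :: "('a::{real_inner,banach} \<times> 'a) set \<Rightarrow> 'a \<Rightarrow>\<^sub>L 'a" where
  "Gop T = psqrt (Cop T)"

lemma Gop_positive: "sa T \<Longrightarrow> positive (Gop T)"
  unfolding Gop_def by (intro psqrt_positive Cop_positive)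

lemma Gop_symm: "sa T \<Longrightarrow> symm (Gop T)"
  using Gop_positive positive_def by blast

lemma Gop_Gop: "sa T \<Longrightarrow> Gop T (Gop T x) = Cop T x"
  unfolding Gop_def using psqrt_square[OF Cop_positive] by (metis blinfun_apply_blinfun_compose)

lemma Gop_commutes: "sa T \<Longrightarrow> comm_op B T \<Longrightarrow> commutes B (Gop T)"
  unfolding Gop_def by (intro psqrt_commutes Cop_positive Cop_commutes)

lemma comm_op_Gop: assumes T: "sa T" shows "comm_op (Gop T) T"
proof (rule comm_opI[OF T])
  show "commutes (Gop T) (Cop T)" by (rule Gop_commutes[OF T comm_op_Cop[OF T], symmetric])
  show "commutes (Gop T) (Dop T)" by (rule Gop_commutes[OF T comm_op_Dop[OF T], symmetric])
qed

lemma Gop_range_dense: assumes T: "sa T" shows "closure (range (Gop T)) = UNIV"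
proof (rule closed_subspace_eq_UNIV)
  show "subspace (closure (range (Gop T)))"
    by (rule subspace_closure_range)
  fix x assume *: "\<And>v. v \<in> closure (range (Gop T)) \<Longrightarrow> inner x v = 0"
  have "inner x (Gop T (Gop T (Gop T x))) = 0" by (rule *) (meson closure_subset rangeI subsetD)
  moreover have "inner x (Gop T (Gop T (Gop T x))) = inner (Cop T x) (Gop T x)"
    using symmD[OF Gop_symm[OF T]] Gop_Gop[OF T] by metis
  moreover have "inner x (Cop T x) = 0" unfolding Gop_Gop[OF T, symmetric]
    by (rule *) (meson closure_subset rangeI subsetD)
  ultimately have "Cop T x = 0" using positive_inner_0[OF Cop_positive[OF T], of x] by (simp add: inner_commute)
  then show "x = 0" by (rule Cop_eq_0[OF T])
qed simp

text \<open>On the dense range of G the operator T G acts as G z -> D z, which is a contraction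
  because |G z|^2 = |C z|^2 + |D z|^2. Closedness of T extends the relation to all vectors.\<close>

lemma Fop_exists:
  fixes T :: "('a::{real_inner,banach} \<times> 'a) set"
  assumes T: "sa T"
  shows "\<exists>F :: 'a \<Rightarrow>\<^sub>L 'a. \<forall>x. (Gop T x, F x) \<in> T"
proof -
  have DG: "norm (Dop T z) \<le> norm (Gop T z)" for z
  proof -
    have "(norm (Gop T z))\<^sup>2 = inner (Cop T z) z"
      using symmD[OF Gop_symm[OF T], of "Gop T z" z] by (simp add: Gop_Gop[OF T] power2_norm_eq_inner)
    also have "\<dots> = (norm (Cop T z))\<^sup>2 + (norm (Dop T z))\<^sup>2"
      using inner_Cop[OF T, of z z] by (simp add: power2_norm_eq_inner)
    finally show ?thesis by (auto intro: power2_le_imp_le[OF _ norm_ge_zero])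
  qed
  have "\<exists>y. (Gop T x, y) \<in> T \<and> norm y \<le> norm x" for x
  proof -
    have "x \<in> closure (range (Gop T))" using Gop_range_dense[OF T] by simp
    then obtain s where s: "\<And>n. s n \<in> range (Gop T)" "s \<longlonglongrightarrow> x"
      using closure_sequential[of x] by blast
    from s(1) have "\<forall>n. \<exists>z. s n = Gop T z" by blast
    then obtain z where z: "\<And>n. s n = Gop T (z n)" by metis
    have "Cauchy (\<lambda>n. Dop T (z n))"
    proof (rule metric_CauchyI)
      fix e :: real assume "e > 0"
      then obtain N where N: "\<And>m n. m \<ge> N \<Longrightarrow> n \<ge> N \<Longrightarrow> dist (s m) (s n) < e"
        using LIMSEQ_imp_Cauchy[OF s(2)] by (meson metric_CauchyD)
      have "dist (Dop T (z m)) (Dop T (z n)) \<le> dist (s m) (s n)" for m n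
        using DG[of "z m - z n"] by (simp add: dist_norm z blinfun.bilinear_simps)
      then show "\<exists>M. \<forall>m\<ge>M. \<forall>n\<ge>M. dist (Dop T (z m)) (Dop T (z n)) < e"
        using N order.strict_trans1 by blast
    qed
    then obtain y where y: "(\<lambda>n. Dop T (z n)) \<longlonglongrightarrow> y" using Cauchy_convergent convergent_def by blast
    have "(\<lambda>n. Gop T (s n)) \<longlonglongrightarrow> Gop T x" by (intro tendsto_intros s)
    then have "(Gop T x, y) \<in> T"
      by (intro sa_limit[OF T _ _ _ y, of "\<lambda>n. Gop T (s n)"]) (auto simp: z Gop_Gop[OF T] Cop_Dop[OF T])
    moreover have "norm y \<le> norm x"
      by (rule LIMSEQ_le[OF tendsto_norm[OF y] tendsto_norm[OF s(2)]]) (auto simp: z DG)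
    ultimately show ?thesis by blast
  qed
  then obtain f where f: "\<And>x. (Gop T x, f x) \<in> T" "\<And>x. norm (f x) \<le> norm x" by metis
  have "bounded_linear f"
  proof (rule bounded_linear_intro[of _ 1])
    show "f (x + y) = f x + f y" for x y
      using sa_single[OF T f(1)[of "x + y"]] sa_add[OF T f(1)[of x] f(1)[of y]]
      by (simp add: blinfun.bilinear_simps)
    show "f (r *\<^sub>R x) = r *\<^sub>R f x" for r x
      using sa_single[OF T f(1)[of "r *\<^sub>R x"]] sa_scale[OF T f(1)[of x], of r]
      by (simp add: blinfun.bilinear_simps)
  qed (simp add: f)
  then have "\<forall>x. (Gop T x, Blinfun f x) \<in> T" by (simp add: bounded_linear_Blinfun_apply f)
  then show ?thesis by blast
qed

definition Fop :: "('a::{real_inner,banach} \<times> 'a) set \<Rightarrow> 'a \<Rightarrow>\<^sub>L 'a" where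
  "Fop T = (SOME F :: 'a \<Rightarrow>\<^sub>L 'a. \<forall>x. (Gop T x, F x) \<in> T)"

lemma Gop_Fop: "sa T \<Longrightarrow> (Gop T x, Fop T x) \<in> T"
  using someI_ex[OF Fop_exists] unfolding Fop_def by blast

lemma Fop_eq: "sa T \<Longrightarrow> (Gop T x, y) \<in> T \<Longrightarrow> Fop T x = y"
  using Gop_Fop sa_single by blast

lemma Fop_commutes:
  assumes T: "sa T" and B: "comm_op B T" shows "commutes B (Fop T)"
proof -
  have "Fop T (B x) = B (Fop T x)" for x
  proof (rule Fop_eq[OF T])
    show "(Gop T (B x), B (Fop T x)) \<in> T"
      using comm_opD[OF B Gop_Fop[OF T, of x]] commutesD[OF Gop_commutes[OF T B], of x] by simp
  qed
  then show ?thesis by (simp add: commutes_iff)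
qed

lemma Fop_Gop: "sa T \<Longrightarrow> Fop T (Gop T x) = Dop T x"
  by (rule Fop_eq) (auto simp: Gop_Gop Cop_Dop)

lemma Gop_Fop_apply: "sa T \<Longrightarrow> Gop T (Fop T x) = Dop T x"
  using commutesD[OF Fop_commutes[OF _ comm_op_Gop]] Fop_Gop by metis

lemma dense_eq:
  assumes "closure D = UNIV" "continuous_on UNIV f" "continuous_on UNIV g" "\<And>x. x \<in> D \<Longrightarrow> f x = g x"
  shows "f x = (g x :: 'b::t2_space)"
proof -
  have "closed {x. f x = g x}" by (intro closed_Collect_eq assms)
  then have "closure D \<subseteq> {x. f x = g x}" using assms(4) by (intro closure_minimal) auto
  then show ?thesis using assms(1) by auto
qed

lemma Fop_symm: assumes T: "sa T" shows "symm (Fop T)"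
  unfolding symm_def
proof (intro allI)
  fix x y
  show "inner (Fop T x) y = inner x (Fop T y)"
  proof (rule dense_eq[OF Gop_range_dense[OF T], where x = y])
    fix y assume "y \<in> range (Gop T)"
    then obtain w where y: "y = Gop T w" by blast
    have "inner (Fop T x) y = inner (Gop T x) (Fop T w)"
      unfolding y by (rule sa_sym[OF T Gop_Fop[OF T] Gop_Fop[OF T]])
    then show "inner (Fop T x) y = inner x (Fop T y)"
      by (simp add: y symmD[OF Gop_symm[OF T]] Gop_Fop_apply[OF T] Fop_Gop[OF T])
  qed (intro continuous_intros)+
qed

lemma Fop_Gop_squares: assumes T: "sa T" shows "Fop T (Fop T x) + Cop T x = x"
proof (rule dense_eq[OF Gop_range_dense[OF T], where x = x])
  fix y assume "y \<in> range (Gop T)"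
  then obtain w where y: "y = Gop T w" by blast
  have "(Gop T (Dop T w), Gop T (w - Cop T w)) \<in> T"
    by (rule comm_opD[OF comm_op_Gop[OF T] Dop_mem[OF T]])
  then have "Fop T (Dop T w) = Gop T (w - Cop T w)" by (rule Fop_eq[OF T])
  moreover have "Cop T (Gop T w) = Gop T (Cop T w)" by (simp add: Gop_Gop[OF T, symmetric])
  ultimately show "Fop T (Fop T y) + Cop T y = y"
    by (simp add: y Fop_Gop[OF T] blinfun.bilinear_simps)
qed (intro continuous_intros)+

text \<open>Since F^2 + G^2 = 1, the map w -> (G w, F w) parametrises the graph isometrically; w = G
  x + F y is the parameter of (x, y).\<close>

lemma
  assumes T: "sa T" and xy: "(x, y) \<in> T"
  shows Gop_surj: "x = Gop T (Gop T x + Fop T y)" and Fop_surj: "y = Fop T (Gop T x + Fop T y)"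
proof -
  show 1: "x = Gop T (Gop T x + Fop T y)"
    by (simp add: blinfun.bilinear_simps Gop_Gop[OF T] Gop_Fop_apply[OF T] Dop_apply[OF T xy])
  show "y = Fop T (Gop T x + Fop T y)"
    using Fop_eq[OF T, of "Gop T x + Fop T y" y] 1 xy by simp
qed

subsection \<open>The spectral family\<close>

text \<open>Characterises the spectral projection for (-infinity, t] through the quadratic form
  alone, without integrals. The pairing of \<le> with < assigns the eigenvalue t to the
  range.\<close>

definition below :: "('a::{real_inner,banach} \<times> 'a) set \<Rightarrow> real \<Rightarrow> ('a \<Rightarrow>\<^sub>L 'a) \<Rightarrow> bool" where
  "below T t P \<longleftrightarrow> is_proj P \<and> comm_op P T \<and>
     (\<forall>x y. (x, y) \<in> T \<longrightarrow> P x = x \<longrightarrow> inner y x \<le> t * (norm x)\<^sup>2) \<and>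
     (\<forall>x y. (x, y) \<in> T \<longrightarrow> P x = 0 \<longrightarrow> x \<noteq> 0 \<longrightarrow> t * (norm x)\<^sup>2 < inner y x)"

text \<open>D = T (1 + T^2)^-1 has the sign of T: if (x, y) = (G w, F w), then <y, x> = <G F w, w> =
  <D w, w>. So the sign projection of the bounded operator D serves for T.\<close>

lemma below_0_exists:
  assumes T: "sa T"
  obtains P where "below T 0 P" "\<And>B. comm_op B T \<Longrightarrow> commutes B P"
proof -
  obtain P where P: "is_proj P" "\<And>B. commutes B (Dop T) \<Longrightarrow> commutes B P"
    "\<And>x. P x = x \<Longrightarrow> inner (Dop T x) x \<le> 0" "\<And>x. P x = 0 \<Longrightarrow> x \<noteq> 0 \<Longrightarrow> 0 < inner (Dop T x) x"
    using sign_projection[OF Dop_symm[OF T]] by blast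
  have comm: "commutes B P" if "comm_op B T" for B
    by (rule P(2)[OF Dop_commutes[OF T that]])
  have PT: "comm_op P T"
    by (rule comm_opI[OF T comm[OF comm_op_Cop[OF T], symmetric] comm[OF comm_op_Dop[OF T], symmetric]])
  have form: "inner y x = inner (Dop T (Gop T x + Fop T y)) (Gop T x + Fop T y)" if "(x, y) \<in> T" for x y
  proof -
    define w where "w = Gop T x + Fop T y"
    have "inner y x = inner (Fop T w) (Gop T w)"
      using Gop_surj[OF T that] Fop_surj[OF T that] unfolding w_def by metis
    then show ?thesis
      by (simp add: symmD[OF Gop_symm[OF T], symmetric] Gop_Fop_apply[OF T] w_def[symmetric])
  qed
  have Pw: "P (Gop T x + Fop T y) = Gop T (P x) + Fop T (P y)" if "(x, y) \<in> T" for x y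
    by (simp add: blinfun.bilinear_simps commutesD[OF Gop_commutes[OF T PT]] commutesD[OF Fop_commutes[OF T PT]])
  have "below T 0 P" unfolding below_def
  proof (intro conjI allI impI)
    fix x y assume xy: "(x, y) \<in> T"
    { assume x: "P x = x"
      have "P y = y" using sa_single[OF T xy] comm_opD[OF PT xy] x by metis
      then show "inner y x \<le> 0 * (norm x)\<^sup>2" using P(3) form[OF xy] Pw[OF xy] x by simp }
    { assume x: "P x = 0" "x \<noteq> 0"
      have "P y = 0" using sa_single[OF T sa_0[OF T]] comm_opD[OF PT xy] x by metis
      moreover have "Gop T x + Fop T y \<noteq> 0" using Gop_surj[OF T xy] x by force
      ultimately show "0 * (norm x)\<^sup>2 < inner y x" using P(4) form[OF xy] Pw[OF xy] x by simp }
  qed (auto simp: P PT)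
  then show ?thesis using that comm by blast
qed

lemma below_shift: "below (shift_op T r) (t + r) P \<longleftrightarrow> below T t P"
proof -
  have *: "below (shift_op T r) (t + r) P" if "below T t P" for T and t r :: real
    using that unfolding below_def comm_op_shift mem_shift_op
    by (fastforce simp: inner_diff_left power2_norm_eq_inner algebra_simps)
  show ?thesis using *[of T t r] *[of "shift_op T r" "t + r" "- r"] by (auto simp: shift_op_shift_op)
qed

lemma below_exists:
  assumes T: "sa T"
  obtains P where "below T t P" "\<And>B. comm_op B T \<Longrightarrow> commutes B P"
proof -
  obtain P where "below (shift_op T (- t)) 0 P" "\<And>B. comm_op B (shift_op T (- t)) \<Longrightarrow> commutes B P"
    using below_0_exists[OF sa_shift_op[OF T]] by blast
  then show ?thesis using that below_shift[of T "- t" t P] by (simp add: comm_op_shift)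
qed

text \<open>\<open>R\<close> maps the dense domain of \<open>T\<close> into itself, so it is enough
  to find no nonzero vector of the range inside the domain, where the form of \<open>T\<close> is
  available.\<close>

lemma proj_eq_0:
  fixes T :: "('a::{real_inner,banach} \<times> 'a) set"
  assumes T: "sa T" and R: "comm_op R T" "is_proj R" "\<And>x y. (x, y) \<in> T \<Longrightarrow> R x = x \<Longrightarrow> x = 0"
  shows "R = 0"
proof (rule blinfun_eqI)
  fix x
  show "R x = (0 :: 'a \<Rightarrow>\<^sub>L 'a) x"
  proof (rule dense_eq[OF sa_dense[OF T], where x = x])
    fix u assume "u \<in> Domain T"
    then obtain v where "(u, v) \<in> T" by blast
    then have "(R u, R v) \<in> T" by (rule comm_opD[OF R(1)])
    then show "R u = (0 :: 'a \<Rightarrow>\<^sub>L 'a) u" using R(3) is_proj_idem[OF R(2)] by auto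
  qed (auto intro: continuous_intros)
qed

text \<open>On the range of P (1 - Q) the form would be at most s and, for nonzero vectors, above t,
  while s \<le> t.\<close>

lemma below_compose:
  assumes T: "sa T" and P: "below T s P" and Q: "below T t Q" and st: "s \<le> t" and PQ: "commutes P Q"
  shows "P o\<^sub>L Q = P"
proof -
  define R where "R = P o\<^sub>L (id_blinfun - Q)"
  have Rx: "R x = P x - P (Q x)" for x by (simp add: R_def blinfun.bilinear_simps)
  have "R = 0"
  proof (rule proj_eq_0[OF T])
    show "comm_op R T" unfolding R_def using P Q
      by (intro comm_op_compose comm_op_diff[OF T] comm_op_id) (auto simp: below_def)
    show "is_proj R" unfolding R_def using P Q
      by (intro is_proj_compose is_proj_compl) (auto simp: below_def commutes_iff blinfun.bilinear_simps commutesD[OF PQ])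
    fix x y assume xy: "(x, y) \<in> T" and Rxx: "R x = x"
    have PP: "P (P x) = P x" and QQ: "Q (Q x) = Q x" for x using P Q by (auto simp: below_def is_proj_def)
    have "P (R x) = R x" "Q (R x) = 0"
      by (simp_all add: Rx blinfun.bilinear_simps PP QQ commutesD[OF PQ, symmetric])
    then have "P x = x" "Q x = 0" using Rxx by simp_all
    then have "inner y x \<le> s * (norm x)\<^sup>2" "x \<noteq> 0 \<Longrightarrow> t * (norm x)\<^sup>2 < inner y x"
      using P Q xy by (auto simp: below_def)
    then show "x = 0" using mult_right_mono[OF st zero_le_power2[of "norm x"]] by force
  qed
  then have "P x - P (Q x) = 0" for x using Rx[of x] by simp
  then show ?thesis by (intro blinfun_eqI) simp
qed

text \<open>Monotonicity with s = t in both directions; \<open>P\<close> commutes with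
  \<open>Q\<close> because it commutes with everything that commutes with \<open>T\<close>.\<close>

lemma below_unique:
  assumes T: "sa T" and P: "below T t P" "\<And>B. comm_op B T \<Longrightarrow> commutes B P" and Q: "below T t Q"
  shows "Q = P"
proof -
  have c: "commutes Q P" using P(2) Q by (simp add: below_def)
  show ?thesis using below_compose[OF T P(1) Q order_refl c[symmetric]]
      below_compose[OF T Q P(1) order_refl c] c by simp
qed

definition Eproj :: "('a::{real_inner,banach} \<times> 'a) set \<Rightarrow> real \<Rightarrow> 'a \<Rightarrow>\<^sub>L 'a" where
  "Eproj T t = (THE P. below T t P)"

lemma
  assumes T: "sa T"
  shows Eproj_below: "below T t (Eproj T t)" and Eproj_commutes: "comm_op B T \<Longrightarrow> commutes B (Eproj T t)"
    and Eproj_unique: "\<And>Q. below T t Q \<Longrightarrow> Eproj T t = Q"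
proof -
  obtain P where P: "below T t P" "\<And>B. comm_op B T \<Longrightarrow> commutes B P" using below_exists[OF T] by blast
  have uq: "Q = P" if "below T t Q" for Q by (rule below_unique[OF T P that])
  have E: "Eproj T t = P" unfolding Eproj_def by (rule the_equality) (fact P(1), erule uq)
  show "below T t (Eproj T t)" "comm_op B T \<Longrightarrow> commutes B (Eproj T t)" using E P(1) P(2)[of B] by simp_all
  show "Eproj T t = Q" if "below T t Q" for Q using uq[OF that] E by simp
qed

lemma Eproj_is_proj: "sa T \<Longrightarrow> is_proj (Eproj T t)"
  using Eproj_below below_def by blast

lemma Eproj_comm_op: "sa T \<Longrightarrow> comm_op (Eproj T t) T"
  using Eproj_below below_def by blast

lemma Eproj_shift: "sa T \<Longrightarrow> Eproj (shift_op T r) t = Eproj T (t - r)"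
  using Eproj_unique[OF sa_shift_op] below_shift[of T r "t - r"] Eproj_below by fastforce

lemma Eproj_le: "sa T \<Longrightarrow> (x, y) \<in> T \<Longrightarrow> Eproj T t x = x \<Longrightarrow> inner y x \<le> t * (norm x)\<^sup>2"
  using Eproj_below below_def by blast

lemma Eproj_gr: "sa T \<Longrightarrow> (x, y) \<in> T \<Longrightarrow> Eproj T t x = 0 \<Longrightarrow> x \<noteq> 0 \<Longrightarrow> t * (norm x)\<^sup>2 < inner y x"
  using Eproj_below below_def by blast

lemma Eproj_mono: assumes T: "sa T" and "s \<le> t"
  shows "Eproj T s (Eproj T t x) = Eproj T s x" "Eproj T t (Eproj T s x) = Eproj T s x"
proof -
  have c: "commutes (Eproj T s) (Eproj T t)" by (rule Eproj_commutes[OF T Eproj_comm_op[OF T]])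
  show 1: "Eproj T s (Eproj T t x) = Eproj T s x"
    using below_compose[OF T Eproj_below[OF T] Eproj_below[OF T] assms(2) c]
    by (metis blinfun_apply_blinfun_compose)
  show "Eproj T t (Eproj T s x) = Eproj T s x" using 1 commutesD[OF c] by simp
qed

subsection \<open>Limits of the spectral family\<close>

lemma Eproj_norm_diff:
  assumes T: "sa T" and "r \<le> s"
  shows "(norm (Eproj T s x - Eproj T r x))\<^sup>2 = (norm (Eproj T s x))\<^sup>2 - (norm (Eproj T r x))\<^sup>2"
proof -
  have "inner (Eproj T s x) (Eproj T r x) = (norm (Eproj T r x))\<^sup>2"
    using is_proj_sym[OF Eproj_is_proj[OF T], of s x "Eproj T r x"] Eproj_mono(2)[OF T assms(2), of x]
      is_proj_inner[OF Eproj_is_proj[OF T], of r x] by (simp add: inner_commute)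
  then show ?thesis
    by (simp add: power2_norm_eq_inner inner_diff_left inner_diff_right inner_commute)
qed

lemma Eproj_norm_mono:
  assumes T: "sa T" and "r \<le> s" shows "(norm (Eproj T r x))\<^sup>2 \<le> (norm (Eproj T s x))\<^sup>2"
  using Eproj_norm_diff[OF assms, of x] zero_le_power2[of "norm (Eproj T s x - Eproj T r x)"] by linarith

lemma Eproj_norm_bound: "sa T \<Longrightarrow> (norm (Eproj T r x))\<^sup>2 \<le> (norm x)\<^sup>2"
  by (intro power_mono is_proj_norm_le Eproj_is_proj) auto

text \<open>The squared norm of an increment is the increment of the squared norms, so strong
  convergence reduces to convergence of a monotone real function.\<close>

lemma Eproj_converges:
  assumes T: "sa T" and F: "F \<noteq> bot" and c: "((\<lambda>s. (norm (Eproj T s x))\<^sup>2) \<longlongrightarrow> c) F"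
  shows "\<exists>l. ((\<lambda>s. Eproj T s x) \<longlongrightarrow> l) F"
proof -
  have "cauchy_filter (filtermap (\<lambda>s. Eproj T s x) F)"
    unfolding cauchy_filter_metric_filtermap
  proof (intro allI impI)
    fix e :: real assume e: "e > 0"
    have ev: "eventually (\<lambda>s. dist ((norm (Eproj T s x))\<^sup>2) c < e\<^sup>2 / 2) F"
      by (rule tendstoD[OF c]) (use e in simp)
    have *: "dist (Eproj T s x) (Eproj T r x) < e"
      if "dist ((norm (Eproj T s x))\<^sup>2) c < e\<^sup>2 / 2" "dist ((norm (Eproj T r x))\<^sup>2) c < e\<^sup>2 / 2" "r \<le> s" for r s
    proof -
      have "(norm (Eproj T s x - Eproj T r x))\<^sup>2 < e\<^sup>2"
        using that(1,2) unfolding Eproj_norm_diff[OF T that(3)] dist_real_def by linarith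
      then show ?thesis using e by (simp add: dist_norm power_less_imp_less_base)
    qed
    show "\<exists>P. eventually P F \<and> (\<forall>r s. P r \<and> P s \<longrightarrow> dist (Eproj T r x) (Eproj T s x) < e)"
    proof (intro exI conjI allI impI)
      show "eventually (\<lambda>s. dist ((norm (Eproj T s x))\<^sup>2) c < e\<^sup>2 / 2) F" by (rule ev)
      fix r s assume "dist ((norm (Eproj T r x))\<^sup>2) c < e\<^sup>2 / 2 \<and> dist ((norm (Eproj T s x))\<^sup>2) c < e\<^sup>2 / 2"
      then show "dist (Eproj T r x) (Eproj T s x) < e"
        using *[of r s] *[of s r] by (cases "r \<le> s") (auto simp: dist_commute)
    qed
  qed
  then have "\<exists>c. filtermap (\<lambda>s. Eproj T s x) F \<le> nhds c"
    by (rule cauchy_filter_complete_converges[OF _ complete_UNIV]) (simp_all add: filtermap_bot_iff F)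
  then show ?thesis by (auto simp: filterlim_def)
qed

lemma
  fixes g :: "real \<Rightarrow> real"
  assumes g: "mono g" and bd: "\<And>s. a \<le> g s" "\<And>s. g s \<le> b"
  shows mono_lim_at_left: "\<exists>c. (g \<longlongrightarrow> c) (at_left t)" and mono_lim_at_right: "\<exists>c. (g \<longlongrightarrow> c) (at_right t)"
    and mono_lim_at_top: "\<exists>c. (g \<longlongrightarrow> c) at_top" and mono_lim_at_bot: "\<exists>c. (g \<longlongrightarrow> c) at_bot"
proof -
  have bdd: "bdd_above (g ` S)" "bdd_below (g ` S)" for S using bd by (auto intro!: bdd_aboveI bdd_belowI)
  show "\<exists>c. (g \<longlongrightarrow> c) (at_left t)"
  proof (intro exI increasing_tendsto)
    show "eventually (\<lambda>s. g s \<le> (SUP s\<in>{..<t}. g s)) (at_left t)"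
      unfolding eventually_at_filter by (rule always_eventually) (auto intro!: cSUP_upper bdd)
    fix y assume "y < (SUP s\<in>{..<t}. g s)"
    then obtain s where "s < t" "y < g s" using less_cSUP_iff[OF _ bdd(1), of "{..<t}" y] by (auto simp: lessThan_empty_iff)
    then show "eventually (\<lambda>s. y < g s) (at_left t)"
      unfolding eventually_at_left[OF \<open>s < t\<close>]
      using monoD[OF g] by (intro exI[of _ s]) (auto intro: less_le_trans)
  qed
  show "\<exists>c. (g \<longlongrightarrow> c) (at_right t)"
  proof (intro exI decreasing_tendsto)
    show "eventually (\<lambda>s. (INF s\<in>{t<..}. g s) \<le> g s) (at_right t)"
      unfolding eventually_at_filter by (rule always_eventually) (auto intro!: cINF_lower bdd)
    fix y assume "(INF s\<in>{t<..}. g s) < y"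
    then obtain s where "t < s" "g s < y" using cINF_less_iff[OF _ bdd(2), of "{t<..}" y] by auto
    then show "eventually (\<lambda>s. g s < y) (at_right t)"
      unfolding eventually_at_right[OF \<open>t < s\<close>]
      by (intro exI[of _ s]) (meson \<open>t < s\<close> le_less_trans less_imp_le monoD[OF g])
  qed
  show "\<exists>c. (g \<longlongrightarrow> c) at_top"
  proof (intro exI increasing_tendsto)
    show "eventually (\<lambda>s. g s \<le> (SUP s. g s)) at_top"
      by (rule always_eventually) (auto intro!: cSUP_upper bdd)
    fix y assume "y < (SUP s. g s)"
    then obtain s where "y < g s" using less_cSUP_iff[OF _ bdd(1), of UNIV y] by auto
    then show "eventually (\<lambda>s. y < g s) at_top"
      unfolding eventually_at_top_linorder using monoD[OF g] by (intro exI[of _ s]) (auto intro: less_le_trans)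
  qed
  show "\<exists>c. (g \<longlongrightarrow> c) at_bot"
  proof (intro exI decreasing_tendsto)
    show "eventually (\<lambda>s. (INF s. g s) \<le> g s) at_bot"
      by (rule always_eventually) (auto intro!: cINF_lower bdd)
    fix y assume "(INF s. g s) < y"
    then obtain s where "g s < y" using cINF_less_iff[OF _ bdd(2), of UNIV y] by auto
    then show "eventually (\<lambda>s. g s < y) at_bot"
      unfolding eventually_at_bot_linorder using monoD[OF g] by (intro exI[of _ s]) (auto intro: le_less_trans)
  qed
qed

lemma Eproj_limit_exists:
  assumes T: "sa T" and F: "F = at_left t \<or> F = at_right t \<or> F = at_top \<or> F = at_bot"
  shows "\<exists>l. ((\<lambda>s. Eproj T s x) \<longlongrightarrow> l) F"
proof -
  have "mono (\<lambda>s. (norm (Eproj T s x))\<^sup>2)" using Eproj_norm_mono[OF T] by (simp add: mono_def)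
  note * = this zero_le_power2 Eproj_norm_bound[OF T]
  have "\<exists>c. ((\<lambda>s. (norm (Eproj T s x))\<^sup>2) \<longlongrightarrow> c) F"
    using F mono_lim_at_left[OF *] mono_lim_at_right[OF *] mono_lim_at_top[OF *] mono_lim_at_bot[OF *] by blast
  moreover have "F \<noteq> bot" using F by (elim disjE) simp_all
  ultimately show ?thesis using Eproj_converges[OF T] by blast
qed

text \<open>Symmetry and idempotence survive strong limits through <E x, E y> = <E x, y>, and
  commutation with \<open>T\<close> survives because \<open>T\<close> is closed.\<close>

lemma Eproj_limit_op:
  fixes T :: "('a::{real_inner,banach} \<times> 'a) set"
  assumes T: "sa T" and F: "F = at_left t \<or> F = at_right t \<or> F = at_top \<or> F = at_bot"
  obtains Q where "is_proj Q" "comm_op Q T" "\<And>B. comm_op B T \<Longrightarrow> commutes B Q"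
    "\<And>x. ((\<lambda>s. Eproj T s x) \<longlongrightarrow> Q x) F"
proof -
  have nb: "F \<noteq> bot" using F by (elim disjE) simp_all
  obtain q where q: "\<And>x. ((\<lambda>s. Eproj T s x) \<longlongrightarrow> q x) F"
    using Eproj_limit_exists[OF T F] by metis
  note uq = tendsto_unique[OF nb]
  have "bounded_linear q"
  proof (rule bounded_linear_intro[of _ 1])
    show "q (x + y) = q x + q y" for x y
      using uq[OF q[of "x + y"]] tendsto_add[OF q[of x] q[of y]] by (simp add: blinfun.bilinear_simps)
    show "q (r *\<^sub>R x) = r *\<^sub>R q x" for r x
      using uq[OF q[of "r *\<^sub>R x"]] tendsto_scaleR[OF tendsto_const q[of x]] by (simp add: blinfun.bilinear_simps)
    show "norm (q x) \<le> norm x * 1" for x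
      using tendsto_upperbound[OF tendsto_norm[OF q[of x]] _ nb, of "norm x"]
      by (simp add: is_proj_norm_le[OF Eproj_is_proj[OF T]])
  qed
  then have Q: "Blinfun q x = q x" for x by (simp add: bounded_linear_Blinfun_apply)
  have sym: "inner (q x) y = inner x (q y)" for x y
  proof -
    have "((\<lambda>s. inner (Eproj T s x) y) \<longlongrightarrow> inner (q x) y) F" "((\<lambda>s. inner x (Eproj T s y)) \<longlongrightarrow> inner x (q y)) F"
      by (intro tendsto_intros q)+
    then show ?thesis using uq by (simp add: is_proj_sym[OF Eproj_is_proj[OF T]])
  qed
  have "inner (q (q x)) y = inner (q x) y" for x y
  proof -
    have "((\<lambda>s. inner (Eproj T s x) (Eproj T s y)) \<longlongrightarrow> inner (q x) (q y)) F" "((\<lambda>s. inner (Eproj T s x) y) \<longlongrightarrow> inner (q x) y) F"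
      by (intro tendsto_intros q)+
    moreover have "inner (Eproj T s x) (Eproj T s y) = inner (Eproj T s x) y" for s
      by (simp add: is_proj_sym[OF Eproj_is_proj[OF T], symmetric] is_proj_idem[OF Eproj_is_proj[OF T]])
    ultimately show ?thesis using uq by (simp add: sym)
  qed
  then have idem: "q (q x) = q x" for x by (rule inner_eq_all_eq)
  show ?thesis
  proof (rule that[of "Blinfun q"])
    show "is_proj (Blinfun q)" by (simp add: is_proj_def Q idem sym)
    show "comm_op (Blinfun q) T" unfolding comm_op_def Q
    proof (intro allI impI)
      fix x y assume "(x, y) \<in> T"
      then show "(q x, q y) \<in> T"
        by (intro sa_limit[OF T nb _ q q] always_eventually) (simp add: comm_opD[OF Eproj_comm_op[OF T]])
    qed
    show "((\<lambda>s. Eproj T s x) \<longlongrightarrow> Blinfun q x) F" for x unfolding Q by (rule q)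
    fix B assume B: "comm_op B T"
    have "B (q x) = q (B x)" for x
    proof -
      have "((\<lambda>s. B (Eproj T s x)) \<longlongrightarrow> B (q x)) F" by (intro tendsto_intros q)
      then show ?thesis using uq[OF q[of "B x"]] by (simp add: commutesD[OF Eproj_commutes[OF T B]])
    qed
    then show "commutes B (Blinfun q)" by (simp add: commutes_iff Q)
  qed
qed

lemma tendsto_eventually_eq:
  assumes "F \<noteq> bot" "(f \<longlongrightarrow> l) F" "eventually (\<lambda>s. f s = c) F" shows "l = (c :: 'a::t2_space)"
  using tendsto_unique[OF assms(1,2) tendsto_eventually[OF assms(3)]] .

lemma eventually_at_left_less: "eventually (\<lambda>r. r < t) (at_left (t::real))"
  by (simp add: eventually_at_filter)

text \<open>Applied to a form value \<open>p\<close> and a squared norm \<open>q\<close>: a form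
  cannot lie below every multiple of a nonzero squared norm as s tends to -infinity.\<close>

lemma ge_0_all_mult:
  fixes p :: real assumes "\<And>s. s \<le> S \<Longrightarrow> p \<le> s * q" "0 \<le> q" shows "q = 0"
proof (rule ccontr)
  assume "q \<noteq> 0"
  then have q: "q > 0" using assms(2) by simp
  define s where "s = min S ((p - 1) / q)"
  have "p \<le> s * q" by (rule assms(1)) (simp add: s_def)
  also have "s * q \<le> ((p - 1) / q) * q" using q by (intro mult_right_mono) (auto simp: s_def)
  finally show False using q by simp
qed

text \<open>A vector in the range of the limit projection would have form at most s |x|^2 for every
  real s.\<close>

lemma Eproj_at_bot: assumes T: "sa T" shows "((\<lambda>s. Eproj T s x) \<longlongrightarrow> 0) at_bot"
proof -
  obtain Q where Q: "is_proj Q" "comm_op Q T" "\<And>x. ((\<lambda>s. Eproj T s x) \<longlongrightarrow> Q x) at_bot"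
    using Eproj_limit_op[OF T, of at_bot] by blast
  have EQ: "Eproj T r (Q x) = Q x" for r x
  proof -
    have "Eproj T r (Q x) - Q x = 0"
    proof (rule tendsto_eventually_eq)
      show "((\<lambda>s. Eproj T r (Eproj T s x) - Eproj T s x) \<longlongrightarrow> Eproj T r (Q x) - Q x) at_bot"
        by (intro tendsto_intros Q)
      show "eventually (\<lambda>s. Eproj T r (Eproj T s x) - Eproj T s x = 0) at_bot"
        using eventually_le_at_bot[of r] by eventually_elim (simp add: Eproj_mono[OF T])
    qed simp_all
    then show ?thesis by simp
  qed
  have "Q = 0"
  proof (rule proj_eq_0[OF T Q(2,1)])
    fix x y assume xy: "(x, y) \<in> T" and "Q x = x"
    then have "Eproj T s x = x" for s using EQ[of s x] by simp
    then have "inner y x \<le> s * (norm x)\<^sup>2" for s using Eproj_le[OF T xy] by blast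
    then have "(norm x)\<^sup>2 = 0" by (rule ge_0_all_mult) simp
    then show "x = 0" by simp
  qed
  then show ?thesis using Q(3)[of x] by simp
qed

lemma Eproj_at_top: assumes T: "sa T" shows "((\<lambda>s. Eproj T s x) \<longlongrightarrow> x) at_top"
proof -
  obtain Q where Q: "is_proj Q" "comm_op Q T" "\<And>x. ((\<lambda>s. Eproj T s x) \<longlongrightarrow> Q x) at_top"
    using Eproj_limit_op[OF T, of at_top] by blast
  have EQ: "Eproj T r (Q x) = Eproj T r x" for r x
  proof (rule tendsto_eventually_eq)
    show "((\<lambda>s. Eproj T r (Eproj T s x)) \<longlongrightarrow> Eproj T r (Q x)) at_top" by (intro tendsto_intros Q)
    show "eventually (\<lambda>s. Eproj T r (Eproj T s x) = Eproj T r x) at_top"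
      using eventually_ge_at_top[of r] by eventually_elim (simp add: Eproj_mono[OF T])
  qed simp_all
  have "id_blinfun - Q = 0"
  proof (rule proj_eq_0[OF T comm_op_diff[OF T comm_op_id Q(2)] is_proj_compl[OF Q(1)]])
    fix x y assume xy: "(x, y) \<in> T" and "(id_blinfun - Q) x = x"
    then have "Q x = 0" by (simp add: blinfun.bilinear_simps)
    then have E0: "Eproj T s x = 0" for s using EQ[of s x] by simp
    have "- inner y x \<le> s * (norm x)\<^sup>2" for s
      using Eproj_gr[OF T xy E0[of "- s"]] by (cases "x = 0") auto
    then have "(norm x)\<^sup>2 = 0" by (rule ge_0_all_mult) simp
    then show "x = 0" by simp
  qed
  then have "Q x = x" by (metis blinfun.diff_left blinfun_apply_id_blinfun eq_iff_diff_eq_0 id_apply zero_blinfun.rep_eq)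
  then show ?thesis using Q(3)[of x] by simp
qed

text \<open>On the range of Q - E t the form is at most s |x|^2 for all s > t, hence at most t
  |x|^2, against the strict inequality on the kernel of E t. The strictness in \<open>below\<close>
  is what gives right continuity.\<close>

lemma Eproj_at_right: assumes T: "sa T" shows "((\<lambda>s. Eproj T s x) \<longlongrightarrow> Eproj T t x) (at_right t)"
proof -
  obtain Q where Q: "is_proj Q" "comm_op Q T" "\<And>x. ((\<lambda>s. Eproj T s x) \<longlongrightarrow> Q x) (at_right t)"
    using Eproj_limit_op[OF T, of "at_right t"] by blast
  have EQ: "Eproj T t (Q x) = Eproj T t x" for x
  proof (rule tendsto_eventually_eq)
    show "((\<lambda>s. Eproj T t (Eproj T s x)) \<longlongrightarrow> Eproj T t (Q x)) (at_right t)" by (intro tendsto_intros Q)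
    show "eventually (\<lambda>s. Eproj T t (Eproj T s x) = Eproj T t x) (at_right t)"
      using eventually_at_right_less by eventually_elim (simp add: Eproj_mono[OF T])
  qed simp_all
  have QE: "Q (Eproj T t x) = Eproj T t x" for x
  proof (rule tendsto_eventually_eq)
    show "((\<lambda>s. Eproj T s (Eproj T t x)) \<longlongrightarrow> Q (Eproj T t x)) (at_right t)" by (rule Q(3))
    show "eventually (\<lambda>s. Eproj T s (Eproj T t x) = Eproj T t x) (at_right t)"
      using eventually_at_right_less by eventually_elim (simp add: Eproj_mono[OF T])
  qed simp_all
  have ErQ: "Eproj T r (Q x) = Q x" if "t < r" for r x
  proof -
    have "Eproj T r (Q x) - Q x = 0"
    proof (rule tendsto_eventually_eq)
      show "((\<lambda>s. Eproj T r (Eproj T s x) - Eproj T s x) \<longlongrightarrow> Eproj T r (Q x) - Q x) (at_right t)" by (intro tendsto_intros Q)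
      show "eventually (\<lambda>s. Eproj T r (Eproj T s x) - Eproj T s x = 0) (at_right t)"
        using eventually_at_right_real[OF that] by eventually_elim (simp add: Eproj_mono[OF T])
    qed simp_all
    then show ?thesis by simp
  qed
  have "Q - Eproj T t = 0"
  proof (rule proj_eq_0[OF T comm_op_diff[OF T Q(2) Eproj_comm_op[OF T]] is_proj_diff[OF Q(1) Eproj_is_proj[OF T]]])
    show "Q o\<^sub>L Eproj T t = Eproj T t" by (rule blinfun_eqI) (simp add: QE)
    fix x y assume xy: "(x, y) \<in> T" and "(Q - Eproj T t) x = x"
    then have x: "Q x - Eproj T t x = x" by (simp add: blinfun.bilinear_simps)
    have "Eproj T t (Q x - Eproj T t x) = 0"
      by (simp add: blinfun.bilinear_simps EQ is_proj_idem[OF Eproj_is_proj[OF T]])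
    then have E0: "Eproj T t x = 0" using x by simp
    then have "Q x = x" using x by simp
    then have "Eproj T s x = x" if "s > t" for s using ErQ[OF that, of x] by simp
    then have le: "inner y x \<le> s * (norm x)\<^sup>2" if "s > t" for s using Eproj_le[OF T xy] that by blast
    have "((\<lambda>s. s * (norm x)\<^sup>2) \<longlongrightarrow> t * (norm x)\<^sup>2) (at_right t)" by (intro tendsto_intros)
    then have "inner y x \<le> t * (norm x)\<^sup>2"
      by (rule tendsto_lowerbound) (auto intro: eventually_mono[OF eventually_at_right_less le])
    then show "x = 0" using Eproj_gr[OF T xy E0] by force
  qed
  then have "Q = Eproj T t" by simp
  then show ?thesis using Q(3)[of x] by simp
qed

definition Lproj :: "('a::{real_inner,banach} \<times> 'a) set \<Rightarrow> real \<Rightarrow> 'a \<Rightarrow>\<^sub>L 'a" where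
  "Lproj T t = (THE Q :: 'a \<Rightarrow>\<^sub>L 'a. \<forall>x. ((\<lambda>s. Eproj T s x) \<longlongrightarrow> Q x) (at_left t))"

lemma
  assumes T: "sa T"
  shows Lproj_is_proj: "is_proj (Lproj T t)" and Lproj_comm_op: "comm_op (Lproj T t) T"
    and Lproj_commutes: "comm_op B T \<Longrightarrow> commutes B (Lproj T t)"
    and Lproj_tendsto: "((\<lambda>s. Eproj T s x) \<longlongrightarrow> Lproj T t x) (at_left t)"
proof -
  obtain Q where Q: "is_proj Q" "comm_op Q T" "\<And>B. comm_op B T \<Longrightarrow> commutes B Q"
    "\<And>x. ((\<lambda>s. Eproj T s x) \<longlongrightarrow> Q x) (at_left t)"
    using Eproj_limit_op[OF T, of "at_left t"] by blast
  have "Lproj T t = Q" unfolding Lproj_def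
  proof (rule the_equality)
    fix R assume "\<forall>x. ((\<lambda>s. Eproj T s x) \<longlongrightarrow> blinfun_apply R x) (at_left t)"
    then show "R = Q" using Q(4) tendsto_unique[OF trivial_limit_at_left_real] by (intro blinfun_eqI) blast
  qed (use Q(4) in blast)
  then show "is_proj (Lproj T t)" "comm_op (Lproj T t) T" "comm_op B T \<Longrightarrow> commutes B (Lproj T t)"
    "((\<lambda>s. Eproj T s x) \<longlongrightarrow> Lproj T t x) (at_left t)"
    using Q(1,2,4) Q(3)[of B] by simp_all
qed

lemma
  assumes T: "sa T" and "s < t"
  shows Eproj_Lproj_less: "Eproj T s (Lproj T t x) = Eproj T s x"
    and Lproj_Eproj_less: "Lproj T t (Eproj T s x) = Eproj T s x"
proof -
  show 1: "Eproj T s (Lproj T t x) = Eproj T s x"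
  proof (rule tendsto_eventually_eq)
    show "((\<lambda>r. Eproj T s (Eproj T r x)) \<longlongrightarrow> Eproj T s (Lproj T t x)) (at_left t)"
      by (intro tendsto_intros Lproj_tendsto[OF T])
    show "eventually (\<lambda>r. Eproj T s (Eproj T r x) = Eproj T s x) (at_left t)"
      using eventually_at_left_real[OF assms(2)] by eventually_elim (simp add: Eproj_mono[OF T])
  qed simp_all
  show "Lproj T t (Eproj T s x) = Eproj T s x"
    using 1 commutesD[OF Lproj_commutes[OF T Eproj_comm_op[OF T]]] by metis
qed

lemma
  assumes T: "sa T" and "t \<le> s"
  shows Eproj_Lproj_ge: "Eproj T s (Lproj T t x) = Lproj T t x"
    and Lproj_Eproj_ge: "Lproj T t (Eproj T s x) = Lproj T t x"
proof -
  have "Eproj T s (Lproj T t x) - Lproj T t x = 0"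
  proof (rule tendsto_eventually_eq)
    show "((\<lambda>r. Eproj T s (Eproj T r x) - Eproj T r x) \<longlongrightarrow> Eproj T s (Lproj T t x) - Lproj T t x) (at_left t)"
      by (intro tendsto_intros Lproj_tendsto[OF T])
    show "eventually (\<lambda>r. Eproj T s (Eproj T r x) - Eproj T r x = 0) (at_left t)"
      using eventually_at_left_less by eventually_elim (use assms in \<open>simp_all add: Eproj_mono[OF T]\<close>)
  qed simp_all
  then show 1: "Eproj T s (Lproj T t x) = Lproj T t x" by simp
  show "Lproj T t (Eproj T s x) = Lproj T t x"
    using 1 commutesD[OF Lproj_commutes[OF T Eproj_comm_op[OF T]]] by metis
qed

lemma Lproj_mono:
  assumes T: "sa T" and "s \<le> t"
  shows "Lproj T s (Lproj T t x) = Lproj T s x" "Lproj T t (Lproj T s x) = Lproj T s x"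
proof -
  show 1: "Lproj T s (Lproj T t x) = Lproj T s x"
  proof (rule tendsto_unique[OF trivial_limit_at_left_real Lproj_tendsto[OF T]])
    have "eventually (\<lambda>r. Eproj T r x = Eproj T r (Lproj T t x)) (at_left s)"
      using eventually_at_left_less by eventually_elim (use assms in \<open>simp_all add: Eproj_Lproj_less[OF T]\<close>)
    then show "((\<lambda>r. Eproj T r (Lproj T t x)) \<longlongrightarrow> Lproj T s x) (at_left s)"
      using Lproj_tendsto[OF T, where t = s and x = x] by (simp add: tendsto_cong)
  qed
  show "Lproj T t (Lproj T s x) = Lproj T s x"
    using 1 commutesD[OF Lproj_commutes[OF T Lproj_comm_op[OF T]]] by metis
qed

lemma Lproj_ge:
  assumes T: "sa T" and xy: "(x, y) \<in> T" and "Lproj T t x = 0" shows "t * (norm x)\<^sup>2 \<le> inner y x"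
proof (cases "x = 0")
  case False
  have "Eproj T s x = 0" if "s < t" for s using Eproj_Lproj_less[OF T that, of x] assms by simp
  then have *: "s * (norm x)\<^sup>2 \<le> inner y x" if "s < t" for s
    using Eproj_gr[OF T xy] False that less_imp_le by blast
  have "((\<lambda>s. s * (norm x)\<^sup>2) \<longlongrightarrow> t * (norm x)\<^sup>2) (at_left t)" by (intro tendsto_intros)
  then show ?thesis
    by (rule tendsto_upperbound) (auto intro: eventually_mono[OF eventually_at_left_less *])
qed simp

lemma Lproj_le: "sa T \<Longrightarrow> (x, y) \<in> T \<Longrightarrow> Lproj T t x = x \<Longrightarrow> inner y x \<le> t * (norm x)\<^sup>2"
  using Eproj_le[of T x y t] Eproj_Lproj_ge[of T t t x] by simp

lemma Lproj_shift: assumes T: "sa T" shows "Lproj (shift_op T r) t = Lproj T (t - r)"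
proof (rule blinfun_eqI)
  fix x
  have 1: "((\<lambda>s. Eproj T (s - r) x) \<longlongrightarrow> Lproj (shift_op T r) t x) (at_left t)"
    using Lproj_tendsto[OF sa_shift_op[OF T], where t = t and x = x] by (simp add: Eproj_shift[OF T])
  have "filterlim (\<lambda>s. s - r) (at_left (t - r)) (at_left t)"
    unfolding filterlim_at
    by (auto intro!: tendsto_intros simp: eventually_at_filter)
  then have "((\<lambda>s. Eproj T (s - r) x) \<longlongrightarrow> Lproj T (t - r) x) (at_left t)"
    by (rule filterlim_compose[OF Lproj_tendsto[OF T]])
  then show "Lproj (shift_op T r) t x = Lproj T (t - r) x"
    by (rule tendsto_unique[OF trivial_limit_at_left_real 1])
qed

subsection \<open>Spectral blocks\<close>

text \<open>The numerical range of T - c on the reducing subspace \<open>range M\<close> lies in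
  [a - c, b - c], and polarisation turns this into a norm bound. The restriction is handled as the
  relation \<open>S\<close>, since it is not yet known to be everywhere defined on that
  subspace.\<close>

lemma reduced_norm_le:
  assumes T: "sa T" and M: "is_proj M" "comm_op M T"
    and bd: "\<And>x y. (x, y) \<in> T \<Longrightarrow> M x = x \<Longrightarrow> a * (norm x)\<^sup>2 \<le> inner y x \<and> inner y x \<le> b * (norm x)\<^sup>2"
    and xy: "(x, y) \<in> T" and Mx: "M x = x"
  shows "norm (y - c *\<^sub>R x) \<le> max \<bar>a - c\<bar> \<bar>b - c\<bar> * norm x"
proof -
  define S where "S = {(x, y - c *\<^sub>R x) |x y. (x, y) \<in> T \<and> M x = x}"
  define r where "r = max \<bar>a - c\<bar> \<bar>b - c\<bar>"
  have memS: "(u, v) \<in> S \<longleftrightarrow> (u, v + c *\<^sub>R u) \<in> T \<and> M u = u" for u v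
    by (auto simp: S_def) (metis add_diff_cancel_right')
  have subS: "subspace S" unfolding subspace_def
  proof (intro conjI ballI allI)
    show "0 \<in> S" by (simp add: zero_prod_def memS sa_0[OF T])
    fix p q assume "p \<in> S" "q \<in> S"
    then show "p + q \<in> S" using sa_add[OF T]
      by (cases p; cases q) (fastforce simp: memS blinfun.bilinear_simps scaleR_add_right add_ac)
  next
    fix k p assume "p \<in> S"
    then show "k *\<^sub>R p \<in> S" using sa_scale[OF T, of _ _ k]
      by (cases p) (fastforce simp: memS blinfun.bilinear_simps scaleR_add_right mult.commute)
  qed
  have formS: "inner (y - c *\<^sub>R x) u \<le> r * norm x * norm u" if "(u, w) \<in> T" "M u = u" for u w
  proof (rule symm_relation_form_bound[OF subS])
    show "(x, y - c *\<^sub>R x) \<in> S" "(u, w - c *\<^sub>R u) \<in> S" using xy Mx that by (simp_all add: memS)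
    fix p q assume pq: "(p, q) \<in> S"
    { fix u v assume "(u, v) \<in> S"
      then show "inner q u = inner p v"
        using sa_sym[OF T, of p "q + c *\<^sub>R p" u "v + c *\<^sub>R u"] pq
        by (simp add: memS inner_add_left inner_add_right) }
    have "a * (norm p)\<^sup>2 \<le> inner (q + c *\<^sub>R p) p \<and> inner (q + c *\<^sub>R p) p \<le> b * (norm p)\<^sup>2"
      by (rule bd) (use pq memS in auto)
    then have "(a - c) * (norm p)\<^sup>2 \<le> inner q p" "inner q p \<le> (b - c) * (norm p)\<^sup>2"
      by (simp_all add: inner_add_left power2_norm_eq_inner algebra_simps)
    moreover have "- r * (norm p)\<^sup>2 \<le> (a - c) * (norm p)\<^sup>2" "(b - c) * (norm p)\<^sup>2 \<le> r * (norm p)\<^sup>2"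
      by (intro mult_right_mono; force simp: r_def)+
    ultimately show "\<bar>inner q p\<bar> \<le> r * (norm p)\<^sup>2" by linarith
  qed
  define z where "z = y - c *\<^sub>R x"
  have My: "M y = y" using sa_single[OF T xy] comm_opD[OF M(2) xy] Mx by metis
  then have Mz: "M z = z" by (simp add: z_def blinfun.bilinear_simps Mx)
  \<comment> \<open>The bilinear bound is available only against vectors of the domain; density
    allows it to be tested against \<open>z\<close> itself.\<close>
  have "closed {u. inner z (M u) \<le> r * norm x * norm (M u)}"
    by (intro closed_Collect_le continuous_intros)
  moreover have "Domain T \<subseteq> {u. inner z (M u) \<le> r * norm x * norm (M u)}"
    using formS comm_opD[OF M(2)] is_proj_idem[OF M(1)] unfolding z_def by blast
  ultimately have "closure (Domain T) \<subseteq> {u. inner z (M u) \<le> r * norm x * norm (M u)}" by (rule closure_minimal[rotated])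
  then have "inner z z \<le> r * norm x * norm z" using sa_dense[OF T] Mz by (auto dest!: subsetD[of _ _ z])
  then have "norm z * norm z \<le> (r * norm x) * norm z" by (simp add: power2_norm_eq_inner[symmetric] power2_eq_square)
  moreover have "0 \<le> r * norm x" by (simp add: r_def)
  ultimately have "norm z \<le> r * norm x" by (cases "z = 0") auto
  then show ?thesis by (simp add: z_def r_def)
qed

text \<open>An approximation of x by domain vectors is projected by \<open>M\<close>; there T is
  bounded, so the images converge, and closedness puts x into the domain.\<close>

lemma reduced_in_domain:
  assumes T: "sa T" and M: "is_proj M" "comm_op M T"
    and bd: "\<And>x y. (x, y) \<in> T \<Longrightarrow> M x = x \<Longrightarrow> a * (norm x)\<^sup>2 \<le> inner y x \<and> inner y x \<le> b * (norm x)\<^sup>2"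
    and Mx: "M x = x"
  shows "\<exists>y. (x, y) \<in> T \<and> M y = y"
proof -
  have "x \<in> closure (Domain T)" using sa_dense[OF T] by simp
  then obtain s where s: "\<And>n. s n \<in> Domain T" "s \<longlonglongrightarrow> x" using closure_sequential[of x] by blast
  from s(1) have "\<forall>n. \<exists>w. (s n, w) \<in> T" by blast
  then obtain w where w: "\<And>n. (s n, w n) \<in> T" by metis
  define r where "r = max \<bar>a - 0\<bar> \<bar>b - 0\<bar>"
  have MT: "(M (s n), M (w n)) \<in> T" for n by (rule comm_opD[OF M(2) w])
  have lim: "(\<lambda>n. M (s n)) \<longlonglongrightarrow> x" using tendsto_intros(1) blinfun.tendsto[OF tendsto_const[of M] s(2)] Mx by simp
  have le: "norm (M (w m) - M (w n)) \<le> r * norm (M (s m) - M (s n))" for m n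
    using reduced_norm_le[OF T M bd sa_diff[OF T MT[of m] MT[of n]], of 0]
    by (simp add: blinfun.bilinear_simps is_proj_idem[OF M(1)] r_def)
  have "Cauchy (\<lambda>n. M (w n))"
  proof (rule metric_CauchyI)
    fix e :: real assume "e > 0"
    \<comment> \<open>\<open>r\<close> may be 0, hence the division by r + 1.\<close>
    then have "e / (r + 1) > 0" by (simp add: r_def)
    then obtain N where N: "\<And>m n. m \<ge> N \<Longrightarrow> n \<ge> N \<Longrightarrow> dist (M (s m)) (M (s n)) < e / (r + 1)"
      using LIMSEQ_imp_Cauchy[OF lim] by (meson metric_CauchyD)
    have "dist (M (w m)) (M (w n)) < e" if "m \<ge> N" "n \<ge> N" for m n
    proof -
      have r1: "r + 1 > 0" by (simp add: r_def)
      have "dist (M (w m)) (M (w n)) \<le> (r + 1) * norm (M (s m) - M (s n))"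
        using le[of m n] by (simp add: dist_norm distrib_right add_increasing2)
      also have "\<dots> < (r + 1) * (e / (r + 1))"
        using N[OF that] r1 by (intro mult_strict_left_mono) (auto simp: dist_norm)
      finally show ?thesis using r1 by simp
    qed
    then show "\<exists>N. \<forall>m\<ge>N. \<forall>n\<ge>N. dist (M (w m)) (M (w n)) < e" by blast
  qed
  then obtain y where y: "(\<lambda>n. M (w n)) \<longlonglongrightarrow> y" using Cauchy_convergent convergent_def by blast
  have "(x, y) \<in> T" by (rule sa_limit[OF T _ _ lim y]) (simp_all add: MT)
  moreover have "M y = y"
  proof (rule LIMSEQ_unique[OF _ y])
    have "(\<lambda>n. M (M (w n))) \<longlonglongrightarrow> M y" by (intro tendsto_intros y)
    then show "(\<lambda>n. M (w n)) \<longlonglongrightarrow> M y" by (simp add: is_proj_idem[OF M(1)])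
  qed
  ultimately show ?thesis by blast
qed

lemma
  assumes T: "sa T" and "a \<le> b"
  shows EE_is_proj: "is_proj (Eproj T b - Eproj T a)" and LE_is_proj: "is_proj (Eproj T b - Lproj T a)"
    and LL_is_proj: "is_proj (Lproj T b - Lproj T a)"
proof -
  show "is_proj (Eproj T b - Eproj T a)"
    by (intro is_proj_diff Eproj_is_proj[OF T] blinfun_eqI) (simp add: Eproj_mono[OF T assms(2)])
  show "is_proj (Eproj T b - Lproj T a)"
    by (intro is_proj_diff Eproj_is_proj[OF T] Lproj_is_proj[OF T] blinfun_eqI) (simp add: Eproj_Lproj_ge[OF T assms(2)])
  show "is_proj (Lproj T b - Lproj T a)"
    by (intro is_proj_diff Lproj_is_proj[OF T] blinfun_eqI) (simp add: Lproj_mono[OF T assms(2)])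
qed

lemma is_proj_diff_fix:
  assumes P: "is_proj P" and Q: "is_proj Q" and PQ: "\<And>x. P (Q x) = Q x" and x: "(P - Q) x = x"
  shows "P x = x" "Q x = 0"
proof -
  have QP: "Q (P y) = Q y" for y
  proof -
    have "inner (Q (P y) - Q y) z = 0" for z
      by (simp add: inner_diff_left is_proj_sym[OF P] is_proj_sym[OF Q] PQ)
    then show ?thesis using inner_eq_zero_iff[of "Q (P y) - Q y"] by simp
  qed
  have x': "P x - Q x = x" using x by (simp add: blinfun.bilinear_simps)
  have "P (P x - Q x) = P x - Q x" "Q (P x - Q x) = 0"
    by (simp_all add: blinfun.bilinear_simps is_proj_idem[OF P] is_proj_idem[OF Q] PQ QP)
  then show "P x = x" "Q x = 0" using x' by simp_all
qed

lemma LE_fix: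
  assumes T: "sa T" and ab: "a \<le> b"
  shows "(Eproj T b - Lproj T a) x = x \<longleftrightarrow> Eproj T b x = x \<and> Lproj T a x = 0"
proof
  assume "(Eproj T b - Lproj T a) x = x"
  then show "Eproj T b x = x \<and> Lproj T a x = 0"
    using is_proj_diff_fix[OF Eproj_is_proj[OF T] Lproj_is_proj[OF T] Eproj_Lproj_ge[OF T ab], of x] by blast
qed (simp add: blinfun.bilinear_simps)

lemma LL_fix:
  assumes T: "sa T" and ab: "a \<le> b"
  shows "(Lproj T b - Lproj T a) x = x \<longleftrightarrow> Lproj T b x = x \<and> Lproj T a x = 0"
proof
  assume "(Lproj T b - Lproj T a) x = x"
  then show "Lproj T b x = x \<and> Lproj T a x = 0"
    using is_proj_diff_fix[OF Lproj_is_proj[OF T] Lproj_is_proj[OF T] Lproj_mono(2)[OF T ab], of x] by blast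
qed (simp add: blinfun.bilinear_simps)

text \<open>Both kinds of lower cut are accepted, so that one estimate serves the windows (a, b] and
  [a, b].\<close>

lemma block_form:
  assumes T: "sa T" and xy: "(x, y) \<in> T" and "Eproj T b x = x" "Eproj T a x = 0 \<or> Lproj T a x = 0"
  shows "a * (norm x)\<^sup>2 \<le> inner y x \<and> inner y x \<le> b * (norm x)\<^sup>2"
proof
  show "a * (norm x)\<^sup>2 \<le> inner y x"
    using assms(4) Lproj_ge[OF T xy, of a] Eproj_gr[OF T xy, of a] by (cases "x = 0") auto
qed (rule Eproj_le[OF T xy assms(3)])

lemma block_in_domain:
  assumes T: "sa T" and "a \<le> b" and "Eproj T b x = x" "Lproj T a x = 0"
  shows "\<exists>y. (x, y) \<in> T \<and> Eproj T b y = y \<and> Lproj T a y = 0"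
proof -
  have "\<exists>y. (x, y) \<in> T \<and> (Eproj T b - Lproj T a) y = y"
  proof (rule reduced_in_domain[OF T LE_is_proj[OF T assms(2)] comm_op_diff[OF T Eproj_comm_op[OF T] Lproj_comm_op[OF T]]])
    show "a * (norm u)\<^sup>2 \<le> inner w u \<and> inner w u \<le> b * (norm u)\<^sup>2"
      if "(u, w) \<in> T" "(Eproj T b - Lproj T a) u = u" for u w
      by (rule block_form[OF T that(1)]) (use that(2) LE_fix[OF T assms(2)] in auto)
    show "(Eproj T b - Lproj T a) x = x" using assms(3,4) LE_fix[OF T assms(2)] by blast
  qed
  then show ?thesis using LE_fix[OF T assms(2)] by blast
qed

lemma block_norm_le:
  assumes T: "sa T" and "a \<le> b" and xy: "(x, y) \<in> T" and "Eproj T b x = x" "Lproj T a x = 0"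
  shows "norm (y - c *\<^sub>R x) \<le> max \<bar>a - c\<bar> \<bar>b - c\<bar> * norm x"
proof (rule reduced_norm_le[OF T LE_is_proj[OF T assms(2)] comm_op_diff[OF T Eproj_comm_op[OF T] Lproj_comm_op[OF T]] _ xy])
  show "a * (norm u)\<^sup>2 \<le> inner w u \<and> inner w u \<le> b * (norm u)\<^sup>2"
    if "(u, w) \<in> T" "(Eproj T b - Lproj T a) u = u" for u w
    by (rule block_form[OF T that(1)]) (use that(2) LE_fix[OF T assms(2)] in auto)
  show "(Eproj T b - Lproj T a) x = x" using assms(4,5) LE_fix[OF T assms(2)] by blast
qed

lemma Eproj_0_imp_Lproj_0: "sa T \<Longrightarrow> Eproj T a x = 0 \<Longrightarrow> Lproj T a x = 0"
  using Lproj_Eproj_ge[of T a a x] by simp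

text \<open>The hypothesis on x removes its component in the window [a, b]. What remains splits
  orthogonally into a part below a, where the form of T - c is at most -(c - a), and a part above b,
  where it is at least b - c. The two images are orthogonal as well, so the two lower bounds combine
  by Pythagoras.\<close>

lemma outside_block_norm_ge:
  assumes T: "sa T" and ab: "a \<le> c" "c \<le> b" and xy: "(x, y) \<in> T" and x: "Eproj T b x = Lproj T a x"
  shows "min (c - a) (b - c) * norm x \<le> norm (y - c *\<^sub>R x)"
proof -
  define u v where "u = Lproj T a x" and "v = x - Lproj T a x"
  define p q where "p = Lproj T a y" and "q = y - Lproj T a y"
  have up: "(u, p) \<in> T" unfolding u_def p_def by (rule comm_opD[OF Lproj_comm_op[OF T] xy])
  have vq: "(v, q) \<in> T" unfolding v_def q_def by (rule sa_diff[OF T xy up[unfolded u_def p_def]])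
  have Lu: "Lproj T a u = u" by (simp add: u_def is_proj_idem[OF Lproj_is_proj[OF T]])
  have Ev: "Eproj T b v = 0" using ab by (simp add: v_def blinfun.bilinear_simps x Eproj_Lproj_ge[OF T])
  define m where "m = min (c - a) (b - c)"
  have m0: "m \<ge> 0" using ab by (simp add: m_def)
  have gen: "m * norm w \<le> norm z" if "m * (norm w)\<^sup>2 \<le> \<bar>inner z w\<bar>" for w z :: 'a
  proof (cases "w = 0")
    case False
    have "m * norm w * norm w \<le> norm z * norm w"
      using that Cauchy_Schwarz_ineq2[of z w] by (simp add: power2_eq_square mult.assoc)
    then show ?thesis using False by simp
  qed simp
  have "m * (norm u)\<^sup>2 \<le> (c - a) * (norm u)\<^sup>2" "m * (norm v)\<^sup>2 \<le> (b - c) * (norm v)\<^sup>2"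
    by (intro mult_right_mono; simp add: m_def)+
  moreover have "inner (p - c *\<^sub>R u) u \<le> (a - c) * (norm u)\<^sup>2"
    using Lproj_le[OF T up Lu] by (simp add: inner_diff_left power2_norm_eq_inner algebra_simps)
  moreover have "(b - c) * (norm v)\<^sup>2 \<le> inner (q - c *\<^sub>R v) v"
    using Eproj_gr[OF T vq Ev] by (cases "v = 0") (simp_all add: inner_diff_left power2_norm_eq_inner algebra_simps)
  ultimately have 1: "m * norm u \<le> norm (p - c *\<^sub>R u)" and 2: "m * norm v \<le> norm (q - c *\<^sub>R v)"
    by (intro gen; simp add: algebra_simps)+
  have Lv: "Lproj T a v = 0" and Lp: "Lproj T a p = p" and Lq: "Lproj T a q = 0"
    by (simp_all add: v_def p_def q_def blinfun.bilinear_simps is_proj_idem[OF Lproj_is_proj[OF T]])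
  have o1: "inner u v = 0" by (rule is_proj_orth[OF Lproj_is_proj[OF T] Lu Lv])
  have o2: "inner (p - c *\<^sub>R u) (q - c *\<^sub>R v) = 0"
    by (rule is_proj_orth[OF Lproj_is_proj[OF T], of a]) (simp_all add: blinfun.bilinear_simps Lu Lv Lp Lq)
  have "(m * norm x)\<^sup>2 = (m * norm u)\<^sup>2 + (m * norm v)\<^sup>2"
    using norm_Pythagoras_eq[OF o1] by (simp add: u_def v_def power_mult_distrib algebra_simps)
  also have "\<dots> \<le> (norm (p - c *\<^sub>R u))\<^sup>2 + (norm (q - c *\<^sub>R v))\<^sup>2"
    using 1 2 m0 by (intro add_mono power_mono) auto
  also have "\<dots> = (norm (y - c *\<^sub>R x))\<^sup>2"
    using norm_Pythagoras_eq[OF o2] by (simp add: u_def v_def p_def q_def algebra_simps)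
  finally show ?thesis unfolding m_def by (rule power2_le_imp_le) simp
qed

subsection \<open>The integral representation\<close>

text \<open>The integral of \<open>f\<close> satisfies the same local estimate as \<Phi>, so their
  difference is additive and of size O(v - u) times the measure of (u, v]. Bisection then bounds it
  by every e > 0 times the measure of (a, b], without any Riemann sums.\<close>

lemma additive_eq_set_integral:
  fixes \<Phi> :: "real \<Rightarrow> real \<Rightarrow> real" and f :: "real \<Rightarrow> real"
  assumes fb: "finite_borel_measure \<mu>" and ab: "a \<le> b" and f: "f \<in> borel_measurable borel" and K: "0 \<le> K"
    and add: "\<And>u v w. a \<le> u \<Longrightarrow> u \<le> v \<Longrightarrow> v \<le> w \<Longrightarrow> w \<le> b \<Longrightarrow> \<Phi> u w = \<Phi> u v + \<Phi> v w"
    and lip: "\<And>u s. a \<le> u \<Longrightarrow> u \<le> s \<Longrightarrow> s \<le> b \<Longrightarrow> \<bar>f s - f u\<bar> \<le> K * (s - u)"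
    and bd: "\<And>u v. a \<le> u \<Longrightarrow> u \<le> v \<Longrightarrow> v \<le> b \<Longrightarrow>
      \<bar>\<Phi> u v - f u * measure \<mu> {u<..v}\<bar> \<le> K * (v - u) * measure \<mu> {u<..v}"
  shows "set_integrable \<mu> {a<..b} f \<and> \<Phi> a b = (LINT s:{a<..b}|\<mu>. f s)"
proof -
  interpret finite_borel_measure \<mu> by (rule fb)
  have sets: "{u<..v} \<in> sets \<mu>" for u v by (simp add: M_is_borel)
  have fm: "f \<in> borel_measurable \<mu>" using f by (simp add: measurable_cong_sets[OF M_is_borel refl])
  have fin: "emeasure \<mu> {u<..v} \<noteq> \<infinity>" for u v by simp
  have constI: "set_integrable \<mu> {u<..v} (\<lambda>_. c)" for u v and c :: real
    unfolding set_integrable_def by (intro integrable_scaleR_left integrable_real_indicator sets) (simp add: emeasure_eq_measure)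
  have intf: "set_integrable \<mu> {u<..v} f" if "a \<le> u" "u \<le> v" "v \<le> b" for u v
    unfolding set_integrable_def
  proof (rule integrable_const_bound[where B = "\<bar>f u\<bar> + K * (v - u)"])
    have "\<bar>f s\<bar> \<le> \<bar>f u\<bar> + K * (v - u)" if "s \<in> {u<..v}" for s
      using lip[of u s] mult_left_mono[OF _ K, of "s - u" "v - u"] that \<open>a \<le> u\<close> \<open>v \<le> b\<close> by simp
    moreover have "0 \<le> \<bar>f u\<bar> + K * (v - u)" using K that by simp
    ultimately show "AE s in \<mu>. norm (indicat_real {u<..v} s *\<^sub>R f s) \<le> \<bar>f u\<bar> + K * (v - u)"
      by (intro AE_I2) (auto simp: indicator_def)
  qed (use fm sets in measurable)
  have int: "set_integrable \<mu> {a<..b} f" by (rule intf) (use ab in auto)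
  define \<Psi> where "\<Psi> u v = (LINT s:{u<..v}|\<mu>. f s)" for u v
  have \<Psi>add: "\<Psi> u w = \<Psi> u v + \<Psi> v w" if "a \<le> u" "u \<le> v" "v \<le> w" "w \<le> b" for u v w
  proof -
    have "{u<..w} = {u<..v} \<union> {v<..w}" using that by auto
    then show ?thesis unfolding \<Psi>_def using that by (auto intro!: set_integral_Un intf)
  qed
  have \<Psi>bd: "\<bar>\<Psi> u v - f u * measure \<mu> {u<..v}\<bar> \<le> K * (v - u) * measure \<mu> {u<..v}" if "a \<le> u" "u \<le> v" "v \<le> b" for u v
  proof -
    have "f u - K * (v - u) \<le> f s \<and> f s \<le> f u + K * (v - u)" if "s \<in> {u<..v}" for s
      using lip[of u s] mult_left_mono[OF _ K, of "s - u" "v - u"] that \<open>a \<le> u\<close> \<open>v \<le> b\<close> by (simp add: abs_le_iff)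
    then have "(LINT s:{u<..v}|\<mu>. f u - K * (v - u)) \<le> \<Psi> u v" "\<Psi> u v \<le> (LINT s:{u<..v}|\<mu>. f u + K * (v - u))"
      unfolding \<Psi>_def by (intro set_integral_mono constI intf that; simp)+
    then show ?thesis by (simp add: set_integral_const[OF sets fin] algebra_simps abs_le_iff)
  qed
  define \<Delta> where "\<Delta> u v = \<Phi> u v - \<Psi> u v" for u v
  have \<Delta>bd: "\<bar>\<Delta> u v\<bar> \<le> 2 * K * (v - u) * measure \<mu> {u<..v}" if "a \<le> u" "u \<le> v" "v \<le> b" for u v
    using bd[OF that] \<Psi>bd[OF that] by (simp add: \<Delta>_def)
  have small: "\<bar>\<Delta> a b\<bar> \<le> e * measure \<mu> {a<..b}" if e: "e > 0" for e
  proof -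
    have "a \<le> a \<and> b \<le> b \<longrightarrow> \<bar>\<Delta> a b\<bar> \<le> e * measure \<mu> {a<..b}"
    proof (rule Bolzano[OF ab, where P = "\<lambda>u v. a \<le> u \<and> v \<le> b \<longrightarrow> \<bar>\<Delta> u v\<bar> \<le> e * measure \<mu> {u<..v}"])
      fix u v w
      assume *: "a \<le> u \<and> v \<le> b \<longrightarrow> \<bar>\<Delta> u v\<bar> \<le> e * measure \<mu> {u<..v}"
        "a \<le> v \<and> w \<le> b \<longrightarrow> \<bar>\<Delta> v w\<bar> \<le> e * measure \<mu> {v<..w}" "u \<le> v" "v \<le> w"
      show "a \<le> u \<and> w \<le> b \<longrightarrow> \<bar>\<Delta> u w\<bar> \<le> e * measure \<mu> {u<..w}"
      proof
        assume uw: "a \<le> u \<and> w \<le> b"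
        have "{u<..w} = {u<..v} \<union> {v<..w}" using * by auto
        then have "measure \<mu> {u<..w} = measure \<mu> {u<..v} + measure \<mu> {v<..w}"
          using finite_measure_Union[OF sets[of u v] sets[of v w]] by auto
        moreover have "\<Delta> u w = \<Delta> u v + \<Delta> v w"
          unfolding \<Delta>_def using add[of u v w] \<Psi>add[of u v w] uw * by simp
        moreover have "\<bar>\<Delta> u v\<bar> \<le> e * measure \<mu> {u<..v}" "\<bar>\<Delta> v w\<bar> \<le> e * measure \<mu> {v<..w}"
          using * uw by auto
        ultimately show "\<bar>\<Delta> u w\<bar> \<le> e * measure \<mu> {u<..w}" by (simp add: distrib_left)
      qed
    next
      fix x assume "a \<le> x" "x \<le> b"
      \<comment> \<open>The factor 2 K collects the errors of \<Phi> and \<Psi>; the extra 1 covers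
        K = 0.\<close>
      have "\<bar>\<Delta> u v\<bar> \<le> e * measure \<mu> {u<..v}" if uv: "u \<le> x" "x \<le> v" "v - u < e / (2 * K + 1)" "a \<le> u" "v \<le> b" for u v
      proof -
        have "2 * K * (v - u) \<le> (2 * K + 1) * (v - u)" using uv by (intro mult_right_mono) auto
        also have "\<dots> \<le> (2 * K + 1) * (e / (2 * K + 1))" using uv K by (intro mult_left_mono) auto
        also have "\<dots> = e" using K by simp
        finally have "2 * K * (v - u) * measure \<mu> {u<..v} \<le> e * measure \<mu> {u<..v}" by (intro mult_right_mono) auto
        then show ?thesis using \<Delta>bd[of u v] uv by simp
      qed
      then show "\<exists>d>0. \<forall>u v. u \<le> x \<and> x \<le> v \<and> v - u < d \<longrightarrow> a \<le> u \<and> v \<le> b \<longrightarrow> \<bar>\<Delta> u v\<bar> \<le> e * measure \<mu> {u<..v}"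
        using e K by (intro exI[of _ "e / (2 * K + 1)"]) auto
    qed
    then show ?thesis by simp
  qed
  have "\<bar>\<Delta> a b\<bar> \<le> 0"
  proof (rule field_le_epsilon)
    fix e :: real assume e: "e > 0"
    define m where "m = measure \<mu> {a<..b} + 1"
    have m: "m > 0" unfolding m_def by (simp add: add_nonneg_pos)
    have "\<bar>\<Delta> a b\<bar> \<le> e / m * measure \<mu> {a<..b}" using e m by (intro small) simp
    also have "\<dots> \<le> e / m * m" using e m by (intro mult_left_mono) (auto simp: m_def)
    finally show "\<bar>\<Delta> a b\<bar> \<le> 0 + e" using m by simp
  qed
  then show ?thesis using int by (simp add: \<Delta>_def \<Psi>_def)
qed

definition proj_family :: "(real \<Rightarrow> 'a::{real_inner,banach} \<Rightarrow>\<^sub>L 'a) \<Rightarrow> bool" where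
  "proj_family E \<longleftrightarrow> (\<forall>t. is_proj (E t)) \<and> (\<forall>s t. s \<le> t \<longrightarrow> E s o\<^sub>L E t = E s) \<and>
     (\<forall>t x. ((\<lambda>s. E s x) \<longlongrightarrow> E t x) (at_right t)) \<and>
     (\<forall>x. ((\<lambda>s. E s x) \<longlongrightarrow> 0) at_bot) \<and> (\<forall>x. ((\<lambda>s. E s x) \<longlongrightarrow> x) at_top)"

definition form_measure :: "(real \<Rightarrow> 'a::{real_inner,banach} \<Rightarrow>\<^sub>L 'a) \<Rightarrow> 'a \<Rightarrow> real measure" where
  "form_measure E x = interval_measure (\<lambda>t. inner (E t x) x)"

lemma proj_family_is_proj: "proj_family E \<Longrightarrow> is_proj (E t)"
  by (simp add: proj_family_def)

lemma
  assumes E: "proj_family E" and st: "s \<le> t"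
  shows proj_family_mono1: "E s (E t x) = E s x" and proj_family_mono2: "E t (E s x) = E s x"
proof -
  show 1: "E s (E t x) = E s x" for x
    using E st by (metis proj_family_def blinfun_apply_blinfun_compose)
  have "inner (E t (E s x) - E s x) y = 0" for y
    by (simp add: inner_diff_left is_proj_sym[OF proj_family_is_proj[OF E]] 1)
  then show "E t (E s x) = E s x" using inner_eq_zero_iff[of "E t (E s x) - E s x"] by simp
qed

lemma proj_family_min: "proj_family E \<Longrightarrow> E s (E t x) = E (min s t) x"
  by (cases "s \<le> t") (simp_all add: proj_family_mono1 proj_family_mono2 min_def)

lemma
  assumes E: "proj_family E"
  shows form_measure_finite: "finite_borel_measure (form_measure E x)"
    and measure_form_Iic: "measure (form_measure E x) {..t} = inner (E t x) x"
    and measure_form_UNIV: "measure (form_measure E x) UNIV = (norm x)\<^sup>2"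
    and measure_form_Ioc: "a \<le> b \<Longrightarrow> measure (form_measure E x) {a<..b} = inner (E b x) x - inner (E a x) x"
proof -
  have sq: "inner (E s x) x = (norm (E s x))\<^sup>2" for s by (rule is_proj_inner[OF proj_family_is_proj[OF E]])
  have mono: "inner (E s x) x \<le> inner (E t x) x" if "s \<le> t" for s t
  proof -
    have "norm (E s (E t x)) \<le> norm (E t x)" by (rule is_proj_norm_le[OF proj_family_is_proj[OF E]])
    then show ?thesis by (simp add: proj_family_mono1[OF E that] sq power_mono)
  qed
  have right: "continuous (at_right a) (\<lambda>t. inner (E t x) x)" for a
    unfolding continuous_within using E by (intro tendsto_inner tendsto_const) (simp add: proj_family_def)
  have bot: "((\<lambda>t. inner (E t x) x) \<longlongrightarrow> 0) at_bot"
  proof -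
    have "((\<lambda>t. inner (E t x) x) \<longlongrightarrow> inner 0 x) at_bot"
      using E by (intro tendsto_inner tendsto_const) (simp add: proj_family_def)
    then show ?thesis by simp
  qed
  have top: "((\<lambda>t. inner (E t x) x) \<longlongrightarrow> (norm x)\<^sup>2) at_top"
    unfolding power2_norm_eq_inner using E by (intro tendsto_inner tendsto_const) (simp add: proj_family_def)
  show "finite_borel_measure (form_measure E x)" unfolding form_measure_def
    by (rule finite_borel_measure_interval_measure[OF mono right bot top]) simp_all
  show "measure (form_measure E x) {..t} = inner (E t x) x" unfolding form_measure_def
    by (rule measure_interval_measure_Iic[OF mono right bot])
  show "measure (form_measure E x) UNIV = (norm x)\<^sup>2" unfolding form_measure_def measure_def
    by (subst interval_measure_UNIV[OF mono right bot top]) simp_all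
  show "measure (form_measure E x) {a<..b} = inner (E b x) x - inner (E a x) x" if "a \<le> b"
    unfolding form_measure_def by (rule measure_interval_measure_Ioc[OF that mono right])
qed

lemma proj_family_Eproj: "sa T \<Longrightarrow> proj_family (Eproj T)"
  unfolding proj_family_def
  by (auto intro!: blinfun_eqI simp: Eproj_is_proj Eproj_mono Eproj_at_right Eproj_at_bot Eproj_at_top)

definition tval :: "('a \<times> 'a) set \<Rightarrow> 'a \<Rightarrow> 'a" where
  "tval T x = (THE y. (x, y) \<in> T)"

lemma tval_eq: "sa T \<Longrightarrow> (x, y) \<in> T \<Longrightarrow> tval T x = y"
  unfolding tval_def using sa_single by blast

text \<open>\<open>B u v\<close> is the component of x in the block (u, v] and \<open>Z u v\<close>
  its image under T. Different blocks are orthogonal, so <Z, B> and |Z|^2 are additive interval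
  functions, and on a short block Z is close to u B.\<close>

lemma block_integrals:
  fixes T :: "('a::{real_inner,banach} \<times> 'a) set" and x :: 'a
  assumes T: "sa T" and ab: "a \<le> b"
  defines "m \<equiv> form_measure (Eproj T) x"
  defines "B \<equiv> \<lambda>u v. Eproj T v x - Eproj T u x"
  obtains z where "(B a b, z) \<in> T" "set_integrable m {a<..b} (\<lambda>t. t)" "inner z (B a b) = (LINT t:{a<..b}|m. t)"
    "set_integrable m {a<..b} (\<lambda>t. t\<^sup>2)" "(norm z)\<^sup>2 = (LINT t:{a<..b}|m. t\<^sup>2)"
proof -
  note E = proj_family_Eproj[OF T]
  interpret finite_borel_measure m unfolding m_def by (rule form_measure_finite[OF E])
  define Z where "Z u v = tval T (B u v)" for u v
  have EB: "Eproj T v (B u v) = B u v" "Eproj T u (B u v) = 0" if "u \<le> v" for u v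
    using that by (simp_all add: B_def blinfun.bilinear_simps is_proj_idem[OF Eproj_is_proj[OF T]] Eproj_mono[OF T])
  have BZ: "(B u v, Z u v) \<in> T" and EZ: "Eproj T v (Z u v) = Z u v" if uv: "u \<le> v" for u v
  proof -
    obtain z where z: "(B u v, z) \<in> T" "Eproj T v z = z"
      using block_in_domain[OF T uv EB(1)[OF uv] Eproj_0_imp_Lproj_0[OF T EB(2)[OF uv]]] by blast
    then show "(B u v, Z u v) \<in> T" "Eproj T v (Z u v) = Z u v"
      using tval_eq[OF T z(1)] by (simp_all add: Z_def)
  qed
  have EZ0: "Eproj T u (Z u v) = 0" if uv: "u \<le> v" for u v
    using sa_single[OF T _ sa_0[OF T]] comm_opD[OF Eproj_comm_op[OF T] BZ[OF uv], of u] EB(2)[OF uv] by simp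
  have meas: "measure m {u<..v} = (norm (B u v))\<^sup>2" if "u \<le> v" for u v
    unfolding m_def measure_form_Ioc[OF E that] B_def Eproj_norm_diff[OF T that]
    by (simp add: is_proj_inner[OF Eproj_is_proj[OF T]])
  have Badd: "B u w = B u v + B v w" for u v w by (simp add: B_def)
  have Zadd: "Z u w = Z u v + Z v w" if "u \<le> v" "v \<le> w" for u v w
    using tval_eq[OF T sa_add[OF T BZ[OF that(1)] BZ[OF that(2)]]] Badd[of u w v] by (simp add: Z_def)
  have orth: "inner (Z u v) (B v w) = 0" "inner (Z v w) (B u v) = 0" "inner (Z u v) (Z v w) = 0"
    if "u \<le> v" "v \<le> w" for u v w
    using is_proj_orth[OF Eproj_is_proj[OF T], of v] EB EZ EZ0 that by (metis inner_commute)+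
  have form: "u * (norm (B u v))\<^sup>2 \<le> inner (Z u v) (B u v) \<and> inner (Z u v) (B u v) \<le> v * (norm (B u v))\<^sup>2"
    if "u \<le> v" for u v
    by (rule block_form[OF T BZ[OF that]]) (simp_all add: EB[OF that])
  have nZ: "norm (Z u v - u *\<^sub>R B u v) \<le> (v - u) * norm (B u v)" if uv: "u \<le> v" for u v
    using block_norm_le[OF T uv BZ[OF uv] EB(1)[OF uv] Eproj_0_imp_Lproj_0[OF T EB(2)[OF uv]], of u] uv by simp
  have 1: "set_integrable m {a<..b} (\<lambda>t. t) \<and> inner (Z a b) (B a b) = (LINT t:{a<..b}|m. t)"
  proof (rule additive_eq_set_integral[OF finite_borel_measure_axioms ab, where \<Phi> = "\<lambda>u v. inner (Z u v) (B u v)" and K = 1])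
    fix u v w :: real assume uvw: "u \<le> v" "v \<le> w"
    show "inner (Z u w) (B u w) = inner (Z u v) (B u v) + inner (Z v w) (B v w)"
      unfolding Zadd[OF uvw] Badd[of u w v] using orth[OF uvw] by (simp add: inner_add_left inner_add_right)
  next
    fix u v :: real assume uv: "u \<le> v"
    show "\<bar>inner (Z u v) (B u v) - u * measure m {u<..v}\<bar> \<le> 1 * (v - u) * measure m {u<..v}"
      using form[OF uv] by (simp add: meas[OF uv] algebra_simps abs_le_iff)
  qed auto
  \<comment> \<open>The error of |Z|^2 is <Z - u B, Z + u B>. The first factor is at most (v - u)
    |B|, the second at most (v - u + 2 |u|) |B| \<le> 4 M |B|; this is the origin of K = 4
    M.\<close>
  define M where "M = max \<bar>a\<bar> \<bar>b\<bar>"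
  have M: "\<bar>u\<bar> \<le> M" if "a \<le> u" "u \<le> b" for u using that by (auto simp: M_def)
  have 2: "set_integrable m {a<..b} (\<lambda>t. t\<^sup>2) \<and> (norm (Z a b))\<^sup>2 = (LINT t:{a<..b}|m. t\<^sup>2)"
  proof (rule additive_eq_set_integral[OF finite_borel_measure_axioms ab, where \<Phi> = "\<lambda>u v. (norm (Z u v))\<^sup>2" and K = "4 * M"])
    fix u v w :: real assume uvw: "u \<le> v" "v \<le> w"
    show "(norm (Z u w))\<^sup>2 = (norm (Z u v))\<^sup>2 + (norm (Z v w))\<^sup>2"
      unfolding Zadd[OF uvw] by (rule norm_Pythagoras_eq[OF orth(3)[OF uvw]])
  next
    fix u v :: real assume uv: "a \<le> u" "u \<le> v" "v \<le> b"
    have "\<bar>v + u\<bar> \<le> 4 * M" using M[of u] M[of v] uv by linarith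
    then have "\<bar>(v + u) * (v - u)\<bar> \<le> 4 * M * (v - u)" unfolding abs_mult using uv by (intro mult_mono) auto
    then show "\<bar>v\<^sup>2 - u\<^sup>2\<bar> \<le> 4 * M * (v - u)" by (simp add: power2_eq_square algebra_simps)
    let ?n = "norm (B u v)"
    have "norm (Z u v + u *\<^sub>R B u v) \<le> norm (Z u v - u *\<^sub>R B u v) + norm ((2 * u) *\<^sub>R B u v)"
      using norm_triangle_ineq[of "Z u v - u *\<^sub>R B u v" "(2 * u) *\<^sub>R B u v"] by (simp add: scaleR_2 algebra_simps flip: scaleR_scaleR)
    also have "\<dots> \<le> (v - u) * ?n + 2 * \<bar>u\<bar> * ?n" using nZ[OF uv(2)] by simp
    also have "\<dots> = (v - u + 2 * \<bar>u\<bar>) * ?n" by (simp add: algebra_simps)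
    also have "\<dots> \<le> (4 * M) * ?n" using M[of u] M[of v] uv by (intro mult_right_mono) auto
    finally have plus: "norm (Z u v + u *\<^sub>R B u v) \<le> 4 * M * ?n" .
    have "(norm (Z u v))\<^sup>2 - u\<^sup>2 * ?n\<^sup>2 = inner (Z u v - u *\<^sub>R B u v) (Z u v + u *\<^sub>R B u v)"
      unfolding power2_norm_eq_inner inner_diff_left inner_add_right inner_scaleR_left inner_scaleR_right
      by (simp add: inner_commute power2_eq_square right_diff_distrib)
    then have "\<bar>(norm (Z u v))\<^sup>2 - u\<^sup>2 * ?n\<^sup>2\<bar> \<le> norm (Z u v - u *\<^sub>R B u v) * norm (Z u v + u *\<^sub>R B u v)"
      by (simp add: Cauchy_Schwarz_ineq2)
    also have "\<dots> \<le> ((v - u) * ?n) * (4 * M * ?n)" by (intro mult_mono nZ plus uv) (use uv in auto)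
    also have "((v - u) * ?n) * (4 * M * ?n) = 4 * M * (v - u) * ?n\<^sup>2" by algebra
    finally show "\<bar>(norm (Z u v))\<^sup>2 - u\<^sup>2 * measure m {u<..v}\<bar> \<le> 4 * M * (v - u) * measure m {u<..v}"
      unfolding meas[OF uv(2)] .
  qed (auto simp: M_def)
  show ?thesis using that[of "Z a b"] BZ[OF ab] 1 2 by blast
qed

text \<open>The truncations \<open>y n\<close> of x to (-n, n] lie in the domain, and the squared
  norm of their image \<open>z n\<close> is the truncated integral of t^2. As T is closed, x is in
  the domain exactly when \<open>z\<close> converges, that is, when these integrals stay
  bounded.\<close>

lemma spectral_representation:
  fixes T :: "('a::{real_inner,banach} \<times> 'a) set" and x :: 'a
  assumes T: "sa T"
  shows "x \<in> Domain T \<longleftrightarrow> integrable (form_measure (Eproj T) x) (\<lambda>t. t\<^sup>2)"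
    and "(x, w) \<in> T \<Longrightarrow> inner w x = (LINT t|form_measure (Eproj T) x. t)"
proof -
  note E = proj_family_Eproj[OF T]
  define m where "m = form_measure (Eproj T) x"
  interpret finite_borel_measure m unfolding m_def by (rule form_measure_finite[OF E])
  have mb: "(\<lambda>t. t) \<in> borel_measurable m" "(\<lambda>t::real. t\<^sup>2) \<in> borel_measurable m"
    by (simp_all add: measurable_cong_sets[OF M_is_borel refl])
  define y where "y n = Eproj T (real n) x - Eproj T (- real n) x" for n
  have "\<exists>z. (y n, z) \<in> T \<and> inner z (y n) = (LINT t:{- real n<..real n}|m. t) \<and>
      set_integrable m {- real n<..real n} (\<lambda>t. t\<^sup>2) \<and> (norm z)\<^sup>2 = (LINT t:{- real n<..real n}|m. t\<^sup>2)" for n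
  proof -
    have "- real n \<le> real n" by simp
    from block_integrals[OF T this, of x, folded y_def m_def] show ?thesis by metis
  qed
  then obtain z where z: "\<And>n. (y n, z n) \<in> T" "\<And>n. inner (z n) (y n) = (LINT t:{- real n<..real n}|m. t)"
    "\<And>n. set_integrable m {- real n<..real n} (\<lambda>t. t\<^sup>2)" "\<And>n. (norm (z n))\<^sup>2 = (LINT t:{- real n<..real n}|m. t\<^sup>2)"
    by metis
  have Elim: "(\<lambda>n. Eproj T (real n) v - Eproj T (- real n) v) \<longlonglongrightarrow> v" for v
  proof -
    have "(\<lambda>n. Eproj T (real n) v - Eproj T (- real n) v) \<longlonglongrightarrow> v - 0"
      by (intro tendsto_diff filterlim_compose[OF Eproj_at_top[OF T]] filterlim_compose[OF Eproj_at_bot[OF T]]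
          filterlim_real_sequentially filterlim_compose[OF filterlim_uminus_at_bot_at_top])
    then show ?thesis by simp
  qed
  have ylim: "y \<longlonglongrightarrow> x" unfolding y_def by (rule Elim)
  have ptw: "(\<lambda>n. indicat_real {- real n<..real n} t *\<^sub>R f t) \<longlonglongrightarrow> f t" for f :: "real \<Rightarrow> real" and t
  proof (rule tendsto_eventually)
    obtain N where N: "\<bar>t\<bar> < real N" using reals_Archimedean2 by blast
    show "eventually (\<lambda>n. indicat_real {- real n<..real n} t *\<^sub>R f t = f t) sequentially"
      using eventually_ge_at_top[of N] by eventually_elim (use N in \<open>auto simp: indicator_def\<close>)
  qed
  { fix w assume xw: "(x, w) \<in> T"
    have zeq: "z n = Eproj T (real n) w - Eproj T (- real n) w" for n
      using sa_single[OF T z(1)] sa_diff[OF T comm_opD[OF Eproj_comm_op[OF T] xw] comm_opD[OF Eproj_comm_op[OF T] xw]]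
      unfolding y_def by blast
    have zlim: "z \<longlonglongrightarrow> w" unfolding zeq by (rule Elim)
    have int: "integrable m (\<lambda>t. t\<^sup>2)"
    proof (rule integrable_monotone_convergence)
      show "integrable m (\<lambda>t. indicat_real {- real n<..real n} t *\<^sub>R t\<^sup>2)" for n
        using z(3)[of n] unfolding set_integrable_def .
      show "AE t in m. mono (\<lambda>n. indicat_real {- real n<..real n} t *\<^sub>R t\<^sup>2)"
        by (rule AE_I2) (auto simp: mono_def indicator_def)
      show "AE t in m. (\<lambda>n. indicat_real {- real n<..real n} t *\<^sub>R t\<^sup>2) \<longlonglongrightarrow> t\<^sup>2" by (rule AE_I2) (rule ptw)
      show "(\<lambda>n. \<integral>t. indicat_real {- real n<..real n} t *\<^sub>R t\<^sup>2 \<partial>m) \<longlonglongrightarrow> (norm w)\<^sup>2"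
        using tendsto_power[OF tendsto_norm[OF zlim], of 2] unfolding z(4) set_lebesgue_integral_def .
    qed (rule mb)
    have "inner w x = (LINT t|m. t)"
    proof (rule LIMSEQ_unique)
      show "(\<lambda>n. inner (z n) (y n)) \<longlonglongrightarrow> inner w x" by (intro tendsto_intros zlim ylim)
      show "(\<lambda>n. inner (z n) (y n)) \<longlonglongrightarrow> (LINT t|m. t)"
        unfolding z(2) set_lebesgue_integral_def
      proof (rule integral_dominated_convergence[where w = "\<lambda>t. 1 + t\<^sup>2"])
        show "integrable m (\<lambda>t. 1 + t\<^sup>2)" by (intro Bochner_Integration.integrable_add int) simp
        have tle: "\<bar>t\<bar> \<le> 1 + t\<^sup>2" for t :: real
          using zero_le_power2[of "\<bar>t\<bar> - 1"] by (simp add: power2_diff)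
        show "AE t in m. norm (indicat_real {- real n<..real n} t *\<^sub>R t) \<le> 1 + t\<^sup>2" for n
          by (rule AE_I2) (auto simp: indicator_def tle)
        show "AE t in m. (\<lambda>n. indicat_real {- real n<..real n} t *\<^sub>R t) \<longlonglongrightarrow> t" by (rule AE_I2) (rule ptw)
        show "(\<lambda>t. indicat_real {- real n<..real n} t *\<^sub>R t) \<in> borel_measurable m" for n
          by (simp add: measurable_cong_sets[OF M_is_borel refl])
      qed (rule mb)
    qed
    note this int }
  note dom = this
  show "inner w x = (LINT t|form_measure (Eproj T) x. t)" if "(x, w) \<in> T"
    using dom(1)[OF that] by (simp add: m_def)
  show "x \<in> Domain T \<longleftrightarrow> integrable (form_measure (Eproj T) x) (\<lambda>t. t\<^sup>2)"
  proof
    assume "x \<in> Domain T"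
    then show "integrable (form_measure (Eproj T) x) (\<lambda>t. t\<^sup>2)" using dom(2) by (auto simp: m_def)
  next
    assume "integrable (form_measure (Eproj T) x) (\<lambda>t. t\<^sup>2)"
    then have int: "integrable m (\<lambda>t. t\<^sup>2)" by (simp add: m_def)
    have "(\<lambda>n. (norm (z n))\<^sup>2) \<longlonglongrightarrow> (LINT t|m. t\<^sup>2)"
      unfolding z(4) set_lebesgue_integral_def
    proof (rule integral_dominated_convergence[where w = "\<lambda>t. t\<^sup>2"])
      show "integrable m (\<lambda>t. t\<^sup>2)" by (rule int)
      show "AE t in m. norm (indicat_real {- real n<..real n} t *\<^sub>R t\<^sup>2) \<le> t\<^sup>2" for n
        by (rule AE_I2) (auto simp: indicator_def)
      show "AE t in m. (\<lambda>n. indicat_real {- real n<..real n} t *\<^sub>R t\<^sup>2) \<longlonglongrightarrow> t\<^sup>2" by (rule AE_I2) (rule ptw)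
      show "(\<lambda>t. indicat_real {- real n<..real n} t *\<^sub>R t\<^sup>2) \<in> borel_measurable m" for n
        by (simp add: measurable_cong_sets[OF M_is_borel refl])
    qed (rule mb)
    then have cau: "Cauchy (\<lambda>n. (norm (z n))\<^sup>2)" by (rule LIMSEQ_imp_Cauchy)
    \<comment> \<open>The increments of \<open>z\<close> are orthogonal to the earlier terms, so
      convergence of the norms makes \<open>z\<close> itself Cauchy.\<close>
    have diff: "(norm (z n - z k))\<^sup>2 = (norm (z n))\<^sup>2 - (norm (z k))\<^sup>2" if kn: "k \<le> n" for k n
    proof -
      have "Eproj T (real k) (y n) - Eproj T (- real k) (y n) = y k"
        using kn by (simp add: y_def blinfun.bilinear_simps Eproj_mono[OF T])
      then have "(y k, Eproj T (real k) (z n) - Eproj T (- real k) (z n)) \<in> T"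
        using sa_diff[OF T comm_opD[OF Eproj_comm_op[OF T] z(1)] comm_opD[OF Eproj_comm_op[OF T] z(1)]] by metis
      then have zk: "z k = (Eproj T (real k) - Eproj T (- real k)) (z n)"
        using sa_single[OF T z(1)] by (simp add: blinfun.bilinear_simps)
      have "is_proj (Eproj T (real k) - Eproj T (- real k))" by (rule EE_is_proj[OF T]) simp
      from is_proj_Pythagoras[OF this, of "z n"] show ?thesis unfolding zk[symmetric] by simp
    qed
    have "Cauchy z"
    proof (rule metric_CauchyI)
      fix e :: real assume e: "e > 0"
      then obtain N where N: "\<And>k n. k \<ge> N \<Longrightarrow> n \<ge> N \<Longrightarrow> dist ((norm (z k))\<^sup>2) ((norm (z n))\<^sup>2) < e\<^sup>2"
        using metric_CauchyD[OF cau, of "e\<^sup>2"] by auto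
      have *: "dist (z n) (z k) < e" if "k \<le> n" "N \<le> k" for k n
      proof -
        have "(norm (z n - z k))\<^sup>2 < e\<^sup>2"
          using N[of n k] that unfolding diff[OF that(1)] dist_real_def by simp
        then show ?thesis using e by (simp add: dist_norm power_less_imp_less_base)
      qed
      have "dist (z k) (z n) < e" if "k \<ge> N" "n \<ge> N" for k n
        using *[of k n] *[of n k] that by (cases "k \<le> n") (auto simp: dist_commute)
      then show "\<exists>N. \<forall>k\<ge>N. \<forall>n\<ge>N. dist (z k) (z n) < e" by blast
    qed
    then obtain w where "z \<longlonglongrightarrow> w" using Cauchy_convergent convergent_def by blast
    then have "(x, w) \<in> T" by (intro sa_limit[OF T _ _ ylim]) (simp_all add: z(1))
    then show "x \<in> Domain T" by blast
  qed
qed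

subsection \<open>Uniqueness of the spectral family\<close>

text \<open>Because E r (E t x) = E (min r t) x, the distribution function belonging to E t x is
  that of x stopped at t.\<close>

lemma
  assumes E: "proj_family E"
  shows form_measure_lower: "form_measure E (E t x) = density (form_measure E x) (indicator {..t})"
    and form_measure_upper: "form_measure E (x - E t x) = density (form_measure E x) (indicator {t<..})"
proof -
  let ?m = "form_measure E x"
  interpret finite_borel_measure ?m by (rule form_measure_finite[OF E])
  have fb: "finite_borel_measure (density ?m (indicator S))" if "S \<in> sets borel" for S
  proof -
    have "finite_measure (density ?m (indicator S))" by (rule finite_measure_restricted) (simp add: M_is_borel that)
    then show ?thesis by (simp add: finite_borel_measure_def finite_borel_measure_axioms_def M_is_borel)
  qed
  note P = proj_family_is_proj[OF E]
  have q: "inner (E r (E t x)) (E t x) = inner (E (min r t) x) x" for r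
    by (simp add: is_proj_sym[OF P[of t], symmetric] proj_family_min[OF E])
  show "form_measure E (E t x) = density ?m (indicator {..t})"
  proof (rule cdf_unique'[OF form_measure_finite[OF E] fb])
    show "cdf (form_measure E (E t x)) = cdf (density ?m (indicator {..t}))"
    proof
      fix r
      have "{..t} \<inter> {..r} = {..min r t}" by auto
      then show "cdf (form_measure E (E t x)) r = cdf (density ?m (indicator {..t})) r"
        by (simp add: cdf_def2 measure_restricted M_is_borel measure_form_Iic[OF E] q)
    qed
  qed simp
  show "form_measure E (x - E t x) = density ?m (indicator {t<..})"
  proof (rule cdf_unique'[OF form_measure_finite[OF E] fb])
    show "cdf (form_measure E (x - E t x)) = cdf (density ?m (indicator {t<..}))"
    proof
      fix r
      have "inner (E r (x - E t x)) (x - E t x) = inner (E r x) x - inner (E (min r t) x) x"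
        using q[of r] is_proj_sym[OF P[of t], of "E r x" x]
        by (simp add: blinfun.bilinear_simps inner_diff_left inner_diff_right proj_family_min[OF E] min.commute)
      moreover have "{t<..} \<inter> {..r} = (if r \<le> t then {} else {t<..r})" by auto
      ultimately show "cdf (form_measure E (x - E t x)) r = cdf (density ?m (indicator {t<..})) r"
        by (auto simp: cdf_def2 measure_restricted M_is_borel measure_form_Iic[OF E] measure_form_Ioc[OF E] min_def)
    qed
  qed simp
qed

text \<open>It is enough that \<open>E t\<close> satisfies \<open>below T t\<close>. The form bounds
  follow from where the measure of x is concentrated; the substantial point is that
  \<open>E t\<close> commutes with T, although only diagonal values of the form are given.\<close>

lemma resolution_unique:
  fixes T :: "('a::{real_inner,banach} \<times> 'a) set"
  assumes T: "sa T" and E: "proj_family E"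
    and dom: "\<And>x. x \<in> Domain T \<longleftrightarrow> integrable (form_measure E x) (\<lambda>t. t\<^sup>2)"
    and form: "\<And>x y. (x, y) \<in> T \<Longrightarrow> inner y x = (LINT t|form_measure E x. t)"
  shows "E = Eproj T"
proof
  fix t
  note P = proj_family_is_proj[OF E, of t]
  let ?m = "form_measure E"
  have sets: "sets (?m x) = sets borel" for x by (simp add: form_measure_def)
  have meas: "f \<in> borel_measurable (?m x)" if "f \<in> borel_measurable borel" for f :: "real \<Rightarrow> real" and x
    using that by (simp add: measurable_cong_sets[OF sets refl])
  have fin: "finite_measure (?m x)" for x
    using form_measure_finite[OF E] by (simp add: finite_borel_measure_def)
  have ind: "(indicator S :: real \<Rightarrow> ennreal) = (\<lambda>x. ennreal (indicat_real S x))" for S by (auto simp: indicator_def)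
  have dint: "integrable (density (?m x) (indicator S)) f \<longleftrightarrow> set_integrable (?m x) S f"
    and dlint: "integral\<^sup>L (density (?m x) (indicator S)) f = set_lebesgue_integral (?m x) S f"
    if "S \<in> sets borel" "f \<in> borel_measurable borel" for S and f :: "real \<Rightarrow> real" and x
    unfolding ind set_integrable_def set_lebesgue_integral_def
    using that by (intro integrable_density integral_density meas; simp)+
  have intt: "integrable (?m x) (\<lambda>t. t)" if "x \<in> Domain T" for x
  proof (rule Bochner_Integration.integrable_bound)
    interpret finite_measure "?m x" by (rule fin)
    show "integrable (?m x) (\<lambda>t. 1 + t\<^sup>2)" using dom[of x] that by (intro Bochner_Integration.integrable_add) auto
    have tle: "\<bar>t\<bar> \<le> 1 + t\<^sup>2" for t :: real
      using zero_le_power2[of "\<bar>t\<bar> - 1"] by (simp add: power2_diff)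
    show "AE t in ?m x. norm t \<le> norm (1 + t\<^sup>2)"
      using tle by (intro AE_I2) (simp add: add_nonneg_nonneg)
  qed (simp add: meas)
  have setint: "set_integrable (?m x) S f" if "integrable (?m x) f" "S \<in> sets borel" for S x and f :: "real \<Rightarrow> real"
    unfolding set_integrable_def using that by (intro integrable_mult_indicator) (simp_all add: sets)
  have sp: "space (?m x) = UNIV" for x by (simp add: form_measure_def)
  \<comment> \<open>The measure of E t x is a restriction of that of x, so integrability of t^2 is
    inherited.\<close>
  have lowD: "E t x \<in> Domain T" if "x \<in> Domain T" for x
    unfolding dom form_measure_lower[OF E]
    using that dom[of x] by (subst dint) (auto intro!: setint)
  \<comment> \<open>The cut at t splits the measure of u + v into those of u and v. Hence the
    quadratic form is additive on u + v and the cross terms cancel; being equal by symmetry of T,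
    they vanish.\<close>
  have additive: "inner a v = 0" if ua: "(u, a) \<in> T" "E t u = u" and vb: "(v, b) \<in> T" "E t v = 0" for u v a b
  proof -
    define x where "x = u + v"
    have xT: "(x, a + b) \<in> T" unfolding x_def by (rule sa_add[OF T ua(1) vb(1)])
    have Ex: "E t x = u" "x - E t x = v" by (simp_all add: x_def blinfun.bilinear_simps ua vb)
    have "(LINT t|?m x. t) = (LINT s:{..t} \<union> {t<..}|?m x. s)"
    proof -
      have "{..t} \<union> {t<..} = UNIV" by auto
      then show ?thesis by (simp add: set_lebesgue_integral_def)
    qed
    also have "\<dots> = (LINT s:{..t}|?m x. s) + (LINT s:{t<..}|?m x. s)"
      using intt[of x] xT by (intro set_integral_Un setint) auto
    also have "(LINT s:{..t}|?m x. s) = (LINT s|?m u. s)"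
      using dlint[of "{..t}" "\<lambda>s. s" x] form_measure_lower[OF E, of t x, unfolded Ex] by simp
    also have "(LINT s:{t<..}|?m x. s) = (LINT s|?m v. s)"
      using dlint[of "{t<..}" "\<lambda>s. s" x] form_measure_upper[OF E, of x t, unfolded Ex(2)] by simp
    finally have "inner (a + b) (u + v) = inner a u + inner b v"
      using form[OF xT] form[OF ua(1)] form[OF vb(1)] by (simp add: x_def)
    then have "inner a v + inner b u = 0" by (simp add: inner_add_left inner_add_right)
    then show ?thesis using sa_sym[OF T ua(1) vb(1)] by (simp add: inner_commute)
  qed
  have comm: "comm_op (E t) T" unfolding comm_op_def
  proof (intro allI impI)
    fix x y assume xy: "(x, y) \<in> T"
    then obtain a where a: "(E t x, a) \<in> T" using lowD by blast
    have b: "(x - E t x, y - a) \<in> T" by (rule sa_diff[OF T xy a])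
    have Ex: "E t (E t x) = E t x" "E t (x - E t x) = 0" by (simp_all add: blinfun.bilinear_simps is_proj_idem[OF P])
    have split: "(E t u, c) \<in> T \<Longrightarrow> (u - E t u, d) \<in> T \<Longrightarrow> E t (E t u) = E t u \<and> E t (u - E t u) = 0" for u c d
      by (simp add: blinfun.bilinear_simps is_proj_idem[OF P])
    have domsplit: "\<exists>c d. (E t w, c) \<in> T \<and> (w - E t w, d) \<in> T" if w: "w \<in> Domain T" for w
      using lowD[OF w] w sa_diff[OF T] by blast
    \<comment> \<open>Both components of y = a + (y - a) are tested on the dense domain: a is
      orthogonal to the kernel of E t and y - a to its range, which forces a = E t y.\<close>
    have "a - E t a = 0"
    proof (rule dense_orthogonal_0[OF sa_dense[OF T]])
      fix w assume "w \<in> Domain T"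
      then obtain d where d: "(w - E t w, d) \<in> T" using domsplit by blast
      have "inner a (w - E t w) = 0"
        by (rule additive[OF a _ d]) (simp_all add: blinfun.bilinear_simps is_proj_idem[OF P])
      then show "inner w (a - E t a) = 0"
        using is_proj_sym[OF P, of a w] by (simp add: inner_diff_right inner_commute)
    qed
    moreover have "E t (y - a) = 0"
    proof (rule dense_orthogonal_0[OF sa_dense[OF T]])
      fix w assume "w \<in> Domain T"
      then obtain c where c: "(E t w, c) \<in> T" using domsplit by blast
      have "inner c (x - E t x) = 0" by (rule additive[OF c _ b]) (simp_all add: Ex is_proj_idem[OF P])
      then have "inner (E t w) (y - a) = 0" using sa_sym[OF T c b] by simp
      then show "inner w (E t (y - a)) = 0" by (simp add: is_proj_sym[OF P])
    qed
    ultimately have "E t y = a" by (simp add: blinfun.bilinear_simps)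
    then show "(E t x, E t y) \<in> T" using a by simp
  qed
  have low: "inner y x \<le> t * (norm x)\<^sup>2" if xy: "(x, y) \<in> T" and x: "E t x = x" for x y
  proof -
    interpret finite_measure "?m x" by (rule fin)
    have disj: "{..t} \<inter> {t<..} = {}" by auto
    have "emeasure (?m x) {t<..} = 0"
      using form_measure_lower[OF E, of t x] x emeasure_restricted[of "{..t}" "?m x" "{t<..}"] disj by (simp add: sets)
    then have "AE s in ?m x. s \<le> t" by (intro AE_I'[of "{t<..}"]) (auto simp: null_sets_def sets)
    then have "(LINT s|?m x. s) \<le> (LINT s|?m x. t)" using intt[of x] xy by (intro integral_mono_AE) auto
    also have "\<dots> = t * (norm x)\<^sup>2" using measure_form_UNIV[OF E, of x] by (simp add: sp)
    finally show ?thesis by (simp add: form[OF xy])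
  qed
  have up: "t * (norm x)\<^sup>2 < inner y x" if xy: "(x, y) \<in> T" and x: "E t x = 0" "x \<noteq> 0" for x y
  proof -
    interpret finite_measure "?m x" by (rule fin)
    have disj: "{t<..} \<inter> {..t} = {}" by auto
    have "emeasure (?m x) {..t} = 0"
      using form_measure_upper[OF E, of x t] x emeasure_restricted[of "{t<..}" "?m x" "{..t}"] disj by (simp add: sets)
    then have ae: "AE s in ?m x. t < s" by (intro AE_I'[of "{..t}"]) (auto simp: null_sets_def sets)
    have "measure (?m x) UNIV \<noteq> 0" using measure_form_UNIV[OF E, of x] x by simp
    then have "emeasure (?m x) (space (?m x)) \<noteq> 0" by (auto simp: measure_def form_measure_def)
    then have "(LINT s|?m x. t) < (LINT s|?m x. s)" using intt[of x] xy ae by (intro integral_less_AE_space) auto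
    moreover have "(LINT s|?m x. t) = t * (norm x)\<^sup>2" using measure_form_UNIV[OF E, of x] by (simp add: sp)
    ultimately show ?thesis unfolding form[OF xy] by (simp only:)
  qed
  have "below T t (E t)" unfolding below_def using P comm low up by blast
  then show "E t = Eproj T t" by (rule Eproj_unique[OF T, symmetric])
qed

subsection \<open>Complex selfadjoint operators\<close>

text \<open>Multiplication by i turns the imaginary part of the complex inner product into a real
  part, up to sign; this is the passage from real to complex statements used throughout.\<close>

lemma cinner_eqI:
  fixes a b c d :: "'a::complex_hilbert"
  assumes "inner a b = inner c d" "inner (\<i> *\<^sub>C a) b = inner (\<i> *\<^sub>C c) d"
  shows "cinner a b = cinner c d"
  using assms unfolding Re_cinner[symmetric] cinner_scaleC_left by (simp add: complex_eq_iff)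

lemma norm_scaleC: "norm (c *\<^sub>C x) = cmod c * norm (x::'a::complex_hilbert)"
proof -
  have "cinner (c *\<^sub>C x) (c *\<^sub>C x) = c * cnj c * cinner x x"
    using cinner_commute[of x "c *\<^sub>C x"] cinner_commute[of x x] by (simp add: cinner_scaleC_left)
  then have "inner (c *\<^sub>C x) (c *\<^sub>C x) = (cmod c)\<^sup>2 * inner x x"
    unfolding complex_norm_square[symmetric] by (simp flip: Re_cinner of_real_power)
  then have "(norm (c *\<^sub>C x))\<^sup>2 = (cmod c * norm x)\<^sup>2" by (simp add: power2_norm_eq_inner power_mult_distrib)
  then show ?thesis by (simp add: power2_eq_iff_nonneg)
qed

lemma bounded_linear_scaleC: "bounded_linear (\<lambda>x::'a::complex_hilbert. c *\<^sub>C x)"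
proof (rule bounded_linear_intro[of _ "cmod c"])
  show "c *\<^sub>C (r *\<^sub>R x) = r *\<^sub>R (c *\<^sub>C x)" for r and x :: 'a
    by (simp flip: scaleC_of_real add: scaleC_scaleC mult.commute)
qed (simp_all add: scaleC_add_right norm_scaleC mult.commute)

definition scaleC_op :: "complex \<Rightarrow> 'a::complex_hilbert \<Rightarrow>\<^sub>L 'a" where
  "scaleC_op c = Blinfun (\<lambda>x. c *\<^sub>C x)"

lemma scaleC_op_apply [simp]: "scaleC_op c x = c *\<^sub>C x"
  by (simp add: scaleC_op_def bounded_linear_Blinfun_apply bounded_linear_scaleC)

lemma clinear_iff: "clinear_blinfun B \<longleftrightarrow> (\<forall>c. commutes (scaleC_op c) B)"
  by (auto simp: clinear_blinfun_def commutes_iff)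

lemma clinearD: "clinear_blinfun B \<Longrightarrow> B (c *\<^sub>C x) = c *\<^sub>C B x"
  by (simp add: clinear_blinfun_def)

lemma selfadjoint_scaleC:
  assumes "selfadjoint T" and "(x, y) \<in> T" shows "(c *\<^sub>C x, c *\<^sub>C y) \<in> T"
  using complex_vector.subspace_scale[of T "(x, y)" c] assms
  by (simp add: selfadjoint_def is_operator_def scaleC_prod_def)

lemma selfadjoint_sa:
  fixes T :: "'a::complex_hilbert op"
  assumes T: "selfadjoint T" shows "sa T"
  unfolding sa_def
proof (intro conjI allI iffI)
  show "closure (Domain T) = UNIV" using T by (simp add: selfadjoint_def)
  have adj: "(y, z) \<in> T \<longleftrightarrow> (\<forall>(x, w)\<in>T. cinner w y = cinner x z)" for y z
    using T unfolding selfadjoint_def adjoint_op_def by blast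
  fix y z
  { assume "(y, z) \<in> T"
    then show "\<forall>(x, w)\<in>T. inner w y = inner x z" unfolding adj Re_cinner[symmetric] by auto }
  { assume *: "\<forall>(x, w)\<in>T. inner w y = inner x z"
    show "(y, z) \<in> T" unfolding adj
    proof (intro ballI, clarify)
      fix x w assume xw: "(x, w) \<in> T"
      show "cinner w y = cinner x z"
        using * xw selfadjoint_scaleC[OF T xw, of \<i>] by (intro cinner_eqI) auto
    qed }
qed

lemma sa_selfadjoint:
  fixes T :: "'a::complex_hilbert op"
  assumes T: "sa T" and C: "\<And>c. comm_op (scaleC_op c) T" shows "selfadjoint T"
  unfolding selfadjoint_def is_operator_def adjoint_op_def
proof (intro conjI)
  have sc: "(c *\<^sub>C x, c *\<^sub>C y) \<in> T" if "(x, y) \<in> T" for c x y using comm_opD[OF C that] by simp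
  show "complex_vector.subspace T" unfolding complex_vector.subspace_def
    using subspace_0[OF sa_subspace[OF T]] subspace_add[OF sa_subspace[OF T]] sc by (auto simp: scaleC_prod_def)
  show "single_valued T" using sa_single[OF T] by (auto simp: single_valued_def)
  show "closure (Domain T) = UNIV" by (rule sa_dense[OF T])
  show "{(y, z). \<forall>(x, w)\<in>T. cinner w y = cinner x z} = T"
  proof (intro set_eqI iffI; clarify)
    fix y z assume "\<forall>(x, w)\<in>T. cinner w y = cinner x z"
    then show "(y, z) \<in> T" by (intro sa_memI[OF T]) (auto simp flip: Re_cinner)
  next
    fix y z x w assume "(y, z) \<in> T" "(x, w) \<in> T"
    then show "cinner w y = cinner x z" using sa_sym[OF T] sc[of x w \<i>] by (intro cinner_eqI) auto
  qed
qed

lemma selfadjoint_comm_scaleC: "selfadjoint T \<Longrightarrow> comm_op (scaleC_op c) T"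
  by (simp add: comm_op_def selfadjoint_scaleC)

lemma is_orth_projection_iff:
  "is_orth_projection P \<longleftrightarrow> is_proj P \<and> clinear_blinfun P"
proof
  assume P: "is_orth_projection P"
  then have 1: "is_proj P" unfolding is_orth_projection_def is_proj_def
    by (metis Re_cinner blinfun_apply_blinfun_compose)
  have "P (c *\<^sub>C x) - c *\<^sub>C P x = 0" for c x
  proof -
    have s: "cinner (P u) v = cinner u (P v)" for u v using P by (simp add: is_orth_projection_def)
    have "cinner (P (c *\<^sub>C x)) y = cinner (c *\<^sub>C P x) y" for y
      by (simp add: s cinner_scaleC_left)
    then have "inner (P (c *\<^sub>C x)) y = inner (c *\<^sub>C P x) y" for y by (metis Re_cinner)
    then show ?thesis using inner_eq_all_eq[of "P (c *\<^sub>C x)" "c *\<^sub>C P x"] by simp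
  qed
  then show "is_proj P \<and> clinear_blinfun P" using 1 by (simp add: clinear_blinfun_def)
next
  assume P: "is_proj P \<and> clinear_blinfun P"
  then show "is_orth_projection P" unfolding is_orth_projection_def
    by (auto intro!: blinfun_eqI cinner_eqI simp: is_proj_idem is_proj_sym simp flip: clinearD)
qed

lemma Re_cinner_fun: "spectral_measure E x = form_measure E x"
  by (simp add: spectral_measure_def form_measure_def Re_cinner)

lemma cinner_selfadjoint_real:
  assumes T: "selfadjoint T" and "(x, y) \<in> T" shows "cinner y x = complex_of_real (inner y x)"
proof -
  have "cinner y x = cinner x y"
    using selfadjoint_sa[OF T] sa_sym[of T] assms selfadjoint_scaleC[OF T assms(2), of \<i>] by (intro cinner_eqI) auto
  then have "Im (cinner y x) = 0" using cinner_commute[of y x] by (simp add: complex_eq_iff)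
  then show ?thesis by (simp add: complex_eq_iff Re_cinner)
qed

lemma spectral_family_eq:
  fixes T :: "'a::complex_hilbert op"
  assumes T: "selfadjoint T"
  shows "spectral_family T = Eproj T"
  unfolding spectral_family_def
proof (rule the_equality)
  note S = selfadjoint_sa[OF T]
  have "clinear_blinfun (Eproj T t)" for t
    unfolding clinear_iff using Eproj_commutes[OF S selfadjoint_comm_scaleC[OF T]] by blast
  moreover have "Domain T = {x. integrable (form_measure (Eproj T) x) (\<lambda>t. t\<^sup>2)}"
    using spectral_representation(1)[OF S] by blast
  moreover have "\<forall>(x, y)\<in>T. cinner y x = complex_of_real (LINT t|form_measure (Eproj T) x. t)"
    using cinner_selfadjoint_real[OF T] spectral_representation(2)[OF S] by fastforce
  ultimately show "resolution_of_identity T (Eproj T)"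
    using proj_family_Eproj[OF S]
    unfolding resolution_of_identity_def proj_family_def is_orth_projection_iff Re_cinner_fun by blast
next
  note S = selfadjoint_sa[OF T]
  fix E assume R: "resolution_of_identity T E"
  show "E = Eproj T"
  proof (rule resolution_unique[OF S])
    show "proj_family E" using R
      unfolding resolution_of_identity_def proj_family_def is_orth_projection_iff by blast
    show "x \<in> Domain T \<longleftrightarrow> integrable (form_measure E x) (\<lambda>t. t\<^sup>2)" for x
      using R unfolding resolution_of_identity_def Re_cinner_fun by blast
    show "inner y x = (LINT t|form_measure E x. t)" if "(x, y) \<in> T" for x y
    proof -
      have "cinner y x = complex_of_real (LINT t|form_measure E x. t)"
        using R that unfolding resolution_of_identity_def Re_cinner_fun by blast
      then show ?thesis by (metis Re_cinner Re_complex_of_real)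
    qed
  qed
qed

lemma spectral_proj_eq:
  assumes T: "selfadjoint T"
  shows "spectral_proj T a b = blinfun_apply (Eproj T b - Lproj T a)"
proof
  fix x
  have "Lim (at_left a) (\<lambda>t. Eproj T t x) = Lproj T a x"
    by (rule tendsto_Lim[OF _ Lproj_tendsto[OF selfadjoint_sa[OF T]]]) simp
  then show "spectral_proj T a b x = (Eproj T b - Lproj T a) x"
    by (simp add: spectral_proj_def spectral_family_eq[OF T] blinfun.bilinear_simps)
qed

section \<open>Complex dimensions\<close>

lemma clinear_module_hom: "clinear_blinfun B \<Longrightarrow> module_hom scaleC scaleC (blinfun_apply B)"
  unfolding module_hom_iff
  by (simp add: complex_vector.module_axioms blinfun.bilinear_simps clinearD)

lemma clinear_subspace_range: "clinear_blinfun B \<Longrightarrow> complex_vector.subspace (range (blinfun_apply B))"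
  using module_hom.subspace_image[OF clinear_module_hom complex_vector.subspace_UNIV] .

lemma clinear_diff: "clinear_blinfun A \<Longrightarrow> clinear_blinfun B \<Longrightarrow> clinear_blinfun (A - B)"
  by (simp add: clinear_blinfun_def blinfun.bilinear_simps complex_vector.scale_right_diff_distrib)

lemma fin_dim_subset: "fin_dim W \<Longrightarrow> V \<subseteq> W \<Longrightarrow> fin_dim V"
  unfolding fin_dim_def by blast

lemma fin_dim_basis:
  assumes "fin_dim W"
  obtains B where "finite B" "B \<subseteq> W" "complex_vector.independent B" "W \<subseteq> complex_vector.span B"
    "card B = complex_vector.dim W"
proof -
  obtain F where F: "finite F" "W \<subseteq> complex_vector.span F" using assms by (auto simp: fin_dim_def)
  obtain B where B: "B \<subseteq> W" "complex_vector.independent B" "W \<subseteq> complex_vector.span B" "card B = complex_vector.dim W"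
    using complex_vector.basis_exists by blast
  have "finite B" using complex_vector.independent_span_bound[OF F(1) B(2)] B(1) F(2) by blast
  then show ?thesis using that B by blast
qed

lemma fin_dim_sum:
  assumes "fin_dim A" "fin_dim B" "\<And>x. x \<in> V \<Longrightarrow> \<exists>a\<in>A. \<exists>b\<in>B. x = a + b" shows "fin_dim V"
proof -
  obtain F G where FG: "finite F" "A \<subseteq> complex_vector.span F" "finite G" "B \<subseteq> complex_vector.span G"
    using assms by (auto simp: fin_dim_def)
  have "V \<subseteq> complex_vector.span (F \<union> G)"
  proof
    fix x assume "x \<in> V"
    then obtain a b where ab: "a \<in> A" "b \<in> B" "x = a + b" using assms(3) by blast
    have "complex_vector.span F \<subseteq> complex_vector.span (F \<union> G)" "complex_vector.span G \<subseteq> complex_vector.span (F \<union> G)"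
      by (intro complex_vector.span_mono; blast)+
    then show "x \<in> complex_vector.span (F \<union> G)"
      unfolding ab(3) using ab FG by (intro complex_vector.span_add) blast+
  qed
  then show ?thesis unfolding fin_dim_def using FG by blast
qed

lemma fin_dim_inj:
  assumes f: "clinear_blinfun f" and V: "complex_vector.subspace V" and W: "fin_dim W"
    and fV: "\<And>x. x \<in> V \<Longrightarrow> f x \<in> W" and inj: "\<And>x. x \<in> V \<Longrightarrow> f x = 0 \<Longrightarrow> x = 0"
  shows "fin_dim V" "complex_vector.dim V \<le> complex_vector.dim W"
proof -
  obtain C where C: "finite C" "W \<subseteq> complex_vector.span C" "card C = complex_vector.dim W"
    by (rule fin_dim_basis[OF W])
  obtain B where B: "B \<subseteq> V" "complex_vector.independent B" "V \<subseteq> complex_vector.span B" "card B = complex_vector.dim V"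
    using complex_vector.basis_exists by blast
  have "complex_vector.span B \<subseteq> V" by (rule complex_vector.span_minimal[OF B(1) V])
  then have in0: "x \<in> complex_vector.span B \<Longrightarrow> f x = 0 \<Longrightarrow> x = 0" for x using inj by blast
  have injf: "inj_on f (complex_vector.span B)"
  proof (rule inj_onI)
    fix x y assume xy: "x \<in> complex_vector.span B" "y \<in> complex_vector.span B" "f x = f y"
    have "x - y = 0" by (rule in0) (use xy in \<open>auto simp: complex_vector.span_diff blinfun.bilinear_simps\<close>)
    then show "x = y" by simp
  qed
  have "complex_vector.independent (f ` B)"
    by (rule module_hom.independent_injective_image[OF clinear_module_hom[OF f] B(2) injf])
  moreover have "f ` B \<subseteq> complex_vector.span C" using B(1) fV C(2) by blast
  ultimately have fB: "finite (f ` B)" "card (f ` B) \<le> card C"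
    using complex_vector.independent_span_bound[OF C(1)] by blast+
  have injB: "inj_on f B" by (rule inj_on_subset[OF injf complex_vector.span_superset])
  then have "finite B" using fB(1) finite_imageD by blast
  then show "fin_dim V" unfolding fin_dim_def using B(3) by blast
  show "complex_vector.dim V \<le> complex_vector.dim W"
    using fB(2) card_image[OF injB] B(4) C(3) by simp
qed

text \<open>A nonzero x with Q x = x and P x = 0 would satisfy |x| = |(P - Q) x| < |x|; so P is
  injective on the range of Q.\<close>

lemma fin_dim_near_proj:
  assumes P: "is_proj P" "clinear_blinfun P" and Q: "is_proj Q" "clinear_blinfun Q"
    and near: "norm (P - Q) < 1" and fin: "fin_dim (range (blinfun_apply P))"
  shows "fin_dim (range (blinfun_apply Q))"
    "complex_vector.dim (range (blinfun_apply Q)) \<le> complex_vector.dim (range (blinfun_apply P))"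
proof -
  have inj: "x = 0" if "x \<in> range (blinfun_apply Q)" "P x = 0" for x
  proof (rule ccontr)
    assume x: "x \<noteq> 0"
    have "Q x = x" using that is_proj_range[OF Q(1)] by blast
    then have "norm x = norm ((P - Q) x)" using that by (simp add: blinfun.bilinear_simps)
    also have "\<dots> \<le> norm (P - Q) * norm x" by (rule norm_blinfun)
    also have "\<dots> < norm x" using near x by simp
    finally show False by simp
  qed
  show "fin_dim (range (blinfun_apply Q))"
    by (rule fin_dim_inj(1)[OF P(2) clinear_subspace_range[OF Q(2)] fin rangeI inj])
  show "complex_vector.dim (range (blinfun_apply Q)) \<le> complex_vector.dim (range (blinfun_apply P))"
    by (rule fin_dim_inj(2)[OF P(2) clinear_subspace_range[OF Q(2)] fin rangeI inj])
qed

lemma dim_orthogonal_sum: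
  assumes P: "is_proj P" "clinear_blinfun P" and Q: "is_proj Q" "clinear_blinfun Q"
    and PQ: "\<And>x. P (Q x) = 0" "\<And>x. Q (P x) = 0"
    and fin: "fin_dim (range (blinfun_apply P))" "fin_dim (range (blinfun_apply Q))"
  shows "complex_vector.dim (range (blinfun_apply (P + Q))) =
    complex_vector.dim (range (blinfun_apply P)) + complex_vector.dim (range (blinfun_apply Q))"
proof -
  obtain B where B: "finite B" "B \<subseteq> range (blinfun_apply P)" "complex_vector.independent B"
    "range (blinfun_apply P) \<subseteq> complex_vector.span B" "card B = complex_vector.dim (range (blinfun_apply P))"
    using fin_dim_basis[OF fin(1)] by blast
  obtain C where C: "finite C" "C \<subseteq> range (blinfun_apply Q)" "complex_vector.independent C"
    "range (blinfun_apply Q) \<subseteq> complex_vector.span C" "card C = complex_vector.dim (range (blinfun_apply Q))"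
    using fin_dim_basis[OF fin(2)] by blast
  have PB: "P b = b" "Q b = 0" if "b \<in> B" for b
    using B(2) that PQ(2) is_proj_range[OF P(1)] by (metis subsetD)+
  have QC: "Q c = c" "P c = 0" if "c \<in> C" for c
    using C(2) that PQ(1) is_proj_range[OF Q(1)] by (metis subsetD)+
  have 0: "0 \<notin> B" using B(3) complex_vector.dependent_zero by blast
  have disj: "B \<inter> C = {}" using PB QC 0 by fastforce
  \<comment> \<open>P' fixes B' and annihilates C', so applying it to a linear relation in the union
    leaves a relation within B'. It is used once for each of the two projections.\<close>
  have ind1: "a \<notin> complex_vector.span ((B' \<union> C') - {a})"
    if P': "clinear_blinfun P'" and PB': "\<And>b. b \<in> B' \<Longrightarrow> P' b = b" and PC': "\<And>c. c \<in> C' \<Longrightarrow> P' c = 0"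
      and ind: "complex_vector.independent B'" and a: "a \<in> B'" for a B' C' and P' :: "'a \<Rightarrow>\<^sub>L 'a"
  proof
    assume "a \<in> complex_vector.span ((B' \<union> C') - {a})"
    then have "P' a \<in> P' ` complex_vector.span ((B' \<union> C') - {a})" by blast
    then have "a \<in> complex_vector.span (P' ` ((B' \<union> C') - {a}))"
      using module_hom.span_image[OF clinear_module_hom[OF P']] PB'[OF a] by metis
    also have "\<dots> \<subseteq> complex_vector.span (insert 0 (B' - {a}))"
      by (rule complex_vector.span_mono) (use PB' PC' in auto)
    also have "\<dots> = complex_vector.span (B' - {a})" by simp
    finally show False using ind a unfolding complex_vector.dependent_def by blast
  qed
  have ind: "complex_vector.independent (B \<union> C)"
    unfolding complex_vector.dependent_def
  proof
    assume "\<exists>a\<in>B \<union> C. a \<in> complex_vector.span (B \<union> C - {a})"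
    then obtain a where a: "a \<in> B \<union> C" "a \<in> complex_vector.span (B \<union> C - {a})" by blast
    show False
      using a ind1[where a = a and C' = C, OF P(2) PB(1) QC(2) B(3)] ind1[where a = a and C' = B, OF Q(2) QC(1) PB(2) C(3)]
      by (auto simp: Un_commute)
  qed
  show ?thesis
  proof (rule complex_vector.dim_unique[OF _ _ ind])
    have "(P + Q) b = b" if "b \<in> B \<union> C" for b using that PB QC by (auto simp: blinfun.bilinear_simps)
    then show "B \<union> C \<subseteq> range (blinfun_apply (P + Q))" by (metis rangeI subsetI)
    show "range (blinfun_apply (P + Q)) \<subseteq> complex_vector.span (B \<union> C)"
    proof clarify
      fix x
      have "P x \<in> complex_vector.span (B \<union> C)" "Q x \<in> complex_vector.span (B \<union> C)"
        using B(4) C(4) complex_vector.span_mono[of B "B \<union> C"] complex_vector.span_mono[of C "B \<union> C"] by blast+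
      then show "(P + Q) x \<in> complex_vector.span (B \<union> C)"
        by (simp add: blinfun.bilinear_simps complex_vector.span_add)
    qed
    show "card (B \<union> C) = complex_vector.dim (range (blinfun_apply P)) + complex_vector.dim (range (blinfun_apply Q))"
      using card_Un_disjoint[OF B(1) C(1) disj] B(5) C(5) by simp
  qed
qed

lemma cinner_add_right: "cinner (z::'a::complex_hilbert) (x + y) = cinner z x + cinner z y"
  by (metis cinner_add_left cinner_commute complex_cnj_add)

lemma cinner_scaleC_right: "cinner (z::'a::complex_hilbert) (c *\<^sub>C x) = cnj c * cinner z x"
  by (metis cinner_scaleC_left cinner_commute complex_cnj_mult)

text \<open>Each functional <., b> cuts the dimension by at most one, and jointly they separate the
  points of V.\<close>

lemma fin_dim_orthogonal:
  assumes "finite B" "complex_vector.subspace V" "\<And>x. x \<in> V \<Longrightarrow> (\<And>b. b \<in> B \<Longrightarrow> cinner x b = 0) \<Longrightarrow> x = 0"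
  shows "fin_dim (V :: 'a::complex_hilbert set)"
  using assms
proof (induction B arbitrary: V)
  case empty
  then have "V \<subseteq> {0}" by blast
  then show ?case unfolding fin_dim_def by (intro exI[of _ "{0}"]) (auto simp: complex_vector.span_base)
next
  case (insert b B)
  define V' where "V' = {x \<in> V. cinner x b = 0}"
  have sub: "complex_vector.subspace V'"
  proof -
    have "cinner 0 b = 0" using cinner_add_left[of 0 0 b] by simp
    then show ?thesis using insert.prems(1) unfolding V'_def complex_vector.subspace_def
      by (auto simp: cinner_add_left cinner_scaleC_left)
  qed
  have "fin_dim V'"
  proof (rule insert.IH[OF sub])
    fix x assume "x \<in> V'" "\<And>b. b \<in> B \<Longrightarrow> cinner x b = 0"
    then show "x = 0" using insert.prems(2)[of x] by (auto simp: V'_def)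
  qed
  then obtain F where F: "finite F" "V' \<subseteq> complex_vector.span F" by (auto simp: fin_dim_def)
  show ?case
  proof (cases "V' = V")
    case False
    then obtain w where w: "w \<in> V" "cinner w b \<noteq> 0" by (auto simp: V'_def)
    have "V \<subseteq> complex_vector.span (insert w F)"
    proof
      fix x assume x: "x \<in> V"
      define c where "c = cinner x b / cinner w b"
      have xm: "x - c *\<^sub>C w = x + (- c) *\<^sub>C w" by (simp add: complex_vector.scale_minus_left)
      have "cinner (x - c *\<^sub>C w) b = 0"
        unfolding xm cinner_add_left cinner_scaleC_left using w(2) by (simp add: c_def)
      moreover have "x - c *\<^sub>C w \<in> V"
        using x w insert.prems(1) by (simp add: complex_vector.subspace_diff complex_vector.subspace_scale)
      ultimately have "x - c *\<^sub>C w \<in> V'" by (simp add: V'_def)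
      then have "x - c *\<^sub>C w \<in> complex_vector.span F" using F by blast
      then show "x \<in> complex_vector.span (insert w F)" unfolding complex_vector.span_insert by blast
    qed
    then show ?thesis unfolding fin_dim_def using F(1) by blast
  qed (use \<open>fin_dim V'\<close> in simp)
qed

section \<open>Spectrum and essential spectrum\<close>

lemma plus_scalar_of_real: "plus_scalar T (complex_of_real r) = shift_op T r"
  by (auto simp: plus_scalar_def shift_op_def scaleC_of_real)

lemma plus_scalar_minus_of_real: "plus_scalar T (- complex_of_real r) = shift_op T (- r)"
  using plus_scalar_of_real[of T "- r"] by simp

lemma all_shift_op:
  "(\<forall>x y. (x, y) \<in> shift_op T r \<longrightarrow> Q x y) \<longleftrightarrow> (\<forall>x y. (x, y) \<in> T \<longrightarrow> Q x (y + r *\<^sub>R x))"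
  unfolding mem_shift_op by (metis add_diff_cancel_right' diff_add_cancel)

lemma selfadjoint_shift: "selfadjoint T \<Longrightarrow> selfadjoint (shift_op T r)"
  by (rule sa_selfadjoint[OF sa_shift_op[OF selfadjoint_sa]]) (simp_all add: comm_op_shift selfadjoint_comm_scaleC)

lemma scaleC_scaleR: "c *\<^sub>C (r *\<^sub>R x) = r *\<^sub>R (c *\<^sub>C (x::'a::complex_hilbert))"
  by (simp flip: scaleC_of_real add: scaleC_scaleC mult.commute)

lemma clinear_if_commutes:
  assumes T: "selfadjoint T" and "\<And>B. comm_op B T \<Longrightarrow> commutes B P" shows "clinear_blinfun P"
  unfolding clinear_iff using assms selfadjoint_comm_scaleC by blast

lemma clinear_Eproj: "selfadjoint T \<Longrightarrow> clinear_blinfun (Eproj T t)"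
  and clinear_Lproj: "selfadjoint T \<Longrightarrow> clinear_blinfun (Lproj T t)"
  by (auto intro!: clinear_if_commutes[of T] Eproj_commutes Lproj_commutes selfadjoint_sa)

text \<open>Being bounded below, T has closed range on the kernel of P. A vector of that kernel
  orthogonal to this range is a null vector of T by selfadjointness, and the lower bound makes it 0.
  The choice P = 0 gives invertibility of T.\<close>

lemma reduced_surjective:
  assumes T: "sa T" and P: "is_proj P" "comm_op P T" and k: "k > 0"
    and bd: "\<And>x y. (x, y) \<in> T \<Longrightarrow> P x = 0 \<Longrightarrow> k * norm x \<le> norm y" and Py: "P y = 0"
  shows "\<exists>x. P x = 0 \<and> (x, y) \<in> T"
proof -
  define R where "R = {y. \<exists>x. P x = 0 \<and> (x, y) \<in> T}"
  have RP: "P y = 0" if "y \<in> R" for y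
    using that comm_opD[OF P(2)] sa_single[OF T _ sa_0[OF T]] unfolding R_def by fastforce
  have sub: "subspace R" unfolding subspace_def
  proof (intro conjI ballI allI)
    show "0 \<in> R" using sa_0[OF T] by (auto simp: R_def intro!: exI[of _ 0])
    fix u v assume "u \<in> R" "v \<in> R"
    then obtain a b where "P a = 0" "(a, u) \<in> T" "P b = 0" "(b, v) \<in> T" by (auto simp: R_def)
    then show "u + v \<in> R" unfolding R_def using sa_add[OF T] by (auto intro!: exI[of _ "a + b"] simp: blinfun.bilinear_simps)
  next
    fix c u assume "u \<in> R"
    then obtain a where "P a = 0" "(a, u) \<in> T" by (auto simp: R_def)
    then show "c *\<^sub>R u \<in> R" unfolding R_def using sa_scale[OF T] by (auto intro!: exI[of _ "c *\<^sub>R a"] simp: blinfun.bilinear_simps)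
  qed
  have clo: "closed R" unfolding closed_sequential_limits
  proof (intro allI impI)
    fix s l assume s: "(\<forall>n. s n \<in> R) \<and> s \<longlonglongrightarrow> l"
    then have "\<forall>n. \<exists>a. P a = 0 \<and> (a, s n) \<in> T" by (auto simp: R_def)
    then obtain a where a: "\<And>n. P (a n) = 0" "\<And>n. (a n, s n) \<in> T" by metis
    have le: "norm (a m - a n) \<le> norm (s m - s n) / k" for m n
      using bd[OF sa_diff[OF T a(2)[of m] a(2)[of n]]] k by (simp add: blinfun.bilinear_simps a(1) field_simps)
    have "Cauchy a"
    proof (rule metric_CauchyI)
      fix e :: real assume "e > 0"
      then have "e * k > 0" using k by simp
      then obtain N where N: "\<And>m n. m \<ge> N \<Longrightarrow> n \<ge> N \<Longrightarrow> dist (s m) (s n) < e * k"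
        using LIMSEQ_imp_Cauchy s by (meson metric_CauchyD)
      have "dist (a m) (a n) < e" if "m \<ge> N" "n \<ge> N" for m n
        using le[of m n] N[OF that] k by (simp add: dist_norm pos_divide_less_eq le_less_trans)
      then show "\<exists>N. \<forall>m\<ge>N. \<forall>n\<ge>N. dist (a m) (a n) < e" by blast
    qed
    then obtain x where x: "a \<longlonglongrightarrow> x" using Cauchy_convergent convergent_def by blast
    have "(x, l) \<in> T" by (rule sa_limit[OF T _ _ x]) (use a s in auto)
    moreover have "(\<lambda>n. P (a n)) \<longlonglongrightarrow> P x" by (intro tendsto_intros x)
    then have "P x = 0" using a(1) by (simp add: LIMSEQ_const_iff)
    ultimately show "l \<in> R" by (auto simp: R_def)
  qed
  obtain Q where Q: "is_proj Q" "range (blinfun_apply Q) = R" "\<And>x v. v \<in> R \<Longrightarrow> inner (x - Q x) v = 0"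
    using proj_exists[OF clo sub] by blast
  define z where "z = y - Q y"
  have "Q y \<in> R" using Q(2) by blast
  then have Pz: "P z = 0" by (simp add: z_def blinfun.bilinear_simps Py RP)
  \<comment> \<open>\<open>z\<close> is orthogonal to the range of T on the kernel of P by
    construction and to the range of P because P z = 0; so the adjoint relation holds with value
    0.\<close>
  have "(z, 0) \<in> T"
  proof (rule sa_memI[OF T])
    fix x w assume xw: "(x, w) \<in> T"
    have "(x - P x, w - P w) \<in> T" by (rule sa_diff[OF T xw comm_opD[OF P(2) xw]])
    moreover have "P (x - P x) = 0" by (simp add: blinfun.bilinear_simps is_proj_idem[OF P(1)])
    ultimately have "w - P w \<in> R" by (auto simp: R_def)
    then have "inner z (w - P w) = 0" unfolding z_def by (rule Q(3))
    then show "inner w z = inner x 0"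
      using is_proj_sym[OF P(1), of z w] by (simp add: Pz inner_diff_right inner_commute)
  qed
  then have "z = 0" using bd[of z 0] Pz k by (simp add: mult_le_0_iff)
  then have "y \<in> R" using \<open>Q y \<in> R\<close> by (simp add: z_def)
  then show ?thesis by (simp add: R_def)
qed

text \<open>A lower bound alone suffices: surjectivity is automatic for a selfadjoint operator by
  \<open>reduced_surjective\<close>.\<close>

lemma invertible_op_iff:
  fixes T :: "'a::complex_hilbert op"
  assumes T: "selfadjoint T"
  shows "invertible_op T \<longleftrightarrow> (\<exists>k>0. \<forall>x y. (x, y) \<in> T \<longrightarrow> k * norm x \<le> norm y)"
proof
  assume "invertible_op T"
  then obtain B where B: "T\<inverse> = op_of B" by (auto simp: invertible_op_def bounded_op_def)
  have "1 / (norm B + 1) * norm x \<le> norm y" if "(x, y) \<in> T" for x y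
  proof -
    have "(y, x) \<in> op_of B" using that B by blast
    then have "norm x \<le> norm B * norm y" using norm_blinfun[of B y] by (simp add: op_of_def)
    also have "\<dots> \<le> (norm B + 1) * norm y" by (simp add: distrib_right)
    finally show ?thesis by (simp add: divide_le_eq mult.commute add_nonneg_pos)
  qed
  then show "\<exists>k>0. \<forall>x y. (x, y) \<in> T \<longrightarrow> k * norm x \<le> norm y"
    by (intro exI[of _ "1 / (norm B + 1)"]) (auto simp: add_nonneg_pos)
next
  note S = selfadjoint_sa[OF T]
  assume "\<exists>k>0. \<forall>x y. (x, y) \<in> T \<longrightarrow> k * norm x \<le> norm y"
  then obtain k where k: "k > 0" "\<And>x y. (x, y) \<in> T \<Longrightarrow> k * norm x \<le> norm y" by blast
  have "is_proj (0 :: 'a \<Rightarrow>\<^sub>L 'a)" "comm_op 0 T" using sa_0[OF S] by (simp_all add: is_proj_def comm_op_def)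
  then have "\<exists>x. (x, y) \<in> T" for y using reduced_surjective[OF S _ _ k(1), of 0 y] k(2) by simp
  then obtain g where g: "\<And>y. (g y, y) \<in> T" by metis
  have uq: "x = g y" if "(x, y) \<in> T" for x y
    using k(2)[OF sa_diff[OF S that g[of y]]] k(1) by (simp add: mult_le_0_iff)
  have "bounded_linear g"
  proof (rule bounded_linear_intro[of _ "1 / k"])
    show "g (x + y) = g x + g y" for x y by (rule uq[symmetric]) (rule sa_add[OF S g g])
    show "g (r *\<^sub>R x) = r *\<^sub>R g x" for r x by (rule uq[symmetric]) (rule sa_scale[OF S g])
    show "norm (g x) \<le> norm x * (1 / k)" for x using k(2)[OF g, of x] k(1) by (simp add: field_simps)
  qed
  then have ap: "blinfun_apply (Blinfun g) = g" by (rule bounded_linear_Blinfun_apply)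
  have "clinear_blinfun (Blinfun g)"
    unfolding clinear_blinfun_def ap using uq[OF selfadjoint_scaleC[OF T g]] by simp
  moreover have "T\<inverse> = op_of (Blinfun g)" unfolding op_of_def ap using g uq by auto
  ultimately show "invertible_op T" unfolding invertible_op_def bounded_op_def by blast
qed

section \<open>Real resolvent points and empty spectral windows\<close>

definition resolv :: "('a::{real_inner,banach} \<times> 'a) set \<Rightarrow> real \<Rightarrow> bool" where
  "resolv T c \<longleftrightarrow> (\<exists>k>0. \<forall>x y. (x, y) \<in> T \<longrightarrow> k * norm x \<le> norm (y - c *\<^sub>R x))"

lemma op_spectrum_of_real:
  assumes T: "selfadjoint T" shows "complex_of_real c \<in> op_spectrum T \<longleftrightarrow> \<not> resolv T c"
  unfolding op_spectrum_def mem_Collect_eq plus_scalar_minus_of_real invertible_op_iff[OF selfadjoint_shift[OF T]] resolv_def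
    all_shift_op by simp

lemma invertible_op_resolv: "selfadjoint T \<Longrightarrow> invertible_op T \<longleftrightarrow> resolv T 0"
  by (simp add: invertible_op_iff resolv_def)

lemma resolv_shift: "resolv (shift_op T r) c \<longleftrightarrow> resolv T (c - r)"
proof -
  have eq: "y + r *\<^sub>R x - c *\<^sub>R x = y - (c - r) *\<^sub>R x" for x y :: 'a by (simp add: scaleR_diff_left)
  show ?thesis by (simp only: resolv_def all_shift_op eq)
qed

text \<open>For z = u + i v with v nonzero, R = (T - u) / v is selfadjoint and (R - i)^-1 = (R +
  i)(1 + R^2)^-1 = D + i C with the operators C, D of R. As T - z = v (R - i), its inverse is (D + i
  C) / v.\<close>

lemma op_spectrum_real:
  fixes T :: "'a::complex_hilbert op"
  assumes T: "selfadjoint T" and z: "z \<in> op_spectrum T" shows "Im z = 0"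
proof (rule ccontr)
  assume v: "Im z \<noteq> 0"
  note S = selfadjoint_sa[OF T]
  define u where "u = Re z"
  define v where "v = Im z"
  define R where "R = {(x, (1 / v) *\<^sub>R (y - u *\<^sub>R x)) |x y. (x, y) \<in> T}"
  have v0: "v \<noteq> 0" using \<open>Im z \<noteq> 0\<close> by (simp add: v_def)
  have memR: "(x, y) \<in> R \<longleftrightarrow> (x, v *\<^sub>R y + u *\<^sub>R x) \<in> T" for x y
    using v0 unfolding R_def by (auto intro!: exI[of _ "v *\<^sub>R y + u *\<^sub>R x"])
  have saR: "sa R" unfolding sa_def
  proof (intro conjI allI iffI)
    have "Domain R = Domain T" by (auto simp: R_def)
    then show "closure (Domain R) = UNIV" using sa_dense[OF S] by simp
    fix y w
    { assume "(y, w) \<in> R"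
      then show "\<forall>(x, q)\<in>R. inner q y = inner x w"
        using sa_sym[OF S] v0 unfolding memR by (fastforce simp: memR inner_add_left inner_add_right) }
    { assume *: "\<forall>(x, q)\<in>R. inner q y = inner x w"
      show "(y, w) \<in> R" unfolding memR
      proof (rule sa_memI[OF S])
        fix x q assume "(x, q) \<in> T"
        then have "(x, (1 / v) *\<^sub>R (q - u *\<^sub>R x)) \<in> R" by (auto simp: R_def)
        then have "inner ((1 / v) *\<^sub>R (q - u *\<^sub>R x)) y = inner x w" using * by blast
        then show "inner q y = inner x (v *\<^sub>R w + u *\<^sub>R y)"
          using v0 by (simp add: inner_diff_left inner_add_right field_simps)
      qed }
  qed
  have CT: "comm_op (scaleC_op c) R" for c
    unfolding comm_op_def memR
  proof (intro allI impI)
    fix x y assume "(x, v *\<^sub>R y + u *\<^sub>R x) \<in> T"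
    from selfadjoint_scaleC[OF T this, of c]
    show "(scaleC_op c x, v *\<^sub>R scaleC_op c y + u *\<^sub>R scaleC_op c x) \<in> T"
      by (simp add: scaleC_add_right scaleC_scaleR)
  qed
  define B where "B = (1 / v) *\<^sub>R (Dop R + (scaleC_op \<i> o\<^sub>L Cop R))"
  have Bx: "B x = (1 / v) *\<^sub>R (Dop R x + \<i> *\<^sub>C Cop R x)" for x by (simp add: B_def blinfun.bilinear_simps)
  have ii: "\<i> *\<^sub>C (\<i> *\<^sub>C x) = - (x::'a)" for x
    by (simp add: scaleC_scaleC complex_vector.scale_minus_left)
  note sc = scaleC_scaleR
  have sm: "c *\<^sub>C (x - y) = c *\<^sub>C x - c *\<^sub>C y" for c and x y :: 'a
    by (simp add: complex_vector.scale_right_diff_distrib)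
  have zx: "z *\<^sub>C x = u *\<^sub>R x + v *\<^sub>R (\<i> *\<^sub>C x)" for x :: 'a
  proof -
    have "z = complex_of_real u + complex_of_real v * \<i>" by (simp add: u_def v_def complex_eq_iff)
    then show ?thesis by (simp only: scaleC_add_left scaleC_of_real flip: scaleC_scaleC)
  qed
  have "(plus_scalar T (- z))\<inverse> = op_of B"
  proof (intro set_eqI iffI; clarify)
    fix p q assume "(q, p) \<in> plus_scalar T (- z)"
    then obtain y where y: "(q, y) \<in> T" "p = y - (u *\<^sub>R q + v *\<^sub>R (\<i> *\<^sub>C q))"
      by (auto simp: plus_scalar_def zx)
    define w where "w = (1 / v) *\<^sub>R (y - u *\<^sub>R q)"
    have w: "(q, w) \<in> R" using y by (auto simp: R_def w_def)
    have p: "p = v *\<^sub>R (w - \<i> *\<^sub>C q)" using v0 by (simp add: y w_def scaleR_diff_right)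
    have CJ: "Cop R (\<i> *\<^sub>C q) = \<i> *\<^sub>C Cop R q" "Dop R (\<i> *\<^sub>C q) = \<i> *\<^sub>C Dop R q"
      using commutesD[OF Cop_commutes[OF saR CT[of \<i>]], of q] commutesD[OF Dop_commutes[OF saR CT[of \<i>]], of q] by simp_all
    have "B p = Dop R (w - \<i> *\<^sub>C q) + \<i> *\<^sub>C Cop R (w - \<i> *\<^sub>C q)"
      using v0 by (simp add: Bx p blinfun.bilinear_simps sc sm scaleR_add_right scaleR_diff_right)
    also have "\<dots> = q"
      by (simp add: blinfun.bilinear_simps CJ sm ii Dop_apply[OF saR w] Cop_apply[OF saR w])
    finally show "(p, q) \<in> op_of B" by (auto simp: op_of_def)
  next
    fix p q assume "(p, q) \<in> op_of B"
    then have q: "q = B p" by (simp add: op_of_def)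
    define x where "x = Dop R p + \<i> *\<^sub>C Cop R p"
    define w where "w = (p - Cop R p) + \<i> *\<^sub>C Dop R p"
    have "(x, w) \<in> R" unfolding x_def w_def
      using sa_add[OF saR Dop_mem[OF saR, of p] comm_opD[OF CT[of \<i>] Cop_Dop[OF saR, of p]]] by simp
    then have "(q, (1 / v) *\<^sub>R w) \<in> R"
      using sa_scale[OF saR] by (simp add: q Bx x_def)
    then have "(q, w + u *\<^sub>R q) \<in> T" using v0 by (simp add: memR)
    moreover have "w + u *\<^sub>R q + (- z) *\<^sub>C q = w - \<i> *\<^sub>C x"
      using v0 by (simp add: zx q Bx x_def[symmetric] sc scaleR_diff_right)
    moreover have "w - \<i> *\<^sub>C x = p" by (simp add: w_def x_def scaleC_add_right ii)
    ultimately have "(q, p) \<in> plus_scalar T (- z)" unfolding plus_scalar_def by force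
    then show "(q, p) \<in> plus_scalar T (- z)" .
  qed
  moreover have "clinear_blinfun B"
    unfolding clinear_blinfun_def Bx
  proof (intro allI)
    fix c x
    have "Cop R (c *\<^sub>C x) = c *\<^sub>C Cop R x" "Dop R (c *\<^sub>C x) = c *\<^sub>C Dop R x"
      using commutesD[OF Cop_commutes[OF saR CT[of c]], of x] commutesD[OF Dop_commutes[OF saR CT[of c]], of x] by simp_all
    then show "(1 / v) *\<^sub>R (Dop R (c *\<^sub>C x) + \<i> *\<^sub>C Cop R (c *\<^sub>C x)) = c *\<^sub>C ((1 / v) *\<^sub>R (Dop R x + \<i> *\<^sub>C Cop R x))"
      by (simp add: sc scaleC_add_right scaleC_scaleC mult.commute)
  qed
  ultimately have "invertible_op (plus_scalar T (- z))" unfolding invertible_op_def bounded_op_def by blast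
  then show False using z by (simp add: op_spectrum_def)
qed

text \<open>On a window [u, v] within distance less than k of c, T - c has norm below k, against its
  lower bound k; so the window projection vanishes.\<close>

lemma resolv_imp_window:
  assumes T: "sa T" and "resolv T c"
  obtains k where "k > 0" "\<And>u v. c - k < u \<Longrightarrow> u \<le> v \<Longrightarrow> v < c + k \<Longrightarrow> Eproj T v = Lproj T u"
proof -
  obtain k where k: "k > 0" "\<And>x y. (x, y) \<in> T \<Longrightarrow> k * norm x \<le> norm (y - c *\<^sub>R x)"
    using assms(2) by (auto simp: resolv_def)
  show ?thesis
  proof (rule that[OF k(1)])
    fix u v assume uv: "c - k < u" "u \<le> v" "v < c + k"
    have "Eproj T v - Lproj T u = 0"
    proof (rule is_proj_zero_if[OF LE_is_proj[OF T uv(2)]])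
      fix x assume "(Eproj T v - Lproj T u) x = x"
      then have x: "Eproj T v x = x" "Lproj T u x = 0" using LE_fix[OF T uv(2)] by blast+
      then obtain y where y: "(x, y) \<in> T" using block_in_domain[OF T uv(2)] by blast
      have "k * norm x \<le> max \<bar>u - c\<bar> \<bar>v - c\<bar> * norm x"
        using k(2)[OF y] block_norm_le[OF T uv(2) y x, of c] by simp
      moreover have "max \<bar>u - c\<bar> \<bar>v - c\<bar> < k" using uv by auto
      ultimately show "x = 0" by (metis mult_less_cancel_right not_le norm_ge_zero norm_eq_zero order_le_less)
    qed
    then show "Eproj T v = Lproj T u" by simp
  qed
qed

lemma window_imp_resolv:
  assumes T: "sa T" and "a < c" "c < b" "Eproj T b = Lproj T a" shows "resolv T c"
  unfolding resolv_def
  using outside_block_norm_ge[OF T less_imp_le[OF assms(2)] less_imp_le[OF assms(3)]] assms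
  by (intro exI[of _ "min (c - a) (b - c)"]) auto

lemma resolv_EL: "sa T \<Longrightarrow> resolv T c \<Longrightarrow> Eproj T c = Lproj T c"
  using resolv_imp_window[of T c] by (metis less_add_same_cancel1 diff_less_eq order_refl)

lemma window_sub:
  assumes T: "sa T" and "a \<le> u" "u \<le> v" "v \<le> b" and eq: "Eproj T b = Lproj T a"
  shows "Eproj T v = Lproj T u"
proof (rule blinfun_eqI)
  fix x
  have 1: "Eproj T v x = Lproj T a x"
    using Eproj_mono(1)[OF T assms(4), of x] Eproj_Lproj_ge[OF T, of a v x] assms by simp
  have "Lproj T u x = Lproj T u (Eproj T b x)" using Lproj_Eproj_ge[OF T, of u b x] assms by simp
  then have "Lproj T u x = Lproj T a x" using Lproj_mono(2)[OF T assms(2), of x] eq by simp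
  then show "Eproj T v x = Lproj T u x" using 1 by simp
qed

lemma window_join:
  assumes T: "sa T" and "Eproj T v = Lproj T u" "Eproj T w = Lproj T v" and uv: "u \<le> v"
  shows "Eproj T w = Lproj T u"
proof (rule blinfun_eqI)
  fix x
  have "Lproj T v x = Lproj T v (Eproj T v x)" by (simp add: Lproj_Eproj_ge[OF T])
  then show "Eproj T w x = Lproj T u x" by (simp add: assms(2,3) Lproj_mono(2)[OF T uv])
qed

text \<open>Every point has a neighbourhood in which all windows are empty, and adjacent empty
  windows join; bisection covers [a, b].\<close>

lemma resolv_gap:
  assumes T: "sa T" and ab: "a \<le> b" and res: "\<And>c. a \<le> c \<Longrightarrow> c \<le> b \<Longrightarrow> resolv T c"
  shows "Eproj T b = Lproj T a"
proof (rule Bolzano[OF ab])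
  show "Eproj T w = Lproj T u" if "Eproj T v = Lproj T u" "Eproj T w = Lproj T v" "u \<le> v" for u v w
    by (rule window_join[OF T that])
  fix x assume "a \<le> x" "x \<le> b"
  then obtain k where k: "k > 0" "\<And>u v. x - k < u \<Longrightarrow> u \<le> v \<Longrightarrow> v < x + k \<Longrightarrow> Eproj T v = Lproj T u"
    using resolv_imp_window[OF T res] by metis
  then show "\<exists>d>0. \<forall>u v. u \<le> x \<and> x \<le> v \<and> v - u < d \<longrightarrow> Eproj T v = Lproj T u"
    by (intro exI[of _ k]) auto
qed

text \<open>The uniform boundedness principle for the functionals <z, .>, by Baire's
  theorem.\<close>

lemma uniformly_bounded:
  fixes Z :: "'a::{real_inner,banach} set"
  assumes "\<And>y. \<exists>M. \<forall>z\<in>Z. \<bar>inner z y\<bar> \<le> M"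
  shows "\<exists>M. \<forall>z\<in>Z. norm z \<le> M"
proof -
  define C where "C n = {y. \<forall>z\<in>Z. \<bar>inner z y\<bar> \<le> real n}" for n
  have clC: "closed (C n)" for n
  proof -
    have "C n = (\<Inter>z\<in>Z. {y. \<bar>inner z y\<bar> \<le> real n})" by (auto simp: C_def)
    then show ?thesis by (auto intro!: closed_INT closed_Collect_le continuous_intros)
  qed
  have "(\<Union>n. C n) = UNIV"
  proof (intro set_eqI iffI UNIV_I)
    fix y
    obtain M where "\<forall>z\<in>Z. \<bar>inner z y\<bar> \<le> M" using assms by blast
    moreover obtain n where "M \<le> real n" using real_arch_simple by blast
    ultimately have "y \<in> C n" by (fastforce simp: C_def)
    then show "y \<in> (\<Union>n. C n)" by blast
  qed
  have "\<exists>n. interior (C n) \<noteq> {}"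
  proof (rule ccontr)
    assume "\<not> (\<exists>n. interior (C n) \<noteq> {})"
    then have "(euclidean :: 'a topology) interior_of \<Union>(range C) = {}"
      using clC by (intro Baire_category_alt) (auto simp: completely_metrizable_space_euclidean)
    then show False using \<open>(\<Union>n. C n) = UNIV\<close> by simp
  qed
  then obtain n y where "y \<in> interior (C n)" by blast
  then obtain e where e: "e > 0" "ball y e \<subseteq> C n" unfolding mem_interior by blast
  have "norm z \<le> 4 * real n / e" if z: "z \<in> Z" for z
  proof (cases "z = 0")
    case False
    \<comment> \<open>The vector of norm e/2 in the direction of z: it stays in the ball about y and
      tests the norm of z.\<close>
    define w where "w = (e / (2 * norm z)) *\<^sub>R z"
    have "norm w = e / 2" using False e by (simp add: w_def)
    then have "y + w \<in> C n" "y \<in> C n" using e by (auto simp: dist_norm intro!: subsetD[OF e(2)])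
    then have "\<bar>inner z (y + w)\<bar> \<le> real n" "\<bar>inner z y\<bar> \<le> real n" using z by (auto simp: C_def)
    then have "\<bar>inner z w\<bar> \<le> 2 * real n" by (simp add: inner_add_right)
    moreover have "inner z w = e / 2 * norm z"
      using False by (simp add: w_def power2_norm_eq_inner[symmetric] power2_eq_square)
    ultimately show ?thesis using e by (simp add: field_simps abs_mult)
  qed (use e in simp)
  then show ?thesis by blast
qed

lemma cinner_span_0:
  assumes "\<And>b. b \<in> B \<Longrightarrow> cinner x b = 0" "w \<in> complex_vector.span B" shows "cinner x (w::'a::complex_hilbert) = 0"
  using assms(2)
proof (induction rule: complex_vector.span_induct_alt)
  case base
  show ?case using cinner_add_right[of x 0 0] by simp
next
  case (step c b w)
  then show ?case by (simp add: cinner_add_right cinner_scaleC_right assms(1))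
qed

text \<open>Rescaling a sequence of unit vectors on which \<open>T\<close> tends to \<open>0\<close> would give a weakly bounded but
  unbounded sequence, because a vector orthogonal to \<open>B\<close> is tested only against the range of \<open>T\<close>.\<close>

lemma fin_codim_range_lower_bound:
  fixes T :: "'a::complex_hilbert op"
  assumes T: "selfadjoint T" and "fin_codim (Range T)"
  obtains B k where "finite B" "k > 0" "\<And>x y. (x, y) \<in> T \<Longrightarrow> (\<And>b. b \<in> B \<Longrightarrow> cinner x b = 0) \<Longrightarrow> k * norm x \<le> norm y"
proof -
  note S = selfadjoint_sa[OF T]
  obtain B where B: "finite B" "complex_vector.span (Range T \<union> B) = UNIV" using assms(2) by (auto simp: fin_codim_def)
  have subR: "complex_vector.subspace (Range T)" unfolding complex_vector.subspace_def
    using sa_0[OF S] sa_add[OF S] selfadjoint_scaleC[OF T] by blast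
  define Z where "Z = {x. \<exists>y. (x, y) \<in> T \<and> (\<forall>b\<in>B. cinner x b = 0) \<and> norm y \<le> 1}"
  have "\<exists>M. \<forall>z\<in>Z. \<bar>inner z p\<bar> \<le> M" for p
  proof -
    have "p \<in> complex_vector.span (Range T \<union> B)" using B(2) by simp
    then obtain q w where qw: "q \<in> Range T" "w \<in> complex_vector.span B" "p = q + w"
      unfolding complex_vector.span_Un complex_vector.span_eq_iff[THEN iffD2, OF subR] by blast
    then obtain x where x: "(x, q) \<in> T" by blast
    have "\<bar>inner z p\<bar> \<le> norm x" if z: "z \<in> Z" for z
    proof -
      obtain y where y: "(z, y) \<in> T" "\<forall>b\<in>B. cinner z b = 0" "norm y \<le> 1" using z by (auto simp: Z_def)
      have "cinner z w = 0" by (rule cinner_span_0[OF _ qw(2)]) (use y in blast)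
      then have "inner z w = 0" by (metis Re_cinner zero_complex.simps(1))
      then have "inner z p = inner y x" using sa_sym[OF S y(1) x] by (simp add: qw(3) inner_add_right)
      also have "\<bar>inner y x\<bar> \<le> norm y * norm x" by (rule Cauchy_Schwarz_ineq2)
      also have "\<dots> \<le> 1 * norm x" by (intro mult_right_mono y) simp
      finally show ?thesis by simp
    qed
    then show ?thesis by blast
  qed
  then obtain M where M: "\<And>z. z \<in> Z \<Longrightarrow> norm z \<le> M" using uniformly_bounded by metis
  define K where "K = max M 1"
  have K: "K > 0" by (simp add: K_def)
  show ?thesis
  proof (rule that[OF B(1), of "1 / K"])
    show "1 / K > 0" using K by simp
    fix x y assume xy: "(x, y) \<in> T" "\<And>b. b \<in> B \<Longrightarrow> cinner x b = 0"
    show "1 / K * norm x \<le> norm y"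
    proof (cases "y = 0")
      case True
      \<comment> \<open>For y = 0 the whole line through x lies in \<open>Z\<close>, so boundedness
        of \<open>Z\<close> forces x = 0.\<close>
      have sx: "r *\<^sub>R x \<in> Z" for r
      proof -
        have "(r *\<^sub>R x, 0) \<in> T" using sa_scale[OF S xy(1), of r] True by simp
        moreover have "\<forall>b\<in>B. cinner (r *\<^sub>R x) b = 0"
          using xy(2) by (simp flip: scaleC_of_real add: cinner_scaleC_left)
        ultimately show ?thesis by (auto simp: Z_def)
      qed
      have "x = 0"
      proof (rule ccontr)
        assume "x \<noteq> 0"
        then show False using M[OF sx[of "(K + 1) / norm x"]] K by (simp add: K_def)
      qed
      then show ?thesis by simp
    next
      case False
      define r where "r = 1 / norm y"
      have "(r *\<^sub>R x, r *\<^sub>R y) \<in> T" by (rule sa_scale[OF S xy(1)])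
      moreover have "\<forall>b\<in>B. cinner (r *\<^sub>R x) b = 0"
        using xy(2) by (simp flip: scaleC_of_real add: cinner_scaleC_left)
      ultimately have "r *\<^sub>R x \<in> Z" using False by (auto simp: Z_def r_def)
      then have "norm (r *\<^sub>R x) \<le> K" using M by (fastforce simp: K_def)
      then show ?thesis using False K by (simp add: r_def field_simps)
    qed
  qed
qed

text \<open>The kernel of T lies in the finite-dimensional range of P, and the range of T contains
  the kernel of P.\<close>

lemma fredholm_if_reduced:
  fixes T :: "'a::complex_hilbert op"
  assumes T: "selfadjoint T" and P: "is_proj P" "comm_op P T" "fin_dim (range (blinfun_apply P))"
    and k: "k > 0" "\<And>x y. (x, y) \<in> T \<Longrightarrow> P x = 0 \<Longrightarrow> k * norm x \<le> norm y"
  shows "fredholm T"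
  unfolding fredholm_def
proof
  note S = selfadjoint_sa[OF T]
  have "ker_op T \<subseteq> range (blinfun_apply P)"
  proof
    fix x assume "x \<in> ker_op T"
    then have x: "(x, 0) \<in> T" by (simp add: ker_op_def)
    then have "(x - P x, 0 - P 0) \<in> T" by (intro sa_diff[OF S] comm_opD[OF P(2)])
    then have "k * norm (x - P x) \<le> 0"
      using k(2)[of "x - P x" "0 - P 0"] by (simp add: blinfun.bilinear_simps is_proj_idem[OF P(1)])
    then have "P x = x" using k(1) by (simp add: mult_le_0_iff)
    then show "x \<in> range (blinfun_apply P)" by (metis rangeI)
  qed
  then show "fin_dim (ker_op T)" by (rule fin_dim_subset[OF P(3)])
  obtain B where B: "finite B" "range (blinfun_apply P) \<subseteq> complex_vector.span B" using P(3) by (auto simp: fin_dim_def)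
  have "complex_vector.span (Range T \<union> B) = UNIV"
  proof (intro set_eqI iffI UNIV_I)
    fix y
    have "P (y - P y) = 0" by (simp add: blinfun.bilinear_simps is_proj_idem[OF P(1)])
    then obtain x where "(x, y - P y) \<in> T" using reduced_surjective[OF S P(1,2) k] by blast
    then have 1: "y - P y \<in> complex_vector.span (Range T \<union> B)" by (intro complex_vector.span_base) blast
    have 2: "P y \<in> complex_vector.span (Range T \<union> B)"
      using B(2) complex_vector.span_mono[of B "Range T \<union> B"] by blast
    show "y \<in> complex_vector.span (Range T \<union> B)" using complex_vector.span_add[OF 1 2] by simp
  qed
  then show "fin_codim (Range T)" unfolding fin_codim_def using B(1) by blast
qed

section \<open>Finite-dimensional spectral windows and the essential spectrum\<close>

definition fin_window :: "'a::complex_hilbert op \<Rightarrow> real \<Rightarrow> real \<Rightarrow> bool" where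
  "fin_window T a b \<longleftrightarrow> fin_dim (range (blinfun_apply (Eproj T b - Lproj T a)))"

lemma LE_subspace: "selfadjoint T \<Longrightarrow> complex_vector.subspace (range (blinfun_apply (Eproj T b - Lproj T a)))"
  by (intro clinear_subspace_range clinear_diff clinear_Eproj clinear_Lproj)

lemma fin_window_mono:
  assumes T: "selfadjoint T" and "fin_window T a b" and "a \<le> u" "u \<le> v" "v \<le> b" shows "fin_window T u v"
  unfolding fin_window_def
proof (rule fin_dim_subset[OF assms(2)[unfolded fin_window_def]], rule subsetI)
  note S = selfadjoint_sa[OF T]
  fix x assume "x \<in> range (blinfun_apply (Eproj T v - Lproj T u))"
  then have x: "Eproj T v x = x" "Lproj T u x = 0"
    using is_proj_range[OF LE_is_proj[OF S assms(4)]] LE_fix[OF S assms(4)] by blast+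
  have "Eproj T b x = x" using Eproj_mono(2)[OF S assms(5), of x] x by simp
  moreover have "Lproj T a x = 0" using Lproj_mono(1)[OF S assms(3), of x] x by simp
  ultimately have "(Eproj T b - Lproj T a) x = x" by (simp add: blinfun.bilinear_simps)
  then show "x \<in> range (blinfun_apply (Eproj T b - Lproj T a))" by (metis rangeI)
qed

lemma fin_window_join:
  assumes T: "selfadjoint T" and "fin_window T u v" "fin_window T v w" "u \<le> v" shows "fin_window T u w"
  unfolding fin_window_def
proof (rule fin_dim_sum[OF assms(2,3)[unfolded fin_window_def]])
  note S = selfadjoint_sa[OF T]
  fix x assume "x \<in> range (blinfun_apply (Eproj T w - Lproj T u))"
  then obtain z where z: "x = Eproj T w z - Lproj T u z" by (auto simp: blinfun.bilinear_simps)
  have "x = (Eproj T v - Lproj T u) (Lproj T v z) + (Eproj T w - Lproj T v) z"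
    by (simp add: z blinfun.bilinear_simps Eproj_Lproj_ge[OF S] Lproj_mono[OF S assms(4)])
  then show "\<exists>a\<in>range (blinfun_apply (Eproj T v - Lproj T u)). \<exists>b\<in>range (blinfun_apply (Eproj T w - Lproj T v)). x = a + b"
    by blast
qed

text \<open>If the range has finite codimension, T is bounded below by k on the complement of
  finitely many vectors. On a window of radius e < k the norm of T is at most e, so these vectors
  separate the points of the window. Conversely T is bounded below by e off the window
  [-e, e].\<close>

lemma fredholm_iff_window:
  assumes T: "selfadjoint T" shows "fredholm T \<longleftrightarrow> (\<exists>e>0. fin_window T (- e) e)"
proof
  note S = selfadjoint_sa[OF T]
  assume "fredholm T"
  then obtain B k where B: "finite B" "k > 0"
    "\<And>x y. (x, y) \<in> T \<Longrightarrow> (\<And>b. b \<in> B \<Longrightarrow> cinner x b = 0) \<Longrightarrow> k * norm x \<le> norm y"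
    using fin_codim_range_lower_bound[OF T] unfolding fredholm_def by metis
  define e where "e = k / 2"
  have e: "e > 0" "e < k" "- e \<le> e" using B(2) by (simp_all add: e_def)
  have "fin_window T (- e) e" unfolding fin_window_def
  proof (rule fin_dim_orthogonal[OF B(1) LE_subspace[OF T]])
    fix x assume "x \<in> range (blinfun_apply (Eproj T e - Lproj T (- e)))" and orth: "\<And>b. b \<in> B \<Longrightarrow> cinner x b = 0"
    then have x: "Eproj T e x = x" "Lproj T (- e) x = 0"
      using is_proj_range[OF LE_is_proj[OF S e(3)]] LE_fix[OF S e(3)] by blast+
    obtain y where y: "(x, y) \<in> T" using block_in_domain[OF S e(3) x] by blast
    have "norm y \<le> e * norm x" using block_norm_le[OF S e(3) y x, of 0] e by simp
    then have "k * norm x \<le> e * norm x" using B(3)[OF y orth] by simp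
    then show "x = 0" using e(2) by (metis mult_less_cancel_right not_le norm_ge_zero norm_eq_zero order_le_less)
  qed
  then show "\<exists>e>0. fin_window T (- e) e" using e(1) by blast
next
  note S = selfadjoint_sa[OF T]
  assume "\<exists>e>0. fin_window T (- e) e"
  then obtain e where e: "e > 0" "fin_window T (- e) e" by blast
  show "fredholm T"
  proof (rule fredholm_if_reduced[OF T])
    show "is_proj (Eproj T e - Lproj T (- e))" by (rule LE_is_proj[OF S]) (use e in simp)
    show "comm_op (Eproj T e - Lproj T (- e)) T" by (intro comm_op_diff S Eproj_comm_op Lproj_comm_op)
    show "fin_dim (range (blinfun_apply (Eproj T e - Lproj T (- e))))" using e(2) by (simp add: fin_window_def)
    show "e > 0" by (rule e(1))
    fix x y assume "(x, y) \<in> T" "(Eproj T e - Lproj T (- e)) x = 0"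
    then show "e * norm x \<le> norm y"
      using outside_block_norm_ge[OF S, of "- e" 0 e x y] e by (simp add: blinfun.bilinear_simps)
  qed
qed

lemma fin_window_shift: "selfadjoint T \<Longrightarrow> fin_window (shift_op T r) a b \<longleftrightarrow> fin_window T (a - r) (b - r)"
  by (simp add: fin_window_def Eproj_shift Lproj_shift selfadjoint_sa)

lemma ess_spectrum_of_real:
  assumes T: "selfadjoint T"
  shows "complex_of_real c \<notin> ess_spectrum T \<longleftrightarrow> (\<exists>e>0. fin_window T (c - e) (c + e))"
  unfolding ess_spectrum_def mem_Collect_eq plus_scalar_minus_of_real
  by (simp add: fredholm_iff_window[OF selfadjoint_shift[OF T]] fin_window_shift[OF T] algebra_simps)

text \<open>Compactness by bisection: each point has a finite-dimensional window around it, and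
  adjacent ones join.\<close>

lemma fin_window_if_not_ess:
  assumes T: "selfadjoint T" and ab: "a \<le> b" and ess: "\<And>c. a \<le> c \<Longrightarrow> c \<le> b \<Longrightarrow> complex_of_real c \<notin> ess_spectrum T"
  shows "fin_window T a b"
proof -
  have "a \<le> b \<longrightarrow> fin_window T a b"
  proof (rule Bolzano[OF ab, where P = "\<lambda>u v. u \<le> v \<longrightarrow> fin_window T u v"])
    fix u v w
    assume "u \<le> v \<longrightarrow> fin_window T u v" "v \<le> w \<longrightarrow> fin_window T v w" "u \<le> v" "v \<le> w"
    then show "u \<le> w \<longrightarrow> fin_window T u w" using fin_window_join[OF T] by blast
  next
    fix x assume "a \<le> x" "x \<le> b"
    then obtain e where e: "e > 0" "fin_window T (x - e) (x + e)" using ess ess_spectrum_of_real[OF T] by blast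
    then show "\<exists>d>0. \<forall>u v. u \<le> x \<and> x \<le> v \<and> v - u < d \<longrightarrow> u \<le> v \<longrightarrow> fin_window T u v"
      by (intro exI[of _ e] conjI allI impI fin_window_mono[OF T e(2)]) auto
  qed
  then show ?thesis using ab by blast
qed

lemma not_ess_if_fin_window:
  assumes T: "selfadjoint T" and "fin_window T a b" "a < c" "c < b"
  shows "complex_of_real c \<notin> ess_spectrum T"
  unfolding ess_spectrum_of_real[OF T]
proof (intro exI conjI)
  show "0 < min (c - a) (b - c)" using assms by simp
  show "fin_window T (c - min (c - a) (b - c)) (c + min (c - a) (b - c))"
    by (rule fin_window_mono[OF T assms(2)]) (use assms in auto)
qed

section \<open>The gap metric\<close>

lemma proj_nearest:
  assumes "is_proj Q" "Q v = v" shows "norm (x - Q x) \<le> norm (x - v)"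
proof -
  have "(id_blinfun - Q) (x - v) = x - Q x" using assms(2) by (simp add: blinfun.bilinear_simps)
  then show ?thesis using is_proj_norm_le[OF is_proj_compl[OF assms(1)], of "x - v"] by simp
qed

text \<open>(1 - P) Q is the adjoint of Q (1 - P) and has the same norm.\<close>

lemma proj_cross_adjoint:
  assumes P: "is_proj P" and Q: "is_proj Q" and bd: "\<And>x. norm (Q (x - P x)) \<le> b * norm x"
  shows "norm (Q x - P (Q x)) \<le> b * norm x"
proof -
  define v where "v = Q x - P (Q x)"
  have Pv: "P v = 0" by (simp add: v_def blinfun.bilinear_simps is_proj_idem[OF P])
  have "inner v v = inner v (Q x)"
    using is_proj_sym[OF P, of v "Q x"] Pv by (simp add: v_def inner_diff_right)
  also have "\<dots> = inner (Q (v - P v)) x" by (simp add: is_proj_sym[OF Q] Pv)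
  also have "\<dots> \<le> norm (Q (v - P v)) * norm x" by (rule norm_cauchy_schwarz)
  also have "\<dots> \<le> (b * norm v) * norm x" by (intro mult_right_mono bd) simp
  finally have "norm v * norm v \<le> (b * norm x) * norm v" by (simp add: power2_norm_eq_inner[symmetric] power2_eq_square mult_ac)
  moreover have "0 \<le> b * norm x" using bd[of x] norm_ge_zero order_trans by blast
  ultimately have "norm v \<le> b * norm x" by (cases "v = 0") auto
  then show ?thesis by (simp add: v_def)
qed

text \<open>P - Q = (1 - Q) P - Q (1 - P), and the second term is the adjoint of (1 - P) Q.\<close>

lemma proj_diff_norm:
  assumes P: "is_proj P" and Q: "is_proj Q" and ab: "0 \<le> a" "0 \<le> b"
    and a: "\<And>x. norm (P x - Q (P x)) \<le> a * norm x" and b: "\<And>x. norm (Q x - P (Q x)) \<le> b * norm x"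
  shows "norm (P - Q) \<le> a + b"
proof (rule norm_blinfun_bound)
  fix x
  define u where "u = Q (x - P x)"
  have Qu: "Q u = u" by (simp add: u_def is_proj_idem[OF Q])
  have "P (x - P x) = 0" by (simp add: blinfun.bilinear_simps is_proj_idem[OF P])
  then have "inner u u = inner (u - P u) (x - P x)"
    using is_proj_sym[OF Q, of u "x - P x"] is_proj_sym[OF P, of u "x - P x"] Qu
    by (simp add: u_def inner_diff_left)
  also have "\<dots> \<le> norm (u - P u) * norm (x - P x)" by (rule norm_cauchy_schwarz)
  also have "\<dots> \<le> (b * norm u) * norm x"
    using b[of u] is_proj_norm_le[OF is_proj_compl[OF P], of x] ab
    by (intro mult_mono) (auto simp: Qu blinfun.bilinear_simps)
  finally have "norm u * norm u \<le> (b * norm x) * norm u" by (simp add: power2_norm_eq_inner[symmetric] power2_eq_square mult_ac)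
  then have "norm u \<le> b * norm x" using ab by (cases "u = 0") auto
  moreover have "(P - Q) x = (P x - Q (P x)) - u" by (simp add: u_def blinfun.bilinear_simps)
  then have "norm ((P - Q) x) \<le> norm (P x - Q (P x)) + norm u" by (simp add: norm_triangle_ineq4)
  ultimately show "norm ((P - Q) x) \<le> (a + b) * norm x" using a[of x] by (simp add: distrib_right)
qed (use ab in simp)

lemma selfadjoint_orth_proj:
  fixes T :: "'a::complex_hilbert op"
  assumes T: "selfadjoint T"
  obtains P where "is_proj P" "range (blinfun_apply P) = T" "orth_proj T = blinfun_apply P"
proof -
  note S = selfadjoint_sa[OF T]
  obtain P where P: "is_proj P" "range (blinfun_apply P) = T" "\<And>x v. v \<in> T \<Longrightarrow> inner (x - P x) v = 0"
    using proj_exists[OF sa_closed[OF S] sa_subspace[OF S]] by blast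
  have "orth_proj T z = P z" for z unfolding orth_proj_def
  proof (rule the_equality)
    have "cinner (z - P z) v = 0" if v: "v \<in> T" for v
    proof -
      have iv: "\<i> *\<^sub>C v \<in> T" using v selfadjoint_scaleC[OF T, of "fst v" "snd v" \<i>] by (simp add: scaleC_prod_def)
      have "Re (cinner (z - P z) v) = 0" "Re (cnj \<i> * cinner (z - P z) v) = 0"
        unfolding cinner_scaleC_right[symmetric] Re_cinner using P(3)[OF v] P(3)[OF iv] by blast+
      then show ?thesis by (simp add: complex_eq_iff)
    qed
    then show "P z \<in> T \<and> (\<forall>v\<in>T. cinner (z - P z) v = 0)" using P(2) by blast
    fix w assume w: "w \<in> T \<and> (\<forall>v\<in>T. cinner (z - w) v = 0)"
    have "P z \<in> T" using P(2) by blast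
    then have d: "w - P z \<in> T" using w subspace_diff[OF sa_subspace[OF S]] by blast
    then have "cinner (z - w) (w - P z) = 0" using w by blast
    then have "inner (z - w) (w - P z) = 0" by (simp flip: Re_cinner)
    moreover have "inner (z - P z) (w - P z) = 0" by (rule P(3)[OF d])
    ultimately have "inner (w - P z) (w - P z) = 0" by (simp add: inner_diff_left)
    then show "w = P z" by simp
  qed
  then show ?thesis using that[OF P(1,2)] by blast
qed

definition gproj :: "'a::complex_hilbert op \<Rightarrow> ('a \<times> 'a) \<Rightarrow>\<^sub>L ('a \<times> 'a)" where
  "gproj T = Blinfun (orth_proj T)"

lemma
  assumes "selfadjoint T"
  shows gproj_is_proj: "is_proj (gproj T)" and gproj_range: "range (blinfun_apply (gproj T)) = T"
proof -
  obtain P where P: "is_proj P" "range (blinfun_apply P) = T" "orth_proj T = blinfun_apply P"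
    using selfadjoint_orth_proj[OF assms] by blast
  have "gproj T = P" unfolding gproj_def P(3) by (rule blinfun_apply_inverse)
  then show "is_proj (gproj T)" "range (blinfun_apply (gproj T)) = T" using P by simp_all
qed

lemma gproj_fix: "selfadjoint T \<Longrightarrow> gproj T z = z \<longleftrightarrow> z \<in> T"
  using is_proj_range[OF gproj_is_proj, of T z] by (simp add: gproj_range)

lemma gap_dist_gproj: "gap_dist T S = norm (gproj T - gproj S)"
  by (simp add: gap_dist_def gproj_def)

lemma Metric_space_gap: "Metric_space CFsa gap_dist"
proof
  show "0 \<le> gap_dist T S" "gap_dist T S = gap_dist S T" for T S :: "'a op"
    by (simp_all add: gap_dist_gproj norm_minus_commute)
  show "gap_dist T S = 0 \<longleftrightarrow> T = S" if "T \<in> CFsa" "S \<in> CFsa" for T S :: "'a op"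
  proof
    assume "gap_dist T S = 0"
    then have "gproj T = gproj S" by (simp add: gap_dist_gproj)
    note eq = this
    have sT: "selfadjoint T" and sS: "selfadjoint S" using that by (simp_all add: CFsa_def Csa_def)
    have "T = range (blinfun_apply (gproj T))" using sT by (rule gproj_range[symmetric])
    also have "\<dots> = range (blinfun_apply (gproj S))" by (simp only: eq)
    also have "\<dots> = S" using sS by (rule gproj_range)
    finally show "T = S" .
  qed (simp add: gap_dist_gproj)
  show "gap_dist T U \<le> gap_dist T S + gap_dist S U" for T S U :: "'a op"
    unfolding gap_dist_gproj using norm_triangle_ineq[of "gproj T - gproj S" "gproj S - gproj U"] by simp
qed

lemma gap_approx:
  assumes T: "selfadjoint T" and S: "selfadjoint S" and z: "z \<in> T"
  obtains w where "w \<in> S" "norm (z - w) \<le> gap_dist T S * norm z"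
proof (rule that[of "gproj S z"])
  show "gproj S z \<in> S" using gproj_range[OF S] by blast
  have "gproj T z = z" using gproj_fix[OF T] z by blast
  then have "z - gproj S z = (gproj T - gproj S) z" by (simp add: blinfun.bilinear_simps)
  then show "norm (z - gproj S z) \<le> gap_dist T S * norm z" by (simp add: gap_dist_gproj norm_blinfun)
qed

lemma gap_dist_le:
  assumes T: "selfadjoint T" and S: "selfadjoint S" and ab: "0 \<le> a" "0 \<le> b"
    and a: "\<And>z. z \<in> T \<Longrightarrow> \<exists>w\<in>S. norm (z - w) \<le> a * norm z"
    and b: "\<And>z. z \<in> S \<Longrightarrow> \<exists>w\<in>T. norm (z - w) \<le> b * norm z"
  shows "gap_dist T S \<le> a + b"
proof -
  have gen: "norm (gproj T x - gproj S (gproj T x)) \<le> c * norm x"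
    if T: "selfadjoint T" and S: "selfadjoint S" and c: "0 \<le> c" and near: "\<And>z. z \<in> T \<Longrightarrow> \<exists>w\<in>S. norm (z - w) \<le> c * norm z"
    for S T :: "'a op" and c x
  proof -
    have "gproj T x \<in> T" using gproj_range[OF T] by blast
    then obtain w where w: "w \<in> S" "norm (gproj T x - w) \<le> c * norm (gproj T x)" using near by blast
    have "norm (gproj T x - gproj S (gproj T x)) \<le> norm (gproj T x - w)"
      by (rule proj_nearest[OF gproj_is_proj[OF S]]) (use w gproj_fix[OF S] in blast)
    also have "\<dots> \<le> c * norm (gproj T x)" by (rule w)
    also have "\<dots> \<le> c * norm x" by (intro mult_left_mono c is_proj_norm_le gproj_is_proj T)
    finally show ?thesis .
  qed
  show ?thesis unfolding gap_dist_gproj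
    by (rule proj_diff_norm[OF gproj_is_proj[OF T] gproj_is_proj[OF S] ab gen[OF T S ab(1) a] gen[OF S T ab(2) b]])
qed

text \<open>The map (x, y) -> (x, y + r x) has norm at most 1 + m. This factor enters once for the
  vector and once for the error of its approximation, and the remaining error is (r - s) x. The
  leading 2 comes from the two one-sided estimates.\<close>

lemma gap_dist_shift:
  assumes T: "selfadjoint T" and S: "selfadjoint S" and m: "\<bar>r\<bar> \<le> m" "\<bar>s\<bar> \<le> m"
  shows "gap_dist (shift_op T r) (shift_op S s) \<le> 2 * ((1 + m) * ((1 + m) * gap_dist T S + \<bar>r - s\<bar>))"
proof -
  have d0: "0 \<le> gap_dist T S" for T S :: "'a op" by (simp add: gap_dist_gproj)
  have m0: "0 \<le> m" using m by simp
  have gen: "\<exists>w\<in>shift_op S s. norm (z - w) \<le> ((1 + m) * ((1 + m) * gap_dist T S + \<bar>r - s\<bar>)) * norm z"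
    if T: "selfadjoint T" and S: "selfadjoint S" and m: "\<bar>r\<bar> \<le> m" "\<bar>s\<bar> \<le> m" and z: "z \<in> shift_op T r" for T S :: "'a op" and r s z
  proof -
    obtain x y where xy: "(x, y) \<in> T" "z = (x, y + r *\<^sub>R x)" using z by (auto simp: shift_op_def)
    obtain u v where uv: "(u, v) \<in> S" "norm ((x, y) - (u, v)) \<le> gap_dist T S * norm (x, y)"
      using gap_approx[OF T S xy(1)] by (metis surj_pair)
    define d where "d = gap_dist T S"
    have d: "0 \<le> d" unfolding d_def by (rule d0)
    have xz: "norm x \<le> norm z" unfolding xy(2) by (rule norm_fst_le)
    have "(x, y) = z - (0, r *\<^sub>R x)" by (simp add: xy(2))
    then have "norm (x, y) \<le> norm z + norm ((0, r *\<^sub>R x) :: 'a \<times> 'a)" by (metis norm_triangle_ineq4)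
    also have "norm ((0, r *\<^sub>R x) :: 'a \<times> 'a) \<le> m * norm z"
      using mult_mono[OF m(1) xz] m0 by (simp add: norm_Pair)
    finally have nxy: "norm (x, y) \<le> (1 + m) * norm z" by (simp add: distrib_right)
    have xu: "norm (x - u) \<le> norm ((x, y) - (u, v))" using norm_fst_le[of "x - u" "y - v"] by simp
    have eq: "z - (u, v + s *\<^sub>R u) = ((x, y) - (u, v)) + (0, s *\<^sub>R (x - u) + (r - s) *\<^sub>R x)"
      by (simp add: xy(2) algebra_simps)
    have "norm (z - (u, v + s *\<^sub>R u)) \<le> norm ((x, y) - (u, v)) + norm (s *\<^sub>R (x - u) + (r - s) *\<^sub>R x)"
      unfolding eq using norm_triangle_ineq[of "(x, y) - (u, v)" "(0, s *\<^sub>R (x - u) + (r - s) *\<^sub>R x)"] by (simp add: norm_Pair)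
    also have "norm (s *\<^sub>R (x - u) + (r - s) *\<^sub>R x) \<le> \<bar>s\<bar> * norm (x - u) + \<bar>r - s\<bar> * norm x"
      by (metis norm_scaleR norm_triangle_ineq)
    also have "\<dots> \<le> m * norm ((x, y) - (u, v)) + \<bar>r - s\<bar> * norm (x, y)"
      using m(2) xu by (intro add_mono mult_mono norm_fst_le) auto
    finally have "norm (z - (u, v + s *\<^sub>R u)) \<le> (1 + m) * norm ((x, y) - (u, v)) + \<bar>r - s\<bar> * norm (x, y)"
      by (simp add: distrib_right)
    also have "\<dots> \<le> (1 + m) * (d * norm (x, y)) + \<bar>r - s\<bar> * norm (x, y)"
      using uv(2) m0 by (intro add_mono mult_left_mono) (auto simp: d_def)
    also have "\<dots> = ((1 + m) * d + \<bar>r - s\<bar>) * norm (x, y)" by (simp add: algebra_simps)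
    also have "\<dots> \<le> ((1 + m) * d + \<bar>r - s\<bar>) * ((1 + m) * norm z)"
      using d m0 by (intro mult_left_mono nxy) auto
    finally have "norm (z - (u, v + s *\<^sub>R u)) \<le> ((1 + m) * ((1 + m) * d + \<bar>r - s\<bar>)) * norm z" by (simp add: mult_ac)
    then show ?thesis using shift_opI[OF uv(1), of s] unfolding d_def by blast
  qed
  have "gap_dist (shift_op T r) (shift_op S s) \<le>
      ((1 + m) * ((1 + m) * gap_dist T S + \<bar>r - s\<bar>)) + ((1 + m) * ((1 + m) * gap_dist S T + \<bar>s - r\<bar>))"
    by (rule gap_dist_le[OF selfadjoint_shift[OF T] selfadjoint_shift[OF S] _ _ gen[OF T S m] gen[OF S T m(2,1)]])
      (use m0 d0 in simp_all)
  moreover have "gap_dist S T = gap_dist T S" by (simp add: gap_dist_gproj norm_minus_commute)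
  ultimately show ?thesis by (simp add: abs_minus_commute)
qed

lemma gproj_Pair_0:
  assumes T: "selfadjoint T" shows "gproj T (x, 0) = (Cop T x, Dop T x)"
proof -
  note S = selfadjoint_sa[OF T]
  have "inner (gproj T (x - Cop T x, - Dop T x)) w = 0" for w
  proof -
    obtain u v where uv: "gproj T w = (u, v)" "(u, v) \<in> T" using gproj_range[OF T] by (metis rangeI surj_pair)
    have "inner (gproj T (x - Cop T x, - Dop T x)) w = inner (x - Cop T x, - Dop T x) (u, v)"
      by (simp add: is_proj_sym[OF gproj_is_proj[OF T]] uv)
    also have "\<dots> = 0" using sa_sym[OF S Dop_mem[OF S, of x] uv(2)] by simp
    finally show ?thesis .
  qed
  then have 0: "gproj T (x - Cop T x, - Dop T x) = 0" by (metis inner_eq_zero_iff)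
  have "(x, 0) = (Cop T x, Dop T x) + (x - Cop T x, - Dop T x)" by simp
  then have "gproj T (x, 0) = gproj T (Cop T x, Dop T x) + gproj T (x - Cop T x, - Dop T x)"
    by (metis blinfun.add_right)
  then show ?thesis using 0 gproj_fix[OF T] Cop_Dop[OF S] by simp
qed

text \<open>\<open>Cop T\<close> is a corner of the projection onto the graph, namely the first
  component of its values on vectors (x, 0).\<close>

lemma Cop_dist_le_gap:
  assumes T: "selfadjoint T" and S: "selfadjoint S" shows "norm (Cop T - Cop S) \<le> gap_dist T S"
proof (rule norm_blinfun_bound)
  fix x
  have "(Cop T x - Cop S x, Dop T x - Dop S x) = (gproj T - gproj S) (x, 0)"
    by (simp add: gproj_Pair_0[OF T] gproj_Pair_0[OF S] blinfun.bilinear_simps)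
  then have "norm (Cop T x - Cop S x) \<le> norm ((gproj T - gproj S) (x, 0))" by (metis norm_fst_le)
  also have "\<dots> \<le> gap_dist T S * norm (x, 0 :: 'a)" unfolding gap_dist_gproj by (rule norm_blinfun)
  finally show "norm ((Cop T - Cop S) x) \<le> gap_dist T S * norm x" by (simp add: norm_Pair blinfun.bilinear_simps)
qed (simp add: gap_dist_gproj)

section \<open>Spectral windows around zero\<close>

text \<open>The spectral projection for [-a, a]. A window symmetric about 0 is a spectral subspace
  of (1 + T^2)^-1, so windows of two operators can be compared through \<open>Cop\<close>
  alone.\<close>

definition Wproj :: "('a::{real_inner,banach} \<times> 'a) set \<Rightarrow> real \<Rightarrow> 'a \<Rightarrow>\<^sub>L 'a" where
  "Wproj T a = Eproj T a - Lproj T (- a)"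

lemma Wproj_is_proj: "sa T \<Longrightarrow> 0 \<le> a \<Longrightarrow> is_proj (Wproj T a)"
  unfolding Wproj_def by (rule LE_is_proj) auto

lemma Wproj_fix: "sa T \<Longrightarrow> 0 \<le> a \<Longrightarrow> Wproj T a x = x \<longleftrightarrow> Eproj T a x = x \<and> Lproj T (- a) x = 0"
  unfolding Wproj_def by (rule LE_fix) auto

lemma Wproj_eq_0: "Wproj T a x = 0 \<longleftrightarrow> Eproj T a x = Lproj T (- a) x"
  by (simp add: Wproj_def blinfun.bilinear_simps)

lemma Wproj_comm_op: "sa T \<Longrightarrow> comm_op (Wproj T a) T"
  unfolding Wproj_def by (intro comm_op_diff Eproj_comm_op Lproj_comm_op)

lemma clinear_Wproj: "selfadjoint T \<Longrightarrow> clinear_blinfun (Wproj T a)"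
  unfolding Wproj_def by (intro clinear_diff clinear_Eproj clinear_Lproj)

lemma Wproj_Cop: "sa T \<Longrightarrow> Wproj T a (Cop T x) = Cop T (Wproj T a x)"
  by (rule commutesD[OF Cop_commutes[OF _ Wproj_comm_op]])

lemma Wproj_Dop: "sa T \<Longrightarrow> Wproj T a (Dop T x) = Dop T (Wproj T a x)"
  by (rule commutesD[OF Dop_commutes[OF _ Wproj_comm_op]])

text \<open>The operator version of 1 / (1 + t^2) \<le> 1 / (1 + a^2) for |t| \<ge> a: with u = C x
  and w = T u, the bound |w| \<ge> a |u| is inserted into |u|^2 + |w|^2 = <u, x>.\<close>

lemma Cop_outside:
  assumes T: "sa T" and a: "0 \<le> a" and x: "Wproj T a x = 0"
  shows "norm (Cop T x) \<le> norm x / (1 + a\<^sup>2)"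
proof -
  let ?u = "Cop T x" and ?w = "Dop T x"
  have "Wproj T a ?u = 0" by (simp add: Wproj_Cop[OF T] x)
  then have "a * norm ?u \<le> norm ?w"
    using outside_block_norm_ge[OF T, of "- a" 0 a ?u ?w] a Cop_Dop[OF T] by (simp add: Wproj_eq_0)
  then have "(a * norm ?u)\<^sup>2 \<le> (norm ?w)\<^sup>2" using a by (intro power_mono) auto
  then have "(1 + a\<^sup>2) * (norm ?u)\<^sup>2 \<le> (norm ?u)\<^sup>2 + (norm ?w)\<^sup>2" by (simp add: power_mult_distrib distrib_right)
  also have "\<dots> = inner ?u x" using inner_Cop[OF T, of x x] by (simp add: power2_norm_eq_inner)
  also have "\<dots> \<le> norm ?u * norm x" by (rule norm_cauchy_schwarz)
  finally have "((1 + a\<^sup>2) * norm ?u) * norm ?u \<le> norm x * norm ?u" by (simp add: power2_eq_square mult_ac)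
  then have "(1 + a\<^sup>2) * norm ?u \<le> norm x" by (cases "?u = 0") auto
  then show ?thesis by (simp add: field_simps add_pos_nonneg)
qed

text \<open>With u = C x and w = T u one has x - u = T w, and T has norm at most a on the window; so
  |x| \<le> (1 + a^2) |u|.\<close>

lemma Cop_inside:
  assumes T: "sa T" and a: "0 \<le> a" and x: "Wproj T a x = x"
  shows "norm x / (1 + a\<^sup>2) \<le> norm (Cop T x)"
proof -
  let ?u = "Cop T x" and ?w = "Dop T x"
  have ma: "- a \<le> a" using a by simp
  have u: "Eproj T a ?u = ?u" "Lproj T (- a) ?u = 0" and w: "Eproj T a ?w = ?w" "Lproj T (- a) ?w = 0"
    using Wproj_fix[OF T a] Wproj_Cop[OF T, of a x] Wproj_Dop[OF T, of a x] x by simp_all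
  have "norm ?w \<le> a * norm ?u"
    using block_norm_le[OF T ma Cop_Dop[OF T, of x] u, of 0] a by simp
  moreover have "norm (x - ?u) \<le> a * norm ?w"
    using block_norm_le[OF T ma Dop_mem[OF T, of x] w, of 0] a by simp
  ultimately have "norm (x - ?u) \<le> a * (a * norm ?u)" using a by (meson mult_left_mono order_trans)
  moreover have "norm x \<le> norm (x - ?u) + norm ?u" using norm_triangle_ineq[of "x - ?u" ?u] by simp
  ultimately have "norm x \<le> (1 + a\<^sup>2) * norm ?u" by (simp add: power2_eq_square distrib_right mult.assoc)
  then show ?thesis by (simp add: field_simps add_pos_nonneg)
qed

text \<open>The Davis-Kahan argument: \<open>C X - X C' = P (C - C') (1 - P')\<close> for \<open>X = P (1 - P')\<close>.\<close>

lemma window_cross_norm: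
  assumes T: "sa T" and S: "sa S" and ab: "0 \<le> a" "a < b"
  shows "norm (Wproj T a (x - Wproj S b x)) \<le>
    norm (Cop T - Cop S) / (1 / (1 + a\<^sup>2) - 1 / (1 + b\<^sup>2)) * norm x"
proof -
  define e where "e = norm (Cop T - Cop S)"
  define p where "p = 1 / (1 + a\<^sup>2)"
  define q where "q = 1 / (1 + b\<^sup>2)"
  have pos: "0 < 1 + a\<^sup>2" "0 < 1 + b\<^sup>2" by (simp_all add: add_pos_nonneg)
  have q0: "0 < q" "0 < p" using pos by (simp_all add: q_def p_def)
  have "a\<^sup>2 < b\<^sup>2" using ab by (simp add: power_strict_mono)
  then have pq: "q < p" using pos unfolding p_def q_def by (simp add: frac_less2)
  have b0: "0 \<le> b" using ab by simp
  define X where "X = Wproj T a o\<^sub>L (id_blinfun - Wproj S b)"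
  have Xz: "X z = Wproj T a (z - Wproj S b z)" for z by (simp add: X_def blinfun.bilinear_simps)
  note Ta = Wproj_is_proj[OF T ab(1)] and Sb = Wproj_is_proj[OF S b0]
  have key: "norm (X z) \<le> ((e + q * norm X) / p) * norm z" for z
  proof -
    define y where "y = z - Wproj S b z"
    have Wy: "Wproj S b y = 0" by (simp add: y_def blinfun.bilinear_simps is_proj_idem[OF Sb])
    have ny: "norm y \<le> norm z"
      using is_proj_norm_le[OF is_proj_compl[OF Sb], of z] by (simp add: y_def blinfun.bilinear_simps)
    have "p * norm (X z) \<le> norm (Cop T (X z))"
      using Cop_inside[OF T ab(1), of "X z"] by (simp add: Xz is_proj_idem[OF Ta] p_def)
    also have "Cop T (X z) = Wproj T a ((Cop T - Cop S) y) + X (Cop S y)"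
      by (simp add: Xz y_def[symmetric] Wproj_Cop[OF T, symmetric] Wproj_Cop[OF S] Wy blinfun.bilinear_simps)
    also have "norm \<dots> \<le> norm (Wproj T a ((Cop T - Cop S) y)) + norm (X (Cop S y))" by (rule norm_triangle_ineq)
    also have "\<dots> \<le> e * norm y + norm X * (q * norm y)"
    proof (rule add_mono)
      show "norm (Wproj T a ((Cop T - Cop S) y)) \<le> e * norm y"
        unfolding e_def by (rule order_trans[OF is_proj_norm_le[OF Ta] norm_blinfun])
      have "norm (X (Cop S y)) \<le> norm X * norm (Cop S y)" by (rule norm_blinfun)
      also have "\<dots> \<le> norm X * (q * norm y)"
        using Cop_outside[OF S b0 Wy] by (intro mult_left_mono) (simp_all add: q_def)
      finally show "norm (X (Cop S y)) \<le> norm X * (q * norm y)" .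
    qed
    also have "\<dots> = (e + q * norm X) * norm y" by (simp add: algebra_simps)
    also have "\<dots> \<le> (e + q * norm X) * norm z" using ny q0 by (intro mult_left_mono) (auto simp: e_def)
    finally show ?thesis using q0 by (simp add: field_simps)
  qed
  \<comment> \<open>The bound for norm X contains norm X again; since q < p this term is absorbed on
    the left.\<close>
  have "norm X \<le> (e + q * norm X) / p" by (rule norm_blinfun_bound[OF _ key]) (use q0 in \<open>simp add: e_def\<close>)
  then have "(p - q) * norm X \<le> e" using q0 by (simp add: field_simps)
  then have "norm X \<le> e / (p - q)" using pq by (simp add: pos_le_divide_eq mult.commute)
  then have "norm (X x) \<le> e / (p - q) * norm x"
    using norm_blinfun[of X x] by (meson mult_right_mono norm_ge_zero order_trans)
  then show ?thesis by (simp add: Xz e_def p_def q_def)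
qed

text \<open>The windows for a and b coincide for each operator, so the gap between the two radii
  makes the denominator positive and \<open>window_cross_norm\<close> applies in both
  directions.\<close>

lemma window_dist:
  assumes T: "sa T" and S: "sa S" and ab: "0 \<le> a" "a < b" and eq: "Wproj T a = Wproj T b" "Wproj S a = Wproj S b"
  shows "norm (Wproj T a - Wproj S a) \<le> 2 / (1 / (1 + a\<^sup>2) - 1 / (1 + b\<^sup>2)) * norm (Cop T - Cop S)"
proof -
  define K where "K = norm (Cop T - Cop S) / (1 / (1 + a\<^sup>2) - 1 / (1 + b\<^sup>2))"
  have "a\<^sup>2 < b\<^sup>2" using ab by (simp add: power_strict_mono)
  then have "1 / (1 + b\<^sup>2) < 1 / (1 + a\<^sup>2)" by (intro frac_less2) (auto simp: add_pos_nonneg)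
  then have K0: "0 \<le> K" by (simp add: K_def)
  note P = Wproj_is_proj[OF T ab(1)] and Q = Wproj_is_proj[OF S ab(1)]
  have 1: "norm (Wproj T a (x - Wproj S a x)) \<le> K * norm x" for x
    using window_cross_norm[OF T S ab, of x] by (simp add: eq(2) K_def)
  have 2: "norm (Wproj S a (x - Wproj T a x)) \<le> K * norm x" for x
    using window_cross_norm[OF S T ab, of x] by (simp add: eq(1) K_def norm_minus_commute)
  have "norm (Wproj T a - Wproj S a) \<le> K + K"
    by (rule proj_diff_norm[OF P Q K0 K0 proj_cross_adjoint[OF Q P 1] proj_cross_adjoint[OF P Q 2]])
  then show ?thesis by (simp add: K_def)
qed

lemma Wproj_const:
  assumes T: "sa T" and ab: "0 < a" "a \<le> b" and eq: "Eproj T b = Lproj T a" "Eproj T (- a) = Lproj T (- b)"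
    and r: "a \<le> r" "r \<le> b"
  shows "Wproj T r = Wproj T a"
proof (rule blinfun_eqI)
  fix x
  have "Eproj T v = Lproj T a" if "a \<le> v" "v \<le> b" for v
    by (rule window_sub[OF T _ _ _ eq(1)]) (use that in auto)
  then have 1: "Eproj T r = Eproj T a" using r by simp
  have L: "Eproj T (- a) = Lproj T u" if "- b \<le> u" "u \<le> - a" for u
    by (rule window_sub[OF T _ _ _ eq(2)]) (use that in auto)
  then have 2: "Lproj T (- r) = Lproj T (- a)" using L[of "- r"] L[of "- a"] r ab by simp
  show "Wproj T r x = Wproj T a x" by (simp add: Wproj_def 1 2)
qed

text \<open>Factorisation: 1 - (1 + b^2) C = (T^2 - b^2) C, which acts on the domain of T as (D + b
  C)(T - b). A lower bound for C - 1/(1 + b^2) thus passes to T - b, whatever the sign of b.\<close>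

lemma resolv_if_Cop_bounded_below:
  assumes T: "sa T" and k: "0 < k" and bd: "\<And>x. k * norm x \<le> norm (Cop T x - (1 / (1 + b\<^sup>2)) *\<^sub>R x)"
  shows "resolv T b"
  unfolding resolv_def
proof (intro exI conjI allI impI)
  define c where "c = 1 / (1 + b\<^sup>2)"
  have pos: "0 < 1 + b\<^sup>2" by (simp add: add_pos_nonneg)
  have c0: "0 < c" using pos by (simp add: c_def)
  have D: "norm (Dop T w) \<le> norm (Dop T) * norm w" and C: "norm (Cop T w) \<le> norm (Cop T) * norm w" for w by (rule norm_blinfun)+
  define M where "M = c * (norm (Dop T) + \<bar>b\<bar> * norm (Cop T)) + 1"
  have M: "M > 0" using c0 by (simp add: M_def add_nonneg_pos)
  show "0 < k / M" using k M by simp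
  fix x y assume xy: "(x, y) \<in> T"
  define w where "w = y - b *\<^sub>R x"
  have y: "y = w + b *\<^sub>R x" by (simp add: w_def)
  have "Dop T y = x - Cop T x" "Cop T y = Dop T x" by (rule Dop_apply[OF T xy], rule Cop_apply[OF T xy])
  then have 1: "Dop T w + b *\<^sub>R Dop T x = x - Cop T x" and 2: "Dop T x = Cop T w + b *\<^sub>R Cop T x"
    by (simp_all add: y blinfun.bilinear_simps)
  have "Dop T w + b *\<^sub>R Cop T w = x - (1 + b\<^sup>2) *\<^sub>R Cop T x"
    using 1 unfolding 2 by (simp add: algebra_simps power2_eq_square)
  then have "c *\<^sub>R (Dop T w + b *\<^sub>R Cop T w) = c *\<^sub>R x - Cop T x"
    using pos by (simp add: c_def scaleR_diff_right)
  then have "norm (Cop T x - c *\<^sub>R x) = c * norm (Dop T w + b *\<^sub>R Cop T w)"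
    using c0 by (metis abs_of_pos norm_minus_commute norm_scaleR)
  also have "\<dots> \<le> c * (norm (Dop T) * norm w + \<bar>b\<bar> * (norm (Cop T) * norm w))"
    using c0 D[of w] C[of w] norm_triangle_ineq[of "Dop T w" "b *\<^sub>R Cop T w"] mult_left_mono[OF C[of w], of "\<bar>b\<bar>"]
    by (intro mult_left_mono) auto
  also have "\<dots> \<le> M * norm w" by (simp add: M_def algebra_simps)
  finally have "k * norm x \<le> M * norm w" using bd[of x] by (simp add: c_def)
  then show "k / M * norm x \<le> norm (y - b *\<^sub>R x)" using M by (simp add: w_def field_simps)
qed

lemma fin_dim_dim_0: "fin_dim V \<Longrightarrow> complex_vector.dim V = 0 \<Longrightarrow> V \<subseteq> {0}"
proof -
  assume V: "fin_dim V" "complex_vector.dim V = 0"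
  obtain B where "finite B" "B \<subseteq> V" "complex_vector.independent B" "V \<subseteq> complex_vector.span B" "card B = complex_vector.dim V"
    by (rule fin_dim_basis[OF V(1)])
  then show "V \<subseteq> {0}" using V(2) by simp
qed

text \<open>The dimensions of the windows [-r, r] are natural numbers. Once the least one is
  reached, shrinking the window removes nothing, so no spectrum is left at 0 < |t| < e.\<close>

lemma fredholm_isolated:
  fixes T :: "'a::complex_hilbert op"
  assumes T: "selfadjoint T" and F: "fredholm T"
  obtains e where "e > 0" "fin_window T (- e) e" "\<And>c. 0 < \<bar>c\<bar> \<Longrightarrow> \<bar>c\<bar> < e \<Longrightarrow> resolv T c"
proof -
  note S = selfadjoint_sa[OF T]
  obtain e0 where e0: "e0 > 0" "fin_window T (- e0) e0" using F fredholm_iff_window[OF T] by blast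
  define n where "n e = complex_vector.dim (range (blinfun_apply (Wproj T e)))" for e
  \<comment> \<open>A window of least dimension among all radii up to e0.\<close>
  obtain e where e: "0 < e" "e \<le> e0" and least: "\<And>r. 0 < r \<Longrightarrow> r \<le> e0 \<Longrightarrow> n e \<le> n r"
  proof -
    obtain e where "0 < e \<and> e \<le> e0" "\<forall>r. 0 < r \<and> r \<le> e0 \<longrightarrow> n e \<le> n r"
      using exists_least_iff[of "\<lambda>m. \<exists>e. (0 < e \<and> e \<le> e0) \<and> m = n e"] e0(1) by (metis le_less_linear order_refl)
    then show ?thesis using that by blast
  qed
  have fin: "fin_window T (- r) r" if "0 < r" "r \<le> e0" for r
    by (rule fin_window_mono[OF T e0(2)]) (use that in auto)
  have const: "Eproj T e = Eproj T r \<and> Lproj T (- r) = Lproj T (- e)" if r: "0 < r" "r \<le> e" for r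
  proof -
    have re0: "r \<le> e0" using r e by simp
    define R where "R = Wproj T e - Wproj T r"
    have WW: "Wproj T e (Wproj T r x) = Wproj T r x" for x
      unfolding Wproj_def using r by (simp add: blinfun.bilinear_simps Eproj_mono[OF S] Eproj_Lproj_ge[OF S]
          Lproj_mono[OF S] Lproj_Eproj_ge[OF S])
    have Pr: "is_proj (Wproj T r)" "is_proj (Wproj T e)" using r by (auto intro: Wproj_is_proj[OF S])
    have PR: "is_proj R" unfolding R_def by (intro is_proj_diff Pr blinfun_eqI) (simp add: WW)
    have RW: "R (Wproj T r x) = 0" for x by (simp add: R_def blinfun.bilinear_simps WW is_proj_idem[OF Pr(1)])
    have WR: "Wproj T r (R x) = 0" for x
    proof -
      have "inner (Wproj T r (R x)) y = 0" for y
        by (simp add: is_proj_sym[OF Pr(1)] is_proj_sym[OF PR] RW)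
      then show ?thesis by (metis inner_eq_zero_iff)
    qed
    have cR: "clinear_blinfun R" unfolding R_def by (intro clinear_diff clinear_Wproj T)
    have finR: "fin_dim (range (blinfun_apply R))"
    proof (rule fin_dim_subset)
      show "fin_dim (range (blinfun_apply (Wproj T e)))" using fin[OF e] by (simp add: fin_window_def Wproj_def)
      have "R x = Wproj T e (x - Wproj T r x)" for x by (simp add: R_def blinfun.bilinear_simps WW)
      then show "range (blinfun_apply R) \<subseteq> range (blinfun_apply (Wproj T e))" by auto
    qed
    have "n e = complex_vector.dim (range (blinfun_apply (Wproj T r + R)))" by (simp add: n_def R_def)
    also have "\<dots> = n r + complex_vector.dim (range (blinfun_apply R))" unfolding n_def
      using fin[OF r(1) re0] by (intro dim_orthogonal_sum Pr PR cR clinear_Wproj T WR RW finR) (simp add: fin_window_def Wproj_def)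
    finally have "complex_vector.dim (range (blinfun_apply R)) = 0" using least[OF r(1) re0] by simp
    then have "range (blinfun_apply R) \<subseteq> {0}" by (rule fin_dim_dim_0[OF finR])
    then have R0: "R x = 0" for x by blast
    have sum0: "(Eproj T e x - Eproj T r x) + (Lproj T (- r) x - Lproj T (- e) x) = 0" for x
      using R0[of x] by (simp add: R_def Wproj_def blinfun.bilinear_simps algebra_simps)
    have "Eproj T e x = Eproj T r x" for x
    proof -
      have "Eproj T r ((Eproj T e x - Eproj T r x) + (Lproj T (- r) x - Lproj T (- e) x)) = Lproj T (- r) x - Lproj T (- e) x"
        using r by (simp add: blinfun.bilinear_simps Eproj_mono[OF S] is_proj_idem[OF Eproj_is_proj[OF S]] Eproj_Lproj_ge[OF S])
      then show ?thesis using sum0[of x] by simp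
    qed
    moreover from this have "Lproj T (- r) x = Lproj T (- e) x" for x using sum0[of x] by simp
    ultimately show ?thesis by (auto intro: blinfun_eqI)
  qed
  show ?thesis
  proof (rule that[OF e(1) fin[OF e]])
    fix c :: real assume c: "0 < \<bar>c\<bar>" "\<bar>c\<bar> < e"
    define r where "r = \<bar>c\<bar> / 2"
    have r: "0 < r" "r < e" "r < \<bar>c\<bar>" using c by (simp_all add: r_def)
    \<comment> \<open>Equality of two cumulative projections means that nothing lies between the two
      cuts; \<open>EL\<close> and \<open>LE\<close> turn it into emptiness of a closed window whose
      free endpoint lies strictly inside.\<close>
    have EL: "Eproj T v = Lproj T u" if "Eproj T v = Eproj T u'" "u' < u" "u \<le> v" for u v u'
    proof (rule blinfun_eqI)
      fix x
      have "Lproj T u x = Lproj T u (Eproj T v x)" by (simp add: Lproj_Eproj_ge[OF S that(3)])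
      then show "Eproj T v x = Lproj T u x" by (simp add: that(1) Lproj_Eproj_less[OF S that(2)])
    qed
    have LE: "Eproj T v = Lproj T u" if "Lproj T u = Lproj T v'" "v < v'" "u \<le> v" for u v v'
    proof (rule blinfun_eqI)
      fix x
      have "Lproj T u x = Eproj T v (Lproj T u x)" by (simp add: Eproj_Lproj_ge[OF S that(3)])
      then show "Eproj T v x = Lproj T u x" by (simp add: that(1) Eproj_Lproj_less[OF S that(2)])
    qed
    show "resolv T c"
    proof (cases "c > 0")
      case True
      show ?thesis
      proof (rule window_imp_resolv[OF S])
        show "Eproj T e = Lproj T ((r + c) / 2)"
          using const[OF r(1)] r True c by (intro EL[of _ r]) auto
      qed (use r True c in auto)
    next
      case False
      then have c0: "c < 0" using c by simp
      show ?thesis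
      proof (rule window_imp_resolv[OF S])
        show "Eproj T ((c - r) / 2) = Lproj T (- e)"
          using const[OF r(1)] r c0 c by (intro LE[of _ "- r"]) auto
      qed (use r c0 c in auto)
    qed
  qed
qed

text \<open>The punctured interval 0 < |t| < e is free of spectrum of T. In terms of C = (1 +
  T^2)^-1 this is a gap in the spectrum, which is stable under norm perturbation of C; so a smaller
  annulus stays free for all nearby operators, and their windows are uniformly Lipschitz in
  C.\<close>

lemma local_window:
  fixes T :: "'a::complex_hilbert op"
  assumes T: "selfadjoint T" and F: "fredholm T"
  obtains a b d K where "0 < a" "a < b" "0 < d" "0 < K"
    "\<And>S. selfadjoint S \<Longrightarrow> norm (Cop S - Cop T) < d \<Longrightarrow> resolv S a \<and> resolv S (- a) \<and> fin_window S (- b) b"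
    "\<And>S R. selfadjoint S \<Longrightarrow> norm (Cop S - Cop T) < d \<Longrightarrow> selfadjoint R \<Longrightarrow> norm (Cop R - Cop T) < d \<Longrightarrow>
      norm (Wproj S a - Wproj R a) \<le> K * norm (Cop S - Cop R)"
proof -
  note sT = selfadjoint_sa[OF T]
  obtain e where e: "e > 0" "fin_window T (- e) e" "\<And>c. 0 < \<bar>c\<bar> \<Longrightarrow> \<bar>c\<bar> < e \<Longrightarrow> resolv T c"
    using fredholm_isolated[OF T F] by blast
  define h where "h t = 1 / (1 + (t * e)\<^sup>2)" for t
  have h_less: "h t < h s" if "0 \<le> s" "s < t" for s t
  proof -
    have "(s * e)\<^sup>2 < (t * e)\<^sup>2" using that e(1) by (intro power_strict_mono) auto
    then show ?thesis unfolding h_def by (intro frac_less2) (auto simp: add_pos_nonneg)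
  qed
  have h_le: "h t \<le> h s" if "0 \<le> s" "s \<le> t" for s t
    using h_less[of s t] that by (cases "s = t") auto
  \<comment> \<open>C is at least h (1/8) on the window of radius e/8 and at most h (7/8) off the
    one of radius 7e/8, while 1/(1 + r^2) lies between h (3/4) and h (1/4) for e/4 \<le> r \<le>
    3e/4; \<open>k\<close> is the smaller distance.\<close>
  define k where "k = min (h (1/8) - h (1/4)) (h (3/4) - h (7/8))"
  have k: "k > 0" using h_less[of "1/8" "1/4"] h_less[of "3/4" "7/8"] by (simp add: k_def)
  have Weq: "Wproj T r = Wproj T (e/8)" if "e/8 \<le> r" "r \<le> 7*e/8" for r
  proof (rule Wproj_const[OF sT _ _ _ _ that])
    show "Eproj T (7*e/8) = Lproj T (e/8)" "Eproj T (- (e/8)) = Lproj T (- (7*e/8))"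
      by (rule resolv_gap[OF sT _ e(3)]; use e(1) in auto)+
  qed (use e(1) in auto)
  have below: "k * norm x \<le> norm (Cop T x - (1 / (1 + r\<^sup>2)) *\<^sub>R x)" if r: "e/4 \<le> r" "r \<le> 3*e/4" for r x
  proof -
    define c where "c = 1 / (1 + r\<^sup>2)"
    have re: "r = (r/e) * e" using e(1) by simp
    have ch: "c = h (r/e)" unfolding h_def c_def using re by simp
    have c1: "c \<le> h (1/4)" "h (3/4) \<le> c" unfolding ch using r e(1)
      by (intro h_le; simp add: field_simps)+
    have c0: "0 < c" by (simp add: c_def add_pos_nonneg)
    let ?W = "Wproj T (e/8)"
    have P: "is_proj ?W" by (rule Wproj_is_proj[OF sT]) (use e(1) in simp)
    define u v where "u = ?W x" and "v = x - ?W x"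
    have Wu: "?W u = u" and Wv: "?W v = 0" by (simp_all add: u_def v_def blinfun.bilinear_simps is_proj_idem[OF P])
    have "norm u * h (1/8) \<le> norm (Cop T u)"
      using Cop_inside[OF sT _ Wu] e(1) by (simp add: h_def power_divide mult.commute)
    moreover have "norm (Cop T u) \<le> norm (Cop T u - c *\<^sub>R u) + c * norm u"
      using norm_triangle_ineq[of "Cop T u - c *\<^sub>R u" "c *\<^sub>R u"] c0 by simp
    ultimately have "norm u * h (1/8) - c * norm u \<le> norm (Cop T u - c *\<^sub>R u)" by simp
    moreover have "k * norm u \<le> (h (1/8) - c) * norm u" using c1 by (intro mult_right_mono) (auto simp: k_def)
    ultimately have 1: "k * norm u \<le> norm (Cop T u - c *\<^sub>R u)" by (simp add: algebra_simps)
    have "Wproj T (7*e/8) v = 0" using Weq[of "7*e/8"] Wv e(1) by simp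
    then have "norm (Cop T v) \<le> norm v * h (7/8)"
      using Cop_outside[OF sT, of "7*e/8" v] e(1) by (simp add: h_def power_divide mult.commute)
    moreover have "c * norm v \<le> norm (Cop T v - c *\<^sub>R v) + norm (Cop T v)"
      using norm_triangle_ineq4[of "Cop T v - c *\<^sub>R v" "Cop T v"] c0 by simp
    ultimately have "c * norm v - norm v * h (7/8) \<le> norm (Cop T v - c *\<^sub>R v)" by simp
    moreover have "k * norm v \<le> (c - h (7/8)) * norm v" using c1 by (intro mult_right_mono) (auto simp: k_def)
    ultimately have 2: "k * norm v \<le> norm (Cop T v - c *\<^sub>R v)" by (simp add: algebra_simps)
    have o1: "inner u v = 0" by (rule is_proj_orth[OF P Wu Wv])
    have o2: "inner (Cop T u - c *\<^sub>R u) (Cop T v - c *\<^sub>R v) = 0"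
      by (rule is_proj_orth[OF P]) (simp_all add: blinfun.bilinear_simps Wproj_Cop[OF sT] Wu Wv)
    have "(k * norm x)\<^sup>2 = (k * norm u)\<^sup>2 + (k * norm v)\<^sup>2"
      using norm_Pythagoras_eq[OF o1] by (simp add: u_def v_def power_mult_distrib distrib_left)
    also have "\<dots> \<le> (norm (Cop T u - c *\<^sub>R u))\<^sup>2 + (norm (Cop T v - c *\<^sub>R v))\<^sup>2"
      using 1 2 k by (intro add_mono power_mono) auto
    also have "\<dots> = (norm (Cop T x - c *\<^sub>R x))\<^sup>2"
      using norm_Pythagoras_eq[OF o2] by (simp add: u_def v_def blinfun.bilinear_simps algebra_simps)
    finally show ?thesis unfolding c_def by (rule power2_le_imp_le) simp
  qed
  \<comment> \<open>Two radii in [e/4, 3e/4], the range kept free of spectrum for all nearby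
    operators.\<close>
  define a b where "a = e/2" and "b = 3*e/4"
  have ab: "0 < a" "a < b" "e/4 < a" using e(1) by (simp_all add: a_def b_def)
  define K where "K = 2 / (1 / (1 + a\<^sup>2) - 1 / (1 + b\<^sup>2))"
  have "a\<^sup>2 < b\<^sup>2" using ab by (simp add: power_strict_mono)
  then have "1 / (1 + b\<^sup>2) < 1 / (1 + a\<^sup>2)" by (intro frac_less2) (auto simp: add_pos_nonneg)
  then have K: "K > 0" by (simp add: K_def)
  \<comment> \<open>The bound k/2 preserves half of the lower bound of C - 1/(1 + r^2); the bound
    1/K keeps the window projections at distance less than 1, so that finite dimension is
    transferred.\<close>
  define d where "d = min (k / 2) (1 / K)"
  have d: "d > 0" using k K by (simp add: d_def)
  have res: "resolv S r" if S: "selfadjoint S" and near: "norm (Cop S - Cop T) < d" and r: "e/4 \<le> \<bar>r\<bar>" "\<bar>r\<bar> \<le> 3*e/4" for S r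
  proof (rule resolv_if_Cop_bounded_below[OF selfadjoint_sa[OF S]])
    show "0 < k / 2" using k by simp
    fix x
    have "k * norm x \<le> norm (Cop T x - (1 / (1 + r\<^sup>2)) *\<^sub>R x)" using below[OF r, of x] by simp
    also have "\<dots> \<le> norm (Cop S x - (1 / (1 + r\<^sup>2)) *\<^sub>R x) + norm ((Cop S - Cop T) x)"
      using norm_triangle_ineq4[of "Cop S x - (1 / (1 + r\<^sup>2)) *\<^sub>R x" "(Cop S - Cop T) x"] by (simp add: blinfun.bilinear_simps)
    also have "norm ((Cop S - Cop T) x) \<le> norm (Cop S - Cop T) * norm x" by (rule norm_blinfun)
    also have "norm (Cop S - Cop T) * norm x \<le> (k / 2) * norm x" using near by (intro mult_right_mono) (auto simp: d_def)
    finally show "k / 2 * norm x \<le> norm (Cop S x - (1 / (1 + r\<^sup>2)) *\<^sub>R x)" by simp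
  qed
  have WS: "Wproj S r = Wproj S (e/4)" if S: "selfadjoint S" "norm (Cop S - Cop T) < d" and r: "e/4 \<le> r" "r \<le> 3*e/4" for S r
  proof (rule Wproj_const[OF selfadjoint_sa[OF S(1)] _ _ _ _ r])
    show "Eproj S (3*e/4) = Lproj S (e/4)" "Eproj S (- (e/4)) = Lproj S (- (3*e/4))"
      by (rule resolv_gap[OF selfadjoint_sa[OF S(1)] _ res[OF S]]; use e(1) in auto)+
  qed (use e(1) in auto)
  have dist: "norm (Wproj S a - Wproj R a) \<le> K * norm (Cop S - Cop R)"
    if "selfadjoint S" "norm (Cop S - Cop T) < d" "selfadjoint R" "norm (Cop R - Cop T) < d" for S R
    unfolding K_def
  proof (rule window_dist[OF selfadjoint_sa[OF that(1)] selfadjoint_sa[OF that(3)] less_imp_le[OF ab(1)] ab(2)])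
    show "Wproj S a = Wproj S b" using WS[OF that(1,2), of a] WS[OF that(1,2), of b] e(1) by (simp add: a_def b_def)
    show "Wproj R a = Wproj R b" using WS[OF that(3,4), of a] WS[OF that(3,4), of b] e(1) by (simp add: a_def b_def)
  qed
  show ?thesis
  proof (rule that[OF ab(1,2) d K _ dist])
    fix S assume S: "selfadjoint S" "norm (Cop S - Cop T) < d"
    have "norm (Wproj T a - Wproj S a) \<le> K * norm (Cop T - Cop S)"
      by (rule dist[OF T _ S]) (use d in simp)
    also have "\<dots> < K * (1 / K)" using S(2) K by (intro mult_strict_left_mono) (auto simp: d_def norm_minus_commute)
    finally have near: "norm (Wproj T a - Wproj S a) < 1" using K by simp
    have "fin_dim (range (blinfun_apply (Wproj T a)))"
      using fin_window_mono[OF T e(2), of "- a" a] e(1) unfolding fin_window_def Wproj_def by (simp add: a_def)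
    then have "fin_dim (range (blinfun_apply (Wproj S a)))"
      by (rule fin_dim_near_proj(1)[OF Wproj_is_proj[OF sT] clinear_Wproj[OF T] Wproj_is_proj[OF selfadjoint_sa[OF S(1)]] clinear_Wproj[OF S(1)] near, rotated 2])
        (use ab in auto)
    moreover have "Wproj S b = Wproj S a" using WS[OF S, of a] WS[OF S, of b] e(1) by (simp add: a_def b_def)
    ultimately have "fin_window S (- b) b" by (simp add: fin_window_def Wproj_def)
    then show "resolv S a \<and> resolv S (- a) \<and> fin_window S (- b) b"
      using res[OF S, of a] res[OF S, of "- a"] e(1) by (simp add: a_def)
  qed
qed

section \<open>Existence of partitions for the spectral flow\<close>

definition sf_piece :: "(real \<Rightarrow> 'a::complex_hilbert op) \<Rightarrow> real \<Rightarrow> real \<Rightarrow> real \<Rightarrow> bool" where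
  "sf_piece A c d a \<longleftrightarrow> a > 0 \<and>
     (\<forall>s\<in>{c..d}. complex_of_real a \<notin> op_spectrum (A s) \<and> complex_of_real (- a) \<notin> op_spectrum (A s) \<and>
        complex_of_real ` {- a..a} \<inter> ess_spectrum (A s) = {}) \<and>
     continuous_on {c..d} (\<lambda>s. Blinfun (spectral_proj (A s) (- a) a))"

lemma sf_partition_iff:
  "sf_partition A N l a \<longleftrightarrow> l 0 = 0 \<and> l N = 1 \<and> (\<forall>i\<in>{1..N}. l (i - 1) < l i \<and> sf_piece A (l (i - 1)) (l i) (a i))"
  unfolding sf_partition_def sf_piece_def by blast

lemma Blinfun_spectral_proj:
  "selfadjoint T \<Longrightarrow> Blinfun (spectral_proj T a b) = Eproj T b - Lproj T a"
  by (simp add: spectral_proj_eq blinfun_apply_inverse)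

lemma sf_piece_local:
  fixes A :: "real \<Rightarrow> 'a::complex_hilbert op"
  assumes A: "\<And>s. s \<in> {0..1} \<Longrightarrow> A s \<in> CFsa"
    and cont: "\<And>s e. s \<in> {0..1} \<Longrightarrow> e > 0 \<Longrightarrow> \<exists>d>0. \<forall>t\<in>{0..1}. \<bar>t - s\<bar> < d \<longrightarrow> gap_dist (A t) (A s) < e"
    and x: "x \<in> {0..1}"
  obtains r where "r > 0" "\<And>c d. {c..d} \<subseteq> ball x r \<Longrightarrow> {c..d} \<subseteq> {0..1} \<Longrightarrow> \<exists>a. sf_piece A c d a"
proof -
  have SA: "selfadjoint (A s)" if "s \<in> {0..1}" for s using A[OF that] by (simp add: CFsa_def Csa_def)
  have "fredholm (A x)" using A[OF x] by (simp add: CFsa_def)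
  then obtain a b d K where abd: "0 < a" "a < b" "0 < d" "0 < K"
    "\<And>S. selfadjoint S \<Longrightarrow> norm (Cop S - Cop (A x)) < d \<Longrightarrow> resolv S a \<and> resolv S (- a) \<and> fin_window S (- b) b"
    "\<And>S R. selfadjoint S \<Longrightarrow> norm (Cop S - Cop (A x)) < d \<Longrightarrow> selfadjoint R \<Longrightarrow> norm (Cop R - Cop (A x)) < d \<Longrightarrow>
      norm (Wproj S a - Wproj R a) \<le> K * norm (Cop S - Cop R)"
    using local_window[OF SA[OF x]] by metis
  obtain r where r: "r > 0" "\<And>t. t \<in> {0..1} \<Longrightarrow> \<bar>t - x\<bar> < r \<Longrightarrow> gap_dist (A t) (A x) < d"
    using cont[OF x abd(3)] by blast
  show ?thesis
  proof (rule that[OF r(1)])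
    fix p q assume pq: "{p..q} \<subseteq> ball x r" "{p..q} \<subseteq> {0..1}"
    have near: "norm (Cop (A s) - Cop (A x)) < d" if "s \<in> {p..q}" for s
    proof -
      have s: "s \<in> {0..1}" "\<bar>s - x\<bar> < r" using that pq by (auto simp: dist_real_def dest!: subsetD[of _ _ s])
      show ?thesis using Cop_dist_le_gap[OF SA[OF s(1)] SA[OF x]] r(2)[OF s] by linarith
    qed
    have W: "Blinfun (spectral_proj (A s) (- a) a) = Wproj (A s) a" if "s \<in> {p..q}" for s
      using that pq SA by (auto simp: Wproj_def Blinfun_spectral_proj)
    have "continuous_on {p..q} (\<lambda>s. Wproj (A s) a)"
      unfolding continuous_on_iff
    proof (intro ballI allI impI)
      fix s and e :: real assume s: "s \<in> {p..q}" and e: "e > 0"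
      have s01: "s \<in> {0..1}" using s pq by blast
      obtain \<delta> where \<delta>: "\<delta> > 0" "\<And>t. t \<in> {0..1} \<Longrightarrow> \<bar>t - s\<bar> < \<delta> \<Longrightarrow> gap_dist (A t) (A s) < e / K"
        using cont[OF s01, of "e / K"] e abd(4) by auto
      have "dist (Wproj (A t) a) (Wproj (A s) a) < e" if t: "t \<in> {p..q}" "dist t s < \<delta>" for t
      proof -
        have t01: "t \<in> {0..1}" using t pq by blast
        have "norm (Wproj (A t) a - Wproj (A s) a) \<le> K * norm (Cop (A t) - Cop (A s))"
          by (rule abd(6)[OF SA[OF t01] near[OF t(1)] SA[OF s01] near[OF s]])
        also have "\<dots> \<le> K * gap_dist (A t) (A s)"
          using abd(4) by (intro mult_left_mono Cop_dist_le_gap SA t01 s01) auto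
        also have "\<dots> < K * (e / K)"
          using \<delta>(2)[OF t01] t abd(4) by (intro mult_strict_left_mono) (auto simp: dist_real_def)
        finally show ?thesis using abd(4) by (simp add: dist_norm)
      qed
      then show "\<exists>\<delta>>0. \<forall>t\<in>{p..q}. dist t s < \<delta> \<longrightarrow> dist (Wproj (A t) a) (Wproj (A s) a) < e" using \<delta>(1) by blast
    qed
    then have C: "continuous_on {p..q} (\<lambda>s. Blinfun (spectral_proj (A s) (- a) a))"
      by (rule continuous_on_eq) (simp add: W)
    have "complex_of_real a \<notin> op_spectrum (A s) \<and> complex_of_real (- a) \<notin> op_spectrum (A s) \<and>
        complex_of_real ` {- a..a} \<inter> ess_spectrum (A s) = {}" if s: "s \<in> {p..q}" for s
    proof -
      have Ss: "selfadjoint (A s)" using SA s pq by blast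
      note * = abd(5)[OF Ss near[OF s]]
      have "complex_of_real c \<notin> ess_spectrum (A s)" if "c \<in> {- a..a}" for c
        by (rule not_ess_if_fin_window[OF Ss, of "- b" b]) (use * that abd(2) in auto)
      then show ?thesis using * op_spectrum_of_real[OF Ss] by blast
    qed
    then show "\<exists>a. sf_piece A p q a" using C abd(1) unfolding sf_piece_def by blast
  qed
qed

text \<open>Equal pieces, shorter than a Lebesgue number of the cover by balls on which one radius
  works.\<close>

lemma sf_partition_exists:
  fixes A :: "real \<Rightarrow> 'a::complex_hilbert op"
  assumes A: "\<And>s. s \<in> {0..1} \<Longrightarrow> A s \<in> CFsa"
    and cont: "\<And>s e. s \<in> {0..1} \<Longrightarrow> e > 0 \<Longrightarrow> \<exists>d>0. \<forall>t\<in>{0..1}. \<bar>t - s\<bar> < d \<longrightarrow> gap_dist (A t) (A s) < e"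
  shows "\<exists>N l a. sf_partition A N l a"
proof -
  have "\<forall>x\<in>{0..1}. \<exists>r>0. \<forall>c d. {c..d} \<subseteq> ball x r \<longrightarrow> {c..d} \<subseteq> {0..1} \<longrightarrow> (\<exists>a. sf_piece A c d a)"
    using sf_piece_local[OF A cont] by metis
  then obtain r where r: "\<And>x. x \<in> {0..1} \<Longrightarrow> r x > 0"
    "\<And>x c d. x \<in> {0..1} \<Longrightarrow> {c..d} \<subseteq> ball x (r x) \<Longrightarrow> {c..d} \<subseteq> {0..1} \<Longrightarrow> \<exists>a. sf_piece A c d a" by metis
  have cover: "{0..1} \<subseteq> \<Union>((\<lambda>x. ball x (r x)) ` {0..1})" using r(1) by force
  have ne: "(\<lambda>x. ball x (r x)) ` {0..1::real} \<noteq> {}" by simp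
  have op: "\<And>B. B \<in> (\<lambda>x. ball x (r x)) ` {0..1} \<Longrightarrow> open B" by auto
  obtain \<delta> where \<delta>: "0 < \<delta>" "\<And>T. T \<subseteq> {0..1} \<Longrightarrow> diameter T < \<delta> \<Longrightarrow> \<exists>B\<in>(\<lambda>x. ball x (r x)) ` {0..1::real}. T \<subseteq> B"
    using Lebesgue_number_lemma[OF compact_Icc ne cover op] by blast
  obtain N :: nat where N: "1 / \<delta> < real N" using reals_Archimedean2 by blast
  have N0: "N > 0" using N \<delta>(1) by (metis divide_pos_pos gr0I not_less_iff_gr_or_eq of_nat_0 order_less_trans zero_less_one)
  define l where "l i = real i / real N" for i
  have "\<exists>a. sf_piece A (l (i - 1)) (l i) a" if i: "i \<in> {1..N}" for i
  proof -
    have 1: "{l (i - 1)..l i} \<subseteq> {0..1}" using i N0 by (auto simp: l_def field_simps of_nat_diff)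
    have d: "l i - l (i - 1) = 1 / real N" using i N0 by (simp add: l_def of_nat_diff field_simps)
    have "diameter {l (i - 1)..l i} \<le> 1 / real N"
      by (rule diameter_le) (use d in \<open>auto simp: dist_real_def\<close>)
    also have "\<dots> < \<delta>" using N N0 \<delta>(1) by (simp add: field_simps)
    finally obtain x where "x \<in> {0..1}" "{l (i - 1)..l i} \<subseteq> ball x (r x)" using \<delta>(2)[OF 1] by blast
    then show ?thesis using r(2) 1 by blast
  qed
  then obtain a where a: "\<And>i. i \<in> {1..N} \<Longrightarrow> sf_piece A (l (i - 1)) (l i) (a i)" by metis
  have "l (i - 1) < l i" if "i \<in> {1..N}" for i using that N0 by (simp add: l_def divide_strict_right_mono)
  then have "sf_partition A N l a" unfolding sf_partition_iff using a N0 by (simp add: l_def)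
  then show ?thesis by blast
qed

section \<open>Bounded operators\<close>

lemma mem_op_of [simp]: "(x, y) \<in> op_of B \<longleftrightarrow> y = B x"
  by (simp add: op_of_def)

lemma op_of_inject: "op_of A = op_of B \<longleftrightarrow> A = B"
  by (auto intro!: blinfun_eqI dest: eqset_imp_iff[of _ _ "(_, _)"])

lemma op_of_O: "op_of A O op_of B = op_of (B o\<^sub>L A)"
  by (auto simp: relcomp_unfold)

lemma blinfun_of_op_of: "blinfun_of (op_of B) = B"
  by (simp add: blinfun_of_def blinfun_apply_inverse)

lemma Domain_op_of: "Domain (op_of B) = UNIV"
  by (auto simp: op_of_def)

lemma sa_op_of: "symm B \<Longrightarrow> sa (op_of B)"
  unfolding sa_def
proof (intro conjI allI)
  assume B: "symm B"
  show "closure (Domain (op_of B)) = UNIV" by (simp add: Domain_op_of)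
  fix y z
  have "(\<forall>x. inner (B x) y = inner x z) \<longleftrightarrow> z = B y"
  proof
    assume "\<forall>x. inner (B x) y = inner x z"
    then have "inner z x = inner (B y) x" for x by (metis symmD[OF B] inner_commute)
    then show "z = B y" by (rule inner_eq_all_eq)
  qed (simp add: symmD[OF B])
  then show "(y, z) \<in> op_of B \<longleftrightarrow> (\<forall>(x, w)\<in>op_of B. inner w y = inner x z)"
    by (auto simp: op_of_def)
qed

lemma comm_op_op_of: "comm_op A (op_of B) \<longleftrightarrow> commutes A B"
  by (auto simp: comm_op_def commutes_iff)

lemma selfadjoint_op_of: "symm B \<Longrightarrow> clinear_blinfun B \<Longrightarrow> selfadjoint (op_of B)"
  by (rule sa_selfadjoint[OF sa_op_of]) (auto simp: comm_op_op_of clinear_iff)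

lemma Bsa_iff: "T \<in> Bsa \<longleftrightarrow> (\<exists>B. symm B \<and> clinear_blinfun B \<and> T = op_of B)"
proof
  assume "T \<in> Bsa"
  then obtain B where B: "clinear_blinfun B" "T = op_of B" "selfadjoint T"
    by (auto simp: Bsa_def Csa_def bounded_op_def)
  have "symm B" unfolding symm_def using sa_sym[OF selfadjoint_sa[OF B(3)]] B(2) by simp
  then show "\<exists>B. symm B \<and> clinear_blinfun B \<and> T = op_of B" using B by blast
next
  assume "\<exists>B. symm B \<and> clinear_blinfun B \<and> T = op_of B"
  then show "T \<in> Bsa" using selfadjoint_op_of by (auto simp: Bsa_def Csa_def bounded_op_def)
qed

lemma shift_op_of: "shift_op (op_of B) r = op_of (B + r *\<^sub>R id_blinfun)"
  by (auto simp: mem_shift_op blinfun.bilinear_simps algebra_simps)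

section \<open>The Riesz transform\<close>

lemma clinear_Gop: "selfadjoint T \<Longrightarrow> clinear_blinfun (Gop T)"
  and clinear_Fop: "selfadjoint T \<Longrightarrow> clinear_blinfun (Fop T)"
  by (auto intro!: clinear_if_commutes[of T] Gop_commutes Fop_commutes selfadjoint_sa)

lemma inverse_one_plus_square:
  assumes T: "sa T" shows "(plus_scalar (T O T) 1)\<inverse> = op_of (Cop T)"
proof (intro set_eqI iffI; clarify)
  fix p q assume "(q, p) \<in> plus_scalar (T O T) 1"
  then obtain w y where "(q, w) \<in> T" "(w, y) \<in> T" "p = y + q"
    using scaleC_of_real[of 1] by (auto simp: plus_scalar_def)
  then show "(p, q) \<in> op_of (Cop T)" using Cop_Dop_unique(1)[OF T, of q w p] by simp
next
  fix p q assume "(p, q) \<in> op_of (Cop T)"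
  then have "(q, Dop T p) \<in> T" "(Dop T p, p - q) \<in> T" using Cop_Dop[OF T] Dop_mem[OF T] by simp_all
  then have "(q, p - q) \<in> T O T" by blast
  then show "(q, p) \<in> plus_scalar (T O T) 1"
    using scaleC_of_real[of 1 q] by (force simp: plus_scalar_def)
qed

lemma inv_sqrt_op_eq:
  assumes T: "selfadjoint T" shows "inv_sqrt_op T = op_of (Gop T)"
  unfolding inv_sqrt_op_def inverse_one_plus_square[OF selfadjoint_sa[OF T]]
proof (rule the_equality)
  note S = selfadjoint_sa[OF T]
  have GG: "Gop T o\<^sub>L Gop T = Cop T" by (rule blinfun_eqI) (simp add: Gop_Gop[OF S])
  show "op_of (Gop T) \<in> Bsa \<and> (\<forall>(x, y)\<in>op_of (Gop T). 0 \<le> Re (cinner y x)) \<and> op_of (Gop T) O op_of (Gop T) = op_of (Cop T)"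
    using Gop_positive[OF S] clinear_Gop[OF T] unfolding Bsa_iff op_of_O GG positive_def by (auto simp: Re_cinner)
  fix R assume R: "R \<in> Bsa \<and> (\<forall>(x, y)\<in>R. 0 \<le> Re (cinner y x)) \<and> R O R = op_of (Cop T)"
  then obtain B where B: "symm B" "R = op_of B" unfolding Bsa_iff by blast
  then have "positive B" "B o\<^sub>L B = Cop T" using R by (auto simp: positive_def Re_cinner op_of_O op_of_inject)
  then have "B = Gop T" using positive_sqrt_unique[OF _ Gop_positive[OF S]] GG by simp
  then show "R = op_of (Gop T)" using B by simp
qed

lemma riesz_transform_eq:
  assumes T: "selfadjoint T" shows "riesz_transform T = op_of (Fop T)"
  unfolding riesz_transform_def inv_sqrt_op_eq[OF T]
  using Gop_Fop[OF selfadjoint_sa[OF T]] Fop_eq[OF selfadjoint_sa[OF T]] by (auto simp: relcomp_unfold)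

lemma riesz_dist_eq:
  "selfadjoint T \<Longrightarrow> selfadjoint S \<Longrightarrow> riesz_dist T S = norm (Fop T - Fop S)"
  by (simp add: riesz_dist_def norm_dist_def riesz_transform_eq blinfun_of_op_of)

text \<open>F determines C = 1 - F^2, hence its root G, and the graph is the set of all (G w, F
  w).\<close>

lemma Fop_inject:
  assumes T: "sa T" and S: "sa S" and F: "Fop T = Fop S" shows "T = S"
proof -
  have "Cop T = Cop S"
  proof (rule blinfun_eqI)
    fix x
    have "Fop T (Fop T x) + Cop T x = Fop S (Fop S x) + Cop S x"
      by (simp only: Fop_Gop_squares[OF T] Fop_Gop_squares[OF S])
    then show "Cop T x = Cop S x" by (simp add: F)
  qed
  then have G: "Gop T = Gop S" by (simp add: Gop_def)
  have *: "R \<subseteq> R'" if R: "sa R" and R': "sa R'" and eq: "Gop R = Gop R'" "Fop R = Fop R'" for R R' :: "('a \<times> 'a) set"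
  proof clarify
    fix x y assume xy: "(x, y) \<in> R"
    show "(x, y) \<in> R'" using Gop_surj[OF R xy] Fop_surj[OF R xy] Gop_Fop[OF R', of "Gop R x + Fop R y"] eq by simp
  qed
  show ?thesis using *[OF T S G F] *[OF S T G[symmetric] F[symmetric]] by blast
qed

lemma Fop_Gop_norm:
  assumes T: "sa T" shows "(norm (Fop T x))\<^sup>2 + (norm (Gop T x))\<^sup>2 = (norm x)\<^sup>2"
proof -
  have "(norm (Fop T x))\<^sup>2 + (norm (Gop T x))\<^sup>2 = inner (Fop T (Fop T x) + Cop T x) x"
    by (simp add: power2_norm_eq_inner inner_add_left symmD[OF Fop_symm[OF T]] symmD[OF Gop_symm[OF T]] flip: Gop_Gop[OF T])
  then show ?thesis by (simp add: Fop_Gop_squares[OF T] power2_norm_eq_inner)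
qed

lemma Fop_norm: "sa T \<Longrightarrow> norm (Fop T) \<le> 1"
proof (rule norm_blinfun_bound)
  fix x assume T: "sa T"
  have "(norm (Fop T x))\<^sup>2 \<le> (norm x)\<^sup>2"
    using Fop_Gop_norm[OF T, of x] zero_le_power2[of "norm (Gop T x)"] by linarith
  then show "norm (Fop T x) \<le> 1 * norm x" by (auto intro: power2_le_imp_le)
qed simp

lemma comm_op_Fop: assumes T: "sa T" shows "comm_op (Fop T) T"
  by (rule comm_opI[OF T Fop_commutes[OF T comm_op_Cop[OF T], symmetric] Fop_commutes[OF T comm_op_Dop[OF T], symmetric]])

text \<open>At an approximate eigenvector \<open>x\<close> of \<open>S = \<surd>A - \<surd>B\<close> for the extreme spectral value \<open>\<lambda>\<close>, the
  identity \<open>A - B = S \<surd>A + \<surd>B S\<close> gives \<open>\<langle>(A - B) x, x\<rangle> \<approx> \<lambda> \<langle>(\<surd>A + \<surd>B) x, x\<rangle> \<ge> \<lambda>\<^sup>2\<close>.\<close>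

lemma sqrt_diff_form:
  assumes P: "positive P" and Q: "positive Q" and n: "norm (P - Q) \<le> n" and x: "norm x = 1"
    and h: "inner ((P - Q) x) x \<ge> n - h" "h \<ge> 0"
  shows "n * (n - h) - norm (P + Q) * sqrt (2 * n * h) \<le> norm ((P o\<^sub>L P) - (Q o\<^sub>L Q))"
proof -
  define S where "S = P - Q"
  have sP: "symm P" and sQ: "symm Q" using P Q by (simp_all add: positive_def)
  have Sx: "S y = P y - Q y" for y by (simp add: S_def blinfun.bilinear_simps)
  have n0: "0 \<le> n" using n norm_ge_zero order_trans by blast
  have nS: "norm (S x) \<le> n" using norm_blinfun[of S x] n x by (simp add: S_def)
  have "(norm (S x - n *\<^sub>R x))\<^sup>2 = (norm (S x))\<^sup>2 - 2 * n * inner (S x) x + n\<^sup>2"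
    using dot_norm_neg[of "S x" "n *\<^sub>R x"] x by (simp add: field_simps)
  also have "\<dots> \<le> n\<^sup>2 - 2 * n * (n - h) + n\<^sup>2"
    using nS n0 h(1) by (intro add_mono diff_mono power_mono mult_left_mono) (auto simp: S_def)
  also have "\<dots> = 2 * n * h" by (simp add: power2_eq_square algebra_simps)
  finally have small: "norm (S x - n *\<^sub>R x) \<le> sqrt (2 * n * h)" by (rule real_le_rsqrt)
  define y where "y = (P + Q) x"
  have ny: "norm y \<le> norm (P + Q)" using norm_blinfun[of "P + Q" x] x by (simp add: y_def)
  have "inner (P (P x) - Q (Q x)) x = inner y (S x)"
    using symmD[OF sP, of "P x" x] symmD[OF sQ, of "Q x" x] inner_commute[of "P x" "Q x"]
    by (simp add: y_def Sx blinfun.bilinear_simps inner_diff_left inner_diff_right inner_add_left)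
  also have "\<dots> = n * inner y x + inner y (S x - n *\<^sub>R x)" by (simp add: inner_diff_right)
  finally have eq: "inner (P (P x) - Q (Q x)) x = n * inner y x + inner y (S x - n *\<^sub>R x)" .
  \<comment> \<open>Positivity of Q turns the lower bound for the form of P - Q into one for P +
    Q.\<close>
  have "0 \<le> inner (Q x) x" using Q by (simp add: positive_def)
  then have "n - h \<le> inner y x" using h(1) by (simp add: y_def blinfun.bilinear_simps inner_add_left inner_diff_left)
  then have "n * (n - h) \<le> n * inner y x" using n0 by (rule mult_left_mono)
  moreover have "- (norm (P + Q) * sqrt (2 * n * h)) \<le> inner y (S x - n *\<^sub>R x)"
  proof -
    have "\<bar>inner y (S x - n *\<^sub>R x)\<bar> \<le> norm y * norm (S x - n *\<^sub>R x)" by (rule Cauchy_Schwarz_ineq2)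
    also have "\<dots> \<le> norm (P + Q) * sqrt (2 * n * h)" by (intro mult_mono ny small) auto
    finally show ?thesis by linarith
  qed
  moreover have "inner (P (P x) - Q (Q x)) x \<le> norm ((P o\<^sub>L P) - (Q o\<^sub>L Q))"
  proof -
    have "inner (P (P x) - Q (Q x)) x \<le> norm (((P o\<^sub>L P) - (Q o\<^sub>L Q)) x) * norm x"
      using norm_cauchy_schwarz[of "P (P x) - Q (Q x)" x] by (simp add: blinfun.bilinear_simps)
    also have "\<dots> \<le> norm ((P o\<^sub>L P) - (Q o\<^sub>L Q))" using norm_blinfun[of "(P o\<^sub>L P) - (Q o\<^sub>L Q)" x] x by simp
    finally show ?thesis .
  qed
  ultimately show ?thesis using eq by linarith
qed

lemma sqrt_diff_norm:
  fixes P Q :: "'a::{real_inner,banach} \<Rightarrow>\<^sub>L 'a"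
  assumes P: "positive P" and Q: "positive Q"
  shows "(norm (P - Q))\<^sup>2 \<le> norm ((P o\<^sub>L P) - (Q o\<^sub>L Q))"
proof (cases "norm (P - Q) = 0")
  case False
  define n where "n = norm (P - Q)"
  have n: "n > 0" using False by (simp add: n_def)
  have sS: "symm (P - Q)" using P Q by (simp add: positive_def symm_def blinfun.bilinear_simps inner_diff_left inner_diff_right)
  define c where "c = norm (P + Q)"
  define e where "e = norm ((P o\<^sub>L P) - (Q o\<^sub>L Q))"
  \<comment> \<open>The supremum of |<(P - Q) x, x>| over unit vectors need not be attained in
    infinite dimension; \<open>h\<close> measures the defect and tends to 0 at the end.\<close>
  have step: "n * (n - h) - c * sqrt (2 * n * h) \<le> e" if h: "0 < h" "h < n" for h
  proof -
    have "\<exists>x. (n - h) * (norm x)\<^sup>2 < \<bar>inner ((P - Q) x) x\<bar>"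
    proof (rule ccontr)
      assume "\<not> ?thesis"
      then have "norm ((P - Q) x) \<le> (n - h) * norm x" for x by (intro symm_norm_le[OF sS]) (simp add: not_less)
      then have "n \<le> n - h" unfolding n_def[symmetric] using h by (subst n_def) (intro norm_blinfun_bound, auto)
      then show False using h by simp
    qed
    then obtain z where z: "(n - h) * (norm z)\<^sup>2 < \<bar>inner ((P - Q) z) z\<bar>" by blast
    then have z0: "z \<noteq> 0" by auto
    define x where "x = (1 / norm z) *\<^sub>R z"
    have x: "norm x = 1" using z0 by (simp add: x_def)
    have "inner ((P - Q) x) x = inner ((P - Q) z) z / (norm z)\<^sup>2"
      by (simp add: x_def blinfun.bilinear_simps power2_eq_square)
    then have "n - h < \<bar>inner ((P - Q) x) x\<bar>" using z z0 by (simp add: abs_div pos_less_divide_eq abs_divide)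
    \<comment> \<open>The extreme value may be the negative one; exchanging P and Q changes the
      sign.\<close>
    then consider "n - h \<le> inner ((P - Q) x) x" | "n - h \<le> inner ((Q - P) x) x"
      by (force simp: abs_if blinfun.bilinear_simps inner_diff_left split: if_splits)
    then show ?thesis
    proof cases
      case 1
      then show ?thesis using sqrt_diff_form[OF P Q _ x 1] h by (simp add: n_def c_def e_def)
    next
      case 2
      have "norm (Q - P) \<le> n" by (simp add: n_def norm_minus_commute)
      from sqrt_diff_form[OF Q P this x 2] h show ?thesis
        by (simp add: c_def e_def add.commute norm_minus_commute)
    qed
  qed
  have "((\<lambda>h. n * (n - h) - c * sqrt (2 * n * h)) \<longlongrightarrow> n * (n - 0) - c * sqrt (2 * n * 0)) (at_right 0)"
    by (intro tendsto_intros)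
  moreover have "eventually (\<lambda>h. n * (n - h) - c * sqrt (2 * n * h) \<le> e) (at_right 0)"
    using eventually_at_right_real[OF n] by eventually_elim (auto intro: step)
  ultimately have "n * (n - 0) - c * sqrt (2 * n * 0) \<le> e"
    by (rule tendsto_upperbound) simp
  then show ?thesis by (simp add: n_def e_def power2_eq_square)
qed simp

lemma tendsto_sqrt_op:
  fixes P :: "'b \<Rightarrow> 'a::{real_inner,banach} \<Rightarrow>\<^sub>L 'a"
  assumes "\<And>n. positive (P n)" "positive Q" "((\<lambda>n. P n o\<^sub>L P n) \<longlongrightarrow> Q o\<^sub>L Q) F"
  shows "(P \<longlongrightarrow> Q) F"
proof -
  have "((\<lambda>n. norm ((P n o\<^sub>L P n) - (Q o\<^sub>L Q))) \<longlongrightarrow> 0) F"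
    using assms(3) by (simp add: tendsto_norm_zero LIM_zero)
  then have s: "((\<lambda>n. sqrt (norm ((P n o\<^sub>L P n) - (Q o\<^sub>L Q)))) \<longlongrightarrow> 0) F"
    using tendsto_real_sqrt by fastforce
  have "norm (P n - Q) \<le> sqrt (norm ((P n o\<^sub>L P n) - (Q o\<^sub>L Q)))" for n
    by (rule real_le_rsqrt) (rule sqrt_diff_norm[OF assms(1,2)])
  then have "((\<lambda>n. P n - Q) \<longlongrightarrow> 0) F"
    by (intro Lim_null_comparison[OF always_eventually s] allI) simp
  then show ?thesis by (simp add: LIM_zero_iff)
qed

lemmas tendsto_compose_blinfun = bounded_bilinear.tendsto[OF bounded_bilinear_blinfun_compose]

lemma tendsto_Gop:
  fixes S :: "'b \<Rightarrow> ('a::{real_inner,banach} \<times> 'a) set"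
  assumes S: "\<And>n. sa (S n)" and T: "sa T" and F: "((\<lambda>n. Fop (S n)) \<longlongrightarrow> Fop T) Fl"
  shows "((\<lambda>n. Gop (S n)) \<longlongrightarrow> Gop T) Fl"
proof (rule tendsto_sqrt_op[OF Gop_positive[OF S] Gop_positive[OF T]])
  have eq: "Gop R o\<^sub>L Gop R = id_blinfun - (Fop R o\<^sub>L Fop R)" if R: "sa R" for R :: "('a \<times> 'a) set"
  proof (rule blinfun_eqI)
    fix x
    have "Cop R x = x - Fop R (Fop R x)" using Fop_Gop_squares[OF R, of x] by (metis add_diff_cancel_left')
    then show "(Gop R o\<^sub>L Gop R) x = (id_blinfun - (Fop R o\<^sub>L Fop R)) x" by (simp add: Gop_Gop[OF R] blinfun.bilinear_simps)
  qed
  show "((\<lambda>n. Gop (S n) o\<^sub>L Gop (S n)) \<longlongrightarrow> Gop T o\<^sub>L Gop T) Fl"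
    unfolding eq[OF S] eq[OF T] by (intro tendsto_diff tendsto_const tendsto_compose_blinfun F)
qed

text \<open>\<open>F(T + r) \<surd>K = F(T) + r G(T)\<close> with \<open>K = (F(T) + r G(T))\<^sup>2 + G(T)\<^sup>2\<close>; since \<open>K\<close> is bounded below,
  this transfers continuity from \<open>F(T)\<close> to \<open>F(T + r)\<close>.\<close>

definition Kop :: "('a::{real_inner,banach} \<times> 'a) set \<Rightarrow> real \<Rightarrow> 'a \<Rightarrow>\<^sub>L 'a" where
  "Kop T r = ((Fop T + r *\<^sub>R Gop T) o\<^sub>L (Fop T + r *\<^sub>R Gop T)) + (Gop T o\<^sub>L Gop T)"

lemma Kop_form:
  assumes T: "sa T" shows "inner (Kop T r x) x = (norm (Fop T x + r *\<^sub>R Gop T x))\<^sup>2 + (norm (Gop T x))\<^sup>2"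
proof -
  have "symm (Fop T + r *\<^sub>R Gop T)"
    using Fop_symm[OF T] Gop_symm[OF T] by (simp add: symm_def blinfun.bilinear_simps inner_add_left inner_add_right)
  then have "inner ((Fop T + r *\<^sub>R Gop T) ((Fop T + r *\<^sub>R Gop T) x)) x = (norm ((Fop T + r *\<^sub>R Gop T) x))\<^sup>2"
    by (simp only: symmD power2_norm_eq_inner)
  moreover have "inner (Gop T (Gop T x)) x = (norm (Gop T x))\<^sup>2"
    by (simp only: symmD[OF Gop_symm[OF T]] power2_norm_eq_inner)
  ultimately show ?thesis by (simp add: Kop_def blinfun.bilinear_simps inner_add_left)
qed

lemma Kop_positive: assumes T: "sa T" shows "positive (Kop T r)"
proof -
  have "symm (Fop T + r *\<^sub>R Gop T)"
    using Fop_symm[OF T] Gop_symm[OF T] by (simp add: symm_def blinfun.bilinear_simps inner_add_left inner_add_right)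
  then have "symm ((Fop T + r *\<^sub>R Gop T) o\<^sub>L (Fop T + r *\<^sub>R Gop T))" "symm (Gop T o\<^sub>L Gop T)"
    using Gop_symm[OF T] unfolding symm_def by (metis blinfun_apply_blinfun_compose)+
  then have "symm (Kop T r)"
    unfolding Kop_def symm_def by (simp add: plus_blinfun.rep_eq inner_add_left inner_add_right del: blinfun_apply_blinfun_compose)
  then show ?thesis unfolding positive_def Kop_form[OF T] by simp
qed

text \<open>With f = |F x + r G x| and g = |G x|, the triangle inequality gives |F x|^2 \<le> 2 f^2
  + 2 r^2 g^2, and |x|^2 = |F x|^2 + g^2.\<close>

lemma Kop_lower:
  assumes T: "sa T" shows "(norm x)\<^sup>2 \<le> (2 + 2 * r\<^sup>2) * inner (Kop T r x) x"
proof -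
  define f where "f = norm (Fop T x + r *\<^sub>R Gop T x)"
  define g where "g = norm (Gop T x)"
  have "norm (Fop T x) \<le> f + \<bar>r\<bar> * g"
    using norm_triangle_ineq4[of "Fop T x + r *\<^sub>R Gop T x" "r *\<^sub>R Gop T x"] by (simp add: f_def g_def)
  then have "(norm (Fop T x))\<^sup>2 \<le> (f + \<bar>r\<bar> * g)\<^sup>2" by (intro power_mono) auto
  also have "\<dots> \<le> 2 * f\<^sup>2 + 2 * (\<bar>r\<bar> * g)\<^sup>2"
    using zero_le_power2[of "f - \<bar>r\<bar> * g"] by (simp add: power2_sum power2_diff)
  finally have "(norm x)\<^sup>2 \<le> 2 * f\<^sup>2 + 2 * r\<^sup>2 * g\<^sup>2 + g\<^sup>2"
    using Fop_Gop_norm[OF T, of x] by (simp add: power_mult_distrib g_def[symmetric])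
  also have "\<dots> \<le> (2 + 2 * r\<^sup>2) * (f\<^sup>2 + g\<^sup>2)"
    using zero_le_power2[of "r * f"] zero_le_power2[of g] by (simp add: algebra_simps power_mult_distrib)
  finally show ?thesis by (simp add: Kop_form[OF T] f_def g_def)
qed

text \<open>From C(T + r) K = C(T) and commutation, the positive operators G(T + r) sqrt K and G(T)
  have the same square, hence coincide. So (G(T) x, F(T) x + r G(T) x) is the graph element of T + r
  with parameter sqrt K x.\<close>

lemma Fop_shift:
  assumes T: "sa T" shows "Fop (shift_op T r) (psqrt (Kop T r) x) = Fop T x + r *\<^sub>R Gop T x"
proof -
  let ?S = "shift_op T r" and ?R = "psqrt (Kop T r)"
  note S = sa_shift_op[OF T, of r] and K = Kop_positive[OF T, of r]
  have cF: "comm_op (Fop T) ?S" and cG: "comm_op (Gop T) ?S"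
    by (simp_all add: comm_op_shift comm_op_Fop[OF T] comm_op_Gop[OF T])
  have c1: "commutes (Fop T) (Gop ?S)" by (rule Gop_commutes[OF S cF])
  have c2: "commutes (Gop T) (Gop ?S)" by (rule Gop_commutes[OF S cG])
  have cK: "commutes (Gop ?S) (Kop T r)"
    by (simp add: commutes_iff Kop_def blinfun.bilinear_simps commutesD[OF c1] commutesD[OF c2])
  have cR: "commutes (Gop ?S) ?R" by (rule psqrt_commutes[OF K cK])
  have RR: "?R (?R x) = Kop T r x" for x by (metis psqrt_square[OF K] blinfun_apply_blinfun_compose)
  have CK: "Cop ?S (Kop T r x) = Cop T x" for x
  proof (rule Cop_Dop_unique(1)[OF S])
    show "(Cop T x, Dop T x + r *\<^sub>R Cop T x) \<in> ?S" by (rule shift_opI[OF Cop_Dop[OF T]])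
    have "(Dop T x + r *\<^sub>R Cop T x, (x - Cop T x) + r *\<^sub>R Dop T x) \<in> T"
      by (intro sa_add[OF T] sa_scale[OF T] Dop_mem[OF T] Cop_Dop[OF T])
    then have 1: "(Dop T x + r *\<^sub>R Cop T x, (x - Cop T x) + r *\<^sub>R Dop T x + r *\<^sub>R (Dop T x + r *\<^sub>R Cop T x)) \<in> ?S"
      by (rule shift_opI)
    have "Fop T (Fop T x) = x - Cop T x" using Fop_Gop_squares[OF T, of x] by (metis add_diff_cancel_right')
    then have "Kop T r x - Cop T x = (x - Cop T x) + r *\<^sub>R Dop T x + r *\<^sub>R (Dop T x + r *\<^sub>R Cop T x)"
      by (simp add: Kop_def blinfun.bilinear_simps Gop_Gop[OF T] Fop_Gop[OF T] Gop_Fop_apply[OF T])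
    then show "(Dop T x + r *\<^sub>R Cop T x, Kop T r x - Cop T x) \<in> ?S" using 1 by (simp only:)
  qed
  have "Gop ?S o\<^sub>L ?R = Gop T"
  proof (rule positive_sqrt_unique)
    show "positive (Gop ?S o\<^sub>L ?R)" by (rule positive_mult[OF Gop_positive[OF S] psqrt_positive[OF K] cR])
    show "positive (Gop T)" by (rule Gop_positive[OF T])
    show "(Gop ?S o\<^sub>L ?R) o\<^sub>L (Gop ?S o\<^sub>L ?R) = Gop T o\<^sub>L Gop T"
      by (rule blinfun_eqI) (simp add: commutesD[OF cR, symmetric] Gop_Gop[OF S] Gop_Gop[OF T] RR CK)
  qed
  then have GR: "Gop ?S (?R x) = Gop T x" by (metis blinfun_apply_blinfun_compose)
  have "(Gop T x, Fop T x + r *\<^sub>R Gop T x) \<in> ?S" by (rule shift_opI[OF Gop_Fop[OF T]])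
  then show ?thesis using Fop_eq[OF S, of "?R x"] GR by simp
qed

lemma tendsto_Fop_shift:
  fixes S :: "'b \<Rightarrow> 'a::complex_hilbert op"
  assumes S: "\<And>n. sa (S n)" and T: "sa T" and F: "((\<lambda>n. Fop (S n)) \<longlongrightarrow> Fop T) Fl" and r: "(s \<longlongrightarrow> r) Fl"
  shows "((\<lambda>n. Fop (shift_op (S n) (s n))) \<longlongrightarrow> Fop (shift_op T r)) Fl"
proof -
  note G = tendsto_Gop[OF S T F]
  define A where "A n = Fop (S n) + s n *\<^sub>R Gop (S n)" for n
  define A0 where "A0 = Fop T + r *\<^sub>R Gop T"
  have A: "(A \<longlongrightarrow> A0) Fl" unfolding A_def A0_def by (intro tendsto_intros F G r)
  have K: "((\<lambda>n. Kop (S n) (s n)) \<longlongrightarrow> Kop T r) Fl"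
    unfolding Kop_def by (intro tendsto_add tendsto_scaleR tendsto_compose_blinfun F G r)
  define R where "R n = psqrt (Kop (S n) (s n))" for n
  define R0 where "R0 = psqrt (Kop T r)"
  have R: "(R \<longlongrightarrow> R0) Fl"
    unfolding R_def R0_def
    by (rule tendsto_sqrt_op) (simp_all add: psqrt_positive psqrt_square Kop_positive S T K)
  define k where "k = 1 / sqrt (2 + 2 * r\<^sup>2)"
  have pos: "0 < 2 + 2 * r\<^sup>2" by (simp add: add_pos_nonneg)
  have k: "k > 0" using pos by (simp add: k_def)
  have sR: "symm R0" using psqrt_positive[OF Kop_positive[OF T]] by (simp add: R0_def positive_def)
  have low: "k * norm x \<le> norm (R0 x)" for x
  proof -
    have "(norm (R0 x))\<^sup>2 = inner (R0 (R0 x)) x" by (simp only: power2_norm_eq_inner symmD[OF sR])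
    also have "R0 (R0 x) = Kop T r x" unfolding R0_def by (metis psqrt_square[OF Kop_positive[OF T]] blinfun_apply_blinfun_compose)
    finally have "(norm x)\<^sup>2 \<le> (2 + 2 * r\<^sup>2) * (norm (R0 x))\<^sup>2" using Kop_lower[OF T, of x r] by simp
    then have "(k * norm x)\<^sup>2 \<le> (norm (R0 x))\<^sup>2" using pos by (simp add: k_def power_mult_distrib power_divide field_simps)
    then show ?thesis by (rule power2_le_imp_le) simp
  qed
  have surj: "\<exists>y. x = R0 y" for x
  proof -
    have "is_proj (0 :: 'a \<Rightarrow>\<^sub>L 'a)" "comm_op 0 (op_of R0)" by (simp_all add: is_proj_def comm_op_def)
    then show ?thesis using reduced_surjective[OF sa_op_of[OF sR] _ _ k, of 0 x] low by simp
  qed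
  \<comment> \<open>Writing x = R0 y, the difference is (A n - A0) y - F(S n + s n) (R n - R0) y.
    The unknown operator occurs only as a contraction, so its convergence is not
    presupposed.\<close>
  have bound: "norm (Fop (shift_op (S n) (s n)) - Fop (shift_op T r)) \<le> (norm (A n - A0) + norm (R n - R0)) / k" for n
  proof (rule norm_blinfun_bound)
    fix x
    obtain y where y: "x = R0 y" using surj by blast
    have ny: "norm y \<le> norm x / k" using low[of y] k y by (simp add: field_simps)
    let ?F = "Fop (shift_op (S n) (s n))"
    have 1: "?F (R n y) = A n y" unfolding R_def A_def using Fop_shift[OF S] by (simp add: blinfun.bilinear_simps)
    have 2: "Fop (shift_op T r) x = A0 y" unfolding y R0_def A0_def using Fop_shift[OF T] by (simp add: blinfun.bilinear_simps)
    have "(?F - Fop (shift_op T r)) x = (A n - A0) y - ?F ((R n - R0) y)"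
      by (simp add: blinfun.bilinear_simps 1 2 flip: y)
    also have "norm \<dots> \<le> norm ((A n - A0) y) + norm (?F ((R n - R0) y))" by (rule norm_triangle_ineq4)
    also have "\<dots> \<le> norm (A n - A0) * norm y + norm (R n - R0) * norm y"
    proof (intro add_mono norm_blinfun)
      have "norm (?F ((R n - R0) y)) \<le> 1 * norm ((R n - R0) y)"
        by (rule order_trans[OF norm_blinfun mult_right_mono[OF Fop_norm[OF sa_shift_op[OF S]]]]) simp
      then show "norm (?F ((R n - R0) y)) \<le> norm (R n - R0) * norm y" using norm_blinfun[of "R n - R0" y] by simp
    qed
    also have "\<dots> = (norm (A n - A0) + norm (R n - R0)) * norm y" by (simp add: distrib_right)
    also have "\<dots> \<le> (norm (A n - A0) + norm (R n - R0)) * (norm x / k)" by (intro mult_left_mono ny) auto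
    finally show "norm ((?F - Fop (shift_op T r)) x) \<le> (norm (A n - A0) + norm (R n - R0)) / k * norm x" by simp
  qed (use k in simp)
  have "((\<lambda>n. (norm (A n - A0) + norm (R n - R0)) / k) \<longlongrightarrow> (0 + 0) / k) Fl"
    using A R by (intro tendsto_intros tendsto_norm_zero LIM_zero) (use k in auto)
  then have "((\<lambda>n. (norm (A n - A0) + norm (R n - R0)) / k) \<longlongrightarrow> 0) Fl" by simp
  then have "((\<lambda>n. Fop (shift_op (S n) (s n)) - Fop (shift_op T r)) \<longlongrightarrow> 0) Fl"
    by (rule Lim_null_comparison[OF always_eventually[OF allI[OF bound]]])
  then show ?thesis by (simp add: LIM_zero_iff)
qed

text \<open>A graph element (G w, F w) of one operator is compared with the element of the other
  graph that has the same parameter w; the parametrisation is isometric.\<close>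

lemma gap_dist_le_riesz:
  assumes T: "selfadjoint T" and S: "selfadjoint S"
  shows "gap_dist T S \<le> 2 * (norm (Gop T - Gop S) + norm (Fop T - Fop S))"
proof -
  define c where "c = norm (Gop T - Gop S) + norm (Fop T - Fop S)"
  have gen: "\<exists>w\<in>S. norm (z - w) \<le> (norm (Gop T - Gop S) + norm (Fop T - Fop S)) * norm z"
    if T: "selfadjoint T" and S: "selfadjoint S" and z: "z \<in> T" for T S :: "'a op" and z
  proof -
    note sT = selfadjoint_sa[OF T] and sS = selfadjoint_sa[OF S]
    obtain x y where xy: "z = (x, y)" "(x, y) \<in> T" using z by (cases z) auto
    define w where "w = Gop T x + Fop T y"
    have z: "z = (Gop T w, Fop T w)" using Gop_surj[OF sT xy(2)] Fop_surj[OF sT xy(2)] xy(1) by (simp add: w_def)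
    have "(norm z)\<^sup>2 = (norm w)\<^sup>2" using Fop_Gop_norm[OF sT, of w] by (simp add: z norm_Pair)
    then have nz: "norm z = norm w" by simp
    have "norm (z - (Gop S w, Fop S w)) \<le> norm ((Gop T - Gop S) w) + norm ((Fop T - Fop S) w)"
      using norm_Pair_le[of "(Gop T - Gop S) w" "(Fop T - Fop S) w"] by (simp add: z blinfun.bilinear_simps)
    also have "\<dots> \<le> norm (Gop T - Gop S) * norm w + norm (Fop T - Fop S) * norm w" by (intro add_mono norm_blinfun)
    finally show ?thesis using Gop_Fop[OF sS, of w] by (auto simp: nz distrib_right intro!: bexI[of _ "(Gop S w, Fop S w)"])
  qed
  have "gap_dist T S \<le> c + c" unfolding c_def
    by (rule gap_dist_le[OF T S _ _ gen[OF T S]]) (use gen[OF S T] in \<open>auto simp: norm_minus_commute\<close>)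
  then show ?thesis by (simp add: c_def)
qed

section \<open>Operators with positive and negative essential spectrum\<close>

text \<open>For a Fredholm operator this replaces the condition on the essential spectrum in the
  definition of the starred spaces. It involves only the cut at 0, which the Riesz transform
  preserves and which a shift moves across a finite-dimensional window.\<close>

definition inf_both :: "'a::complex_hilbert op \<Rightarrow> bool" where
  "inf_both T \<longleftrightarrow> \<not> fin_dim (range (blinfun_apply (Eproj T 0))) \<and>
     \<not> fin_dim (range (blinfun_apply (id_blinfun - Eproj T 0)))"

text \<open>The spectral family of a bounded operator is trivial outside [-M, M]. If there is no
  positive essential spectrum, then, 0 being excluded by the Fredholm property, [0, M] is covered by
  finite-dimensional windows; similarly on the negative side.\<close>

lemma BFsa_star_iff:
  fixes B :: "'a::complex_hilbert \<Rightarrow>\<^sub>L 'a"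
  assumes B: "op_of B \<in> BFsa" shows "op_of B \<in> BFsa_star \<longleftrightarrow> inf_both (op_of B)"
proof -
  let ?T = "op_of B"
  have T: "selfadjoint ?T" and F: "fredholm ?T" using B by (simp_all add: BFsa_def Bsa_def Csa_def)
  note S = selfadjoint_sa[OF T]
  have ess0: "complex_of_real 0 \<notin> ess_spectrum ?T"
    unfolding ess_spectrum_of_real[OF T] using F fredholm_iff_window[OF T] by simp
  \<comment> \<open>The added 1 makes the lower form bound strict, as is required for E (- M) =
    0.\<close>
  define M where "M = norm B + 1"
  have M: "M > 0" by (simp add: M_def add_nonneg_pos)
  have form: "\<bar>inner (B x) x\<bar> \<le> norm B * (norm x)\<^sup>2" for x
    using order_trans[OF Cauchy_Schwarz_ineq2[of "B x" x] mult_right_mono[OF norm_blinfun[of B x] norm_ge_zero[of x]]]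
    by (simp add: power2_eq_square)
  have form': "inner (B x) x \<le> M * (norm x)\<^sup>2" "x \<noteq> 0 \<Longrightarrow> - M * (norm x)\<^sup>2 < inner (B x) x" for x
  proof -
    have "M * (norm x)\<^sup>2 = norm B * (norm x)\<^sup>2 + (norm x)\<^sup>2" by (simp add: M_def distrib_right)
    then show "inner (B x) x \<le> M * (norm x)\<^sup>2" using form[of x] zero_le_power2[of "norm x"] by linarith
    assume "x \<noteq> 0"
    then have "0 < (norm x)\<^sup>2" by simp
    then show "- M * (norm x)\<^sup>2 < inner (B x) x"
      using \<open>M * (norm x)\<^sup>2 = norm B * (norm x)\<^sup>2 + (norm x)\<^sup>2\<close> form[of x] by (simp only: mult_minus_left)
  qed
  have EM: "Eproj ?T M = id_blinfun"
    by (rule Eproj_unique[OF S]) (auto simp: below_def is_proj_id comm_op_id form')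
  have Em: "Eproj ?T (- M) = 0"
    using form'(2) by (intro Eproj_unique[OF S]) (auto simp: below_def is_proj_def comm_op_def)
  have Lm: "Lproj ?T (- M) = 0"
    using Lproj_Eproj_ge[OF S, of "- M" "- M"] by (intro blinfun_eqI) (simp add: Em)
  have pos: "(\<exists>r>0. complex_of_real r \<in> ess_spectrum ?T) \<longleftrightarrow> \<not> fin_dim (range (blinfun_apply (id_blinfun - Eproj ?T 0)))"
  proof
    assume "\<exists>r>0. complex_of_real r \<in> ess_spectrum ?T"
    then obtain r where r: "r > 0" "complex_of_real r \<in> ess_spectrum ?T" by blast
    show "\<not> fin_dim (range (blinfun_apply (id_blinfun - Eproj ?T 0)))"
    proof
      assume fin: "fin_dim (range (blinfun_apply (id_blinfun - Eproj ?T 0)))"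
      have "fin_window ?T (r / 2) (2 * r)" unfolding fin_window_def
      proof (rule fin_dim_subset[OF fin], rule subsetI)
        fix x assume "x \<in> range (blinfun_apply (Eproj ?T (2 * r) - Lproj ?T (r / 2)))"
        then have "Lproj ?T (r / 2) x = 0"
          using is_proj_range[OF LE_is_proj[OF S]] LE_fix[OF S, of "r / 2" "2 * r"] r(1) by auto
        then have "(id_blinfun - Eproj ?T 0) x = x"
          using Eproj_Lproj_less[OF S, of 0 "r / 2" x] r(1) by (simp add: blinfun.bilinear_simps)
        then show "x \<in> range (blinfun_apply (id_blinfun - Eproj ?T 0))" by (metis rangeI)
      qed
      then show False using not_ess_if_fin_window[OF T, of "r / 2" "2 * r" r] r by simp
    qed
  next
    assume inf: "\<not> fin_dim (range (blinfun_apply (id_blinfun - Eproj ?T 0)))"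
    show "\<exists>r>0. complex_of_real r \<in> ess_spectrum ?T"
    proof (rule ccontr)
      assume "\<not> ?thesis"
      then have "fin_window ?T 0 M"
        using ess0 M by (intro fin_window_if_not_ess[OF T]) (auto simp: le_less)
      moreover have "(id_blinfun - Eproj ?T 0) x = (Eproj ?T M - Lproj ?T 0) ((id_blinfun - Eproj ?T 0) x)" for x
        by (simp add: EM blinfun.bilinear_simps Lproj_Eproj_ge[OF S])
      then have "range (blinfun_apply (id_blinfun - Eproj ?T 0)) \<subseteq> range (blinfun_apply (Eproj ?T M - Lproj ?T 0))" by (metis image_subsetI rangeI)
      ultimately show False using inf fin_dim_subset unfolding fin_window_def by blast
    qed
  qed
  have neg: "(\<exists>r<0. complex_of_real r \<in> ess_spectrum ?T) \<longleftrightarrow> \<not> fin_dim (range (blinfun_apply (Eproj ?T 0)))"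
  proof
    assume "\<exists>r<0. complex_of_real r \<in> ess_spectrum ?T"
    then obtain r where r: "r < 0" "complex_of_real r \<in> ess_spectrum ?T" by blast
    show "\<not> fin_dim (range (blinfun_apply (Eproj ?T 0)))"
    proof
      assume fin: "fin_dim (range (blinfun_apply (Eproj ?T 0)))"
      have "fin_window ?T (2 * r) (r / 2)" unfolding fin_window_def
      proof (rule fin_dim_subset[OF fin], rule subsetI)
        fix x assume "x \<in> range (blinfun_apply (Eproj ?T (r / 2) - Lproj ?T (2 * r)))"
        then have "Eproj ?T (r / 2) x = x"
          using is_proj_range[OF LE_is_proj[OF S]] LE_fix[OF S, of "2 * r" "r / 2"] r(1) by auto
        then have "Eproj ?T 0 x = x" using Eproj_mono(2)[OF S, of "r / 2" 0 x] r(1) by simp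
        then show "x \<in> range (blinfun_apply (Eproj ?T 0))" by (metis rangeI)
      qed
      then show False using not_ess_if_fin_window[OF T, of "2 * r" "r / 2" r] r by simp
    qed
  next
    assume inf: "\<not> fin_dim (range (blinfun_apply (Eproj ?T 0)))"
    show "\<exists>r<0. complex_of_real r \<in> ess_spectrum ?T"
    proof (rule ccontr)
      assume "\<not> ?thesis"
      then have "fin_window ?T (- M) 0"
        using ess0 M by (intro fin_window_if_not_ess[OF T]) (auto simp: le_less)
      then show False using inf by (simp add: fin_window_def Lm)
    qed
  qed
  show ?thesis using B pos neg unfolding BFsa_star_def inf_both_def by blast
qed

text \<open>F has the sign of T: with H the root of G, <F x, x> = <T H x, H x> for x in the domain.
  Density extends this only with non-strict inequalities, so strict positivity on the kernel of the
  projection needs a separate argument.\<close>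

lemma Eproj_Fop:
  fixes T :: "'a::complex_hilbert op"
  assumes T: "selfadjoint T" shows "Eproj (op_of (Fop T)) 0 = Eproj T 0"
proof (rule Eproj_unique[OF sa_op_of[OF Fop_symm[OF selfadjoint_sa[OF T]]]])
  note S = selfadjoint_sa[OF T]
  let ?P = "Eproj T 0" and ?F = "Fop T"
  note P = Eproj_is_proj[OF S, of 0]
  have cPF: "commutes ?P ?F" by (rule Fop_commutes[OF S Eproj_comm_op[OF S]])
  define H where "H = psqrt (Gop T)"
  note H = psqrt_positive[OF Gop_positive[OF S], folded H_def]
  have sH: "symm H" using H by (simp add: positive_def)
  have HH: "H (H x) = Gop T x" for x unfolding H_def by (metis psqrt_square[OF Gop_positive[OF S]] blinfun_apply_blinfun_compose)
  have cH: "commutes B H" if "comm_op B T" for B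
    unfolding H_def by (rule psqrt_commutes[OF Gop_positive[OF S] Gop_commutes[OF S that]])
  have HT: "comm_op H T"
    by (rule comm_opI[OF S cH[OF comm_op_Cop[OF S], symmetric] cH[OF comm_op_Dop[OF S], symmetric]])
  have form: "inner (?F x) x = inner (H y) (H x)" if xy: "(x, y) \<in> T" for x y
  proof -
    have "?F x = Gop T y" using Fop_eq[OF S comm_opD[OF comm_op_Gop[OF S] xy]] .
    then show ?thesis by (simp add: symmD[OF sH] flip: HH)
  qed
  have PH: "?P (H x) = H (?P x)" for x by (rule commutesD[OF cH[OF Eproj_comm_op[OF S]]])
  have low: "inner (?F x) x \<le> 0" if x: "?P x = x" for x
  proof -
    have "closed {u. inner (?F (?P u)) (?P u) \<le> 0}" by (intro closed_Collect_le continuous_intros)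
    moreover have "Domain T \<subseteq> {u. inner (?F (?P u)) (?P u) \<le> 0}"
    proof clarify
      fix u v assume "(u, v) \<in> T"
      then have uv: "(?P u, ?P v) \<in> T" by (rule comm_opD[OF Eproj_comm_op[OF S]])
      have "inner (H (?P v)) (H (?P u)) \<le> 0 * (norm (H (?P u)))\<^sup>2"
        by (rule Eproj_le[OF S comm_opD[OF HT uv]]) (simp add: PH is_proj_idem[OF P])
      then show "inner (?F (?P u)) (?P u) \<le> 0" by (simp add: form[OF uv])
    qed
    ultimately have "closure (Domain T) \<subseteq> {u. inner (?F (?P u)) (?P u) \<le> 0}" by (rule closure_minimal[rotated])
    then have "inner (?F (?P x)) (?P x) \<le> 0" using sa_dense[OF S] by auto
    then show ?thesis by (simp add: x)
  qed
  define Q where "Q = id_blinfun - ?P"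
  have Qx: "Q x = x - ?P x" for x by (simp add: Q_def blinfun.bilinear_simps)
  have PQ: "?P (Q x) = 0" for x by (simp add: Qx blinfun.bilinear_simps is_proj_idem[OF P])
  have Q: "is_proj Q" unfolding Q_def by (rule is_proj_compl[OF P])
  have QT: "comm_op Q T" unfolding Q_def by (rule comm_op_diff[OF S comm_op_id Eproj_comm_op[OF S]])
  have up: "0 \<le> inner (?F (Q x)) (Q x)" for x
  proof -
    have "closed {u. 0 \<le> inner (?F (Q u)) (Q u)}" by (intro closed_Collect_le continuous_intros)
    moreover have "Domain T \<subseteq> {u. 0 \<le> inner (?F (Q u)) (Q u)}"
    proof clarify
      fix u v assume "(u, v) \<in> T"
      then have uv: "(Q u, Q v) \<in> T" by (rule comm_opD[OF QT])
      have "Eproj T 0 (H (Q u)) = 0" by (simp add: PH PQ)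
      then have "0 \<le> inner (H (Q v)) (H (Q u))"
        using Eproj_gr[OF S comm_opD[OF HT uv], of 0] by (cases "H (Q u) = 0") auto
      then show "0 \<le> inner (?F (Q u)) (Q u)" by (simp add: form[OF uv])
    qed
    ultimately have "closure (Domain T) \<subseteq> {u. 0 \<le> inner (?F (Q u)) (Q u)}" by (rule closure_minimal[rotated])
    then show ?thesis using sa_dense[OF S] by auto
  qed
  have cQF: "commutes Q ?F" by (rule Fop_commutes[OF S QT])
  \<comment> \<open>For a positive operator a vanishing form value gives a null vector; a null
    vector of F in the range of Q yields G x = 0 and hence x = 0.\<close>
  have posFQ: "positive (?F o\<^sub>L Q)"
    unfolding positive_def symm_def
  proof (intro conjI allI)
    fix x y
    show "inner ((?F o\<^sub>L Q) x) y = inner x ((?F o\<^sub>L Q) y)"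
      by (simp add: symmD[OF Fop_symm[OF S]] is_proj_sym[OF Q] commutesD[OF cQF])
    have "inner (?F (Q x)) x = inner (?F (Q x)) (Q x)"
      using is_proj_sym[OF Q, of "?F (Q x)" x] by (simp add: commutesD[OF cQF] is_proj_idem[OF Q])
    then show "0 \<le> inner ((?F o\<^sub>L Q) x) x" using up[of x] by simp
  qed
  have strict: "0 < inner (?F x) x" if x: "?P x = 0" "x \<noteq> 0" for x
  proof (rule ccontr)
    assume "\<not> 0 < inner (?F x) x"
    moreover have Qxx: "Q x = x" using x by (simp add: Qx)
    ultimately have "inner ((?F o\<^sub>L Q) x) x = 0" using up[of x] by simp
    then have "(?F o\<^sub>L Q) x = 0" by (rule positive_inner_0[OF posFQ])
    then have "?F x = 0" by (simp add: Qxx)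
    then have g: "(Gop T x, 0) \<in> T" using Gop_Fop[OF S, of x] by simp
    have "?P (Gop T x) = 0" using commutesD[OF Gop_commutes[OF S Eproj_comm_op[OF S]], of 0 x] x(1) by simp
    then have "Gop T x = 0" using Eproj_gr[OF S g, of 0] by fastforce
    then have "Cop T x = 0" using Gop_Gop[OF S, of x] by simp
    then show False using Cop_eq_0[OF S] x(2) by blast
  qed
  show "below (op_of (Fop T)) 0 (Eproj T 0)"
    unfolding below_def comm_op_op_of using P cPF low strict by auto
qed

text \<open>F^2 = 1 - C, and C is at most 1/(1 + e^2) off the window [-e, e]; so F is bounded below
  there by the constant \<open>k\<close>.\<close>

lemma riesz_fredholm:
  fixes T :: "'a::complex_hilbert op"
  assumes T: "T \<in> CFsa" shows "op_of (Fop T) \<in> BFsa"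
proof -
  have sT: "selfadjoint T" and F: "fredholm T" using T by (simp_all add: CFsa_def Csa_def)
  note S = selfadjoint_sa[OF sT]
  have Bs: "op_of (Fop T) \<in> Bsa" unfolding Bsa_iff using Fop_symm[OF S] clinear_Fop[OF sT] by blast
  obtain e where e: "e > 0" "fin_window T (- e) e" using F fredholm_iff_window[OF sT] by blast
  define k where "k = sqrt (1 - 1 / (1 + e\<^sup>2))"
  have e2: "0 < e\<^sup>2" using e(1) by simp
  have "fredholm (op_of (Fop T))"
  proof (rule fredholm_if_reduced)
    show "selfadjoint (op_of (Fop T))" using Bs by (simp add: Bsa_def Csa_def)
    show "is_proj (Wproj T e)" by (rule Wproj_is_proj[OF S]) (use e in simp)
    show "comm_op (Wproj T e) (op_of (Fop T))" unfolding comm_op_op_of by (rule Fop_commutes[OF S Wproj_comm_op[OF S]])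
    show "fin_dim (range (blinfun_apply (Wproj T e)))" using e(2) by (simp add: fin_window_def Wproj_def)
    show "k > 0" using e2 by (simp add: k_def field_simps add_pos_pos)
    fix x y assume xy: "(x, y) \<in> op_of (Fop T)" "Wproj T e x = 0"
    have "inner (Cop T x) x \<le> norm (Cop T x) * norm x" by (rule norm_cauchy_schwarz)
    also have "\<dots> \<le> (norm x / (1 + e\<^sup>2)) * norm x"
      using Cop_outside[OF S _ xy(2)] e(1) by (intro mult_right_mono) auto
    finally have "inner (Cop T x) x \<le> (norm x)\<^sup>2 / (1 + e\<^sup>2)" by (simp add: power2_eq_square)
    moreover have "(norm (Fop T x))\<^sup>2 = (norm x)\<^sup>2 - inner (Cop T x) x"
      using Fop_Gop_norm[OF S, of x] symmD[OF Gop_symm[OF S], of "Gop T x" x]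
      by (simp add: Gop_Gop[OF S] power2_norm_eq_inner)
    ultimately have "(1 - 1 / (1 + e\<^sup>2)) * (norm x)\<^sup>2 \<le> (norm (Fop T x))\<^sup>2" by (simp add: left_diff_distrib)
    moreover have "1 / (1 + e\<^sup>2) \<le> 1" using e2 by (subst divide_le_eq_1_pos) (simp_all add: add_pos_pos)
    then have "0 \<le> 1 - 1 / (1 + e\<^sup>2)" by simp
    ultimately have "(k * norm x)\<^sup>2 \<le> (norm (Fop T x))\<^sup>2" by (simp add: k_def power_mult_distrib)
    then show "k * norm x \<le> norm y" using xy(1) by (auto intro: power2_le_imp_le)
  qed
  then show ?thesis using Bs by (simp add: BFsa_def)
qed

lemma CFsa_star_iff: "T \<in> CFsa_star \<longleftrightarrow> T \<in> CFsa \<and> inf_both T"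
proof -
  have "riesz_transform T \<in> BFsa_star \<longleftrightarrow> inf_both T" if T: "T \<in> CFsa"
  proof -
    have sT: "selfadjoint T" using T by (simp add: CFsa_def Csa_def)
    show ?thesis
      using BFsa_star_iff[OF riesz_fredholm[OF T]] by (simp add: riesz_transform_eq[OF sT] inf_both_def Eproj_Fop[OF sT])
  qed
  then show ?thesis unfolding CFsa_star_def by blast
qed

lemma BFsa_star_iff': "T \<in> BFsa_star \<longleftrightarrow> T \<in> BFsa \<and> inf_both T"
proof
  assume T: "T \<in> BFsa_star"
  then have TB: "T \<in> BFsa" by (simp add: BFsa_star_def)
  then obtain B where B: "T = op_of B" by (auto simp: BFsa_def Bsa_iff)
  show "T \<in> BFsa \<and> inf_both T" using BFsa_star_iff[of B] T TB unfolding B by simp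
next
  assume T: "T \<in> BFsa \<and> inf_both T"
  then obtain B where B: "T = op_of B" by (auto simp: BFsa_def Bsa_iff)
  show "T \<in> BFsa_star" using BFsa_star_iff[of B] T unfolding B by simp
qed

lemma fin_dim_Eproj_window:
  assumes T: "selfadjoint T" and ab: "a \<le> b" and fin: "fin_window T a b"
  shows "fin_dim (range (blinfun_apply (Eproj T a))) \<longleftrightarrow> fin_dim (range (blinfun_apply (Eproj T b)))"
    and "fin_dim (range (blinfun_apply (id_blinfun - Eproj T a))) \<longleftrightarrow> fin_dim (range (blinfun_apply (id_blinfun - Eproj T b)))"
proof -
  note S = selfadjoint_sa[OF T] and W = fin[unfolded fin_window_def]
  show "fin_dim (range (blinfun_apply (Eproj T a))) \<longleftrightarrow> fin_dim (range (blinfun_apply (Eproj T b)))"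
  proof
    assume Fa: "fin_dim (range (blinfun_apply (Eproj T a)))"
    show "fin_dim (range (blinfun_apply (Eproj T b)))"
    proof (rule fin_dim_sum[OF Fa W])
      fix x assume "x \<in> range (blinfun_apply (Eproj T b))"
      then obtain z where "x = Eproj T b z" by blast
      then have "x = Eproj T a (Lproj T a z) + (Eproj T b - Lproj T a) z"
        by (simp add: blinfun.bilinear_simps Eproj_Lproj_ge[OF S])
      then show "\<exists>u\<in>range (blinfun_apply (Eproj T a)). \<exists>v\<in>range (blinfun_apply (Eproj T b - Lproj T a)). x = u + v" by blast
    qed
  next
    assume Fb: "fin_dim (range (blinfun_apply (Eproj T b)))"
    have "Eproj T a x = Eproj T b (Eproj T a x)" for x by (simp add: Eproj_mono[OF S ab])
    then have "range (blinfun_apply (Eproj T a)) \<subseteq> range (blinfun_apply (Eproj T b))" by (metis image_subsetI rangeI)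
    then show "fin_dim (range (blinfun_apply (Eproj T a)))" by (rule fin_dim_subset[OF Fb])
  qed
  show "fin_dim (range (blinfun_apply (id_blinfun - Eproj T a))) \<longleftrightarrow> fin_dim (range (blinfun_apply (id_blinfun - Eproj T b)))"
  proof
    assume Fa: "fin_dim (range (blinfun_apply (id_blinfun - Eproj T a)))"
    have "(id_blinfun - Eproj T b) x = (id_blinfun - Eproj T a) ((id_blinfun - Eproj T b) x)" for x
      by (simp add: blinfun.bilinear_simps Eproj_mono[OF S ab])
    then have "range (blinfun_apply (id_blinfun - Eproj T b)) \<subseteq> range (blinfun_apply (id_blinfun - Eproj T a))"
      by (metis image_subsetI rangeI)
    then show "fin_dim (range (blinfun_apply (id_blinfun - Eproj T b)))" by (rule fin_dim_subset[OF Fa])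
  next
    assume Fb: "fin_dim (range (blinfun_apply (id_blinfun - Eproj T b)))"
    show "fin_dim (range (blinfun_apply (id_blinfun - Eproj T a)))"
    proof (rule fin_dim_sum[OF Fb W])
      fix x assume "x \<in> range (blinfun_apply (id_blinfun - Eproj T a))"
      then obtain z where "x = z - Eproj T a z" by (auto simp: blinfun.bilinear_simps)
      then have "x = (id_blinfun - Eproj T b) z + (Eproj T b - Lproj T a) (z - Eproj T a z)"
        by (simp add: blinfun.bilinear_simps Eproj_mono[OF S ab] Lproj_Eproj_ge[OF S])
      then show "\<exists>u\<in>range (blinfun_apply (id_blinfun - Eproj T b)). \<exists>v\<in>range (blinfun_apply (Eproj T b - Lproj T a)). x = u + v" by blast
    qed
  qed
qed

text \<open>The shift moves the cut from 0 to -r; the two spectral subspaces differ by a window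
  without essential spectrum, which is finite-dimensional.\<close>

lemma inf_both_shift:
  assumes T: "selfadjoint T" and ess: "\<And>c. c \<in> closed_segment 0 (- r) \<Longrightarrow> complex_of_real c \<notin> ess_spectrum T"
    and inf: "inf_both T"
  shows "inf_both (shift_op T r)"
proof -
  have eq: "Eproj (shift_op T r) 0 = Eproj T (- r)" by (simp add: Eproj_shift[OF selfadjoint_sa[OF T]])
  consider "0 \<le> - r" | "- r \<le> 0" by linarith
  then show ?thesis
  proof cases
    case 1
    then have "fin_window T 0 (- r)"
      by (intro fin_window_if_not_ess[OF T 1] ess) (simp add: closed_segment_eq_real_ivl)
    note W = fin_dim_Eproj_window[OF T 1 this]
    show ?thesis using inf unfolding inf_both_def eq W .
  next
    case 2
    then have "fin_window T (- r) 0"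
      by (intro fin_window_if_not_ess[OF T 2] ess) (simp add: closed_segment_eq_real_ivl)
    note W = fin_dim_Eproj_window[OF T 2 this]
    show ?thesis using inf unfolding inf_both_def eq W .
  qed
qed

section \<open>The three metric spaces\<close>

text \<open>What the argument needs to know about the three topologies. A filter on \<open>real \<times> real\<close> suffices,
  since the operators will depend on a parameter and a shift.\<close>

locale operator_space = Metric_space M d for M :: "'a::complex_hilbert op set" and d +
  assumes M_CFsa: "M \<subseteq> CFsa"
    and M_shift: "T \<in> M \<Longrightarrow> (\<And>c. c \<in> closed_segment 0 (- r) \<Longrightarrow> complex_of_real c \<notin> ess_spectrum T) \<Longrightarrow>
      shift_op T r \<in> M"
    and shift_tendsto: "\<And>S s F. (\<And>x :: real \<times> real. S x \<in> M) \<Longrightarrow> T \<in> M \<Longrightarrow> (\<And>x. shift_op (S x) (s x) \<in> M) \<Longrightarrow>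
      shift_op T r \<in> M \<Longrightarrow> ((\<lambda>x. d (S x) T) \<longlongrightarrow> 0) F \<Longrightarrow> (s \<longlongrightarrow> r) F \<Longrightarrow>
      ((\<lambda>x. d (shift_op (S x) (s x)) (shift_op T r)) \<longlongrightarrow> 0) F"
    and gap_tendsto: "\<And>S F. (\<And>x :: real. S x \<in> M) \<Longrightarrow> T \<in> M \<Longrightarrow> ((\<lambda>x. d (S x) T) \<longlongrightarrow> 0) F \<Longrightarrow>
      ((\<lambda>x. gap_dist (S x) T) \<longlongrightarrow> 0) F"

lemma CFsa_selfadjoint: "T \<in> CFsa \<Longrightarrow> selfadjoint T" and CFsa_fredholm: "T \<in> CFsa \<Longrightarrow> fredholm T"
  by (simp_all add: CFsa_def Csa_def)

lemma CFsa_shift_iff: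
  assumes "selfadjoint T" shows "shift_op T r \<in> CFsa \<longleftrightarrow> complex_of_real (- r) \<notin> ess_spectrum T"
proof -
  have "plus_scalar T (- complex_of_real (- r)) = shift_op T r" by (simp add: plus_scalar_of_real)
  then show ?thesis using selfadjoint_shift[OF assms] by (simp add: CFsa_def Csa_def ess_spectrum_def)
qed

lemma gap_operator_space: "operator_space CFsa gap_dist"
proof (intro operator_space.intro operator_space_axioms.intro)
  show "Metric_space CFsa gap_dist" by (rule Metric_space_gap)
  fix T :: "'a op" and r
  assume T: "T \<in> CFsa"
  note sT = CFsa_selfadjoint[OF T]
  show "shift_op T r \<in> CFsa" if "\<And>c. c \<in> closed_segment 0 (- r) \<Longrightarrow> complex_of_real c \<notin> ess_spectrum T"
    using that[of "- r"] CFsa_shift_iff[OF sT] by simp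
  fix S :: "real \<times> real \<Rightarrow> 'a op" and s :: "real \<times> real \<Rightarrow> real" and F
  assume S: "\<And>x. S x \<in> CFsa" and lim: "((\<lambda>x. gap_dist (S x) T) \<longlongrightarrow> 0) F" "(s \<longlongrightarrow> r) F"
  define m where "m = \<bar>r\<bar> + 1"
  have "eventually (\<lambda>x. dist (s x) r < 1) F" using lim(2) by (rule tendstoD) simp
  then have ev: "eventually (\<lambda>x. norm (gap_dist (shift_op (S x) (s x)) (shift_op T r)) \<le>
      2 * ((1 + m) * ((1 + m) * gap_dist (S x) T + \<bar>s x - r\<bar>))) F"
  proof eventually_elim
    case (elim x)
    then have "\<bar>s x\<bar> \<le> m" "\<bar>r\<bar> \<le> m" by (auto simp: m_def dist_real_def)
    from gap_dist_shift[OF CFsa_selfadjoint[OF S] sT this] show ?case by (simp add: gap_dist_gproj)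
  qed
  have "((\<lambda>x. 2 * ((1 + m) * ((1 + m) * gap_dist (S x) T + \<bar>s x - r\<bar>))) \<longlongrightarrow>
      2 * ((1 + m) * ((1 + m) * 0 + \<bar>r - r\<bar>))) F"
    by (intro tendsto_intros lim)
  then have "((\<lambda>x. 2 * ((1 + m) * ((1 + m) * gap_dist (S x) T + \<bar>s x - r\<bar>))) \<longlongrightarrow> 0) F" by simp
  then show "((\<lambda>x. gap_dist (shift_op (S x) (s x)) (shift_op T r)) \<longlongrightarrow> 0) F" by (rule Lim_null_comparison[OF ev])
qed simp_all

lemma tendsto_Fop_iff:
  assumes S: "\<And>x. selfadjoint (S x)" and T: "selfadjoint T"
  shows "((\<lambda>x. riesz_dist (S x) T) \<longlongrightarrow> 0) F \<longleftrightarrow> ((\<lambda>x. Fop (S x)) \<longlongrightarrow> Fop T) F"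
  unfolding riesz_dist_eq[OF S T] tendsto_norm_zero_iff LIM_zero_iff ..

lemma riesz_operator_space: "operator_space (CFsa_star :: 'a::complex_hilbert op set) riesz_dist"
proof (intro operator_space.intro operator_space_axioms.intro)
  have sa: "selfadjoint T" if "T \<in> CFsa_star" for T :: "'a op"
    by (rule CFsa_selfadjoint) (use that in \<open>simp add: CFsa_star_def\<close>)
  show "Metric_space (CFsa_star :: 'a op set) riesz_dist"
  proof
    show "0 \<le> riesz_dist T S" "riesz_dist T S = riesz_dist S T" for T S :: "'a op"
      by (simp_all add: riesz_dist_def norm_dist_def norm_minus_commute)
    show "riesz_dist T S = 0 \<longleftrightarrow> T = S" if "T \<in> CFsa_star" "S \<in> CFsa_star" for T S :: "'a op"
      using Fop_inject[OF selfadjoint_sa[OF sa[OF that(1)]] selfadjoint_sa[OF sa[OF that(2)]]]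
      by (auto simp: riesz_dist_eq[OF sa sa] that)
    show "riesz_dist T U \<le> riesz_dist T S + riesz_dist S U" for T S U :: "'a op"
      using norm_triangle_ineq[of "blinfun_of (riesz_transform T) - blinfun_of (riesz_transform S)"
        "blinfun_of (riesz_transform S) - blinfun_of (riesz_transform U)"] by (simp add: riesz_dist_def norm_dist_def)
  qed
  show "CFsa_star \<subseteq> (CFsa :: 'a op set)" by (auto simp: CFsa_star_def)
  fix T :: "'a op" and r
  assume T: "T \<in> CFsa_star"
  note sT = sa[OF T]
  show "shift_op T r \<in> CFsa_star" if ess: "\<And>c. c \<in> closed_segment 0 (- r) \<Longrightarrow> complex_of_real c \<notin> ess_spectrum T"
    using ess[of "- r"] T inf_both_shift[OF sT ess] unfolding CFsa_star_iff CFsa_shift_iff[OF sT] by simp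
  show "((\<lambda>x. riesz_dist (shift_op (S x) (s x)) (shift_op T r)) \<longlongrightarrow> 0) F"
    if S: "\<And>x. S x \<in> CFsa_star" and lim: "((\<lambda>x. riesz_dist (S x) T) \<longlongrightarrow> 0) F" "(s \<longlongrightarrow> r) F"
    for S :: "real \<times> real \<Rightarrow> 'a op" and s and F
    using lim(1) unfolding tendsto_Fop_iff[OF sa[OF S] sT]
      tendsto_Fop_iff[OF selfadjoint_shift[OF sa[OF S]] selfadjoint_shift[OF sT]]
    by (rule tendsto_Fop_shift[OF selfadjoint_sa[OF sa[OF S]] selfadjoint_sa[OF sT] _ lim(2)])
  show "((\<lambda>x. gap_dist (S x) T) \<longlongrightarrow> 0) F"
    if S: "\<And>x. S x \<in> CFsa_star" and lim: "((\<lambda>x. riesz_dist (S x) T) \<longlongrightarrow> 0) F" for S :: "real \<Rightarrow> 'a op" and F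
  proof -
    have F: "((\<lambda>x. Fop (S x)) \<longlongrightarrow> Fop T) F" using lim unfolding tendsto_Fop_iff[OF sa[OF S] sT] .
    note G = tendsto_Gop[OF selfadjoint_sa[OF sa[OF S]] selfadjoint_sa[OF sT] F]
    have "((\<lambda>x. 2 * (norm (Gop (S x) - Gop T) + norm (Fop (S x) - Fop T))) \<longlongrightarrow> 2 * (0 + 0)) F"
      by (intro tendsto_mult tendsto_const tendsto_add tendsto_norm_zero LIM_zero F G)
    then have lim: "((\<lambda>x. 2 * (norm (Gop (S x) - Gop T) + norm (Fop (S x) - Fop T))) \<longlongrightarrow> 0) F" by simp
    have "norm (gap_dist (S x) T) \<le> 2 * (norm (Gop (S x) - Gop T) + norm (Fop (S x) - Fop T))" for x
      using gap_dist_le_riesz[OF sa[OF S] sT, of x] by (simp add: gap_dist_gproj)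
    then show ?thesis by (rule Lim_null_comparison[OF always_eventually[OF allI] lim])
  qed
qed

lemma BFsa_op_of: assumes "T \<in> BFsa" shows "op_of (blinfun_of T) = T"
  using assms by (auto simp: BFsa_def Bsa_iff blinfun_of_op_of)

lemma gap_dist_le_norm:
  assumes T: "selfadjoint (op_of A)" and S: "selfadjoint (op_of B)"
  shows "gap_dist (op_of A) (op_of B) \<le> 2 * norm (A - B)"
proof -
  have gen: "\<exists>w\<in>op_of B. norm (z - w) \<le> norm (A - B) * norm z" if z: "z \<in> op_of A" for A B :: "'a \<Rightarrow>\<^sub>L 'a" and z
  proof -
    obtain x where x: "z = (x, A x)" using z by (auto simp: op_of_def)
    have "norm (z - (x, B x)) = norm ((A - B) x)" by (simp add: x norm_Pair blinfun.bilinear_simps)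
    also have "\<dots> \<le> norm (A - B) * norm x" by (rule norm_blinfun)
    also have "\<dots> \<le> norm (A - B) * norm z" unfolding x by (rule mult_left_mono[OF norm_fst_le]) simp
    finally show ?thesis by (intro bexI[of _ "(x, B x)"]) simp_all
  qed
  have "gap_dist (op_of A) (op_of B) \<le> norm (A - B) + norm (A - B)"
    by (rule gap_dist_le[OF T S _ _ gen]) (use gen[of _ B A] in \<open>simp_all add: norm_minus_commute\<close>)
  then show ?thesis by simp
qed

lemma norm_operator_space: "operator_space (BFsa_star :: 'a::complex_hilbert op set) norm_dist"
proof (intro operator_space.intro operator_space_axioms.intro)
  have op: "op_of (blinfun_of T) = T" if "T \<in> BFsa_star" for T :: "'a op"
    using that by (simp add: BFsa_star_def BFsa_op_of)
  have sa: "selfadjoint T" if "T \<in> BFsa_star" for T :: "'a op"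
    using that by (simp add: BFsa_star_def BFsa_def Bsa_def Csa_def)
  have eq: "BFsa = Bsa \<inter> (CFsa :: 'a op set)" by (auto simp: BFsa_def CFsa_def Bsa_def)
  have bs: "blinfun_of (shift_op T r) = blinfun_of T + r *\<^sub>R id_blinfun" if "T \<in> BFsa_star" for T :: "'a op" and r
    by (subst op[OF that, symmetric]) (simp only: shift_op_of blinfun_of_op_of)
  show "Metric_space (BFsa_star :: 'a op set) norm_dist"
  proof
    show "0 \<le> norm_dist T S" "norm_dist T S = norm_dist S T" for T S :: "'a op"
      by (simp_all add: norm_dist_def norm_minus_commute)
    show "norm_dist T S = 0 \<longleftrightarrow> T = S" if "T \<in> BFsa_star" "S \<in> BFsa_star" for T S :: "'a op"
    proof
      assume "norm_dist T S = 0"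
      then have "blinfun_of T = blinfun_of S" by (simp add: norm_dist_def)
      then have "op_of (blinfun_of T) = op_of (blinfun_of S)" by (rule arg_cong)
      then show "T = S" by (simp only: op that)
    qed (simp add: norm_dist_def)
    show "norm_dist T U \<le> norm_dist T S + norm_dist S U" for T S U :: "'a op"
      using norm_triangle_ineq[of "blinfun_of T - blinfun_of S" "blinfun_of S - blinfun_of U"] by (simp add: norm_dist_def)
  qed
  show "BFsa_star \<subseteq> (CFsa :: 'a op set)" by (auto simp: BFsa_star_def eq)
  fix T :: "'a op" and r
  assume T: "T \<in> BFsa_star"
  note sT = sa[OF T]
  show "shift_op T r \<in> BFsa_star" if ess: "\<And>c. c \<in> closed_segment 0 (- r) \<Longrightarrow> complex_of_real c \<notin> ess_spectrum T"
  proof -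
    have B: "T \<in> Bsa" "inf_both T" using T by (auto simp: BFsa_star_iff' BFsa_def)
    then obtain B where B: "symm B" "clinear_blinfun B" "T = op_of B" unfolding Bsa_iff by blast
    have "symm (B + r *\<^sub>R id_blinfun)" using symmD[OF B(1)]
      by (simp add: symm_def blinfun.bilinear_simps inner_add_left inner_add_right)
    moreover have "clinear_blinfun (B + r *\<^sub>R id_blinfun)" using B(2)
      by (simp add: clinear_blinfun_def blinfun.bilinear_simps scaleC_add_right scaleC_scaleR)
    ultimately have "shift_op T r \<in> Bsa" unfolding B(3) shift_op_of Bsa_iff by blast
    moreover have "shift_op T r \<in> CFsa" using ess[of "- r"] unfolding CFsa_shift_iff[OF sT] by simp
    moreover have "inf_both (shift_op T r)" using T inf_both_shift[OF sT ess] by (simp add: BFsa_star_iff')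
    ultimately show ?thesis unfolding BFsa_star_iff' eq by simp
  qed
  show "((\<lambda>x. norm_dist (shift_op (S x) (s x)) (shift_op T r)) \<longlongrightarrow> 0) F"
    if S: "\<And>x. S x \<in> BFsa_star" and lim: "((\<lambda>x. norm_dist (S x) T) \<longlongrightarrow> 0) F" "(s \<longlongrightarrow> r) F"
    for S :: "real \<times> real \<Rightarrow> 'a op" and s and F
  proof -
    have "((\<lambda>x. blinfun_of (S x)) \<longlongrightarrow> blinfun_of T) F"
      using lim(1) unfolding norm_dist_def tendsto_norm_zero_iff LIM_zero_iff .
    then have "((\<lambda>x. blinfun_of (S x) + s x *\<^sub>R id_blinfun) \<longlongrightarrow> blinfun_of T + r *\<^sub>R id_blinfun) F"
      by (intro tendsto_intros lim(2))
    then show ?thesis unfolding norm_dist_def tendsto_norm_zero_iff LIM_zero_iff bs[OF S] bs[OF T] .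
  qed
  show "((\<lambda>x. gap_dist (S x) T) \<longlongrightarrow> 0) F"
    if S: "\<And>x. S x \<in> BFsa_star" and lim: "((\<lambda>x. norm_dist (S x) T) \<longlongrightarrow> 0) F" for S :: "real \<Rightarrow> 'a op" and F
  proof -
    have "((\<lambda>x. 2 * norm_dist (S x) T) \<longlongrightarrow> 2 * 0) F" by (intro tendsto_intros lim)
    then have lim: "((\<lambda>x. 2 * norm_dist (S x) T) \<longlongrightarrow> 0) F" by simp
    have "norm (gap_dist (S x) T) \<le> 2 * norm_dist (S x) T" for x
      using gap_dist_le_norm[of "blinfun_of (S x)" "blinfun_of T"] sa[OF S, of x] sT
      by (simp add: op[OF S] op[OF T] norm_dist_def gap_dist_gproj)
    then show ?thesis by (rule Lim_null_comparison[OF always_eventually[OF allI] lim])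
  qed
qed

lemma (in Metric_space) continuous_map_tendsto:
  fixes K :: "'c::topological_space set"
  shows "continuous_map (top_of_set K) mtopology g \<longleftrightarrow>
    (\<forall>x\<in>K. g x \<in> M \<and> ((\<lambda>y. d (g y) (g x)) \<longlongrightarrow> 0) (at x within K))"
proof
  assume g: "continuous_map (top_of_set K) mtopology g"
  show "\<forall>x\<in>K. g x \<in> M \<and> ((\<lambda>y. d (g y) (g x)) \<longlongrightarrow> 0) (at x within K)"
  proof (intro ballI conjI tendstoI)
    fix x assume x: "x \<in> K"
    show "g x \<in> M" using continuous_map_image_subset_topspace[OF g] x by auto
    fix e :: real assume "e > 0"
    then obtain U where U: "openin (top_of_set K) U" "x \<in> U" "\<And>y. y \<in> U \<Longrightarrow> g y \<in> mball (g x) e"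
      using g x unfolding continuous_map_to_metric topspace_euclidean_subtopology by metis
    obtain V where V: "open V" "U = K \<inter> V" using U(1) unfolding openin_open by blast
    show "eventually (\<lambda>y. dist (d (g y) (g x)) 0 < e) (at x within K)"
      unfolding eventually_at_topological
    proof (intro exI[of _ V] conjI ballI impI)
      fix y assume "y \<in> V" "y \<in> K"
      then have "d (g x) (g y) < e" using U(3)[of y] V(2) by auto
      then show "dist (d (g y) (g x)) 0 < e" by (simp add: commute)
    qed (use U V in auto)
  qed
next
  assume g: "\<forall>x\<in>K. g x \<in> M \<and> ((\<lambda>y. d (g y) (g x)) \<longlongrightarrow> 0) (at x within K)"
  show "continuous_map (top_of_set K) mtopology g"
    unfolding continuous_map_to_metric topspace_euclidean_subtopology
  proof (intro ballI allI impI)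
    fix x and e :: real assume x: "x \<in> K" and e: "0 < e"
    have "eventually (\<lambda>y. dist (d (g y) (g x)) 0 < e) (at x within K)" using g x e by (intro tendstoD) auto
    then obtain V where V: "open V" "x \<in> V" "\<And>y. y \<in> V \<Longrightarrow> y \<noteq> x \<Longrightarrow> y \<in> K \<Longrightarrow> dist (d (g y) (g x)) 0 < e"
      unfolding eventually_at_topological by blast
    have "g y \<in> mball (g x) e" if "y \<in> K \<inter> V" for y
    proof (cases "y = x")
      case False
      then show ?thesis using V(3)[of y] that g x by (simp add: commute)
    qed (use g x e in simp)
    moreover have "openin (top_of_set K) (K \<inter> V)" using V(1) by (simp add: openin_open_Int)
    ultimately show "\<exists>U. openin (top_of_set K) U \<and> x \<in> U \<and> (\<forall>y\<in>U. g y \<in> mball (g x) e)" using x V(2) by blast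
  qed
qed

context operator_space
begin

lemma shift_continuous:
  fixes K :: "(real \<times> real) set"
  assumes A: "continuous_map (top_of_set (fst ` K)) mtopology A" and K: "\<And>z. z \<in> K \<Longrightarrow> shift_op (A (fst z)) (snd z) \<in> M"
  shows "continuous_map (top_of_set K) mtopology (\<lambda>z. shift_op (A (fst z)) (snd z))"
  unfolding continuous_map_tendsto
proof (intro ballI conjI K)
  fix x assume x: "x \<in> K"
  have A': "\<forall>x\<in>fst ` K. A x \<in> M \<and> ((\<lambda>y. d (A y) (A x)) \<longlongrightarrow> 0) (at x within fst ` K)"
    using A unfolding continuous_map_tendsto .
  have AM: "A (fst z) \<in> M" if "z \<in> K" for z using A' that by blast
  have fstK: "continuous_map (top_of_set K) (top_of_set (fst ` K)) fst" by (auto intro!: continuous_intros)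
  have "continuous_map (top_of_set K) mtopology (A \<circ> fst)" by (rule continuous_map_compose[OF fstK A])
  then have lim: "((\<lambda>y. d (A (fst y)) (A (fst x))) \<longlongrightarrow> 0) (at x within K)"
    unfolding continuous_map_tendsto using x by auto
  \<comment> \<open>\<open>shift_tendsto\<close> asks for membership in the space at all points, so
    the functions are frozen outside K at their value at x; this does not affect the limit within
    K.\<close>
  define S where "S y = (if y \<in> K then A (fst y) else A (fst x))" for y
  define s where "s y = (if y \<in> K then snd y else snd x)" for y
  have ev: "eventually (\<lambda>y. y \<in> K) (at x within K)" by (simp add: eventually_at_filter)
  have "((\<lambda>y. d (shift_op (S y) (s y)) (shift_op (A (fst x)) (snd x))) \<longlongrightarrow> 0) (at x within K)"
  proof (rule shift_tendsto)
    show "S y \<in> M" "shift_op (S y) (s y) \<in> M" for y using AM K x by (simp_all add: S_def s_def)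
    have "eventually (\<lambda>y. d (S y) (A (fst x)) = d (A (fst y)) (A (fst x))) (at x within K)"
      using ev by eventually_elim (simp add: S_def)
    then show "((\<lambda>y. d (S y) (A (fst x))) \<longlongrightarrow> 0) (at x within K)" using lim by (simp add: tendsto_cong)
    have "eventually (\<lambda>y. s y = snd y) (at x within K)" using ev by eventually_elim (simp add: s_def)
    then show "(s \<longlongrightarrow> snd x) (at x within K)"
      unfolding tendsto_cong[OF \<open>eventually (\<lambda>y. s y = snd y) (at x within K)\<close>] by (intro tendsto_intros)
  qed (use AM K x in auto)
  moreover have "eventually (\<lambda>y. d (shift_op (S y) (s y)) (shift_op (A (fst x)) (snd x)) =
      d (shift_op (A (fst y)) (snd y)) (shift_op (A (fst x)) (snd x))) (at x within K)"
    using ev by eventually_elim (simp add: S_def s_def)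
  ultimately show "((\<lambda>y. d (shift_op (A (fst y)) (snd y)) (shift_op (A (fst x)) (snd x))) \<longlongrightarrow> 0) (at x within K)"
    by (rule Lim_transform_eventually)
qed

lemma shift_line_continuous:
  assumes "\<And>t. t \<in> J \<Longrightarrow> shift_op T t \<in> M" and "T \<in> M"
  shows "continuous_map (top_of_set J) mtopology (shift_op T)"
proof -
  have K: "continuous_map (top_of_set ({0::real} \<times> J)) mtopology (\<lambda>z. shift_op T (snd z))"
    by (rule shift_continuous[of "{0} \<times> J" "\<lambda>_. T"]) (use assms in auto)
  have "continuous_map (top_of_set J) (top_of_set ({0} \<times> J)) (\<lambda>t. (0 :: real, t))" by (auto intro!: continuous_intros)
  from continuous_map_compose[OF this K] show ?thesis by (simp add: o_def)
qed

lemma gap_continuous: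
  assumes A: "continuous_map (top_of_set {0..1::real}) mtopology A" and s: "s \<in> {0..1}" and e: "e > 0"
  shows "\<exists>\<delta>>0. \<forall>t\<in>{0..1}. \<bar>t - s\<bar> < \<delta> \<longrightarrow> gap_dist (A t) (A s) < e"
proof -
  let ?F = "at s within {0..1}"
  have A': "\<And>x. x \<in> {0..1} \<Longrightarrow> A x \<in> M" "((\<lambda>y. d (A y) (A s)) \<longlongrightarrow> 0) ?F"
    using A s unfolding continuous_map_tendsto by auto
  \<comment> \<open>Frozen outside the unit interval, since \<open>gap_tendsto\<close> asks for
    membership everywhere.\<close>
  define S where "S t = (if t \<in> {0..1} then A t else A s)" for t
  have ev: "eventually (\<lambda>y. y \<in> {0..1}) ?F" by (simp add: eventually_at_filter)
  have "eventually (\<lambda>y. d (S y) (A s) = d (A y) (A s)) ?F" using ev by eventually_elim (simp add: S_def)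
  then have "((\<lambda>y. d (S y) (A s)) \<longlongrightarrow> 0) ?F" using A'(2) by (simp add: tendsto_cong)
  then have "((\<lambda>y. gap_dist (S y) (A s)) \<longlongrightarrow> 0) ?F" by (intro gap_tendsto) (use A' s in \<open>auto simp: S_def\<close>)
  then have "eventually (\<lambda>y. dist (gap_dist (S y) (A s)) 0 < e) ?F" using e by (rule tendstoD)
  then obtain \<delta> where \<delta>: "\<delta> > 0" "\<And>t. t \<in> {0..1} \<Longrightarrow> t \<noteq> s \<Longrightarrow> dist t s < \<delta> \<Longrightarrow> dist (gap_dist (S t) (A s)) 0 < e"
    unfolding eventually_at by blast
  have "gap_dist (A t) (A s) < e" if t: "t \<in> {0..1}" "\<bar>t - s\<bar> < \<delta>" for t
  proof (cases "t = s")
    case True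
    then show ?thesis using e by (simp add: gap_dist_gproj)
  next
    case False
    then show ?thesis using \<delta>(2)[OF t(1)] t by (simp add: S_def dist_real_def gap_dist_gproj)
  qed
  then show ?thesis using \<delta>(1) by blast
qed

end

section \<open>The spectral gap\<close>

lemma resolv_not_ess:
  assumes T: "selfadjoint T" and "resolv T c" shows "complex_of_real c \<notin> ess_spectrum T"
proof -
  obtain k where k: "k > 0" "\<And>u v. c - k < u \<Longrightarrow> u \<le> v \<Longrightarrow> v < c + k \<Longrightarrow> Eproj T v = Lproj T u"
    using resolv_imp_window[OF selfadjoint_sa[OF T] assms(2)] by blast
  have "Eproj T (c + k / 2) = Lproj T (c - k / 2)" by (rule k(2)) (use k(1) in auto)
  then have "fin_window T (c - k / 2) (c + k / 2)" by (auto simp: fin_window_def fin_dim_def)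
  then show ?thesis using ess_spectrum_of_real[OF T] k(1) half_gt_zero by blast
qed

lemma open_resolv: assumes T: "sa T" shows "open {c. resolv T c}"
  unfolding open_dist
proof (intro ballI)
  fix c assume "c \<in> {c. resolv T c}"
  then obtain k where k: "k > 0" "\<And>u v. c - k < u \<Longrightarrow> u \<le> v \<Longrightarrow> v < c + k \<Longrightarrow> Eproj T v = Lproj T u"
    using resolv_imp_window[OF T] by blast
  have eq: "Eproj T (c + k / 2) = Lproj T (c - k / 2)" by (rule k(2)) (use k(1) in auto)
  have "resolv T y" if y: "dist y c < k / 2" for y
  proof -
    have "c - k / 2 < y" "y < c + k / 2" using y unfolding dist_real_def by linarith+
    then show ?thesis by (rule window_imp_resolv[OF T _ _ eq])
  qed
  then show "\<exists>e>0. \<forall>y. dist y c < e \<longrightarrow> y \<in> {c. resolv T c}" using k(1) half_gt_zero by blast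
qed

text \<open>If 0 were the only spectral point, the spectral family would be constant beyond e and
  beyond -e, so the finite-dimensional window [-e, e] would be the whole space. This makes the set
  defining \<open>spectral_gap\<close> nonempty.\<close>

lemma spectrum_nonzero:
  fixes T :: "'a::complex_hilbert op"
  assumes inf: "\<not> fin_dim (UNIV :: 'a set)" and T: "selfadjoint T" and F: "fredholm T"
  shows "\<exists>c. c \<noteq> 0 \<and> \<not> resolv T c"
proof (rule ccontr)
  assume "\<not> ?thesis"
  then have res: "resolv T c" if "c \<noteq> 0" for c using that by blast
  note S = selfadjoint_sa[OF T]
  obtain e where e: "e > 0" "fin_window T (- e) e" using F fredholm_iff_window[OF T] by blast
  have top: "Lproj T e x = x" for x
  proof -
    have "eventually (\<lambda>s. Eproj T s x = Lproj T e x) at_top"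
      using eventually_ge_at_top[of e]
    proof eventually_elim
      case (elim s)
      then show ?case using resolv_gap[OF S elim res] e(1) by simp
    qed
    then show ?thesis using tendsto_eventually_eq[OF trivial_limit_at_top_linorder Eproj_at_top[OF S]] by metis
  qed
  have bot: "Eproj T (- e) x = 0" for x
  proof -
    have "eventually (\<lambda>s. Eproj T s x = Eproj T (- e) x) at_bot"
      using eventually_le_at_bot[of "- e"]
    proof eventually_elim
      case (elim s)
      have "Eproj T (- e) = Lproj T s" by (rule resolv_gap[OF S elim res]) (use e(1) in simp)
      moreover have "Eproj T s = Lproj T s" by (rule resolv_EL[OF S res]) (use e(1) elim in simp)
      ultimately show ?case by simp
    qed
    then show ?thesis using tendsto_eventually_eq[OF trivial_limit_at_bot_linorder Eproj_at_bot[OF S]] by metis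
  qed
  have "(Eproj T e - Lproj T (- e)) x = x" for x
  proof -
    have "Eproj T e = Lproj T e" "Eproj T (- e) = Lproj T (- e)" using res e(1) by (auto intro!: resolv_EL[OF S])
    then show ?thesis using top[of x] bot[of x] by (simp add: blinfun.bilinear_simps)
  qed
  then have "range (blinfun_apply (Eproj T e - Lproj T (- e))) = UNIV" by (metis surj_def)
  then show False using e(2) inf by (simp add: fin_window_def)
qed

text \<open>\<open>LEAST\<close> is meaningful here because the nonzero spectrum is real, nonempty
  and, 0 being isolated, closed; so a nonzero spectral point nearest to 0 exists.\<close>

lemma spectral_gap:
  fixes T :: "'a::complex_hilbert op"
  assumes inf: "\<not> fin_dim (UNIV :: 'a set)" and T: "T \<in> CFsa"
  shows "spectral_gap T > 0" "\<And>c. 0 < \<bar>c\<bar> \<Longrightarrow> \<bar>c\<bar> < 2 * spectral_gap T \<Longrightarrow> resolv T c"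
proof -
  note sT = CFsa_selfadjoint[OF T] and F = CFsa_fredholm[OF T]
  note S = selfadjoint_sa[OF sT]
  obtain e where e: "e > 0" "\<And>c. 0 < \<bar>c\<bar> \<Longrightarrow> \<bar>c\<bar> < e \<Longrightarrow> resolv T c"
    using fredholm_isolated[OF sT F] by blast
  define Q where "Q = {c. \<not> resolv T c} \<inter> {c. e \<le> \<bar>c\<bar>}"
  have Q: "c \<in> Q \<longleftrightarrow> c \<noteq> 0 \<and> \<not> resolv T c" for c using e by (force simp: Q_def not_le[symmetric])
  have "closed {c. \<not> resolv T c}" using open_resolv[OF S] by (simp add: closed_def Compl_eq)
  moreover have "closed {c :: real. e \<le> \<bar>c\<bar>}" by (intro closed_Collect_le continuous_intros)
  ultimately have "closed Q" unfolding Q_def by (rule closed_Int)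
  moreover have "Q \<noteq> {}" using spectrum_nonzero[OF inf sT F] Q by blast
  ultimately obtain c0 where c0: "c0 \<in> Q" "\<And>c. c \<in> Q \<Longrightarrow> dist 0 c0 \<le> dist 0 c"
    by (rule distance_attains_inf[of Q 0]) blast
  have eq: "{cmod z | z. z \<noteq> 0 \<and> z \<in> op_spectrum T} = abs ` Q"
  proof (intro set_eqI iffI)
    fix r assume "r \<in> {cmod z | z. z \<noteq> 0 \<and> z \<in> op_spectrum T}"
    then obtain z where z: "r = cmod z" "z \<noteq> 0" "z \<in> op_spectrum T" by blast
    then have "z = complex_of_real (Re z)" using op_spectrum_real[OF sT z(3)] by (simp add: complex_eq_iff)
    then obtain c where c: "z = complex_of_real c" by blast
    then have "c \<in> Q" "r = \<bar>c\<bar>" using z op_spectrum_of_real[OF sT, of c] Q by auto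
    then show "r \<in> abs ` Q" by blast
  next
    fix r assume "r \<in> abs ` Q"
    then obtain c where c: "c \<in> Q" "r = \<bar>c\<bar>" by blast
    then show "r \<in> {cmod z | z. z \<noteq> 0 \<and> z \<in> op_spectrum T}"
      using Q op_spectrum_of_real[OF sT, of c] by (intro CollectI exI[of _ "complex_of_real c"]) simp
  qed
  have "(LEAST r. r \<in> abs ` Q) = \<bar>c0\<bar>"
    by (rule Least_equality) (use c0 in \<open>auto simp: dist_real_def\<close>)
  then have gap: "2 * spectral_gap T = \<bar>c0\<bar>" unfolding spectral_gap_def eq by simp
  have "c0 \<noteq> 0" using Q[of c0] c0(1) by simp
  then show "spectral_gap T > 0" using gap by simp
  show "resolv T c" if "0 < \<bar>c\<bar>" "\<bar>c\<bar> < 2 * spectral_gap T" for c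
  proof (rule ccontr)
    assume "\<not> resolv T c"
    then have "c \<in> Q" using Q that(1) by auto
    then show False using c0(2)[of c] that(2) gap by (simp add: dist_real_def)
  qed
qed

section \<open>Eigenspaces and spectral windows\<close>

lemma Lproj_const_below:
  assumes T: "sa T" and res: "\<And>c. - b < c \<Longrightarrow> c < 0 \<Longrightarrow> resolv T c" and r: "0 < r" "r < b"
  shows "Lproj T 0 = Lproj T (- r)"
proof (rule blinfun_eqI)
  fix x
  have "eventually (\<lambda>s. Eproj T s x = Lproj T (- r) x) (at_left 0)"
    using eventually_at_left_real[of "- r" 0]
  proof (rule eventually_mono)
    show "- r < 0" using r by simp
    fix s assume s: "s \<in> {- r<..<0}"
    have "Eproj T s = Lproj T (- r)"
      by (rule resolv_gap[OF T _ res]) (use s r in auto)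
    then show "Eproj T s x = Lproj T (- r) x" by simp
  qed
  then show "Lproj T 0 x = Lproj T (- r) x"
    by (rule tendsto_eventually_eq[OF trivial_limit_at_left_real Lproj_tendsto[OF T]])
qed

lemma Lproj_const_above:
  assumes T: "sa T" and res: "\<And>c. 0 < c \<Longrightarrow> c < b \<Longrightarrow> resolv T c" and r: "0 < r" "r < b"
  shows "Lproj T r = Eproj T 0"
proof (rule blinfun_eqI)
  fix x
  have "eventually (\<lambda>s. Eproj T s x = Lproj T r x) (at_right 0)"
    using eventually_at_right_real[OF r(1)]
  proof (rule eventually_mono)
    fix s assume s: "s \<in> {0<..<r}"
    have "Eproj T r = Lproj T s" by (rule resolv_gap[OF T _ res]) (use s r in auto)
    moreover have "Eproj T r = Lproj T r" "Eproj T s = Lproj T s" by (rule resolv_EL[OF T res]; use s r in auto)+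
    ultimately show "Eproj T s x = Lproj T r x" by simp
  qed
  from tendsto_eventually_eq[OF trivial_limit_at_right_real Eproj_at_right[OF T] this]
  show "Lproj T r x = Eproj T 0 x" by simp
qed

text \<open>On the degenerate window [0, 0] the block estimate reads norm y \<le> 0. Conversely a
  null vector has no component below 0, where the form would be negative, and none above 0, where it
  would be positive.\<close>

lemma range_zero_window:
  assumes T: "sa T" shows "range (blinfun_apply (Eproj T 0 - Lproj T 0)) = ker_op T"
proof (intro set_eqI)
  fix x
  have *: "Eproj T 0 x = x \<and> Lproj T 0 x = 0 \<longleftrightarrow> (x, 0) \<in> T"
  proof
    assume x: "Eproj T 0 x = x \<and> Lproj T 0 x = 0"
    then obtain y where y: "(x, y) \<in> T" using block_in_domain[OF T, of 0 0 x] by auto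
    then have "norm (y - 0 *\<^sub>R x) \<le> max \<bar>0 - 0\<bar> \<bar>0 - 0\<bar> * norm x"
      using x by (intro block_norm_le[OF T _ y]) auto
    then show "(x, 0) \<in> T" using y by simp
  next
    assume x: "(x, 0) \<in> T"
    have zero: "Eproj T s x = 0" if s: "s < 0" for s
    proof (rule ccontr)
      assume ne: "Eproj T s x \<noteq> 0"
      have m: "(Eproj T s x, Eproj T s 0) \<in> T" by (rule comm_opD[OF Eproj_comm_op[OF T] x])
      have "inner (Eproj T s 0) (Eproj T s x) \<le> s * (norm (Eproj T s x))\<^sup>2"
        by (rule Eproj_le[OF T m]) (rule is_proj_idem[OF Eproj_is_proj[OF T]])
      moreover have "s * (norm (Eproj T s x))\<^sup>2 < 0" using s ne by (simp add: mult_neg_pos)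
      ultimately show False by (simp add: blinfun.bilinear_simps)
    qed
    have "Lproj T 0 x = 0"
    proof (rule tendsto_eventually_eq[OF trivial_limit_at_left_real Lproj_tendsto[OF T]])
      show "eventually (\<lambda>s. Eproj T s x = 0) (at_left 0)"
        by (rule eventually_mono[OF eventually_at_left_real[of "- 1" 0]]) (use zero in auto)
    qed
    moreover have "x - Eproj T 0 x = 0"
    proof (rule ccontr)
      assume ne: "x - Eproj T 0 x \<noteq> 0"
      have "(x - Eproj T 0 x, 0 - Eproj T 0 0) \<in> T" by (intro sa_diff[OF T] x comm_opD[OF Eproj_comm_op[OF T] x])
      from Eproj_gr[OF T this, of 0] ne show False
        by (simp add: blinfun.bilinear_simps is_proj_idem[OF Eproj_is_proj[OF T]])
    qed
    ultimately show "Eproj T 0 x = x \<and> Lproj T 0 x = 0" by simp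
  qed
  show "x \<in> range (blinfun_apply (Eproj T 0 - Lproj T 0)) \<longleftrightarrow> x \<in> ker_op T"
    using is_proj_range[OF LE_is_proj[OF T order_refl, of 0], of x] LE_fix[OF T order_refl, of 0 x] *
    by (simp add: ker_op_def)
qed

text \<open>\<open>Lproj T (- s) - Lproj T (- t)\<close> is the spectral projection for \<open>[-t, -s)\<close>, the part of the spectrum
  of \<open>T\<close> that crosses zero upwards as the shift runs from \<open>s\<close> to \<open>t\<close>.\<close>

definition crossing :: "'a::complex_hilbert op \<Rightarrow> real \<Rightarrow> real \<Rightarrow> int" where
  "crossing T s t = int (complex_vector.dim (range (blinfun_apply (Lproj T (- s) - Lproj T (- t)))))"

lemma crossing_add:
  assumes T: "selfadjoint T" and "r \<le> s" "s \<le> t" and fin: "fin_window T (- t) (- r)"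
  shows "crossing T r t = crossing T r s + crossing T s t"
proof -
  note S = selfadjoint_sa[OF T]
  let ?P = "Lproj T (- r) - Lproj T (- s)" and ?Q = "Lproj T (- s) - Lproj T (- t)"
  have sub: "range (blinfun_apply (Lproj T (- u) - Lproj T (- v))) \<subseteq> range (blinfun_apply (Eproj T (- r) - Lproj T (- t)))"
    if "r \<le> u" "u \<le> v" "v \<le> t" for u v
  proof
    fix x assume "x \<in> range (blinfun_apply (Lproj T (- u) - Lproj T (- v)))"
    then have x: "Lproj T (- u) x = x" "Lproj T (- v) x = 0"
      using is_proj_range[OF LL_is_proj[OF S]] LL_fix[OF S, of "- v" "- u" x] that by auto
    have "Lproj T (- t) x = 0" using Lproj_mono(1)[OF S, of "- t" "- v" x] x that by (simp add: blinfun.bilinear_simps)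
    moreover have "Eproj T (- r) x = x" using Eproj_Lproj_ge[OF S, of "- u" "- r" x] x that by simp
    ultimately show "x \<in> range (blinfun_apply (Eproj T (- r) - Lproj T (- t)))"
      using LE_fix[OF S, of "- t" "- r" x] that assms by (metis neg_le_iff_le order_trans rangeI)
  qed
  have "complex_vector.dim (range (blinfun_apply (?P + ?Q))) =
      complex_vector.dim (range (blinfun_apply ?P)) + complex_vector.dim (range (blinfun_apply ?Q))"
  proof (rule dim_orthogonal_sum)
    show "is_proj ?P" "is_proj ?Q" using assms by (simp_all add: LL_is_proj[OF S])
    show "clinear_blinfun ?P" "clinear_blinfun ?Q" by (intro clinear_diff clinear_Lproj[OF T])+
    show "?P (?Q x) = 0" "?Q (?P x) = 0" for x
      using assms by (simp_all add: blinfun.bilinear_simps Lproj_mono[OF S] is_proj_idem[OF Lproj_is_proj[OF S]])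
    show "fin_dim (range (blinfun_apply ?P))" "fin_dim (range (blinfun_apply ?Q))"
      using fin_dim_subset[OF fin[unfolded fin_window_def] sub] assms by auto
  qed
  then show ?thesis by (simp add: crossing_def)
qed

lemma crossing_same: "crossing T s s = 0"
proof -
  have "range (blinfun_apply (0 :: 'a \<Rightarrow>\<^sub>L 'a)) = complex_vector.span {}" by auto
  then show ?thesis
    by (simp only: crossing_def diff_self complex_vector.dim_span
        complex_vector.dim_eq_card_independent[OF complex_vector.independent_empty] card.empty of_nat_0)
qed

lemma crossing_shift:
  assumes "sa T" shows "crossing (shift_op T r) s t = crossing T (r + s) (r + t)"
proof -
  have "- u - r = - (r + u)" for u by simp
  then show ?thesis by (simp only: crossing_def Lproj_shift[OF assms])
qed

lemma dim_near_proj: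
  assumes P: "is_proj P" "clinear_blinfun P" and Q: "is_proj Q" "clinear_blinfun Q"
    and near: "norm (P - Q) < 1" and fin: "fin_dim (range (blinfun_apply P))"
  shows "complex_vector.dim (range (blinfun_apply Q)) = complex_vector.dim (range (blinfun_apply P))"
  using fin_dim_near_proj[OF P Q near fin] fin_dim_near_proj(2)[OF Q P] near
  by (auto simp: norm_minus_commute intro: antisym)

text \<open>(Z) is only needed for paths of invertible operators, so that \<open>Y\<close> disappears.\<close>

locale flow_axioms = operator_space M d for M :: "'a::complex_hilbert op set" and d +
  fixes \<mu> :: "(real \<Rightarrow> 'a op) \<Rightarrow> int"
  assumes infinite_dim: "\<not> fin_dim (UNIV :: 'a set)"
    and C: "A \<in> path_space mtopology \<Longrightarrow> B \<in> path_space mtopology \<Longrightarrow> A 1 = B 0 \<Longrightarrow>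
      \<mu> (concat_path A B) = \<mu> A + \<mu> B"
    and H: "continuous_map (top_of_set ({0..1::real} \<times> {0..1::real})) mtopology h \<Longrightarrow>
      (\<forall>s\<in>{0..1}. h (s, 0) = h (0, 0) \<and> h (s, 1) = h (0, 1)) \<Longrightarrow>
      \<mu> (restrict (\<lambda>t. h (0, t)) {0..1}) = \<mu> (restrict (\<lambda>t. h (1, t)) {0..1})"
    and Z: "A \<in> path_space mtopology \<Longrightarrow> (\<forall>t\<in>{0..1}. invertible_op (A t)) \<Longrightarrow> \<mu> A = 0"
    and N: "T \<in> M \<Longrightarrow> \<mu> (reparam (- spectral_gap T) (spectral_gap T) (shift_op T)) = int (complex_vector.dim (ker_op T))"
      "T \<in> M \<Longrightarrow> \<mu> (reparam 0 (spectral_gap T) (shift_op T)) = 0"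
begin

lemma M_sa: "T \<in> M \<Longrightarrow> selfadjoint T"
  using M_CFsa CFsa_selfadjoint by blast

lemma restrict_path_space:
  "continuous_map (top_of_set {0..1}) mtopology A \<Longrightarrow> restrict A {0..1} \<in> path_space mtopology"
  by (auto simp: path_space_def pathin_def elim!: continuous_map_eq)

lemma segment_continuous:
  fixes K :: "'c::real_normed_vector set"
  assumes K: "convex K" and g: "continuous_map (top_of_set K) mtopology g" and xy: "x \<in> K" "y \<in> K"
  shows "continuous_map (top_of_set {0..1}) mtopology (g \<circ> linepath x y)"
proof (rule continuous_map_compose[OF _ g])
  show "continuous_map (top_of_set {0..1}) (top_of_set K) (linepath x y)"
    using linepath_in_convex_hull[of x K y] xy K by (auto simp: hull_same intro!: continuous_intros)
qed

text \<open>The two ways around a triangle are homotopic by convexity of the parameter domain.\<close>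

lemma segment_add:
  fixes K :: "'c::real_normed_vector set"
  assumes K: "convex K" and g: "continuous_map (top_of_set K) mtopology g" and xyz: "x \<in> K" "y \<in> K" "z \<in> K"
  shows "\<mu> (restrict (g \<circ> linepath x z) {0..1}) =
    \<mu> (restrict (g \<circ> linepath x y) {0..1}) + \<mu> (restrict (g \<circ> linepath y z) {0..1})"
proof -
  define q where "q = linepath x y +++ linepath y z"
  \<comment> \<open>Straight-line homotopy from the direct segment (parameter 0) to the detour
    through y (parameter 1), inside the convex set K; the endpoints stay fixed.\<close>
  define h where "h u = (1 - fst u) *\<^sub>R linepath x z (snd u) + fst u *\<^sub>R q (snd u)" for u :: "real \<times> real"
  have q: "path q" "path_image q \<subseteq> K"
    using closed_segment_subset[OF xyz(1,2) K] closed_segment_subset[OF xyz(2,3) K]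
    by (simp_all add: q_def path_image_join)
  have "continuous_on {0..1} q" using q(1) by (simp add: path_def)
  then have qc: "continuous_on ({0..1} \<times> {0..1}) (\<lambda>u :: real \<times> real. q (snd u))"
    by (rule continuous_on_compose2) (auto intro!: continuous_intros)
  have hc: "continuous_on ({0..1} \<times> {0..1}) h"
    unfolding h_def linepath_def by (intro continuous_intros qc)
  have hK: "h u \<in> K" if "u \<in> {0..1} \<times> {0..1}" for u
  proof -
    have "linepath x z (snd u) \<in> K" using closed_segment_subset[OF xyz(1,3) K] linepath_in_path[of "snd u" x z] that by auto
    moreover have "q (snd u) \<in> K" using q(2) that by (auto simp: path_image_def)
    ultimately show ?thesis unfolding h_def using K that by (intro convexD) auto
  qed
  have "continuous_map (top_of_set ({0..1} \<times> {0..1})) mtopology (g \<circ> h)"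
    by (rule continuous_map_compose[OF _ g]) (use hc hK in auto)
  then have "\<mu> (restrict (\<lambda>t. (g \<circ> h) (0, t)) {0..1}) = \<mu> (restrict (\<lambda>t. (g \<circ> h) (1, t)) {0..1})"
  proof (rule H, intro ballI)
    fix s
    have "q 0 = x" "q 1 = z" by (simp_all add: q_def joinpaths_def linepath_def)
    then show "(g \<circ> h) (s, 0) = (g \<circ> h) (0, 0) \<and> (g \<circ> h) (s, 1) = (g \<circ> h) (0, 1)"
      by (simp add: h_def linepath_def algebra_simps flip: scaleR_left_distrib)
  qed
  moreover have "restrict (\<lambda>t. (g \<circ> h) (0, t)) {0..1} = restrict (g \<circ> linepath x z) {0..1}"
    by (simp add: h_def o_def)
  moreover have "restrict (\<lambda>t. (g \<circ> h) (1, t)) {0..1} =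
      concat_path (restrict (g \<circ> linepath x y) {0..1}) (restrict (g \<circ> linepath y z) {0..1})"
    by (auto simp: h_def concat_path_def q_def joinpaths_def fun_eq_iff restrict_def)
  moreover have "\<mu> (concat_path (restrict (g \<circ> linepath x y) {0..1}) (restrict (g \<circ> linepath y z) {0..1})) =
      \<mu> (restrict (g \<circ> linepath x y) {0..1}) + \<mu> (restrict (g \<circ> linepath y z) {0..1})"
    by (intro C restrict_path_space segment_continuous[OF K g] xyz) (simp add: linepath_def)
  ultimately show ?thesis by simp
qed

lemma reparam_linepath: "reparam a b A = restrict (A \<circ> linepath a b) {0..1}"
  by (simp add: reparam_def linepath_def o_def algebra_simps)

lemma reparam_add:
  assumes A: "continuous_map (top_of_set {a..b}) mtopology A" and "x \<in> {a..b}" "y \<in> {a..b}" "z \<in> {a..b}"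
  shows "\<mu> (reparam x z A) = \<mu> (reparam x y A) + \<mu> (reparam y z A)"
  unfolding reparam_linepath by (rule segment_add[OF convex_real_interval(5) A]) (use assms in auto)

lemma reparam_same:
  assumes "continuous_map (top_of_set {a..b}) mtopology A" "x \<in> {a..b}" shows "\<mu> (reparam x x A) = 0"
  using reparam_add[OF assms(1,2,2,2)] by simp

lemma reparam_path_space:
  assumes A: "continuous_map (top_of_set {a..b}) mtopology A" and "x \<in> {a..b}" "y \<in> {a..b}"
  shows "reparam x y A \<in> path_space mtopology"
  unfolding reparam_linepath
  by (intro restrict_path_space segment_continuous[OF convex_real_interval(5) A]) (use assms in auto)

lemma reparam_zero:
  assumes A: "continuous_map (top_of_set {a..b}) mtopology A" and ab: "a \<le> b"
    and inv: "\<And>t. t \<in> {a..b} \<Longrightarrow> invertible_op (A t)"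
  shows "\<mu> (reparam a b A) = 0"
proof (rule Z[OF reparam_path_space[OF A]])
  show "\<forall>t\<in>{0..1}. invertible_op (reparam a b A t)"
  proof
    fix t :: real assume t: "t \<in> {0..1}"
    have "t * (b - a) \<le> 1 * (b - a)" by (rule mult_right_mono) (use t ab in auto)
    moreover have "0 \<le> t * (b - a)" using t ab by simp
    ultimately have "a + t * (b - a) \<in> {a..b}" by simp
    then show "invertible_op (reparam a b A t)" using inv t by (simp add: reparam_def)
  qed
qed (use ab in auto)

lemma reparam_shift_op: "reparam s t (shift_op (shift_op T r)) = reparam (r + s) (r + t) (shift_op T)"
  by (simp add: reparam_def shift_op_shift_op algebra_simps)

lemma near_shift:
  assumes T: "T \<in> M" and t: "\<bar>t\<bar> \<le> spectral_gap T" shows "shift_op T t \<in> M"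
proof (rule M_shift[OF T])
  have TC: "T \<in> CFsa" using T M_CFsa by blast
  note gap = spectral_gap[OF infinite_dim TC]
  fix c assume "c \<in> closed_segment 0 (- t)"
  then have c: "\<bar>c\<bar> < 2 * spectral_gap T" using t gap(1) by (auto simp: closed_segment_eq_real_ivl split: if_splits)
  show "complex_of_real c \<notin> ess_spectrum T"
  proof (cases "c = 0")
    case True
    then show ?thesis using CFsa_shift_iff[OF M_sa[OF T], of 0] TC by simp
  next
    case False
    then show ?thesis using resolv_not_ess[OF M_sa[OF T] gap(2)] c by simp
  qed
qed

lemma near_shift_continuous:
  assumes T: "T \<in> M" shows "continuous_map (top_of_set {- spectral_gap T..spectral_gap T}) mtopology (shift_op T)"
  by (rule shift_line_continuous[OF near_shift[OF T] T]) auto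

lemma shift_invertible: "T \<in> M \<Longrightarrow> invertible_op (shift_op T t) \<longleftrightarrow> resolv T (- t)"
  by (simp add: invertible_op_resolv selfadjoint_shift M_sa resolv_shift)

text \<open>There is no spectrum just below 0, so nothing crosses. On [r, delta] the operators T + t
  are invertible, and the second equation of (N) leaves 0 for [0, r].\<close>

lemma crossing_right:
  assumes T: "T \<in> M" and r: "0 \<le> r" "r \<le> spectral_gap T"
  shows "\<mu> (reparam 0 r (shift_op T)) = crossing T 0 r"
proof (cases "r = 0")
  case True
  then show ?thesis using reparam_same[OF near_shift_continuous[OF T], of 0] r by (simp add: crossing_same)
next
  case False
  have TC: "T \<in> CFsa" using T M_CFsa by blast
  note gap = spectral_gap[OF infinite_dim TC]
  have res: "resolv T c" if "- (2 * spectral_gap T) < c" "c < 0" for c using gap(2)[of c] that by simp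
  have "Lproj T 0 = Lproj T (- r)" by (rule Lproj_const_below[OF selfadjoint_sa[OF M_sa[OF T]] res]) (use False r gap in auto)
  then have cr: "crossing T 0 r = 0" using crossing_same[of T 0] by (simp add: crossing_def)
  have cont: "continuous_map (top_of_set {r..spectral_gap T}) mtopology (shift_op T)"
    by (rule continuous_map_from_subtopology_mono[OF near_shift_continuous[OF T]]) (use r gap(1) in auto)
  have "\<mu> (reparam r (spectral_gap T) (shift_op T)) = 0"
    by (rule reparam_zero[OF cont r(2)]) (use gap(2) r False in \<open>auto simp: shift_invertible[OF T]\<close>)
  moreover have "\<mu> (reparam 0 (spectral_gap T) (shift_op T)) =
      \<mu> (reparam 0 r (shift_op T)) + \<mu> (reparam r (spectral_gap T) (shift_op T))"
    by (rule reparam_add[OF near_shift_continuous[OF T]]) (use r gap(1) in auto)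
  ultimately show ?thesis using N(2)[OF T] cr by simp
qed

text \<open>The difference of the two equations of (N) puts all of dim ker T on [-delta, 0], and (Z)
  removes [-delta, -r]. On the other side the window [0, r) contains no spectral point except
  possibly 0, so its dimension is that of the kernel.\<close>

lemma crossing_left:
  assumes T: "T \<in> M" and r: "0 \<le> r" "r \<le> spectral_gap T"
  shows "\<mu> (reparam (- r) 0 (shift_op T)) = crossing T (- r) 0"
proof (cases "r = 0")
  case True
  then show ?thesis using reparam_same[OF near_shift_continuous[OF T], of 0] r by (simp add: crossing_same)
next
  case False
  have TC: "T \<in> CFsa" using T M_CFsa by blast
  note gap = spectral_gap[OF infinite_dim TC] and S = selfadjoint_sa[OF M_sa[OF T]]
  have res: "resolv T c" if "0 < c" "c < 2 * spectral_gap T" for c using gap(2)[of c] that by simp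
  have "Lproj T r = Eproj T 0" by (rule Lproj_const_above[OF S res]) (use False r gap in auto)
  then have cr: "crossing T (- r) 0 = int (complex_vector.dim (ker_op T))"
    by (simp add: crossing_def range_zero_window[OF S])
  have cont: "continuous_map (top_of_set {- spectral_gap T..- r}) mtopology (shift_op T)"
    by (rule continuous_map_from_subtopology_mono[OF near_shift_continuous[OF T]]) (use r gap(1) in auto)
  have "\<mu> (reparam (- spectral_gap T) (- r) (shift_op T)) = 0"
    by (rule reparam_zero[OF cont]) (use gap(2) r False in \<open>auto simp: shift_invertible[OF T]\<close>)
  moreover have "\<mu> (reparam (- spectral_gap T) (spectral_gap T) (shift_op T)) =
      \<mu> (reparam (- spectral_gap T) 0 (shift_op T)) + \<mu> (reparam 0 (spectral_gap T) (shift_op T))"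
    by (rule reparam_add[OF near_shift_continuous[OF T]]) (use gap(1) in auto)
  moreover have "\<mu> (reparam (- spectral_gap T) 0 (shift_op T)) =
      \<mu> (reparam (- spectral_gap T) (- r) (shift_op T)) + \<mu> (reparam (- r) 0 (shift_op T))"
    by (rule reparam_add[OF near_shift_continuous[OF T]]) (use r gap(1) in auto)
  ultimately show ?thesis using N[OF T] cr by simp
qed

text \<open>Both sides are additive under subdivision, so bisection reduces the claim to short
  intervals around each point x, where (N) at T + x applies.\<close>

lemma flow_shift:
  assumes T: "T \<in> M" and a: "0 \<le> a" and M: "\<And>t. t \<in> {0..a} \<Longrightarrow> shift_op T t \<in> M" and fin: "fin_window T (- a) 0"
  shows "\<mu> (reparam 0 a (shift_op T)) = crossing T 0 a"
proof -
  note sT = M_sa[OF T] and S = selfadjoint_sa[OF M_sa[OF T]]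
  have cont: "continuous_map (top_of_set {0..a}) mtopology (shift_op T)" by (rule shift_line_continuous[OF M T])
  have fw: "fin_window T (- v) (- u)" if "0 \<le> u" "u \<le> v" "v \<le> a" for u v
    by (rule fin_window_mono[OF sT fin]) (use that in auto)
  define P where "P u v \<longleftrightarrow> (0 \<le> u \<longrightarrow> v \<le> a \<longrightarrow> \<mu> (reparam u v (shift_op T)) = crossing T u v)" for u v
  have "P 0 a"
    using a
  proof (induction rule: Bolzano)
    case (trans u v w)
    show ?case
      unfolding P_def
    proof (intro impI)
      assume uw: "0 \<le> u" "w \<le> a"
      have "\<mu> (reparam u w (shift_op T)) = \<mu> (reparam u v (shift_op T)) + \<mu> (reparam v w (shift_op T))"
        by (rule reparam_add[OF cont]) (use uw trans in auto)
      moreover have "crossing T u w = crossing T u v + crossing T v w"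
        by (rule crossing_add[OF sT _ _ fw]) (use uw trans in auto)
      ultimately show "\<mu> (reparam u w (shift_op T)) = crossing T u w" using trans uw by (simp add: P_def)
    qed
  next
    case (local x)
    \<comment> \<open>Recentring at x turns the part left of x into an instance of
      \<open>crossing_left\<close> and the part right of it into one of
      \<open>crossing_right\<close>.\<close>
    define T' where "T' = shift_op T x"
    have T': "T' \<in> M" unfolding T'_def by (rule M) (use local in auto)
    have "T' \<in> CFsa" using T' M_CFsa by blast
    note gap = spectral_gap(1)[OF infinite_dim this]
    have "\<mu> (reparam u v (shift_op T)) = crossing T u v"
      if uv: "u \<le> x" "x \<le> v" "v - u < spectral_gap T'" "0 \<le> u" "v \<le> a" for u v
    proof -
      have 1: "\<mu> (reparam u v (shift_op T)) = \<mu> (reparam u x (shift_op T)) + \<mu> (reparam x v (shift_op T))"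
        by (rule reparam_add[OF cont]) (use uv in auto)
      have 2: "crossing T u v = crossing T u x + crossing T x v"
        by (rule crossing_add[OF sT _ _ fw]) (use uv in auto)
      have "\<mu> (reparam (- (x - u)) 0 (shift_op T')) = crossing T' (- (x - u)) 0"
        by (rule crossing_left[OF T']) (use uv in auto)
      then have 3: "\<mu> (reparam u x (shift_op T)) = crossing T u x"
        unfolding T'_def reparam_shift_op crossing_shift[OF S] by simp
      have "\<mu> (reparam 0 (v - x) (shift_op T')) = crossing T' 0 (v - x)"
        by (rule crossing_right[OF T']) (use uv in auto)
      then have "\<mu> (reparam x v (shift_op T)) = crossing T x v"
        unfolding T'_def reparam_shift_op crossing_shift[OF S] by simp
      then show ?thesis using 1 2 3 by simp
    qed
    then show ?case using gap unfolding P_def by blast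
  qed
  then show ?thesis by (simp add: P_def)
qed

end

section \<open>The spectral flow\<close>

lemma sf_pieceD:
  assumes "sf_piece A c d a" "s \<in> {c..d}" "selfadjoint (A s)"
  shows "a > 0" "resolv (A s) a" "resolv (A s) (- a)"
    "\<And>t. t \<in> {- a..a} \<Longrightarrow> complex_of_real t \<notin> ess_spectrum (A s)"
proof -
  have a: "a > 0" "complex_of_real a \<notin> op_spectrum (A s)" "complex_of_real (- a) \<notin> op_spectrum (A s)"
    "complex_of_real ` {- a..a} \<inter> ess_spectrum (A s) = {}"
    using assms(1,2) unfolding sf_piece_def by blast+
  show "a > 0" "resolv (A s) a" "resolv (A s) (- a)"
    using a(1-3) unfolding op_spectrum_of_real[OF assms(3)] by blast+
  show "complex_of_real t \<notin> ess_spectrum (A s)" if "t \<in> {- a..a}" for t using a(4) that by blast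
qed

text \<open>Projections at norm distance less than 1 have ranges of equal dimension; bisection
  passes from local to global constancy.\<close>

lemma sf_piece_dim_constant:
  assumes piece: "sf_piece A c d a" and cd: "c \<le> d" and sa: "\<And>s. s \<in> {c..d} \<Longrightarrow> selfadjoint (A s)"
  shows "complex_vector.dim (range (blinfun_apply (Wproj (A c) a))) =
    complex_vector.dim (range (blinfun_apply (Wproj (A d) a)))"
proof -
  define n where "n s = complex_vector.dim (range (blinfun_apply (Wproj (A s) a)))" for s
  have a: "a > 0" using piece by (simp add: sf_piece_def)
  have eq: "Blinfun (spectral_proj (A s) (- a) a) = Wproj (A s) a" if "s \<in> {c..d}" for s
    by (simp add: Blinfun_spectral_proj[OF sa[OF that]] Wproj_def)
  have "continuous_on {c..d} (\<lambda>s. Blinfun (spectral_proj (A s) (- a) a))" using piece by (simp add: sf_piece_def)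
  then have cont: "continuous_on {c..d} (\<lambda>s. Wproj (A s) a)" by (rule continuous_on_eq) (rule eq)
  have proj: "is_proj (Wproj (A s) a)" "clinear_blinfun (Wproj (A s) a)"
    "fin_dim (range (blinfun_apply (Wproj (A s) a)))" if s: "s \<in> {c..d}" for s
  proof -
    show "is_proj (Wproj (A s) a)" by (rule Wproj_is_proj[OF selfadjoint_sa[OF sa[OF s]]]) (use a in simp)
    show "clinear_blinfun (Wproj (A s) a)" unfolding Wproj_def by (intro clinear_diff clinear_Eproj clinear_Lproj sa s)
    have "fin_window (A s) (- a) a"
      by (rule fin_window_if_not_ess[OF sa[OF s]]) (use a sf_pieceD(4)[OF piece s sa[OF s]] in auto)
    then show "fin_dim (range (blinfun_apply (Wproj (A s) a)))" by (simp add: fin_window_def Wproj_def)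
  qed
  define P where "P u v \<longleftrightarrow> (c \<le> u \<longrightarrow> v \<le> d \<longrightarrow> n u = n v)" for u v
  have "P c d"
    using cd
  proof (induction rule: Bolzano)
    case (trans u v w)
    then show ?case by (simp add: P_def)
  next
    case (local x)
    then have x: "x \<in> {c..d}" by simp
    obtain e where e: "e > 0" "\<And>s. s \<in> {c..d} \<Longrightarrow> dist s x < e \<Longrightarrow> dist (Wproj (A s) a) (Wproj (A x) a) < 1"
      using cont x unfolding continuous_on_iff by (metis zero_less_one)
    have near: "n s = n x" if s: "s \<in> {c..d}" "\<bar>s - x\<bar> < e" for s
    proof -
      have "norm (Wproj (A x) a - Wproj (A s) a) < 1"
        using e(2)[OF s(1)] s(2) by (simp add: dist_norm norm_minus_commute)
      then show ?thesis unfolding n_def by (intro dim_near_proj proj s x)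
    qed
    have "P u v" if "u \<le> x" "x \<le> v" "v - u < e" for u v
      unfolding P_def
    proof (intro impI)
      assume "c \<le> u" "v \<le> d"
      then show "n u = n v" using near[of u] near[of v] that x by auto
    qed
    then show ?case using e(1) by blast
  qed
  then show ?thesis by (simp add: P_def n_def)
qed

text \<open>[-a, a] is the disjoint union of [0, a], which enters the spectral flow, and [-a, 0),
  which \<open>crossing T 0 a\<close> counts.\<close>

lemma window_dim_split:
  assumes T: "selfadjoint T" and a: "a > 0" and fin: "fin_window T (- a) a"
  shows "int (complex_vector.dim (range (blinfun_apply (Wproj T a)))) =
    int (complex_vector.dim (range (spectral_proj T 0 a))) + crossing T 0 a"
proof -
  note S = selfadjoint_sa[OF T]
  let ?P = "Eproj T a - Lproj T 0" and ?Q = "Lproj T 0 - Lproj T (- a)"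
  have "complex_vector.dim (range (blinfun_apply (?P + ?Q))) =
      complex_vector.dim (range (blinfun_apply ?P)) + complex_vector.dim (range (blinfun_apply ?Q))"
  proof (rule dim_orthogonal_sum)
    show "is_proj ?P" "is_proj ?Q" using a by (simp_all add: LE_is_proj[OF S] LL_is_proj[OF S])
    show "clinear_blinfun ?P" "clinear_blinfun ?Q" by (intro clinear_diff clinear_Eproj clinear_Lproj T)+
    show "?P (?Q x) = 0" "?Q (?P x) = 0" for x
      using a by (simp_all add: blinfun.bilinear_simps Lproj_mono[OF S] is_proj_idem[OF Lproj_is_proj[OF S]]
          Eproj_Lproj_ge[OF S] Lproj_Eproj_ge[OF S])
    show "fin_dim (range (blinfun_apply ?P))"
      using fin_window_mono[OF T fin, of 0 a] a by (simp add: fin_window_def)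
    show "fin_dim (range (blinfun_apply ?Q))"
    proof (rule fin_dim_subset[OF fin_window_mono[OF T fin, of "- a" 0, unfolded fin_window_def]], goal_cases)
      case 4
      show ?case
      proof
        fix x assume "x \<in> range (blinfun_apply ?Q)"
        then have x: "Lproj T 0 x = x" "Lproj T (- a) x = 0"
          using is_proj_range[OF LL_is_proj[OF S]] LL_fix[OF S, of "- a" 0 x] a by auto
        have "Eproj T 0 x = x" using Eproj_Lproj_ge[OF S order_refl, of 0 x] x(1) by simp
        then show "x \<in> range (blinfun_apply (Eproj T 0 - Lproj T (- a)))"
          using LE_fix[OF S, of "- a" 0 x] x(2) a by (metis less_imp_le neg_le_0_iff_le rangeI)
      qed
    qed (use a in auto)
  qed
  then show ?thesis by (simp add: Wproj_def crossing_def spectral_proj_eq[OF T])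
qed

context flow_axioms
begin

lemma flow_piece:
  assumes A: "continuous_map (top_of_set {p..q}) mtopology A" and cd: "p \<le> q" and piece: "sf_piece A p q a"
  shows "\<mu> (reparam p q A) = int (complex_vector.dim (range (spectral_proj (A q) 0 a))) -
    int (complex_vector.dim (range (spectral_proj (A p) 0 a)))"
proof -
  have AM: "A s \<in> M" if "s \<in> {p..q}" for s using continuous_map_image_subset_topspace[OF A] that by auto
  have a: "a > 0" using piece by (simp add: sf_piece_def)
  note D = sf_pieceD[OF piece _ M_sa[OF AM]]
  have shift: "shift_op (A s) t \<in> M" if s: "s \<in> {p..q}" and t: "t \<in> {0..a}" for s t
    by (rule M_shift[OF AM[OF s]], rule D(4)[OF s s]) (use t in \<open>auto simp: closed_segment_eq_real_ivl split: if_splits\<close>)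
  define K where "K = {p..q} \<times> {0..a}"
  define g where "g z = shift_op (A (fst z)) (snd z)" for z :: "real \<times> real"
  have K: "convex K" unfolding K_def by (intro convex_Times convex_real_interval)
  have fstK: "fst ` K = {p..q}" using a by (auto simp: K_def image_iff)
  have g: "continuous_map (top_of_set K) mtopology g"
    unfolding g_def by (rule shift_continuous) (use A fstK shift in \<open>auto simp: K_def\<close>)
  define L where "L x y = \<mu> (restrict (g \<circ> linepath x y) {0..1})" for x y
  have L: "L x z = L x y + L y z" if "x \<in> K" "y \<in> K" "z \<in> K" for x y z
    unfolding L_def by (rule segment_add[OF K g that])
  have corners: "(p, 0) \<in> K" "(q, 0) \<in> K" "(p, a) \<in> K" "(q, a) \<in> K" using cd a by (auto simp: K_def)
  have bottom: "L (p, 0) (q, 0) = \<mu> (reparam p q A)"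
    by (simp add: L_def g_def reparam_linepath linepath_def o_def)
  have side: "L (s, 0) (s, a) = crossing (A s) 0 a" if s: "s \<in> {p..q}" for s
  proof -
    have "L (s, 0) (s, a) = \<mu> (reparam 0 a (shift_op (A s)))"
      by (simp add: L_def g_def reparam_linepath linepath_def o_def flip: distrib_right)
    also have "\<dots> = crossing (A s) 0 a"
    proof (rule flow_shift[OF AM[OF s]])
      show "fin_window (A s) (- a) 0"
        by (rule fin_window_if_not_ess[OF M_sa[OF AM[OF s]]]) (use a D(4)[OF s s] in auto)
    qed (use a shift[OF s] in auto)
    finally show ?thesis .
  qed
  have "continuous_map (top_of_set {p..q}) (top_of_set K) (\<lambda>s. (s, a))"
    using a by (auto simp: K_def intro!: continuous_intros)
  from continuous_map_compose[OF this g] have "continuous_map (top_of_set {p..q}) mtopology (\<lambda>s. g (s, a))"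
    by (simp add: o_def)
  \<comment> \<open>A s + a is invertible because -a is a resolvent point of A s; this is the use of
    the lower end of the window.\<close>
  then have "\<mu> (reparam p q (\<lambda>s. g (s, a))) = 0"
    by (rule reparam_zero[OF _ cd]) (use D(3) in \<open>simp add: g_def shift_invertible AM\<close>)
  moreover have "L (p, a) (q, a) = \<mu> (reparam p q (\<lambda>s. g (s, a)))"
    by (simp add: L_def reparam_linepath linepath_def o_def flip: distrib_right)
  ultimately have top: "L (p, a) (q, a) = 0" by simp
  \<comment> \<open>Two triangles glued along the diagonal from (p, a) to (q, 0) replace the bottom
    edge by the other three.\<close>
  have "L (p, 0) (q, 0) = L (p, 0) (p, a) + L (p, a) (q, a) + L (q, a) (q, 0)"
    using L[OF corners(1,3,2)] L[OF corners(3,4,2)] by simp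
  \<comment> \<open>Reversing an edge changes the sign, since a constant path contributes 0.\<close>
  moreover have "L (q, 0) (q, a) + L (q, a) (q, 0) = 0"
    using L[OF corners(2,4,2)] L[OF corners(2,2,2)] by simp
  ultimately have "\<mu> (reparam p q A) = crossing (A p) 0 a - crossing (A q) 0 a"
    using bottom top side[of p] side[of q] cd by simp
  moreover have "int (complex_vector.dim (range (blinfun_apply (Wproj (A s) a)))) =
      int (complex_vector.dim (range (spectral_proj (A s) 0 a))) + crossing (A s) 0 a" if s: "s \<in> {p..q}" for s
    by (rule window_dim_split[OF M_sa[OF AM[OF s]] a], rule fin_window_if_not_ess[OF M_sa[OF AM[OF s]]])
      (use a D(4)[OF s s] in auto)
  moreover have "complex_vector.dim (range (blinfun_apply (Wproj (A p) a))) =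
      complex_vector.dim (range (blinfun_apply (Wproj (A q) a)))"
    by (rule sf_piece_dim_constant[OF piece cd M_sa[OF AM]])
  ultimately show ?thesis using cd by (smt (verit) atLeastAtMost_iff)
qed

lemma flow_partition:
  assumes A: "A \<in> path_space mtopology" and part: "sf_partition A N l a"
  shows "sf_sum A N l a = \<mu> A"
proof -
  have cont: "continuous_map (top_of_set {0..1}) mtopology A" and ext: "A \<in> extensional {0..1}"
    using A by (auto simp: path_space_def pathin_def)
  have l: "l 0 = 0" "l N = 1" and
    piece: "\<And>i. i \<in> {1..N} \<Longrightarrow> l (i - 1) < l i \<and> sf_piece A (l (i - 1)) (l i) (a i)"
    using part unfolding sf_partition_iff by auto
  have mono: "l i \<le> l j" if "i \<le> j" "j \<le> N" for i j
    using that
  proof (induction j rule: dec_induct)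
    case (step j)
    then show ?case using piece[of "Suc j"] by simp
  qed simp
  have l01: "l i \<in> {0..1}" if "i \<le> N" for i using mono[of 0 i] mono[of i N] that l by simp
  have "\<mu> (reparam 0 (l n) A) =
      (\<Sum>i = 1..n. int (complex_vector.dim (range (spectral_proj (A (l i)) 0 (a i)))) -
        int (complex_vector.dim (range (spectral_proj (A (l (i - 1))) 0 (a i)))))" if "n \<le> N" for n
    using that
  proof (induction n)
    case 0
    then show ?case using reparam_same[OF cont, of 0] l by simp
  next
    case (Suc n)
    have "\<mu> (reparam 0 (l (Suc n)) A) = \<mu> (reparam 0 (l n) A) + \<mu> (reparam (l n) (l (Suc n)) A)"
      by (rule reparam_add[OF cont]) (use l01[of n] l01[of "Suc n"] Suc.prems in auto)
    moreover have "continuous_map (top_of_set {l n..l (Suc n)}) mtopology A"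
      by (rule continuous_map_from_subtopology_mono[OF cont]) (use l01[of n] l01[of "Suc n"] Suc.prems in auto)
    note flow_piece[OF this, of "a (Suc n)"]
    ultimately show ?case using Suc piece[of "Suc n"] by simp
  qed
  from this[of N] have "\<mu> (reparam 0 1 A) = sf_sum A N l a" by (simp add: sf_sum_def l)
  moreover have "reparam 0 1 A = A" using ext by (simp add: reparam_def extensional_restrict)
  ultimately show ?thesis by simp
qed

text \<open>A partition exists, and every partition sum equals \<mu> A; the first fact inhabits the
  definite description and the second makes it unique.\<close>

theorem flow_eq_spectral_flow:
  assumes A: "A \<in> path_space mtopology" shows "\<mu> A = spectral_flow A"
proof -
  have cont: "continuous_map (top_of_set {0..1}) mtopology A"
    using A by (auto simp: path_space_def pathin_def)
  have "A s \<in> CFsa" if "s \<in> {0..1}" for s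
    using image_subset_iff continuous_map_image_subset_topspace[OF cont] M_CFsa that by fastforce
  then obtain N l a where part: "sf_partition A N l a"
    using sf_partition_exists[OF _ gap_continuous[OF cont]] by blast
  have "spectral_flow A = \<mu> A"
    unfolding spectral_flow_def
  proof (rule the_equality)
    show "\<exists>N l a. sf_partition A N l a \<and> \<mu> A = sf_sum A N l a" using part flow_partition[OF A part] by metis
  qed (use flow_partition[OF A] in blast)
  then show ?thesis by simp
qed

end

lemma shift_path_eq: "shift_path T = shift_op T"
  by (rule ext) (simp add: shift_path_def plus_scalar_of_real)

theorem theorem4p3:
  fixes X :: "'a::complex_hilbert op topology"
    and Y :: "'a op set"
    and \<mu> :: "(real \<Rightarrow> 'a op) \<Rightarrow> int"
  assumes infinite_dim: "\<not> fin_dim (UNIV :: 'a set)"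
    and separable: "separable_space (euclidean :: 'a topology)"
    and XY: "(X, Y) = (top_CFsa, GCsa) \<or>
             (X, Y) = (top_CFsa_star, GCsa \<inter> CFsa_star) \<or>
             (X, Y) = (top_BFsa_star, GBsa \<inter> BFsa_star)"
    and C: "\<And>A B. A \<in> path_space X \<Longrightarrow> B \<in> path_space X \<Longrightarrow> A 1 = B 0 \<Longrightarrow>
              \<mu> (concat_path A B) = \<mu> A + \<mu> B"
    and H: "\<And>h :: real \<times> real \<Rightarrow> 'a op.
              continuous_map (top_of_set ({0..1} \<times> {0..1})) X h \<Longrightarrow>
              (\<forall>s\<in>{0..1}. h (s, 0) = h (0, 0) \<and> h (s, 1) = h (0, 1)) \<Longrightarrow>
              \<mu> (restrict (\<lambda>t. h (0, t)) {0..1}) = \<mu> (restrict (\<lambda>t. h (1, t)) {0..1})"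
    and Z: "\<And>A. A \<in> path_space X \<Longrightarrow> (\<forall>t\<in>{0..1}. A t \<in> Y) \<Longrightarrow> \<mu> A = 0"
    and N: "\<And>T. T \<in> topspace X \<Longrightarrow>
              \<mu> (reparam (- spectral_gap T) (spectral_gap T) (shift_path T)) =
                int (complex_vector.dim (ker_op T)) \<and>
              \<mu> (reparam 0 (spectral_gap T) (shift_path T)) = 0"
  shows "\<forall>A \<in> path_space X. \<mu> A = spectral_flow A"
proof -
  \<comment> \<open>Common to the three cases: invertible members of the space belong to
    \<open>Y\<close>, which turns (Z) into the form assumed in \<open>flow_axioms\<close>.\<close>
  have main: "\<forall>A \<in> path_space X. \<mu> A = spectral_flow A"
    if space: "operator_space M d" and X: "X = Metric_space.mtopology M d"
      and Y: "\<And>T. T \<in> M \<Longrightarrow> invertible_op T \<Longrightarrow> T \<in> Y" for M :: "'a op set" and d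
  proof -
    interpret operator_space M d by (rule space)
    note C = C[unfolded X] and H = H[unfolded X] and Z = Z[unfolded X]
      and N = N[unfolded X topspace_mtopology shift_path_eq]
    have Z': "\<mu> A = 0" if A: "A \<in> path_space mtopology" "\<forall>t\<in>{0..1}. invertible_op (A t)" for A
    proof (rule Z[OF A(1)], rule ballI)
      fix t :: real assume "t \<in> {0..1}"
      moreover have "continuous_map (top_of_set {0..1}) mtopology A"
        using A(1) by (simp add: path_space_def pathin_def)
      from continuous_map_image_subset_topspace[OF this] have "A ` {0..1} \<subseteq> M" by simp
      ultimately show "A t \<in> Y" using A(2) Y by blast
    qed
    interpret flow_axioms M d \<mu>
      by unfold_locales (use infinite_dim C H Z' N in \<open>blast+\<close>)
    show ?thesis unfolding X using flow_eq_spectral_flow by blast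
  qed
  from XY show ?thesis
  proof (elim disjE)
    assume "(X, Y) = (top_CFsa, GCsa)"
    then show ?thesis
      by (intro main[OF gap_operator_space]) (auto simp: top_CFsa_def GCsa_def CFsa_def)
  next
    assume "(X, Y) = (top_CFsa_star, GCsa \<inter> CFsa_star)"
    then show ?thesis
      by (intro main[OF riesz_operator_space]) (auto simp: top_CFsa_star_def GCsa_def CFsa_star_def CFsa_def)
  next
    assume "(X, Y) = (top_BFsa_star, GBsa \<inter> BFsa_star)"
    then show ?thesis
      by (intro main[OF norm_operator_space]) (auto simp: top_BFsa_star_def GBsa_def BFsa_star_def BFsa_def)
  qed
qed

end
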